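(* Let $d\ge 1$ be an integer. If $p\ge 0$ and $\mathbf{X}_1,\dots,\mathbf{X}_N$ are $N$ points on $\mathbb{S}^d$ that are independently and randomly distributed with respect to $\sigma_d$, then $$\mathbb{E}\Big[\sum_{k=1}^{f_d}(\rho_k)^p\Big]=B_d\,(\kappa_d)^{-p/d}\,\frac{\Gamma(d+p/d)\,\Gamma(N+1)}{\Gamma(d)\,\Gamma(N+p/d)}\Big\{1+\mathcal{O}(N^{-2/d})\Big\}=c_{d,p}\,N^{1-p/d}\Big\{1+\mathcal{O}(N^{-2/d})\Big\}$$ as $N\to\infty$, where $f_d$ is the number of facets of the convex hull of $\mathbf{X}_1,\dots,\mathbf{X}_N$, $\rho_k=\rho_{k,N}$ is the Euclidean hole radius associated with the $k$th facet of this convex hull, and $$c_{d,p}:=B_d\,B_{d,p},\qquad B_{d,p}:=\frac{\Gamma(d+p/d)}{\Gamma(d)}(\kappa_d)^{-p/d}.$$ The $\mathcal{O}$-terms depend only on $d$ and $p$.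
   Context: $\mathbb{S}^d$ is the unit sphere in $\mathbb{R}^{d+1}$ and $\sigma_d$ is the normalized surface area measure on $\mathbb{S}^d$ (total mass one). Let $\omega_d=2\pi^{(d+1)/2}/\Gamma((d+1)/2)$ be the surface area of $\mathbb{S}^d$ (with $\omega_0=2$). For $d=1,2,3,\dots$ define $$\kappa_d:=\frac1d\frac{\omega_{d-1}}{\omega_d}=\frac1d\frac{\Gamma((d+1)/2)}{\sqrt{\pi}\,\Gamma(d/2)},\qquad B_d:=\frac{2}{d+1}\,\frac{\kappa_{d^2}}{(\kappa_d)^d},$$ where $\kappa_{d^2}$ is $\kappa$ with index $d^2$. Holes: each facet of the convex hull of a finite point set on $\mathbb{S}^d$ determines a hyperplane that divides $\mathbb{S}^d$ into an open spherical cap containing none of the points and a complementary closed spherical cap containing all the points, with at least $d+1$ of them on the boundary. The open cap is the hole associated with the facet. If $\alpha_k\in[0,\pi]$ is the geodesic radius of the hole of the $k$th facet, its Euclidean hole radius is $\rho_k:=2\sin(\alpha_k/2)$, i.e. the Euclidean distance in $\mathbb{R}^{d+1}$ from the cap boundary to the center of the cap (located on the sphere). The number of facets $f_d$ is itself a random variable.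
   Formalization: For d = 1 and p not in {0,1} the second O-term is O(1/N) rather than the printed O(N^{-2}), which is false there (d = 1, p = 2: 1/(N+1) is not (1/N){1+O(N^{-2})}); all other cases and the first equality are as printed. *)

theory Defs
  imports "HOL-Probability.Probability"
begin

section \<open>Surface measure on the unit sphere\<close>

text \<open>
  Surface area measure on the unit sphere of \<open>\<real>\<^sup>n\<close>, defined through polar coordinates: the area of
  \<open>A\<close> is \<open>n\<close> times the Lebesgue measure of the cone \<open>{t x | x \<in> A, 0 < t \<le> 1}\<close>. Since the cone of
  height \<open>r\<close> has measure \<open>\<integral>\<^sub>0\<^sup>r t\<^bsup>n-1\<^esup> area(A) dt\<close>, the factor \<open>n\<close> is the one that
  makes this the usual area. In the code, the cone over \<open>A\<close> is the preimage of \<open>A\<close> under the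
  radial projection \<open>sgn x = x / norm x\<close> of the punctured unit ball.
\<close>

abbreviation unit_sphere :: "(real ^ 'n) set" where
  "unit_sphere \<equiv> sphere 0 1"

definition sphere_area :: "(real ^ 'n) measure" where
  "sphere_area =
     scale_measure (of_nat CARD('n))
       (distr (restrict_space lborel (cball 0 1 - {0})) (restrict_space borel unit_sphere) sgn)"

definition sphere_measure :: "(real ^ 'n) measure" where
  "sphere_measure =
     scale_measure (1 / emeasure sphere_area (unit_sphere :: (real ^ 'n) set)) sphere_area"

text \<open>Surface area of the unit sphere in \<open>\<real>\<^bsup>d+1\<^esup>\<close>.\<close>

definition omega :: "nat \<Rightarrow> real" where
  "omega d = 2 * pi powr ((real d + 1) / 2) / Gamma ((real d + 1) / 2)"

lemma space_sphere_measure [simp]: "space sphere_measure = unit_sphere"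
  by (simp add: sphere_measure_def sphere_area_def space_scale_measure space_restrict_space)

lemma sets_sphere_measure [simp, measurable_cong]:
  "sets sphere_measure = sets (restrict_space borel unit_sphere)"
  by (simp add: sphere_measure_def sphere_area_def)

lemma measurable_sgn_sphere:
  "sgn \<in> restrict_space lborel (cball 0 1 - {0}) \<rightarrow>\<^sub>M restrict_space borel (unit_sphere :: (real ^ 'n) set)"
proof (rule measurable_restrict_space2)
  show "sgn \<in> space (restrict_space lborel (cball 0 1 - {0})) \<rightarrow> (unit_sphere :: (real ^ 'n) set)"
    by (auto simp: space_restrict_space norm_sgn)
  have "(\<lambda>x. x /\<^sub>R norm x) \<in> borel_measurable (borel :: (real ^ 'n) measure)"
    by measurable
  then have "sgn \<in> borel_measurable (borel :: (real ^ 'n) measure)"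
    by (simp add: sgn_div_norm[abs_def])
  then have "sgn \<in> borel_measurable (lborel :: (real ^ 'n) measure)"
    by simp
  then show "sgn \<in> borel_measurable (restrict_space (lborel :: (real ^ 'n) measure) (cball 0 1 - {0}))"
    by (rule measurable_restrict_space1)
qed

lemma emeasure_sphere_area:
  fixes A :: "(real ^ 'n) set"
  assumes "A \<in> sets (restrict_space borel unit_sphere)"
  shows "emeasure sphere_area A =
           of_nat CARD('n) * emeasure lborel {t *\<^sub>R x | t x. x \<in> A \<and> 0 < t \<and> t \<le> 1}"
proof -
  have A: "A \<subseteq> unit_sphere"
    using sets.sets_into_space[OF assms] by (simp add: space_restrict_space)
  have eq: "sgn -` A \<inter> (cball 0 1 - {0}) = {t *\<^sub>R x | t x. x \<in> A \<and> 0 < t \<and> t \<le> 1}" (is "?L = ?R")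
  proof (intro equalityI subsetI)
    fix y assume "y \<in> ?L"
    then have "sgn y \<in> A" "0 < norm y" "norm y \<le> 1" "y = norm y *\<^sub>R sgn y"
      by (auto simp: sgn_div_norm)
    then show "y \<in> ?R" by blast
  next
    fix y assume "y \<in> ?R"
    then obtain t x where y: "y = t *\<^sub>R x" "x \<in> A" "0 < t" "t \<le> 1" by blast
    with A have "norm x = 1" by auto
    with y show "y \<in> ?L" by (auto simp: sgn_div_norm)
  qed
  have "emeasure sphere_area A = of_nat CARD('n) *
          emeasure (restrict_space lborel (cball 0 1 - {0})) (sgn -` A \<inter> (cball 0 1 - {0}))"
    unfolding sphere_area_def
    by (simp add: emeasure_distr[OF measurable_sgn_sphere assms] space_restrict_space)
  also have "emeasure (restrict_space lborel (cball 0 1 - {0})) (sgn -` A \<inter> (cball 0 1 - {0}))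
             = emeasure lborel (sgn -` A \<inter> (cball 0 1 - {0}))"
    by (rule emeasure_restrict_space) auto
  finally show ?thesis by (simp add: eq)
qed

lemma emeasure_sphere_area_sphere:
  "emeasure sphere_area (unit_sphere :: (real ^ 'n) set) = ennreal (omega (CARD('n) - 1))"
proof -
  have "{t *\<^sub>R x | t x. x \<in> (unit_sphere :: (real ^ 'n) set) \<and> 0 < t \<and> t \<le> 1} = cball 0 1 - {0}" (is "?L = ?R")
  proof (intro equalityI subsetI)
    fix y :: "real ^ 'n" assume "y \<in> ?R"
    then have "sgn y \<in> unit_sphere" "0 < norm y" "norm y \<le> 1" "y = norm y *\<^sub>R sgn y"
      by (auto simp: sgn_div_norm)
    then show "y \<in> ?L" by blast
  qed auto
  moreover have "emeasure lborel (cball 0 1 - {0 :: real ^ 'n}) = emeasure lborel (cball (0 :: real ^ 'n) 1)"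
    by (rule emeasure_Diff_null_set) (auto simp: null_sets_def)
  moreover have "(unit_sphere :: (real ^ 'n) set) \<in> sets (restrict_space borel unit_sphere)"
    by (simp add: sets_restrict_space_iff)
  ultimately have "emeasure sphere_area (unit_sphere :: (real ^ 'n) set)
      = of_nat CARD('n) * ennreal (unit_ball_vol (real CARD('n)))"
    by (simp add: emeasure_sphere_area emeasure_cball)
  also have "\<dots> = ennreal (real CARD('n) * unit_ball_vol (real CARD('n)))"
    by (simp add: ennreal_mult flip: ennreal_of_nat_eq_real_of_nat)
  also have "real CARD('n) * unit_ball_vol (real CARD('n)) = omega (CARD('n) - 1)"
  proof -
    have "real CARD('n) / 2 > 0" by simp
    then have "Gamma (real CARD('n) / 2 + 1) = real CARD('n) / 2 * Gamma (real CARD('n) / 2)"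
      by (intro Gamma_plus1 notI) (auto dest: nonpos_Ints_nonpos)
    moreover have "real (CARD('n) - 1) + 1 = real CARD('n)"
      by (simp add: of_nat_diff)
    ultimately show ?thesis
      unfolding unit_ball_vol_def omega_def by (simp only:) simp
  qed
  finally show ?thesis .
qed

lemma omega_pos: "omega d > 0"
  by (auto simp: omega_def intro!: divide_pos_pos mult_pos_pos Gamma_real_pos)

lemma prob_space_sphere_measure: "prob_space (sphere_measure :: (real ^ 'n) measure)"
proof
  show "emeasure sphere_measure (space (sphere_measure :: (real ^ 'n) measure)) = 1"
    using omega_pos[of "CARD('n) - 1"]
    by (simp only: space_sphere_measure)
      (simp add: sphere_measure_def emeasure_sphere_area_sphere ennreal_divide_times
        divide_ennreal flip: ennreal_1 ennreal_mult)
qed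

section \<open>Constants\<close>

definition kappa :: "nat \<Rightarrow> real" where
  "kappa d = 1 / real d * (omega (d - 1) / omega d)"

lemma kappa_altdef:
  assumes "d \<ge> 1"
  shows "kappa d = 1 / real d * (Gamma ((real d + 1) / 2) / (sqrt pi * Gamma (real d / 2)))"
proof -
  have "pi powr ((real d + 1) / 2) = pi powr (real d / 2) * sqrt pi"
    by (simp add: add_divide_distrib powr_add powr_half_sqrt)
  then show ?thesis
    using assms by (simp add: kappa_def omega_def of_nat_diff)
qed

definition B_hull :: "nat \<Rightarrow> real" where
  "B_hull d = 2 / (real d + 1) * (kappa (d\<^sup>2) / kappa d ^ d)"

definition B_hole :: "nat \<Rightarrow> real \<Rightarrow> real" where
  "B_hole d p = Gamma (real d + p / real d) / Gamma (real d) * kappa d powr (- p / real d)"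

definition c_hole :: "nat \<Rightarrow> real \<Rightarrow> real" where
  "c_hole d p = B_hull d * B_hole d p"

section \<open>Holes of a finite point set on the sphere\<close>

definition open_cap :: "real ^ 'n \<Rightarrow> real \<Rightarrow> (real ^ 'n) set" where
  "open_cap c \<alpha> = {x \<in> unit_sphere. arccos (c \<bullet> x) < \<alpha>}"

text \<open>
  The cap around \<open>c\<close> of geodesic radius \<open>\<alpha>\<close> is cut off the sphere by the hyperplane
  \<open>c \<bullet> x = cos \<alpha>\<close>, which has to be the one spanned by the facet \<open>F\<close>. This leaves two antipodal
  candidates for \<open>c\<close>; the hole is the one without points of \<open>S\<close>. For \<open>S\<close> on the sphere the
  complementary closed cap then contains \<open>S\<close>.
\<close>

definition is_hole :: "(real ^ 'n) set \<Rightarrow> (real ^ 'n) set \<Rightarrow> real ^ 'n \<Rightarrow> real \<Rightarrow> bool" where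
  "is_hole S F c \<alpha> \<longleftrightarrow>
     c \<in> unit_sphere \<and> 0 \<le> \<alpha> \<and> \<alpha> \<le> pi \<and>
     affine hull F = {x. c \<bullet> x = cos \<alpha>} \<and> open_cap c \<alpha> \<inter> S = {}"

definition hole_radius :: "(real ^ 'n) set \<Rightarrow> (real ^ 'n) set \<Rightarrow> real" where
  "hole_radius S F = (THE \<alpha>. \<exists>c. is_hole S F c \<alpha>)"

definition euclidean_hole_radius :: "(real ^ 'n) set \<Rightarrow> (real ^ 'n) set \<Rightarrow> real" where
  "euclidean_hole_radius S F = 2 * sin (hole_radius S F / 2)"

definition hull_facets :: "(real ^ 'n) set \<Rightarrow> (real ^ 'n) set set" where
  "hull_facets S = {F. F facet_of (convex hull S)}"

text \<open>
  The sum ranges over the set of facets, so that the number \<open>f\<^sub>d\<close> of its terms depends on \<open>S\<close>.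
  When the hull is full-dimensional, every facet has a positive hole radius, so that the convention
  for \<open>0 powr p\<close> plays no role.
\<close>

definition hole_power_sum :: "real \<Rightarrow> (real ^ 'n) set \<Rightarrow> real" where
  "hole_power_sum p S = (\<Sum>F\<in>hull_facets S. euclidean_hole_radius S F powr p)"

end

theory Submission
  imports Defs "HOL-Real_Asymp.Real_Asymp"
begin

text \<open>
  Almost surely the facets correspond to the sets \<open>T\<close> of \<open>d + 1\<close> points that leave all other points
  on one side of the hyperplane \<open>x \<bullet> w = 1\<close> through \<open>T\<close>, and the hole then has Euclidean radius
  \<open>sqrt (2 (1 \<plusminus> h))\<close> with \<open>h = 1 / norm w\<close>. Conditionally on \<open>T\<close> the other points are one-sided with
  probability \<open>\<Phi>(h)\<^bsup>N-d-1\<^esup>\<close> or \<open>(1 - \<Phi>(h))\<^bsup>N-d-1\<^esup>\<close>, where \<open>\<Phi>\<close> is the distribution function of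
  one coordinate of a uniform point. The distance \<open>h\<close> has a density proportional to
  \<open>(1 - h\<^sup>2)\<^bsup>(d\<^sup>2-2)/2\<^esup>\<close>, a special case of the spherical Blaschke-Petkantschin formula. So the
  expectation is an explicit integral over \<open>h \<in> (-1, 1)\<close>, and the substitution \<open>v = 1 - \<Phi>(h)\<close> turns it,
  up to the stated relative error, into a Beta integral.
\<close>

section \<open>Linear changes of variables\<close>

text \<open>The only consequence of the Blaschke-Petkantschin formula that is used is the law of one
  number, the distance \<open>h\<close>. It is derived inside \<open>real ^ 'n\<close>, without
  measures on moving hyperplanes or on lower-dimensional spheres: the equations
  \<open>x i \<bullet> w = 1\<close> are relaxed to a right-hand side that is uniform near the
  all-ones vector. Then \<open>w\<close> has a Lebesgue density, a mean of determinants over points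
  in a slab around the hyperplane, and its limit factors into powers of \<open>h\<close> and
  \<open>1 - h\<^sup>2\<close>. Constants stay unevaluated until a total mass of 1 fixes them: the
  factor \<open>c\<close> in the density of a coordinate, and the mean simplex volume in the law of
  \<open>h\<close>. Both normalising integrals are the same Beta integral, with parameters
  \<open>d\<close> and \<open>d\<^sup>2\<close>; this is how \<open>kappa d\<close> and
  \<open>kappa (d\<^sup>2)\<close> arise. The relative error \<open>N powr (- 2 / d)\<close> comes
  from the fact that \<open>1 - h\<close> is of order \<open>(1 - \<Phi>(h)) powr (2 / d)\<close>
  near \<open>h = 1\<close>: replacing the integrand by its leading term costs a factor
  \<open>1 + O(1 - h)\<close>, that is, a shift of a Beta parameter by \<open>2 / d\<close>.\<close>

lemma nn_integral_lborel_shift: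
  fixes f :: "'a::euclidean_space \<Rightarrow> ennreal"
  assumes [measurable]: "f \<in> borel_measurable borel"
  shows "(\<integral>\<^sup>+x. f (x + t) \<partial>lborel) = (\<integral>\<^sup>+x. f x \<partial>lborel)"
proof -
  have "(\<integral>\<^sup>+x. f x \<partial>lborel) = (\<integral>\<^sup>+x. f x \<partial>distr lborel borel ((+) t))"
    by (simp add: lborel_distr_plus)
  also have "\<dots> = (\<integral>\<^sup>+x. f (x + t) \<partial>lborel)"
    by (simp add: nn_integral_distr add.commute)
  finally show ?thesis ..
qed

text \<open>Fubini in the coordinate \<open>k\<close> without leaving \<open>real ^ 'n\<close>: a
  new variable \<open>a\<close> takes its place, and the old coordinate survives as a dummy,
  confined to an interval of length 1 and hence contributing the factor 1.\<close>

lemma nn_integral_replace_coordinate: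
  fixes f :: "real ^ 'n \<Rightarrow> ennreal"
  assumes [measurable]: "f \<in> borel_measurable borel"
  shows "(\<integral>\<^sup>+y. f y \<partial>lborel) =
    (\<integral>\<^sup>+a. (\<integral>\<^sup>+y. f (y + (a - y $ k) *\<^sub>R axis k 1) * indicator {0..1} (y $ k) \<partial>lborel) \<partial>lborel)"
proof -
  have [measurable]: "(\<lambda>y :: real ^ 'n. y $ k) \<in> borel_measurable borel"
    by (intro borel_measurable_continuous_onI continuous_intros)
  let ?I = "indicator {0..1} :: real \<Rightarrow> ennreal"
  have "(\<integral>\<^sup>+a. (\<integral>\<^sup>+y. f (y + (a - y $ k) *\<^sub>R axis k 1) * ?I (y $ k) \<partial>lborel) \<partial>lborel)
      = (\<integral>\<^sup>+y. (\<integral>\<^sup>+a. f (y + (a - y $ k) *\<^sub>R axis k 1) * ?I (y $ k) \<partial>lborel) \<partial>lborel)"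
    by (rule lborel_pair.Fubini') measurable
  also have "\<dots> = (\<integral>\<^sup>+y. (\<integral>\<^sup>+a. f (y + a *\<^sub>R axis k 1) * ?I (y $ k) \<partial>lborel) \<partial>lborel)"
  proof (rule nn_integral_cong)
    fix y :: "real ^ 'n"
    show "(\<integral>\<^sup>+a. f (y + (a - y $ k) *\<^sub>R axis k 1) * ?I (y $ k) \<partial>lborel)
        = (\<integral>\<^sup>+a. f (y + a *\<^sub>R axis k 1) * ?I (y $ k) \<partial>lborel)"
      using nn_integral_lborel_shift[of "\<lambda>a. f (y + a *\<^sub>R axis k 1) * ?I (y $ k)" "- (y $ k)"] by simp
  qed
  also have "\<dots> = (\<integral>\<^sup>+a. (\<integral>\<^sup>+y. f (y + a *\<^sub>R axis k 1) * ?I (y $ k) \<partial>lborel) \<partial>lborel)"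
    by (rule lborel_pair.Fubini') measurable
  also have "\<dots> = (\<integral>\<^sup>+a. (\<integral>\<^sup>+y. f y * ?I (y $ k - a) \<partial>lborel) \<partial>lborel)"
  proof (rule nn_integral_cong)
    fix a :: real
    show "(\<integral>\<^sup>+y. f (y + a *\<^sub>R axis k 1) * ?I (y $ k) \<partial>lborel) = (\<integral>\<^sup>+y. f y * ?I (y $ k - a) \<partial>lborel)"
      using nn_integral_lborel_shift[of "\<lambda>y. f y * ?I (y $ k - a)" "a *\<^sub>R axis k 1"] by simp
  qed
  also have "\<dots> = (\<integral>\<^sup>+y. (\<integral>\<^sup>+a. f y * ?I (y $ k - a) \<partial>lborel) \<partial>lborel)"
    by (rule lborel_pair.Fubini') measurable
  also have "\<dots> = (\<integral>\<^sup>+y. f y \<partial>lborel)"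
  proof (rule nn_integral_cong)
    fix y :: "real ^ 'n"
    have "(\<integral>\<^sup>+a. f y * ?I (y $ k - a) \<partial>lborel) = f y * (\<integral>\<^sup>+a. ?I (y $ k - a) \<partial>lborel)"
      by (rule nn_integral_cmult) simp
    also have "(\<integral>\<^sup>+a. ?I (y $ k - a) \<partial>lborel) = (\<integral>\<^sup>+a. indicator {y $ k - 1..y $ k} a \<partial>lborel)"
      by (rule nn_integral_cong) (auto simp: indicator_def)
    also have "\<dots> = 1" by simp
    finally show "(\<integral>\<^sup>+a. f y * ?I (y $ k - a) \<partial>lborel) = f y" by simp
  qed
  finally show ?thesis ..
qed

lemma borel_measurable_matrix_vector_mult [measurable]:
  "(\<lambda>x. (A :: real ^ 'n ^ 'm) *v x) \<in> borel_measurable borel"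
  by (intro borel_measurable_continuous_onI linear_continuous_on matrix_vector_mul_bounded_linear)

lemma borel_measurable_vec_nth' [measurable]:
  "(\<lambda>x :: 'a::euclidean_space ^ 'n. x $ i) \<in> borel_measurable borel"
  by (intro borel_measurable_continuous_onI continuous_intros)

lemma Basis_vec_eq_axis: "(Basis :: (real ^ 'n) set) = (\<lambda>i. axis i 1) ` UNIV"
  by (auto simp: Basis_vec_def)

lemma inj_axis_1: "inj (\<lambda>i :: 'n::finite. axis i 1 :: real ^ 'n)"
  by (auto simp: inj_on_def axis_eq_axis)

lemma prod_Basis_vec:
  fixes g :: "real ^ 'n \<Rightarrow> 'b::comm_monoid_mult"
  shows "(\<Prod>b\<in>Basis. g b) = (\<Prod>i\<in>UNIV. g (axis i 1))"
  unfolding Basis_vec_eq_axis by (subst prod.reindex[OF inj_axis_1]) (simp add: o_def)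

lemma sum_Basis_vec:
  fixes g :: "real ^ 'n \<Rightarrow> 'b::comm_monoid_add"
  shows "(\<Sum>b\<in>Basis. g b) = (\<Sum>i\<in>UNIV. g (axis i 1))"
  unfolding Basis_vec_eq_axis by (subst sum.reindex[OF inj_axis_1]) (simp add: o_def)

lemma nn_integral_lborel_diagonal:
  fixes f :: "real ^ 'n \<Rightarrow> ennreal" and c :: "'n \<Rightarrow> real"
  assumes [measurable]: "f \<in> borel_measurable borel" and c: "\<And>i. c i \<noteq> 0"
  shows "(\<integral>\<^sup>+x. f x \<partial>lborel) = ennreal (\<Prod>i\<in>UNIV. \<bar>c i\<bar>) * (\<integral>\<^sup>+x. f (\<chi> i. c i * x $ i) \<partial>lborel)"
proof -
  define c' where "c' b = b \<bullet> (\<chi> i. c i * b $ i)" for b :: "real ^ 'n"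
  have c': "c' (axis i 1) = c i" for i
    by (simp add: c'_def inner_axis' )
  have T: "(0 :: real ^ 'n) + (\<Sum>j\<in>Basis. (c' j * (x \<bullet> j)) *\<^sub>R j) = (\<chi> i. c i * x $ i)" for x
  proof (rule vector_eq_ldot[THEN iffD1], rule allI)
    fix z :: "real ^ 'n"
    have "z \<bullet> (\<Sum>j\<in>Basis. (c' j * (x \<bullet> j)) *\<^sub>R j) = (\<Sum>j\<in>Basis. c' j * (x \<bullet> j) * (z \<bullet> j))"
      by (simp add: inner_sum_right)
    also have "\<dots> = (\<Sum>i\<in>UNIV. c i * x $ i * z $ i)"
      by (simp add: sum_Basis_vec c' inner_axis)
    also have "\<dots> = z \<bullet> (\<chi> i. c i * x $ i)"
      by (simp add: inner_vec_def mult_ac)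
    finally show "z \<bullet> (0 + (\<Sum>j\<in>Basis. (c' j * (x \<bullet> j)) *\<^sub>R j)) = z \<bullet> (\<chi> i. c i * x $ i)" by simp
  qed
  have [measurable]: "(\<lambda>x. \<chi> i. c i * x $ i) \<in> borel_measurable (borel :: (real ^ 'n) measure)"
    by (intro borel_measurable_continuous_onI continuous_intros)
  have nz: "c' j \<noteq> 0" if "j \<in> Basis" for j :: "real ^ 'n"
    using that c by (auto simp: Basis_vec_def c')
  have p: "(\<Prod>j\<in>Basis. \<bar>c' j\<bar>) = (\<Prod>i\<in>UNIV. \<bar>c i\<bar>)"
    by (simp add: prod_Basis_vec c')
  have "(\<integral>\<^sup>+x. f x \<partial>lborel) = (\<integral>\<^sup>+x. f x \<partial>density (distr lborel borel (\<lambda>x. \<chi> i. c i * x $ i)) (\<lambda>_. ennreal (\<Prod>i\<in>UNIV. \<bar>c i\<bar>)))"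
    using lborel_affine_euclidean[of c' 0] nz by (simp only: T p) simp
  also have "\<dots> = (\<integral>\<^sup>+x. ennreal (\<Prod>i\<in>UNIV. \<bar>c i\<bar>) * f (\<chi> i. c i * x $ i) \<partial>lborel)"
    by (simp add: nn_integral_density nn_integral_distr)
  finally show ?thesis by (simp add: nn_integral_cmult)
qed

text \<open>Lebesgue measure is determined by the volumes of boxes, and a swap of coordinates only
  permutes the side lengths of a box.\<close>

lemma nn_integral_lborel_swap:
  fixes f :: "real ^ 'n \<Rightarrow> ennreal"
  assumes [measurable]: "f \<in> borel_measurable borel"
  shows "(\<integral>\<^sup>+x. f x \<partial>lborel) = (\<integral>\<^sup>+x. f (\<chi> i. x $ Transposition.transpose m n i) \<partial>lborel)"
proof -
  let ?T = "\<lambda>x :: real ^ 'n. \<chi> i. x $ Transposition.transpose m n i"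
  have [measurable]: "?T \<in> borel_measurable borel"
    by (intro borel_measurable_continuous_onI continuous_intros)
  have "lborel = distr lborel borel ?T"
  proof (rule lborel_eqI)
    fix l u :: "real ^ 'n" assume le: "\<And>b. b \<in> Basis \<Longrightarrow> l \<bullet> b \<le> u \<bullet> b"
    have le': "l $ i \<le> u $ i" for i
      using le[of "axis i 1"] by (auto simp: inner_axis Basis_vec_def)
    have "?T x \<in> box l u \<longleftrightarrow> x \<in> box (?T l) (?T u)" for x
    proof -
      have "(\<forall>i. l $ i < x $ \<pi> i \<and> x $ \<pi> i < u $ i) \<longleftrightarrow> (\<forall>i. l $ \<pi> i < x $ i \<and> x $ i < u $ \<pi> i)"
        if "\<And>i. \<pi> (\<pi> i) = i" for \<pi> :: "'n \<Rightarrow> 'n"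
        using that by metis
      from this[of "Transposition.transpose m n"] show ?thesis by (simp add: mem_box_cart)
    qed
    then have "?T -` box l u = box (?T l) (?T u)" by auto
    then have "emeasure (distr lborel borel ?T) (box l u) = emeasure lborel (box (?T l) (?T u))"
      by (simp add: emeasure_distr)
    also have "\<dots> = (\<Prod>b\<in>Basis. (?T u - ?T l) \<bullet> b)"
      using le' by (intro emeasure_lborel_box) (auto simp: Basis_vec_def inner_axis)
    also have "\<dots> = (\<Prod>i\<in>UNIV. (u - l) $ Transposition.transpose m n i)"
      by (simp add: prod_Basis_vec inner_axis)
    also have "\<dots> = (\<Prod>i\<in>UNIV. (u - l) $ i)"
      by (rule arg_cong[where f=ennreal], rule prod.reindex_bij_betw) (simp add: bij_transpose)
    also have "\<dots> = (\<Prod>b\<in>Basis. (u - l) \<bullet> b)"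
      by (simp add: prod_Basis_vec inner_axis)
    finally show "emeasure (distr lborel borel ?T) (box l u) = (\<Prod>b\<in>Basis. (u - l) \<bullet> b)" .
  qed simp
  then have "(\<integral>\<^sup>+x. f x \<partial>lborel) = (\<integral>\<^sup>+x. f x \<partial>distr lborel borel ?T)" by simp
  then show ?thesis by (simp add: nn_integral_distr)
qed

text \<open>Once coordinate \<open>m\<close> is a separate variable, the shear acts for fixed
  \<open>y\<close> as a translation of that variable by \<open>c * y $ n\<close>;
  \<open>m \<noteq> n\<close> keeps \<open>y $ n\<close> untouched.\<close>

lemma nn_integral_lborel_shear:
  fixes f :: "real ^ 'n \<Rightarrow> ennreal"
  assumes [measurable]: "f \<in> borel_measurable borel" and "m \<noteq> n"
  shows "(\<integral>\<^sup>+x. f x \<partial>lborel) = (\<integral>\<^sup>+x. f (x + (c * x $ n) *\<^sub>R axis m 1) \<partial>lborel)"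
proof -
  let ?I = "indicator {0..1} :: real \<Rightarrow> ennreal"
  have "(\<integral>\<^sup>+x. f (x + (c * x $ n) *\<^sub>R axis m 1) \<partial>lborel)
     = (\<integral>\<^sup>+a. (\<integral>\<^sup>+y. f (y + (a - y $ m) *\<^sub>R axis m 1 + (c * y $ n) *\<^sub>R axis m 1) * ?I (y $ m) \<partial>lborel) \<partial>lborel)"
    using assms(2)
    by (subst nn_integral_replace_coordinate[where k=m]) (simp_all add: axis_def)
  also have "\<dots> = (\<integral>\<^sup>+y. (\<integral>\<^sup>+a. f (y + (a - y $ m) *\<^sub>R axis m 1 + (c * y $ n) *\<^sub>R axis m 1) * ?I (y $ m) \<partial>lborel) \<partial>lborel)"
    by (rule lborel_pair.Fubini') measurable
  also have "\<dots> = (\<integral>\<^sup>+y. (\<integral>\<^sup>+a. f (y + (a - y $ m) *\<^sub>R axis m 1) * ?I (y $ m) \<partial>lborel) \<partial>lborel)"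
  proof (rule nn_integral_cong)
    fix y :: "real ^ 'n"
    have "y + (a - y $ m) *\<^sub>R axis m 1 + (c * y $ n) *\<^sub>R axis m 1 = y + (a + c * y $ n - y $ m) *\<^sub>R axis m 1" for a
      by (simp add: algebra_simps)
    then have eq: "f (y + (a - y $ m) *\<^sub>R axis m 1 + (c * y $ n) *\<^sub>R axis m 1) = f (y + (a + c * y $ n - y $ m) *\<^sub>R axis m 1)" for a
      by (rule arg_cong)
    show "(\<integral>\<^sup>+a. f (y + (a - y $ m) *\<^sub>R axis m 1 + (c * y $ n) *\<^sub>R axis m 1) * ?I (y $ m) \<partial>lborel)
        = (\<integral>\<^sup>+a. f (y + (a - y $ m) *\<^sub>R axis m 1) * ?I (y $ m) \<partial>lborel)"
      using nn_integral_lborel_shift[of "\<lambda>a. f (y + (a - y $ m) *\<^sub>R axis m 1) * ?I (y $ m)" "c * y $ n"] unfolding eq by simp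
  qed
  also have "\<dots> = (\<integral>\<^sup>+a. (\<integral>\<^sup>+y. f (y + (a - y $ m) *\<^sub>R axis m 1) * ?I (y $ m) \<partial>lborel) \<partial>lborel)"
    by (rule lborel_pair.Fubini') measurable
  also have "\<dots> = (\<integral>\<^sup>+x. f x \<partial>lborel)"
    by (rule nn_integral_replace_coordinate[symmetric]) measurable
  finally show ?thesis ..
qed

text \<open>Induction over elementary matrices. The determinant factor is multiplicative in
  \<open>A\<close>, so products reduce to their factors; diagonal matrices, swaps and shears are the
  three cases above, and a zero row is excluded by \<open>det A \<noteq> 0\<close>.\<close>

lemma nn_integral_lborel_matrix:
  fixes A :: "real ^ 'n ^ 'n" and f :: "real ^ 'n \<Rightarrow> ennreal"
  assumes "det A \<noteq> 0" and "f \<in> borel_measurable borel"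
  shows "(\<integral>\<^sup>+x. f x \<partial>lborel) = ennreal \<bar>det A\<bar> * (\<integral>\<^sup>+x. f (A *v x) \<partial>lborel)"
proof -
  \<comment> \<open>The quantifier over \<open>f\<close> belongs to the induction predicate: for a
    product \<open>A ** B\<close>, the hypothesis on \<open>B\<close> is applied to
    \<open>\<lambda>x. f (A *v x)\<close>.\<close>
  define P where "P A \<longleftrightarrow> (det A \<noteq> 0 \<longrightarrow> (\<forall>f :: real ^ 'n \<Rightarrow> ennreal. f \<in> borel_measurable borel \<longrightarrow>
      (\<integral>\<^sup>+x. f x \<partial>lborel) = ennreal \<bar>det A\<bar> * (\<integral>\<^sup>+x. f (A *v x) \<partial>lborel)))" for A :: "real ^ 'n ^ 'n"
  have "P A"
  proof (rule induct_matrix_elementary)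
    fix A B :: "real ^ 'n ^ 'n" assume PA: "P A" and PB: "P B"
    show "P (A ** B)" unfolding P_def
    proof (intro impI allI)
      fix f :: "real ^ 'n \<Rightarrow> ennreal"
      assume d: "det (A ** B) \<noteq> 0" and f [measurable]: "f \<in> borel_measurable borel"
      have "(\<integral>\<^sup>+x. f x \<partial>lborel) = ennreal \<bar>det A\<bar> * (\<integral>\<^sup>+x. f (A *v x) \<partial>lborel)"
      proof -
        have "det A \<noteq> 0" using d by (auto simp: det_mul)
        then show ?thesis using PA f unfolding P_def by blast
      qed
      also have "(\<integral>\<^sup>+x. f (A *v x) \<partial>lborel) = ennreal \<bar>det B\<bar> * (\<integral>\<^sup>+x. f (A *v (B *v x)) \<partial>lborel)"
      proof -
        have "det B \<noteq> 0" using d by (auto simp: det_mul)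
        moreover have "(\<lambda>x. f (A *v x)) \<in> borel_measurable borel" by measurable
        ultimately show ?thesis using PB unfolding P_def by blast
      qed
      finally show "(\<integral>\<^sup>+x. f x \<partial>lborel) = ennreal \<bar>det (A ** B)\<bar> * (\<integral>\<^sup>+x. f (A ** B *v x) \<partial>lborel)"
        by (simp add: det_mul abs_mult ennreal_mult' matrix_vector_mul_assoc mult.assoc)
    qed
  next
    fix A :: "real ^ 'n ^ 'n" and i assume "row i A = 0"
    then show "P A" by (simp add: P_def det_zero_row)
  next
    fix A :: "real ^ 'n ^ 'n" assume diag: "\<And>i j. i \<noteq> j \<Longrightarrow> A $ i $ j = 0"
    have d: "det A = (\<Prod>i\<in>UNIV. A $ i $ i)" by (rule det_diagonal) (rule diag)
    have "A *v x = (\<chi> i. A $ i $ i * x $ i)" for x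
    proof -
      have "(\<Sum>j\<in>UNIV. A $ i $ j * x $ j) = (\<Sum>j\<in>{i}. A $ i $ j * x $ j)" for i
        by (rule sum.mono_neutral_right) (auto simp: diag)
      then show ?thesis by (simp add: matrix_vector_mult_def)
    qed
    then show "P A" unfolding P_def d
      using nn_integral_lborel_diagonal[of _ "\<lambda>i. A $ i $ i"] by (simp add: abs_prod)
  next
    fix m n :: 'n assume "m \<noteq> n"
    let ?S = "(\<chi> i j. mat 1 $ i $ Transposition.transpose m n j) :: real ^ 'n ^ 'n"
    have "det ?S = of_int (sign (Transposition.transpose m n)) * det (mat 1 :: real ^ 'n ^ 'n)"
      by (rule det_permute_columns) (simp add: permutes_swap_id)
    then have d: "\<bar>det ?S\<bar> = 1" using \<open>m \<noteq> n\<close> by (simp add: sign_swap_id)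
    have "?S *v x = (\<chi> i. x $ Transposition.transpose m n i)" for x
    proof -
      have "(\<Sum>j\<in>UNIV. (mat 1 :: real ^ 'n ^ 'n) $ i $ Transposition.transpose m n j * x $ j) = x $ Transposition.transpose m n i" for i
      proof -
        have "(mat 1 :: real ^ 'n ^ 'n) $ i $ Transposition.transpose m n j * x $ j = (if Transposition.transpose m n i = j then x $ j else 0)" for j
          by (auto simp: mat_def transpose_eq_iff)
        then show ?thesis by simp
      qed
      then show ?thesis by (simp add: matrix_vector_mult_def)
    qed
    then show "P ?S" unfolding P_def d using nn_integral_lborel_swap[of _ m n] by simp
  next
    fix m n :: 'n and c :: real assume mn: "m \<noteq> n"
    let ?S = "(\<chi> i j. if i = m \<and> j = n then c else of_bool (i = j)) :: real ^ 'n ^ 'n"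
    have "?S = (\<chi> k. if k = m then row m (mat 1) + c *s row n (mat 1) else row k (mat 1))"
      using mn by (auto simp: vec_eq_iff row_def mat_def)
    then have d: "det ?S = 1" using det_row_operation[OF mn, of "mat 1 :: real ^ 'n ^ 'n" c] by simp
    have "?S *v x = x + (c * x $ n) *\<^sub>R axis m 1" for x
    proof -
      have "(\<Sum>j\<in>UNIV. (if i = m \<and> j = n then c else of_bool (i = j)) * x $ j) = x $ i + (c * x $ n) * axis m 1 $ i" for i
      proof -
        have "(if i = m \<and> j = n then c else of_bool (i = j)) * x $ j = (if i = j then x $ j else 0) + (if n = j then (if i = m then c * x $ j else 0) else 0)" for j
          using mn by auto
        then show ?thesis by (simp add: sum.distrib axis_def)
      qed
      then show ?thesis by (simp add: vec_eq_iff matrix_vector_mult_def)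
    qed
    then show "P ?S" unfolding P_def d
      by (simp only: abs_one ennreal_1 mult_1) (intro impI allI nn_integral_lborel_shear[OF _ mn])
  qed
  then show ?thesis using assms unfolding P_def by blast
qed

section \<open>The uniform distribution on the sphere\<close>

text \<open>The measure of the theorem moved from the subspace sigma-algebra of the sphere to all of
  \<open>borel\<close>, so that functions on the whole space need no restriction.
  \<open>distr_sphere_measure\<close> identifies the two.\<close>

definition sphere_unif :: "(real ^ 'n) measure" where
  "sphere_unif = distr (uniform_measure lborel (cball 0 1)) borel sgn"

lemma sets_sphere_unif [simp, measurable_cong]: "sets sphere_unif = sets borel"
  and space_sphere_unif [simp]: "space sphere_unif = UNIV"
  by (simp_all add: sphere_unif_def)

lemma cball_borel [measurable]: "cball c r \<in> sets borel"
  by simp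

lemma emeasure_unit_cball:
  "emeasure lborel (cball (0 :: real ^ 'n) 1) \<noteq> 0" "emeasure lborel (cball (0 :: real ^ 'n) 1) \<noteq> \<infinity>"
  using unit_ball_vol_pos[of "real CARD('n)"] by (simp_all add: emeasure_cball del: unit_ball_vol_pos)

lemma AE_uniform_cball: 
  assumes "\<And>y. y \<in> cball 0 1 \<Longrightarrow> y \<noteq> 0 \<Longrightarrow> P y"
  shows "AE y in uniform_measure lborel (cball (0 :: real ^ 'n) 1). P y"
proof (rule AE_uniform_measureI)
  show "cball (0 :: real ^ 'n) 1 \<in> sets lborel" by simp
  have "AE y :: real ^ 'n in lborel. y \<noteq> 0"
    by (rule AE_lborel_singleton)
  then show "AE y in lborel. y \<in> cball (0 :: real ^ 'n) 1 \<longrightarrow> P y"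
    using assms by (auto elim!: eventually_mono)
qed

interpretation sphere_unif: prob_space "sphere_unif :: (real ^ 'n) measure"
proof -
  interpret prob_space "uniform_measure lborel (cball (0 :: real ^ 'n) 1)"
    by (rule prob_space_uniform_measure) (use emeasure_unit_cball in auto)
  show "prob_space (sphere_unif :: (real ^ 'n) measure)"
    unfolding sphere_unif_def by (rule prob_space_distr) simp
qed

lemma AE_sphere_unif_norm: "AE x in (sphere_unif :: (real ^ 'n) measure). norm x = 1"
proof -
  have "AE y in uniform_measure lborel (cball (0 :: real ^ 'n) 1). norm (sgn y) = 1"
    by (rule AE_uniform_cball) (simp add: norm_sgn)
  then show ?thesis unfolding sphere_unif_def
    by (subst AE_distr_iff) auto
qed

lemma nn_integral_sphere_unif:
  fixes f :: "real ^ 'n \<Rightarrow> ennreal"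
  assumes [measurable]: "f \<in> borel_measurable borel"
  shows "(\<integral>\<^sup>+x. f x \<partial>sphere_unif) =
    (\<integral>\<^sup>+y. f (sgn y) * indicator (cball 0 1) y \<partial>lborel) / emeasure lborel (cball (0 :: real ^ 'n) 1)"
  unfolding sphere_unif_def
  by (simp add: nn_integral_distr nn_integral_uniform_measure)

text \<open>Both measures are normalised volumes of the cone over a set; the factor
  \<open>CARD('n)\<close> of \<open>sphere_area\<close> occurs in numerator and denominator.\<close>

lemma distr_sphere_measure:
  "distr sphere_measure borel (\<lambda>x. x) = (sphere_unif :: (real ^ 'n) measure)"
proof (rule measure_eqI)
  fix A assume "A \<in> sets (distr sphere_measure borel (\<lambda>x :: real ^ 'n. x))"
  then have A [measurable]: "A \<in> sets (borel :: (real ^ 'n) measure)" by simp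
  have m: "(\<lambda>x. x) \<in> (sphere_measure :: (real ^ 'n) measure) \<rightarrow>\<^sub>M borel"
    by (simp add: measurable_cong_sets[OF sets_sphere_measure refl] measurable_restrict_space1)
  define V where "V = emeasure lborel (cball (0 :: real ^ 'n) 1)"
  define n where "n = (of_nat CARD('n) :: ennreal)"
  have n: "n \<noteq> 0" "n \<noteq> \<infinity>" by (auto simp: n_def)
  have V: "V \<noteq> 0" "V \<noteq> \<infinity>" using emeasure_unit_cball by (auto simp: V_def)
  \<comment> \<open>The cone over \<open>B \<inter> unit_sphere\<close> and the preimage of
    \<open>B\<close> under \<open>sgn\<close> in the ball differ at most in the origin.\<close>
  have area: "emeasure sphere_area (B \<inter> unit_sphere) = n * emeasure lborel (sgn -` B \<inter> cball 0 1)"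
    if [measurable]: "B \<in> sets borel" for B :: "(real ^ 'n) set"
  proof -
    have "B \<inter> unit_sphere \<in> sets (restrict_space borel unit_sphere)"
      by (simp add: sets_restrict_space_iff)
    then have "emeasure sphere_area (B \<inter> unit_sphere) =
        n * emeasure (restrict_space lborel (cball 0 1 - {0})) (sgn -` (B \<inter> unit_sphere) \<inter> (cball 0 1 - {0}))"
      unfolding sphere_area_def n_def
      by (simp add: emeasure_distr[OF measurable_sgn_sphere] space_restrict_space)
    also have "sgn -` (B \<inter> unit_sphere) \<inter> (cball 0 1 - {0}) = (sgn -` B \<inter> cball 0 1) - {0}"
      by (auto simp: norm_sgn)
    also have "emeasure (restrict_space lborel (cball 0 1 - {0})) ((sgn -` B \<inter> cball 0 1) - {0})
       = emeasure lborel ((sgn -` B \<inter> cball 0 1) - {0})"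
      by (rule emeasure_restrict_space) auto
    also have "\<dots> = emeasure lborel (sgn -` B \<inter> cball 0 1)"
    proof (rule emeasure_Diff_null_set)
      have "sgn -` B \<inter> space borel \<in> sets borel" by (rule measurable_sets) measurable
      then show "sgn -` B \<inter> cball 0 1 \<in> sets lborel" by simp
    qed (auto simp: null_sets_def)
    finally show ?thesis .
  qed
  have "emeasure (distr sphere_measure borel (\<lambda>x. x)) A = emeasure sphere_measure (A \<inter> unit_sphere)"
    using m by (simp add: emeasure_distr)
  also have "\<dots> = 1 / (n * V) * (n * emeasure lborel (sgn -` A \<inter> cball 0 1))"
  proof -
    have "emeasure sphere_area (unit_sphere :: (real ^ 'n) set) = n * V"
      using area[of UNIV] by (simp add: V_def)
    then show ?thesis by (simp add: sphere_measure_def area)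
  qed
  also have "\<dots> = emeasure lborel (sgn -` A \<inter> cball 0 1) / V"
  proof -
    have nz: "n * V \<noteq> 0" "n * V \<noteq> \<infinity>" using n V by (auto simp: ennreal_mult_eq_top_iff)
    have "1 / (n * V) * (n * x) = x / V" for x
    proof -
      have "inverse (n * V) = inverse n * inverse V"
        by (rule ennreal_inverse_mult) (use n V in \<open>auto simp: less_top\<close>)
      moreover have "n * inverse n = 1"
        using n ennreal_divide_self[of n] by (simp add: divide_ennreal_def less_top)
      ultimately have "1 / (n * V) * (n * x) = 1 * x * inverse V"
        by (simp add: divide_ennreal_def mult_ac) (metis mult.assoc mult.commute mult_1)
      also have "\<dots> = x / V" by (simp add: divide_ennreal_def)
      finally show ?thesis .
    qed
    then show ?thesis by simp
  qed
  also have "\<dots> = emeasure sphere_unif A"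
  proof -
    have "emeasure sphere_unif A = (\<integral>\<^sup>+x. indicator A x \<partial>sphere_unif)" by simp
    also have "\<dots> = (\<integral>\<^sup>+y. indicator A (sgn y) * indicator (cball 0 1) y \<partial>lborel) / V"
      unfolding V_def by (rule nn_integral_sphere_unif) measurable
    also have "(\<integral>\<^sup>+y. indicator A (sgn y) * indicator (cball 0 1) y \<partial>lborel) = (\<integral>\<^sup>+y. indicator (sgn -` A \<inter> cball 0 1) y \<partial>lborel)"
      by (rule nn_integral_cong) (auto simp: indicator_def)
    also have "\<dots> = emeasure lborel (sgn -` A \<inter> cball 0 1)"
    proof (rule nn_integral_indicator)
      have "sgn -` A \<inter> space borel \<in> sets borel" by (rule measurable_sets) measurable
      then show "sgn -` A \<inter> cball 0 1 \<in> sets lborel" by simp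
    qed
    finally show ?thesis by simp
  qed
  finally show "emeasure (distr sphere_measure borel (\<lambda>x. x)) A = emeasure sphere_unif A" .
qed simp

lemma norm_orthogonal_matrix:
  assumes "orthogonal_matrix (A :: real ^ 'n ^ 'n)"
  shows "norm (A *v x) = norm x"
proof -
  have "orthogonal_transformation ((*v) A)"
    using assms by (simp add: orthogonal_transformation_matrix)
  then show ?thesis by (rule orthogonal_transformation_norm)
qed

text \<open>\<open>A\<close> commutes with \<open>sgn\<close>, preserves the ball and has a
  determinant of modulus 1, so the invariance is a linear change of variables in the ball.\<close>

lemma distr_sphere_unif_orthogonal:
  assumes A: "orthogonal_matrix (A :: real ^ 'n ^ 'n)"
  shows "distr sphere_unif borel ((*v) A) = sphere_unif"
proof (rule measure_eqI)
  fix B assume "B \<in> sets (distr sphere_unif borel ((*v) A))"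
  then have [measurable]: "B \<in> sets borel" by simp
  have d: "\<bar>det A\<bar> = 1" using det_orthogonal_matrix[OF A] by auto
  then have dnz: "det A \<noteq> 0" by auto
  have sgnA: "sgn (A *v y) = A *v sgn y" for y
    by (simp add: sgn_div_norm norm_orthogonal_matrix[OF A] matrix_vector_mult_scaleR)
  have "emeasure sphere_unif B = (\<integral>\<^sup>+x. indicator B x \<partial>sphere_unif)" by simp
  also have "\<dots> = (\<integral>\<^sup>+y. indicator B (sgn y) * indicator (cball 0 1) y \<partial>lborel) / emeasure lborel (cball (0 :: real ^ 'n) 1)"
    by (rule nn_integral_sphere_unif) measurable
  also have "(\<integral>\<^sup>+y. indicator B (sgn y) * indicator (cball 0 1) y \<partial>lborel)
      = ennreal \<bar>det A\<bar> * (\<integral>\<^sup>+y. indicator B (sgn (A *v y)) * indicator (cball 0 1) (A *v y) \<partial>lborel)"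
    by (rule nn_integral_lborel_matrix[OF dnz]) measurable
  also have "\<dots> = (\<integral>\<^sup>+y. indicator B (A *v (sgn y)) * indicator (cball 0 1) y \<partial>lborel)"
    by (simp add: d sgnA indicator_def norm_orthogonal_matrix[OF A])
  also have "\<dots> / emeasure lborel (cball (0 :: real ^ 'n) 1) = (\<integral>\<^sup>+x. indicator B (A *v x) \<partial>sphere_unif)"
    by (rule nn_integral_sphere_unif[symmetric]) measurable
  also have "\<dots> = (\<integral>\<^sup>+x. indicator B x \<partial>distr sphere_unif borel ((*v) A))"
    by (rule nn_integral_distr[symmetric]) measurable
  also have "\<dots> = emeasure (distr sphere_unif borel ((*v) A)) B" by simp
  finally show "emeasure (distr sphere_unif borel ((*v) A)) B = emeasure sphere_unif B" ..
qed simp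

lemma nn_integral_sphere_unif_orthogonal:
  assumes "orthogonal_matrix (A :: real ^ 'n ^ 'n)" and [measurable]: "f \<in> borel_measurable borel"
  shows "(\<integral>\<^sup>+x. f (A *v x) \<partial>sphere_unif) = (\<integral>\<^sup>+x. f x \<partial>sphere_unif)"
proof -
  have "(\<integral>\<^sup>+x. f (A *v x) \<partial>sphere_unif) = (\<integral>\<^sup>+x. f x \<partial>distr sphere_unif borel ((*v) A))"
    by (simp add: nn_integral_distr)
  then show ?thesis by (simp add: distr_sphere_unif_orthogonal assms(1))
qed

section \<open>Cylindrical coordinates around a coordinate axis\<close>

definition perp :: "'n \<Rightarrow> real ^ 'n \<Rightarrow> real ^ 'n" where
  "perp k y = y - (y $ k) *\<^sub>R axis k 1"

lemma perp_measurable [measurable]: "perp k \<in> borel_measurable borel"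
  unfolding perp_def[abs_def] by measurable

lemma perp_nth [simp]: "perp k y $ i = (if i = k then 0 else y $ i)"
  by (auto simp: perp_def axis_def)

lemma perp_scaleR: "perp k (c *\<^sub>R y) = c *\<^sub>R perp k y"
  by (simp add: vec_eq_iff)

lemma perp_add: "perp k (x + y) = perp k x + perp k y"
  by (simp add: vec_eq_iff)

lemma perp_axis [simp]: "perp k (axis k a) = 0"
  by (simp add: vec_eq_iff axis_def)

lemma perp_perp [simp]: "perp k (perp k y) = perp k y"
  by (simp add: vec_eq_iff)

lemma norm_perp_add_axis: "norm (perp k y + a *\<^sub>R axis k 1) = sqrt ((norm (perp k y))\<^sup>2 + a\<^sup>2)"
proof -
  have "orthogonal (perp k y) (a *\<^sub>R axis k 1)"
    by (simp add: orthogonal_def inner_axis)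
  then have "(norm (perp k y + a *\<^sub>R axis k 1))\<^sup>2 = (norm (perp k y))\<^sup>2 + (norm (a *\<^sub>R axis k (1::real) :: real ^ 'a))\<^sup>2"
    by (rule norm_add_Pythagorean)
  then have "(norm (perp k y + a *\<^sub>R axis k 1))\<^sup>2 = (norm (perp k y))\<^sup>2 + a\<^sup>2"
    by simp
  then show ?thesis by (metis norm_ge_zero real_sqrt_unique)
qed

text \<open>With at least two coordinates there is some \<open>j \<noteq> k\<close>, and
  \<open>perp k y = 0\<close> forces \<open>y $ j = 0\<close>, a null hyperplane.\<close>

lemma AE_perp_nonzero:
  assumes "CARD('n::finite) \<ge> 2"
  shows "AE y :: real ^ 'n in lborel. perp k y \<noteq> 0"
proof -
  have "\<exists>j :: 'n. j \<noteq> k"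
  proof (rule ccontr)
    assume "\<nexists>j. j \<noteq> k"
    then have "(UNIV :: 'n set) = {k}" by auto
    then have "CARD('n) = card {k}" by (simp only:)
    then show False using assms by simp
  qed
  then obtain j where j: "j \<noteq> k" ..
  have "negligible {x :: real ^ 'n. axis j 1 \<bullet> x = 0}"
    by (rule negligible_hyperplane) auto
  then have "{x :: real ^ 'n. axis j 1 \<bullet> x = 0} \<in> null_sets lebesgue"
    by (simp add: negligible_iff_null_sets)
  then have "AE y :: real ^ 'n in lebesgue. y \<notin> {x. axis j 1 \<bullet> x = 0}"
    by (rule AE_not_in)
  then have "AE y :: real ^ 'n in lborel. y \<notin> {x. axis j 1 \<bullet> x = 0}"
    by (subst (asm) AE_completion_iff) auto
  then show ?thesis
  proof eventually_elim
    case (elim y)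
    then have "y $ j \<noteq> 0" by (simp add: inner_axis')
    then have "perp k y $ j \<noteq> 0" using j by simp
    then show ?case by (metis zero_index)
  qed
qed

text \<open>
  Cylindrical coordinates around the axis \<open>k\<close>: the point with direction \<open>sgn (perp k y)\<close> and
  cotangent \<open>\<tau>\<close> of the polar angle. The coordinate \<open>y $ k\<close> on the right-hand side is a dummy
  variable, which avoids a type for the orthogonal complement.
\<close>

lemma nn_integral_sphere_unif_slice:
  fixes f :: "real ^ 'n \<Rightarrow> ennreal" and k :: 'n
  assumes [measurable]: "f \<in> borel_measurable borel" and n: "CARD('n) \<ge> 2"
  defines "w \<equiv> \<lambda>y :: real ^ 'n. ennreal (norm (perp k y)) * indicator {..1} (norm (perp k y)) * indicator {0..1} (y $ k)"
  shows "(\<integral>\<^sup>+x. f x \<partial>sphere_unif) =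
    (\<integral>\<^sup>+\<tau>. ennreal (1 / sqrt (1 + \<tau>\<^sup>2) ^ CARD('n)) *
       (\<integral>\<^sup>+y. w y * f ((1 / sqrt (1 + \<tau>\<^sup>2)) *\<^sub>R (sgn (perp k y) + \<tau> *\<^sub>R axis k 1)) \<partial>lborel) \<partial>lborel)
     / emeasure lborel (cball (0 :: real ^ 'n) 1)"
proof -
  define F where "F y = f (sgn y) * indicator (cball 0 1) y" for y :: "real ^ 'n"
  define e where "e = (axis k 1 :: real ^ 'n)"
  define I where "I = (indicator {0..1} :: real \<Rightarrow> ennreal)"
  have [measurable]: "F \<in> borel_measurable borel"
    unfolding F_def[abs_def] by measurable
  have [measurable]: "I \<in> borel_measurable borel"
    unfolding I_def by simp
  have "(\<integral>\<^sup>+y. F y \<partial>lborel) = (\<integral>\<^sup>+a. (\<integral>\<^sup>+y. F (perp k y + a *\<^sub>R e) * I (y $ k) \<partial>lborel) \<partial>lborel)"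
    by (subst nn_integral_replace_coordinate[where k=k]) (simp_all add: perp_def e_def I_def algebra_simps)
  also have "\<dots> = (\<integral>\<^sup>+y. (\<integral>\<^sup>+a. F (perp k y + a *\<^sub>R e) * I (y $ k) \<partial>lborel) \<partial>lborel)"
    by (rule lborel_pair.Fubini') measurable
  \<comment> \<open>Substitution \<open>a = norm (perp k y) * \<tau>\<close>: the height is measured
    in units of the distance from the axis, which makes \<open>\<tau>\<close> the cotangent of the
    polar angle. The Jacobian is the weight \<open>norm (perp k y)\<close>.\<close>
  also have "\<dots> = (\<integral>\<^sup>+y. (\<integral>\<^sup>+\<tau>. ennreal (norm (perp k y)) * (F (perp k y + (norm (perp k y) * \<tau>) *\<^sub>R e) * I (y $ k)) \<partial>lborel) \<partial>lborel)"
  proof (rule nn_integral_cong_AE)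
    show "AE y in lborel. (\<integral>\<^sup>+a. F (perp k y + a *\<^sub>R e) * I (y $ k) \<partial>lborel) = (\<integral>\<^sup>+\<tau>. ennreal (norm (perp k y)) * (F (perp k y + (norm (perp k y) * \<tau>) *\<^sub>R e) * I (y $ k)) \<partial>lborel)"
      using AE_perp_nonzero[OF n, of k]
    proof eventually_elim
      case (elim y)
      have "(\<integral>\<^sup>+a. F (perp k y + a *\<^sub>R e) * I (y $ k) \<partial>lborel) = \<bar>norm (perp k y)\<bar> * (\<integral>\<^sup>+\<tau>. (F (perp k y + (0 + norm (perp k y) * \<tau>) *\<^sub>R e) * I (y $ k)) \<partial>lborel)"
        by (rule nn_integral_real_affine) (use elim in auto)
      then show ?case by (simp add: nn_integral_cmult)
    qed
  qed
  also have "\<dots> = (\<integral>\<^sup>+\<tau>. (\<integral>\<^sup>+y. ennreal (norm (perp k y)) * (F (perp k y + (norm (perp k y) * \<tau>) *\<^sub>R e) * I (y $ k)) \<partial>lborel) \<partial>lborel)"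
    by (rule lborel_pair.Fubini') measurable
  also have "\<dots> = (\<integral>\<^sup>+\<tau>. ennreal (1 / sqrt (1 + \<tau>\<^sup>2) ^ CARD('n)) *
       (\<integral>\<^sup>+y. w y * f ((1 / sqrt (1 + \<tau>\<^sup>2)) *\<^sub>R (sgn (perp k y) + \<tau> *\<^sub>R e)) \<partial>lborel) \<partial>lborel)"
  proof (rule nn_integral_cong)
    fix \<tau> :: real
    define r where "r = sqrt (1 + \<tau>\<^sup>2)"
    have r: "r > 0" unfolding r_def using zero_le_power2[of \<tau>] by (simp add: add_pos_nonneg)
    \<comment> \<open>Shrinking every coordinate but \<open>k\<close> by \<open>1 / r\<close> turns
      the norm of the point into \<open>norm (perp k y)\<close>, so that membership in the ball no
      longer involves \<open>\<tau>\<close>. The cost is \<open>1 / r ^ (CARD('n) - 1)\<close> from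
      the Jacobian and \<open>1 / r\<close> from the weight.\<close>
    define c where "c i = (if i = k then 1 else 1 / r)" for i
    have c: "c i \<noteq> 0" for i using r by (simp add: c_def)
    let ?G = "\<lambda>y. ennreal (norm (perp k y)) * (F (perp k y + (norm (perp k y) * \<tau>) *\<^sub>R e) * I (y $ k))"
    have "(\<integral>\<^sup>+y. ?G y \<partial>lborel) = (\<integral>\<^sup>+y. ?G (\<chi> i. c i * y $ i) \<partial>lborel) * ennreal (1 / r ^ (CARD('n) - 1))"
    proof -
      have "(\<Prod>i\<in>UNIV. \<bar>c i\<bar>) = (\<Prod>i\<in>UNIV - {k}. 1 / r)"
        using r by (subst prod.remove[of _ k]) (auto simp: c_def)
      also have "\<dots> = 1 / r ^ (CARD('n) - 1)" by (simp add: power_one_over card_Diff_singleton)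
      finally show ?thesis
        by (subst nn_integral_lborel_diagonal[where c=c, OF _ c]) (simp_all add: mult.commute)
    qed
    also have "(\<integral>\<^sup>+y. ?G (\<chi> i. c i * y $ i) \<partial>lborel) = (\<integral>\<^sup>+y. ennreal (1 / r) * (w y * f ((1 / r) *\<^sub>R (sgn (perp k y) + \<tau> *\<^sub>R e))) \<partial>lborel)"
    proof (rule nn_integral_cong_AE)
      show "AE y in lborel. ?G (\<chi> i. c i * y $ i) = ennreal (1 / r) * (w y * f ((1 / r) *\<^sub>R (sgn (perp k y) + \<tau> *\<^sub>R e)))"
        using AE_perp_nonzero[OF n, of k]
      proof eventually_elim
        case (elim y)
        define p where "p = perp k y"
        define \<rho> where "\<rho> = norm p"
        have \<rho>: "\<rho> > 0" using elim by (simp add: \<rho>_def p_def)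
        have P: "perp k (\<chi> i. c i * y $ i) = (1 / r) *\<^sub>R p"
          by (simp add: vec_eq_iff c_def p_def)
        have N: "norm ((1 / r) *\<^sub>R p) = \<rho> / r" using r by (simp add: \<rho>_def)
        define z where "z = (1 / r) *\<^sub>R p + (\<rho> / r * \<tau>) *\<^sub>R e"
        have z: "z = (\<rho> / r) *\<^sub>R (sgn p + \<tau> *\<^sub>R e)"
          using \<rho> by (simp add: z_def sgn_div_norm scaleR_add_right flip: \<rho>_def)
        have "norm z = sqrt ((\<rho> / r)\<^sup>2 + (\<rho> / r * \<tau>)\<^sup>2)"
        proof -
          have "z = perp k ((1 / r) *\<^sub>R p) + (\<rho> / r * \<tau>) *\<^sub>R axis k 1"
            by (simp add: z_def e_def perp_scaleR p_def)
          then have "norm z = sqrt ((norm (perp k ((1 / r) *\<^sub>R p)))\<^sup>2 + (\<rho> / r * \<tau>)\<^sup>2)"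
            by (simp only: norm_perp_add_axis)
          moreover have "perp k ((1 / r) *\<^sub>R p) = (1 / r) *\<^sub>R p" by (simp add: perp_scaleR p_def)
          ultimately show ?thesis by (simp only: N)
        qed
        also have "(\<rho> / r)\<^sup>2 + (\<rho> / r * \<tau>)\<^sup>2 = (\<rho> / r)\<^sup>2 * (1 + \<tau>\<^sup>2)"
          by (simp add: power_mult_distrib power_divide add_divide_distrib algebra_simps)
        also have "sqrt ((\<rho> / r)\<^sup>2 * (1 + \<tau>\<^sup>2)) = \<rho>"
          using r \<rho> by (simp add: real_sqrt_mult flip: r_def)
        finally have nz: "norm z = \<rho>" .
        have sz: "sgn z = (1 / r) *\<^sub>R (sgn p + \<tau> *\<^sub>R e)"
          using \<rho> by (simp add: sgn_div_norm[of z] nz) (simp add: z)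
        have "?G (\<chi> i. c i * y $ i) = ennreal (\<rho> / r) * (F z * I (y $ k))"
          unfolding P N by (simp add: z_def c_def)
        also have "F z = f ((1 / r) *\<^sub>R (sgn p + \<tau> *\<^sub>R e)) * indicator {..1} \<rho>"
          by (simp add: F_def sz nz indicator_def)
        also have "ennreal (\<rho> / r) = ennreal (1 / r) * ennreal \<rho>"
          using r \<rho> by (simp flip: ennreal_mult)
        finally show ?case
          by (simp add: w_def I_def mult_ac flip: p_def \<rho>_def)
      qed
    qed
    also have "\<dots> = ennreal (1 / r) * (\<integral>\<^sup>+y. w y * f ((1 / r) *\<^sub>R (sgn (perp k y) + \<tau> *\<^sub>R e)) \<partial>lborel)"
      unfolding w_def by (rule nn_integral_cmult) measurable
    finally have "(\<integral>\<^sup>+y. ?G y \<partial>lborel) = (ennreal (1 / r) * ennreal (1 / r ^ (CARD('n) - 1))) * (\<integral>\<^sup>+y. w y * f ((1 / r) *\<^sub>R (sgn (perp k y) + \<tau> *\<^sub>R e)) \<partial>lborel)"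
      by (simp add: mult_ac)
    also have "ennreal (1 / r) * ennreal (1 / r ^ (CARD('n) - 1)) = ennreal (1 / r ^ CARD('n))"
      using r n by (simp flip: ennreal_mult add: power_eq_if[of r "CARD('n)"])
    finally show "(\<integral>\<^sup>+y. ?G y \<partial>lborel) = ennreal (1 / sqrt (1 + \<tau>\<^sup>2) ^ CARD('n)) *
       (\<integral>\<^sup>+y. w y * f ((1 / sqrt (1 + \<tau>\<^sup>2)) *\<^sub>R (sgn (perp k y) + \<tau> *\<^sub>R e)) \<partial>lborel)"
      by (simp only: r_def)
  qed
  finally show ?thesis
    by (simp add: nn_integral_sphere_unif F_def e_def)
qed

lemma sgn_perp_simps [simp]:
  "perp k (sgn (perp k y)) = sgn (perp k y)" "sgn (perp k y) $ k = 0"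
  by (simp_all add: sgn_div_norm perp_scaleR)

lemma sgn_sgn_eq: "sgn (sgn x) = sgn (x :: 'a::real_normed_vector)"
  by (cases "x = 0") (simp_all add: sgn_div_norm)

text \<open>In the slice formula, \<open>g (x $ k) * h (sgn (perp k x))\<close> becomes a function
  of \<open>\<tau>\<close> times a function of \<open>y\<close>. So the double integral splits; this
  gives both the law of the height and its independence of the direction. The constant
  \<open>c\<close> stays open until \<open>c_eq\<close>.\<close>

lemma sphere_unif_cylindrical:
  fixes k :: "'n::finite"
  assumes n: "CARD('n) \<ge> 2"
  shows "\<exists>c>0. (\<integral>\<^sup>+\<tau>. ennreal (1 / sqrt (1 + \<tau>\<^sup>2) ^ CARD('n)) \<partial>lborel) < \<infinity> \<and>
    (\<forall>g. g \<in> borel_measurable borel \<longrightarrow> (\<integral>\<^sup>+x. g (x $ k) \<partial>(sphere_unif :: (real ^ 'n) measure)) =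
        ennreal c * (\<integral>\<^sup>+\<tau>. ennreal (1 / sqrt (1 + \<tau>\<^sup>2) ^ CARD('n)) * g (\<tau> / sqrt (1 + \<tau>\<^sup>2)) \<partial>lborel)) \<and>
    (\<forall>g h. g \<in> borel_measurable borel \<longrightarrow> h \<in> borel_measurable borel \<longrightarrow>
      (\<integral>\<^sup>+x. g (x $ k) * h (sgn (perp k x)) \<partial>(sphere_unif :: (real ^ 'n) measure)) =
      (\<integral>\<^sup>+x. g (x $ k) \<partial>(sphere_unif :: (real ^ 'n) measure)) * (\<integral>\<^sup>+x. h (sgn (perp k x)) \<partial>sphere_unif))"
proof -
  define w where "w y = ennreal (norm (perp k y)) * indicator {..1} (norm (perp k y)) * indicator {0..1} (y $ k)" for y :: "real ^ 'n"
  define K1 where "K1 g = (\<integral>\<^sup>+\<tau>. ennreal (1 / sqrt (1 + \<tau>\<^sup>2) ^ CARD('n)) * g (\<tau> / sqrt (1 + \<tau>\<^sup>2)) \<partial>lborel)" for g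
  define K2 where "K2 h = (\<integral>\<^sup>+y. w y * h (sgn (perp k y)) \<partial>lborel) / emeasure lborel (cball (0 :: real ^ 'n) 1)" for h
  have w [measurable]: "w \<in> borel_measurable borel" unfolding w_def[abs_def] by measurable
  have main: "(\<integral>\<^sup>+x. g (x $ k) * h (sgn (perp k x)) \<partial>sphere_unif) = K1 g * K2 h"
    if [measurable]: "g \<in> borel_measurable borel" "h \<in> borel_measurable borel" for g and h
  proof -
    have eq: "g (((1 / sqrt (1 + \<tau>\<^sup>2)) *\<^sub>R (sgn (perp k y) + \<tau> *\<^sub>R axis k 1)) $ k) * h (sgn (perp k ((1 / sqrt (1 + \<tau>\<^sup>2)) *\<^sub>R (sgn (perp k y) + \<tau> *\<^sub>R axis k 1))))
       = g (\<tau> / sqrt (1 + \<tau>\<^sup>2)) * h (sgn (perp k y))" for \<tau> y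
    proof -
      have r: "sqrt (1 + \<tau>\<^sup>2) > 0" using zero_le_power2[of \<tau>] by (simp add: add_pos_nonneg)
      then have "sgn (perp k ((1 / sqrt (1 + \<tau>\<^sup>2)) *\<^sub>R (sgn (perp k y) + \<tau> *\<^sub>R axis k 1))) = sgn (perp k y)"
        by (simp only: perp_scaleR perp_add sgn_perp_simps sgn_scaleR sgn_sgn_eq perp_axis) (simp add: sgn_sgn_eq)
      then show ?thesis by simp
    qed
    have "(\<integral>\<^sup>+x. g (x $ k) * h (sgn (perp k x)) \<partial>sphere_unif) =
      (\<integral>\<^sup>+\<tau>. ennreal (1 / sqrt (1 + \<tau>\<^sup>2) ^ CARD('n)) *
       (\<integral>\<^sup>+y. w y * (g (\<tau> / sqrt (1 + \<tau>\<^sup>2)) * h (sgn (perp k y))) \<partial>lborel) \<partial>lborel)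
       / emeasure lborel (cball (0 :: real ^ 'n) 1)"
      by (subst nn_integral_sphere_unif_slice[OF _ n, where k=k]) (simp_all only: eq w_def, measurable)
    also have "\<dots> = (\<integral>\<^sup>+\<tau>. (ennreal (1 / sqrt (1 + \<tau>\<^sup>2) ^ CARD('n)) * g (\<tau> / sqrt (1 + \<tau>\<^sup>2))) *
       (\<integral>\<^sup>+y. w y * h (sgn (perp k y)) \<partial>lborel) \<partial>lborel) / emeasure lborel (cball (0 :: real ^ 'n) 1)"
    proof -
      have "(\<integral>\<^sup>+y. w y * (g (\<tau> / sqrt (1 + \<tau>\<^sup>2)) * h (sgn (perp k y))) \<partial>lborel)
         = g (\<tau> / sqrt (1 + \<tau>\<^sup>2)) * (\<integral>\<^sup>+y. w y * h (sgn (perp k y)) \<partial>lborel)" for \<tau>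
        by (subst nn_integral_cmult[symmetric]) (simp_all add: mult_ac)
      then show ?thesis by (simp add: mult.assoc)
    qed
    also have "(\<integral>\<^sup>+\<tau>. (ennreal (1 / sqrt (1 + \<tau>\<^sup>2) ^ CARD('n)) * g (\<tau> / sqrt (1 + \<tau>\<^sup>2))) *
       (\<integral>\<^sup>+y. w y * h (sgn (perp k y)) \<partial>lborel) \<partial>lborel) = K1 g * (\<integral>\<^sup>+y. w y * h (sgn (perp k y)) \<partial>lborel)"
      unfolding K1_def by (rule nn_integral_multc) measurable
    finally show ?thesis by (simp add: K2_def ennreal_times_divide)
  qed
  \<comment> \<open>Constant \<open>g\<close> and \<open>h\<close> give the total mass. Hence both
    factors are finite and non-zero; the same equation supplies the factor 1 in the product rule at
    the end.\<close>
  have one: "K1 (\<lambda>_. 1) * K2 (\<lambda>_. 1) = 1"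
  proof -
    have "emeasure (sphere_unif :: (real ^ 'n) measure) UNIV = 1"
      using sphere_unif.emeasure_space_1 by simp
    then show ?thesis using main[of "\<lambda>_. 1" "\<lambda>_. 1"] by simp
  qed
  then have K2: "K2 (\<lambda>_. 1) \<noteq> 0" "K2 (\<lambda>_. 1) \<noteq> top" and K1: "K1 (\<lambda>_. 1) \<noteq> top"
    using ennreal_mult_eq_top_iff[of "K1 (\<lambda>_. 1)" "K2 (\<lambda>_. 1)"] by auto
  define c where "c = enn2real (K2 (\<lambda>_. 1))"
  have c: "ennreal c = K2 (\<lambda>_. 1)" using K2 by (simp add: c_def less_top)
  have cpos: "c > 0" using K2 unfolding c_def by (simp add: enn2real_positive_iff less_top zero_less_iff_neq_zero)
  have g: "(\<integral>\<^sup>+x. g (x $ k) \<partial>(sphere_unif :: (real ^ 'n) measure)) = ennreal c * K1 g" if "g \<in> borel_measurable borel" for g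
    using main[OF that, of "\<lambda>_. 1"] by (simp add: c mult.commute)
  show ?thesis
  proof (intro exI[of _ c] conjI allI impI)
    show "c > 0" by (rule cpos)
    show "(\<integral>\<^sup>+\<tau>. ennreal (1 / sqrt (1 + \<tau>\<^sup>2) ^ CARD('n)) \<partial>lborel) < \<infinity>"
      using K1 by (simp add: K1_def less_top)
  next
    fix g :: "real \<Rightarrow> ennreal" assume "g \<in> borel_measurable borel"
    then show "(\<integral>\<^sup>+x. g (x $ k) \<partial>(sphere_unif :: (real ^ 'n) measure)) =
        ennreal c * (\<integral>\<^sup>+\<tau>. ennreal (1 / sqrt (1 + \<tau>\<^sup>2) ^ CARD('n)) * g (\<tau> / sqrt (1 + \<tau>\<^sup>2)) \<partial>lborel)"
      using g by (simp add: K1_def)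
  next
    fix g :: "real \<Rightarrow> ennreal" and h :: "real ^ 'n \<Rightarrow> ennreal"
    assume gm: "g \<in> borel_measurable borel" and hm: "h \<in> borel_measurable borel"
    have "(\<integral>\<^sup>+x. h (sgn (perp k x)) \<partial>sphere_unif) = K1 (\<lambda>_. 1) * K2 h"
      using main[of "\<lambda>_. 1", OF _ hm] by simp
    then have "(\<integral>\<^sup>+x. g (x $ k) \<partial>(sphere_unif :: (real ^ 'n) measure)) * (\<integral>\<^sup>+x. h (sgn (perp k x)) \<partial>sphere_unif)
       = (K1 (\<lambda>_. 1) * K2 (\<lambda>_. 1)) * (K1 g * K2 h)"
      using g[OF gm] by (simp add: c mult_ac)
    then show "(\<integral>\<^sup>+x. g (x $ k) * h (sgn (perp k x)) \<partial>(sphere_unif :: (real ^ 'n) measure)) =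
      (\<integral>\<^sup>+x. g (x $ k) \<partial>(sphere_unif :: (real ^ 'n) measure)) * (\<integral>\<^sup>+x. h (sgn (perp k x)) \<partial>sphere_unif)"
      using main[OF gm hm] by (simp add: one)
  qed
qed

lemma sphere_unif_indep_perp:
  fixes k :: "'n::finite"
  assumes "CARD('n) \<ge> 2" "g \<in> borel_measurable borel" "h \<in> borel_measurable borel"
  shows "(\<integral>\<^sup>+x. g (x $ k) * h (sgn (perp k x)) \<partial>(sphere_unif :: (real ^ 'n) measure)) =
      (\<integral>\<^sup>+x. g (x $ k) \<partial>(sphere_unif :: (real ^ 'n) measure)) * (\<integral>\<^sup>+x. h (sgn (perp k x)) \<partial>sphere_unif)"
proof -
  have "\<forall>g h. g \<in> borel_measurable borel \<longrightarrow> h \<in> borel_measurable borel \<longrightarrow>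
      (\<integral>\<^sup>+x. g (x $ k) * h (sgn (perp k x)) \<partial>(sphere_unif :: (real ^ 'n) measure)) =
      (\<integral>\<^sup>+x. g (x $ k) \<partial>(sphere_unif :: (real ^ 'n) measure)) * (\<integral>\<^sup>+x. h (sgn (perp k x)) \<partial>sphere_unif)"
    using sphere_unif_cylindrical[OF assms(1), of k] by (elim exE conjE)
  then show ?thesis using assms(2,3) by simp
qed

lemma nn_integral_sphere_unif_indicator:
  assumes "{x. f x \<in> A} \<in> sets borel"
  shows "(\<integral>\<^sup>+x. indicator A (f x) \<partial>sphere_unif) = emeasure sphere_unif {x :: real ^ 'n. f x \<in> A}"
proof -
  have "indicator A (f x) = (indicator {x. f x \<in> A} x :: ennreal)" for x
    by (simp add: indicator_def)
  then show ?thesis using assms by (simp only: nn_integral_indicator sets_sphere_unif)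
qed

section \<open>Distribution function of one coordinate\<close>

definition sphere_cdf :: "'n::finite \<Rightarrow> real \<Rightarrow> real" where
  "sphere_cdf k t = measure sphere_unif {x :: real ^ 'n. x $ k \<le> t}"

text \<open>Splitting off the fixed part up to \<open>s - 1\<close> leaves an integral over a
  compact interval, where the usual fundamental theorem applies for \<open>u\<close> near
  \<open>s\<close>.\<close>

lemma integral_atMost_has_derivative:
  fixes h :: "real \<Rightarrow> real"
  assumes int: "integrable lborel h" and cont: "continuous_on UNIV h"
  shows "((\<lambda>s. (LINT x:{..s}|lborel. h x)) has_real_derivative h s) (at s)"
proof -
  have [measurable]: "h \<in> borel_measurable borel"
    using borel_measurable_integrable[OF int] by simp
  have si: "set_integrable lborel A h" if "A \<in> sets borel" for A
    unfolding set_integrable_def using int that by (intro integrable_mult_indicator) auto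
  have eq: "(LINT x:{..u}|lborel. h x) = (LINT x:{..s-1}|lborel. h x) + integral {s-1..u} h" if "u \<in> {s-1<..<s+1}" for u
  proof -
    have "{..u} = {..s-1} \<union> {s-1<..u}" using that by auto
    then have "(LINT x:{..u}|lborel. h x) = (LINT x:{..s-1}|lborel. h x) + (LINT x:{s-1<..u}|lborel. h x)"
      by (simp only:) (rule set_integral_Un, auto intro: si)
    also have "(LINT x:{s-1<..u}|lborel. h x) = (LINT x:{s-1..u}|lborel. h x)"
      by (rule set_integral_cong_set)
        (use AE_lborel_singleton[of "s-1"] in \<open>auto simp: set_borel_measurable_def elim!: eventually_mono\<close>)
    also have "\<dots> = integral {s-1..u} h"
      by (rule set_borel_integral_eq_integral) (rule si, simp)
    finally show ?thesis .
  qed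
  have "((\<lambda>u. integral {s-1..u} h) has_real_derivative h s) (at s within {s-1..s+1})"
    by (rule integral_has_real_derivative) (auto intro: continuous_on_subset[OF cont])
  then have "((\<lambda>u. integral {s-1..u} h) has_real_derivative h s) (at s)"
    by (simp add: at_within_Icc_at)
  then have "((\<lambda>u. (LINT x:{..s-1}|lborel. h x) + integral {s-1..u} h) has_real_derivative h s) (at s)"
    by (auto intro!: derivative_eq_intros)
  then show ?thesis
    by (rule has_field_derivative_transform_within_open[where S="{s-1<..<s+1}"]) (auto simp: eq)
qed

text \<open>The height \<open>\<tau> / sqrt (1 + \<tau>\<^sup>2)\<close> increases with
  \<open>\<tau>\<close> and has the inverse \<open>t / sqrt (1 - t\<^sup>2)\<close>, so the
  distribution function is an integral up to that point. With
  \<open>q = sqrt (1 - t\<^sup>2)\<close>, the chain rule gives \<open>q ^ CARD('n)\<close> from the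
  integrand and \<open>1 / q ^ 3\<close> from the inverse, which explains the exponent.\<close>

lemma sphere_cdf_has_derivative_ex:
  fixes k :: "'n::finite"
  assumes n: "CARD('n) \<ge> 2"
  shows "\<exists>c>0. \<forall>t. \<bar>t\<bar> < 1 \<longrightarrow> (sphere_cdf k has_real_derivative c * (1 - t\<^sup>2) powr ((real CARD('n) - 3) / 2)) (at t)"
proof -
  obtain c where c: "c > 0" and fin: "(\<integral>\<^sup>+\<tau>. ennreal (1 / sqrt (1 + \<tau>\<^sup>2) ^ CARD('n)) \<partial>lborel) < \<infinity>"
    and g: "\<And>g. g \<in> borel_measurable borel \<Longrightarrow> (\<integral>\<^sup>+x. g (x $ k) \<partial>(sphere_unif :: (real ^ 'n) measure)) =
        ennreal c * (\<integral>\<^sup>+\<tau>. ennreal (1 / sqrt (1 + \<tau>\<^sup>2) ^ CARD('n)) * g (\<tau> / sqrt (1 + \<tau>\<^sup>2)) \<partial>lborel)"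
    using sphere_unif_cylindrical[OF n, of k] by blast
  define h where "h \<tau> = 1 / sqrt (1 + \<tau>\<^sup>2) ^ CARD('n)" for \<tau> :: real
  have r: "sqrt (1 + \<tau>\<^sup>2) > 0" for \<tau> :: real using zero_le_power2[of \<tau>] by (simp add: add_pos_nonneg)
  have h0: "h \<tau> \<ge> 0" for \<tau> using r[of \<tau>] by (simp add: h_def)
  have hm [measurable]: "h \<in> borel_measurable borel" unfolding h_def[abs_def] by measurable
  have hi: "integrable lborel h"
    by (rule integrableI_nonneg) (use fin h0 in \<open>auto simp: h_def\<close>)
  have hc: "continuous_on UNIV h"
    unfolding h_def[abs_def] using r by (intro continuous_intros) (auto simp: less_le)
  define J where "J s = (LINT x:{..s}|lborel. h x)" for s
  have cdf: "sphere_cdf k t = c * J (t / sqrt (1 - t\<^sup>2))" if t: "\<bar>t\<bar> < 1" for t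
  proof -
    define q where "q = sqrt (1 - t\<^sup>2)"
    have t2: "t\<^sup>2 < 1" using t by (simp add: abs_square_less_1)
    then have q: "q > 0" "q\<^sup>2 = 1 - t\<^sup>2" by (simp_all add: q_def)
    have iff: "\<tau> / sqrt (1 + \<tau>\<^sup>2) \<le> t \<longleftrightarrow> \<tau> \<le> t / q" for \<tau>
    proof -
      define f where "f \<tau> = \<tau> / sqrt (1 + \<tau>\<^sup>2)" for \<tau> :: real
      have "f a < f b" if "a < b" for a b
      proof (rule DERIV_pos_imp_increasing[OF that])
        fix x :: real
        have p: "1 + x\<^sup>2 > 0" using zero_le_power2[of x] by (rule add_pos_nonneg[OF zero_less_one])
        have "(f has_real_derivative (1 * sqrt (1 + x\<^sup>2) - x * (x / sqrt (1 + x\<^sup>2))) / (sqrt (1 + x\<^sup>2) * sqrt (1 + x\<^sup>2))) (at x)"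
          unfolding f_def[abs_def] using p r[of x]
          by (auto intro!: derivative_eq_intros simp: divide_simps)
        moreover have "1 * sqrt (1 + x\<^sup>2) - x * (x / sqrt (1 + x\<^sup>2)) = 1 / sqrt (1 + x\<^sup>2)"
          using r[of x] p by (simp add: field_simps) (simp add: power2_eq_square)
        ultimately show "\<exists>y. (f has_real_derivative y) (at x) \<and> 0 < y"
          using r[of x] by (intro exI conjI) (assumption, simp)
      qed
      then have "f a \<le> f b \<longleftrightarrow> a \<le> b" for a b by (metis linorder_not_less order_le_less)
      moreover have "f (t / q) = t"
      proof -
        have "1 + (t / q)\<^sup>2 = (1 / q)\<^sup>2" using q t2 by (simp add: power_divide divide_simps)
        then have "sqrt (1 + (t / q)\<^sup>2) = 1 / q" using q by (simp only: real_sqrt_abs) simp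
        then show ?thesis using q by (simp add: f_def)
      qed
      ultimately show ?thesis by (metis f_def)
    qed
    have "ennreal (sphere_cdf k t) = (\<integral>\<^sup>+x. indicator {..t} (x $ k) \<partial>(sphere_unif :: (real ^ 'n) measure))"
      by (subst nn_integral_sphere_unif_indicator) (auto simp: sphere_cdf_def sphere_unif.emeasure_eq_measure)
    also have "\<dots> = ennreal c * (\<integral>\<^sup>+\<tau>. ennreal (h \<tau>) * indicator {..t} (\<tau> / sqrt (1 + \<tau>\<^sup>2)) \<partial>lborel)"
      unfolding h_def by (rule g) simp
    also have "(\<integral>\<^sup>+\<tau>. ennreal (h \<tau>) * indicator {..t} (\<tau> / sqrt (1 + \<tau>\<^sup>2)) \<partial>lborel) = (\<integral>\<^sup>+\<tau>. ennreal (indicator {..t / q} \<tau> *\<^sub>R h \<tau>) \<partial>lborel)"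
      by (rule nn_integral_cong) (auto simp: indicator_def iff)
    also have "\<dots> = ennreal (J (t / q))"
      unfolding J_def set_lebesgue_integral_def
      by (rule nn_integral_eq_integral) (use hi h0 in \<open>auto intro!: integrable_mult_indicator[of "{..t / q}" lborel h, unfolded real_scaleR_def, simplified]\<close>)
    finally have "ennreal (sphere_cdf k t) = ennreal (c * J (t / q))"
      using c by (simp add: ennreal_mult')
    moreover have "J (t / q) \<ge> 0" unfolding J_def set_lebesgue_integral_def
      by (rule integral_nonneg_AE) (simp add: h0)
    ultimately show ?thesis using c by (simp add: sphere_cdf_def q_def)
  qed
  have "(sphere_cdf k has_real_derivative c * (1 - t\<^sup>2) powr ((real CARD('n) - 3) / 2)) (at t)" if t: "\<bar>t\<bar> < 1" for t
  proof -
    define q where "q = sqrt (1 - t\<^sup>2)"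
    have t2: "t\<^sup>2 < 1" using t by (simp add: abs_square_less_1)
    then have q: "q > 0" "q\<^sup>2 = 1 - t\<^sup>2" by (simp_all add: q_def)
    have dT: "((\<lambda>t. t / sqrt (1 - t\<^sup>2)) has_real_derivative 1 / q ^ 3) (at t)"
    proof -
      have "((\<lambda>t. t / sqrt (1 - t\<^sup>2)) has_real_derivative (1 * q - t * (- t / q)) / (q * q)) (at t)"
        using t2 q unfolding q_def by (auto intro!: derivative_eq_intros simp: divide_simps)
      moreover have "1 * q - t * (- t / q) = 1 / q"
        using q by (simp add: field_simps power2_eq_square)
      ultimately show ?thesis by (simp add: power3_eq_cube mult.assoc)
    qed
    have dJ: "(J has_real_derivative h (t / q)) (at (t / sqrt (1 - t\<^sup>2)))"
      unfolding J_def[abs_def] q_def by (rule integral_atMost_has_derivative[OF hi hc])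
    have "((\<lambda>t. c * J (t / sqrt (1 - t\<^sup>2))) has_real_derivative c * (h (t / q) * (1 / q ^ 3))) (at t)"
      by (rule DERIV_cmult, rule DERIV_chain2[OF dJ dT])
    moreover have "h (t / q) * (1 / q ^ 3) = (1 - t\<^sup>2) powr ((real CARD('n) - 3) / 2)"
    proof -
      have "1 + (t / q)\<^sup>2 = (1 / q)\<^sup>2" using q t2 by (simp add: power_divide divide_simps)
      then have "sqrt (1 + (t / q)\<^sup>2) = 1 / q" using q by (simp only: real_sqrt_abs) simp
      then have "h (t / q) = q ^ CARD('n)" by (simp add: h_def power_one_over)
      then have "h (t / q) * (1 / q ^ 3) = q powr (real CARD('n) - 3)"
      proof -
        have "q powr (real CARD('n) - 3) = q powr real CARD('n) / q powr 3" by (rule powr_diff)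
        also have "\<dots> = q ^ CARD('n) / q ^ 3"
          using q(1) by (simp only: powr_realpow powr_numeral)
        finally show ?thesis using \<open>h (t / q) = q ^ CARD('n)\<close> by simp
      qed
      also have "q powr (real CARD('n) - 3) = ((1 - t\<^sup>2) powr (1 / 2)) powr (real CARD('n) - 3)"
        using t2 by (simp add: q_def powr_half_sqrt)
      finally show ?thesis by (simp add: powr_powr)
    qed
    ultimately have "((\<lambda>t. c * J (t / sqrt (1 - t\<^sup>2))) has_real_derivative c * (1 - t\<^sup>2) powr ((real CARD('n) - 3) / 2)) (at t)"
      by (simp only:)
    then show ?thesis
      by (rule has_field_derivative_transform_within_open[where S="{-1<..<1}"]) (use t in \<open>auto simp: cdf\<close>)
  qed
  then show ?thesis using c by blast
qed

text \<open>Rotating \<open>w\<close> to a multiple of \<open>axis k 1\<close> leaves the uniform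
  measure unchanged.\<close>

lemma nn_integral_sphere_unif_inner:
  fixes w :: "real ^ 'n" and k :: 'n
  assumes [measurable]: "f \<in> borel_measurable borel"
  shows "(\<integral>\<^sup>+x. f (x \<bullet> w) \<partial>sphere_unif) = (\<integral>\<^sup>+x. f (norm w * x $ k) \<partial>(sphere_unif :: (real ^ 'n) measure))"
proof -
  obtain T where T: "orthogonal_transformation T" "T w = norm w *\<^sub>R (axis k 1 :: real ^ 'n)"
    using orthogonal_transformation_exists[of w "norm w *\<^sub>R axis k 1"] by auto
  have A: "orthogonal_matrix (matrix T)" using T(1) orthogonal_transformation_matrix by blast
  have AT: "matrix T *v x = T x" for x
    using T(1) orthogonal_transformation_matrix by force
  have "x \<bullet> w = norm w * (matrix T *v x) $ k" for x
  proof -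
    have "x \<bullet> w = T x \<bullet> T w" using T(1) by (simp add: orthogonal_transformation_def)
    then show ?thesis by (simp add: T(2) AT inner_axis)
  qed
  then have "(\<integral>\<^sup>+x. f (x \<bullet> w) \<partial>sphere_unif) = (\<integral>\<^sup>+x. f (norm w * (matrix T *v x) $ k) \<partial>sphere_unif)" by simp
  also have "\<dots> = (\<integral>\<^sup>+x. f (norm w * x $ k) \<partial>sphere_unif)"
    by (rule nn_integral_sphere_unif_orthogonal[OF A, where f="\<lambda>x. f (norm w * x $ k)"]) measurable
  finally show ?thesis .
qed

text \<open>The height equals \<open>t\<close> for at most one cotangent \<open>\<tau>\<close>, and
  a single point has Lebesgue measure 0.\<close>

lemma AE_sphere_unif_nth_neq:
  fixes k :: "'n::finite"
  assumes n: "CARD('n) \<ge> 2"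
  shows "AE x in (sphere_unif :: (real ^ 'n) measure). x $ k \<noteq> t"
proof -
  obtain c where g: "\<And>g. g \<in> borel_measurable borel \<Longrightarrow> (\<integral>\<^sup>+x. g (x $ k) \<partial>(sphere_unif :: (real ^ 'n) measure)) =
        ennreal c * (\<integral>\<^sup>+\<tau>. ennreal (1 / sqrt (1 + \<tau>\<^sup>2) ^ CARD('n)) * g (\<tau> / sqrt (1 + \<tau>\<^sup>2)) \<partial>lborel)"
    using sphere_unif_cylindrical[OF n, of k] by blast
  have "(\<integral>\<^sup>+x. indicator {t} (x $ k) \<partial>(sphere_unif :: (real ^ 'n) measure)) =
      ennreal c * (\<integral>\<^sup>+\<tau>. ennreal (1 / sqrt (1 + \<tau>\<^sup>2) ^ CARD('n)) * indicator {t} (\<tau> / sqrt (1 + \<tau>\<^sup>2)) \<partial>lborel)"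
    by (rule g) simp
  also have "(\<integral>\<^sup>+\<tau>. ennreal (1 / sqrt (1 + \<tau>\<^sup>2) ^ CARD('n)) * indicator {t} (\<tau> / sqrt (1 + \<tau>\<^sup>2)) \<partial>lborel) = 0"
  proof (subst nn_integral_0_iff_AE)
    have "\<tau> = t / sqrt (1 - t\<^sup>2)" if "t = \<tau> / sqrt (1 + \<tau>\<^sup>2)" for \<tau>
    proof -
      have p: "1 + \<tau>\<^sup>2 > 0" using zero_le_power2[of \<tau>] by (rule add_pos_nonneg[OF zero_less_one])
      then have "t\<^sup>2 = \<tau>\<^sup>2 / (1 + \<tau>\<^sup>2)" by (simp add: that power_divide)
      then have "1 - t\<^sup>2 = 1 / (1 + \<tau>\<^sup>2)" using p by (simp add: field_simps)
      then have "sqrt (1 - t\<^sup>2) = 1 / sqrt (1 + \<tau>\<^sup>2)" by (simp add: real_sqrt_divide)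
      then show ?thesis using that p by simp
    qed
    then have eq0: "indicator {t} (\<tau> / sqrt (1 + \<tau>\<^sup>2)) = (0 :: ennreal)" if "\<tau> \<noteq> t / sqrt (1 - t\<^sup>2)" for \<tau>
      using that by (metis indicator_simps(2) singletonD)
    show "AE \<tau> in lborel. ennreal (1 / sqrt (1 + \<tau>\<^sup>2) ^ CARD('n)) * indicator {t} (\<tau> / sqrt (1 + \<tau>\<^sup>2)) = 0"
      using AE_lborel_singleton[of "t / sqrt (1 - t\<^sup>2)"]
    proof eventually_elim
      case (elim \<tau>)
      show ?case by (subst eq0[OF elim]) simp
    qed
  qed measurable
  finally have "(\<integral>\<^sup>+x. indicator {t} (x $ k) \<partial>(sphere_unif :: (real ^ 'n) measure)) = 0" by simp
  then have "AE x in (sphere_unif :: (real ^ 'n) measure). indicator {t} (x $ k) = (0 :: ennreal)"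
    by (subst (asm) nn_integral_0_iff_AE) (auto simp: measurable_cong_sets[OF sets_sphere_unif refl])
  then show ?thesis by eventually_elim (auto simp: indicator_def)
qed

lemma AE_sphere_unif_inner_neq:
  fixes w :: "real ^ 'n"
  assumes n: "CARD('n) \<ge> 2" and w: "w \<noteq> 0"
  shows "AE x in sphere_unif. x \<bullet> w \<noteq> c"
proof -
  fix k :: 'n
  have "AE x in (sphere_unif :: (real ^ 'n) measure). x $ k \<noteq> c / norm w"
    by (rule AE_sphere_unif_nth_neq[OF n])
  then have "AE x in (sphere_unif :: (real ^ 'n) measure). indicator {c} (norm w * x $ k) = (0 :: ennreal)"
  proof eventually_elim
    case (elim x)
    then show ?case using w by (auto simp: indicator_def field_simps)
  qed
  then have "(\<integral>\<^sup>+x. indicator {c} (norm w * x $ k) \<partial>(sphere_unif :: (real ^ 'n) measure)) = 0"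
    by (subst nn_integral_0_iff_AE) auto
  then have "(\<integral>\<^sup>+x. indicator {c} (x \<bullet> w) \<partial>sphere_unif) = 0"
    by (subst nn_integral_sphere_unif_inner[where k=k]) auto
  then have "AE x in sphere_unif. indicator {c} (x \<bullet> w) = (0 :: ennreal)"
    by (subst (asm) nn_integral_0_iff_AE) auto
  then show ?thesis by eventually_elim (auto simp: indicator_def)
qed

text \<open>Rotation reduces the side of the hyperplane to a comparison of one coordinate with
  \<open>1 / norm w\<close>, the distance of the hyperplane from the origin; the hyperplane itself
  is null.\<close>

lemma emeasure_sphere_unif_halfspace:
  fixes w :: "real ^ 'n" and k :: 'n
  assumes n: "CARD('n) \<ge> 2" and w: "w \<noteq> 0"
  shows "emeasure sphere_unif {x. x \<bullet> w < 1} = ennreal (sphere_cdf k (1 / norm w))"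
    and "emeasure sphere_unif {x. x \<bullet> w > 1} = ennreal (1 - sphere_cdf k (1 / norm w))"
proof -
  have "AE x in sphere_unif. x \<bullet> w \<noteq> 1" by (rule AE_sphere_unif_inner_neq[OF n w])
  then have "emeasure sphere_unif {x. x \<bullet> w < 1} = emeasure sphere_unif {x. x \<bullet> w \<le> 1}"
    by (intro emeasure_eq_AE) (auto elim: eventually_mono)
  also have "\<dots> = (\<integral>\<^sup>+x. indicator {..1} (x \<bullet> w) \<partial>sphere_unif)"
    by (subst nn_integral_sphere_unif_indicator) auto
  also have "\<dots> = (\<integral>\<^sup>+x. indicator {..1} (norm w * x $ k) \<partial>(sphere_unif :: (real ^ 'n) measure))"
    by (rule nn_integral_sphere_unif_inner) simp
  also have "\<dots> = emeasure sphere_unif {x :: real ^ 'n. x $ k \<le> 1 / norm w}"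
    using w by (subst nn_integral_sphere_unif_indicator) (auto simp: field_simps)
  finally have le: "emeasure sphere_unif {x. x \<bullet> w \<le> 1} = ennreal (sphere_cdf k (1 / norm w))"
    and lt: "emeasure sphere_unif {x. x \<bullet> w < 1} = ennreal (sphere_cdf k (1 / norm w))"
    using \<open>emeasure sphere_unif {x. x \<bullet> w < 1} = emeasure sphere_unif {x. x \<bullet> w \<le> 1}\<close>
    by (simp_all add: sphere_cdf_def sphere_unif.emeasure_eq_measure)
  show "emeasure sphere_unif {x. x \<bullet> w < 1} = ennreal (sphere_cdf k (1 / norm w))" by (rule lt)
  have "measure sphere_unif (space sphere_unif - {x. x \<bullet> w \<le> 1}) = 1 - measure sphere_unif {x. x \<bullet> w \<le> 1}"
    by (rule sphere_unif.prob_compl) simp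
  moreover have "space sphere_unif - {x. x \<bullet> w \<le> 1} = {x. x \<bullet> w > 1}" by auto
  moreover have "measure sphere_unif {x. x \<bullet> w \<le> 1} = sphere_cdf k (1 / norm w)"
    using le by (simp add: sphere_unif.emeasure_eq_measure sphere_cdf_def)
  ultimately show "emeasure sphere_unif {x. x \<bullet> w > 1} = ennreal (1 - sphere_cdf k (1 / norm w))"
    by (simp add: sphere_unif.emeasure_eq_measure)
qed

text \<open>\<open>nn_integral_sphere_unif_inner\<close> for \<open>- axis k 1\<close> shows that a
  coordinate and its negative have the same law; the absence of atoms turns \<open>\<ge>\<close>
  into \<open>>\<close>.\<close>

lemma sphere_cdf_minus:
  fixes k :: "'n::finite"
  assumes n: "CARD('n) \<ge> 2"
  shows "sphere_cdf k (- t) = 1 - sphere_cdf k t"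
proof -
  have "(\<integral>\<^sup>+x. indicator {..-t} (x $ k) \<partial>(sphere_unif :: (real ^ 'n) measure)) = (\<integral>\<^sup>+x. indicator {..-t} (x \<bullet> (- axis k 1)) \<partial>(sphere_unif :: (real ^ 'n) measure))"
    by (subst nn_integral_sphere_unif_inner[where k=k]) auto
  also have "\<dots> = (\<integral>\<^sup>+x. indicator {t..} (x $ k) \<partial>(sphere_unif :: (real ^ 'n) measure))"
    by (rule nn_integral_cong) (auto simp: inner_axis indicator_def)
  also have "\<dots> = emeasure sphere_unif {x :: real ^ 'n. x $ k \<ge> t}"
    by (subst nn_integral_sphere_unif_indicator) auto
  also have "\<dots> = emeasure sphere_unif {x :: real ^ 'n. x $ k > t}"
    using AE_sphere_unif_nth_neq[OF n, of k t]
    by (intro emeasure_eq_AE) (auto elim: eventually_mono)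
  also have "(\<integral>\<^sup>+x. indicator {..-t} (x $ k) \<partial>(sphere_unif :: (real ^ 'n) measure)) = emeasure sphere_unif {x :: real ^ 'n. x $ k \<le> - t}"
    by (subst nn_integral_sphere_unif_indicator) auto
  finally have "sphere_cdf k (- t) = measure sphere_unif {x :: real ^ 'n. x $ k > t}"
    by (simp add: sphere_cdf_def sphere_unif.emeasure_eq_measure)
  also have "{x :: real ^ 'n. x $ k > t} = space sphere_unif - {x. x $ k \<le> t}" by auto
  also have "measure sphere_unif \<dots> = 1 - measure sphere_unif {x :: real ^ 'n. x $ k \<le> t}"
    by (rule sphere_unif.prob_compl) simp
  finally show ?thesis by (simp add: sphere_cdf_def)
qed

text \<open>A coordinate stays in \<open>{-1..1}\<close> and has no atom at 1; the limit at
  \<open>-1\<close> follows by symmetry.\<close>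

lemma sphere_cdf_at_left:
  fixes k :: "'n::finite"
  assumes n: "CARD('n) \<ge> 2"
  shows "(sphere_cdf k \<longlongrightarrow> 1) (at_left 1)" "(sphere_cdf k \<longlongrightarrow> 0) (at_right (-1))"
proof -
  define D where "D = distr (sphere_unif :: (real ^ 'n) measure) borel (\<lambda>x. x $ k)"
  interpret D: real_distribution D
    unfolding D_def by (rule sphere_unif.real_distribution_distr) simp
  have cdf: "cdf D = sphere_cdf k"
    by (auto simp: cdf_def D_def sphere_cdf_def measure_distr fun_eq_iff vimage_def)
  have AE: "AE x in (sphere_unif :: (real ^ 'n) measure). - 1 \<le> x $ k \<and> x $ k \<le> 1"
    using AE_sphere_unif_norm
  proof eventually_elim
    case (elim x)
    then show ?case using component_le_norm_cart[of x k] by linarith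
  qed
  have "measure D {..<1} = 1"
  proof -
    have "measure D {..<1} = measure sphere_unif {x :: real ^ 'n. x $ k < 1}"
      by (auto simp: D_def measure_distr vimage_def)
    also have "\<dots> = 1"
      by (subst sphere_unif.prob_eq_1)
         (use AE AE_sphere_unif_nth_neq[OF n, of k 1] in \<open>auto elim: eventually_elim2\<close>)
    finally show ?thesis .
  qed
  then show l: "(sphere_cdf k \<longlongrightarrow> 1) (at_left 1)"
    using D.cdf_at_left[of 1] by (simp add: cdf)
  have "(sphere_cdf k \<longlongrightarrow> 1 - 1) (at_right (-1))"
  proof -
    have "((\<lambda>t. 1 - sphere_cdf k t) \<longlongrightarrow> 1 - 1) (at_left 1)"
      by (intro tendsto_intros l)
    then have "((\<lambda>t. sphere_cdf k (- t)) \<longlongrightarrow> 1 - 1) (at_left 1)"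
      by (simp add: sphere_cdf_minus[OF n])
    then show ?thesis by (simp add: filterlim_at_left_to_right)
  qed
  then show "(sphere_cdf k \<longlongrightarrow> 0) (at_right (-1))" by simp
qed

section \<open>Random matrices with uniform rows\<close>

text \<open>The points are indexed by the coordinate type, so that a sample is a square matrix whose
  rows are the points.\<close>

abbreviation unif_rows :: "('n::finite \<Rightarrow> real ^ 'n) measure" where
  "unif_rows \<equiv> Pi\<^sub>M UNIV (\<lambda>_. sphere_unif)"

interpretation unif_prod: product_sigma_finite "\<lambda>_ :: 'i. sphere_unif :: (real ^ 'n::finite) measure"
  by unfold_locales

interpretation unif_rows: prob_space "unif_rows :: ('n::finite \<Rightarrow> real ^ 'n) measure"
  by (rule prob_space_PiM) (rule sphere_unif.prob_space_axioms)

lemma borel_measurable_vec_lambda: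
  fixes f :: "'a \<Rightarrow> 'n::finite \<Rightarrow> 'b::euclidean_space"
  assumes "\<And>i. (\<lambda>x. f x i) \<in> borel_measurable M"
  shows "(\<lambda>x. \<chi> i. f x i) \<in> borel_measurable M"
proof (subst borel_measurable_iff_halfspace_le, safe)
  fix b :: "'b ^ 'n" and a assume "b \<in> Basis"
  then obtain i c where b: "b = axis i c" "c \<in> Basis" by (auto simp: Basis_vec_def)
  have "(\<chi> i. f x i) \<bullet> b = f x i \<bullet> c" for x by (simp add: b inner_axis)
  moreover have "(\<lambda>x. f x i \<bullet> c) \<in> borel_measurable M" using assms by measurable
  ultimately show "{x \<in> space M. (\<chi> i. f x i) \<bullet> b \<le> a} \<in> sets M" by simp
qed

lemma continuous_on_det: "continuous_on UNIV (det :: real ^ 'n ^ 'n \<Rightarrow> real)"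
  unfolding det_def[abs_def] by (intro continuous_intros)

lemma borel_measurable_det [measurable]: "(det :: real ^ 'n ^ 'n \<Rightarrow> real) \<in> borel_measurable borel"
  by (rule borel_measurable_continuous_onI[OF continuous_on_det])

lemma measurable_unif_component [measurable]:
  "(\<lambda>x. x i) \<in> borel_measurable (unif_rows :: ('n::finite \<Rightarrow> real ^ 'n) measure)"
proof -
  have "(\<lambda>x. x i) \<in> (unif_rows :: ('n::finite \<Rightarrow> real ^ 'n) measure) \<rightarrow>\<^sub>M sphere_unif" by measurable
  then show ?thesis by (simp add: measurable_cong_sets[OF refl sets_sphere_unif])
qed

lemma measurable_rows [measurable]:
  "(\<lambda>x. \<chi> i. x i) \<in> borel_measurable (unif_rows :: ('n::finite \<Rightarrow> real ^ 'n) measure)"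
  by (rule borel_measurable_vec_lambda) measurable

text \<open>Expansion of row \<open>j\<close> in unit vectors; the vector on the right consists of
  the cofactors of that row. As soon as one cofactor is non-zero, a vanishing determinant confines
  \<open>y\<close> to a hyperplane.\<close>

lemma det_row_inner:
  fixes a :: "'n \<Rightarrow> real ^ 'n::finite"
  shows "det (\<chi> i. if i = j then y else a i) = y \<bullet> (\<chi> l. det (\<chi> i. if i = j then axis l 1 else a i))"
proof -
  have "det (\<chi> i. if i = j then y else a i) = det (\<chi> i. if i = j then (\<Sum>l\<in>UNIV. y $ l *s axis l 1) else a i)"
    by (simp only: basis_expansion)
  also have "\<dots> = (\<Sum>l\<in>UNIV. det (\<chi> i. if i = j then y $ l *s axis l 1 else a i))"
    by (rule det_linear_row_sum[where a="\<lambda>_ l. y $ l *s axis l 1"]) simp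
  also have "\<dots> = (\<Sum>l\<in>UNIV. y $ l * det (\<chi> i. if i = j then axis l 1 else a i))"
    by (rule sum.cong[OF refl]) (rule det_row_mul[where a="\<lambda>_. axis _ 1"])
  finally show ?thesis by (simp add: inner_vec_def)
qed

text \<open>Completing the random rows in \<open>J\<close> to a square matrix by unit vectors allows an induction on \<open>J\<close>.\<close>

lemma AE_det_partial_rows:
  assumes n: "CARD('n::finite) \<ge> 2"
  shows "AE x in Pi\<^sub>M J (\<lambda>_. sphere_unif). det (\<chi> i :: 'n. if i \<in> J then x i else (axis i 1 :: real ^ 'n)) \<noteq> 0"
proof -
  have "finite J" by simp
  then show ?thesis
  proof (induction J rule: finite_induct)
    case empty
    have "(\<chi> i :: 'n. (axis i 1 :: real ^ 'n)) = mat 1"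
      by (simp add: vec_eq_iff mat_def axis_def eq_commute)
    then show ?case by simp
  next
    case (insert j J)
    define m where "m J x = (\<chi> i :: 'n. if i \<in> J then x i else (axis i 1 :: real ^ 'n))" for J x
    have mm [measurable]: "m J \<in> borel_measurable (Pi\<^sub>M J (\<lambda>_. sphere_unif))" for J
      unfolding m_def[abs_def]
    proof (rule borel_measurable_vec_lambda)
      fix i show "(\<lambda>x. if i \<in> J then x i else axis i 1) \<in> borel_measurable (Pi\<^sub>M J (\<lambda>_. sphere_unif))"
      proof (cases "i \<in> J")
        case True
        then have "(\<lambda>x. x i) \<in> Pi\<^sub>M J (\<lambda>_. sphere_unif :: (real ^ 'n) measure) \<rightarrow>\<^sub>M sphere_unif" by measurable
        then show ?thesis using True by (simp add: measurable_cong_sets[OF refl sets_sphere_unif])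
      qed simp
    qed
    let ?M = "\<lambda>J. Pi\<^sub>M J (\<lambda>_. sphere_unif :: (real ^ 'n) measure)"
    let ?f = "\<lambda>x. indicator {0} (det (m (insert j J) x)) :: ennreal"
    have "(\<integral>\<^sup>+x. ?f x \<partial>?M (insert j J)) = (\<integral>\<^sup>+x. (\<integral>\<^sup>+y. ?f (x(j := y)) \<partial>sphere_unif) \<partial>?M J)"
      by (rule unif_prod.product_nn_integral_insert) (use insert.hyps in auto)
    also have "\<dots> = (\<integral>\<^sup>+x. 0 \<partial>?M J)"
    proof (rule nn_integral_cong_AE)
      show "AE x in ?M J. (\<integral>\<^sup>+y. ?f (x(j := y)) \<partial>sphere_unif) = 0"
        using insert.IH
      proof eventually_elim
        case (elim x)
        define a where "a i = (if i \<in> J then x i else axis i 1)" for i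
        define v where "v = (\<chi> l. det (\<chi> i. if i = j then axis l 1 else a i))"
        have eq: "det (m (insert j J) (x(j := y))) = y \<bullet> v" for y
        proof -
          have "m (insert j J) (x(j := y)) = (\<chi> i. if i = j then y else a i)"
            using insert.hyps by (auto simp: m_def a_def vec_eq_iff)
          then have "det (m (insert j J) (x(j := y))) = det (\<chi> i. if i = j then y else a i)" by (rule arg_cong)
          also have "\<dots> = y \<bullet> v" unfolding v_def by (rule det_row_inner)
          finally show ?thesis .
        qed
        \<comment> \<open>The cofactor \<open>v $ j\<close> is the determinant with
          \<open>axis j 1\<close> in row \<open>j\<close>, which is the one that the induction
          hypothesis keeps away from 0.\<close>
        have "(\<chi> i. if i \<in> J then x i else axis i 1) = (\<chi> i. if i = j then axis j 1 else a i)"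
          using insert.hyps by (auto simp: a_def vec_eq_iff)
        then have "v $ j \<noteq> 0" using elim by (simp add: v_def)
        then have "v \<noteq> 0" by auto
        have "(\<integral>\<^sup>+y. ?f (x(j := y)) \<partial>sphere_unif) = (\<integral>\<^sup>+y. 0 \<partial>(sphere_unif :: (real ^ 'n) measure))"
          using AE_sphere_unif_inner_neq[OF n \<open>v \<noteq> 0\<close>, of 0]
          by (intro nn_integral_cong_AE) (auto simp: eq elim!: eventually_mono)
        then show ?case by simp
      qed
    qed
    finally have "(\<integral>\<^sup>+x. ?f x \<partial>?M (insert j J)) = 0" by simp
    then have "AE x in ?M (insert j J). ?f x = 0"
      by (subst (asm) nn_integral_0_iff_AE) auto
    then show ?case unfolding m_def[symmetric]
      by eventually_elim (auto simp: indicator_def split: if_splits)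
  qed
qed

lemma AE_det_unif_rows:
  assumes "CARD('n::finite) \<ge> 2"
  shows "AE x in (unif_rows :: ('n \<Rightarrow> real ^ 'n) measure). det (\<chi> i. x i) \<noteq> 0"
  using AE_det_partial_rows[OF assms, of UNIV] by simp

text \<open>Cramer's rule as an explicit total formula gives measurability in \<open>A\<close> and
  continuity in \<open>z\<close> directly. For \<open>z = 1\<close>, the all-ones vector, the
  solution is the normal vector \<open>w\<close> whose inner product with every row of
  \<open>A\<close> is 1.\<close>

definition cramer_sol :: "real ^ 'n ^ 'n \<Rightarrow> real ^ 'n \<Rightarrow> real ^ 'n" where
  "cramer_sol A z = (\<chi> k. det (\<chi> i j. if j = k then z $ i else A $ i $ j) / det A)"

lemma cramer_sol_iff:
  assumes "det A \<noteq> 0"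
  shows "A *v x = z \<longleftrightarrow> x = cramer_sol A z"
  unfolding cramer_sol_def by (rule cramer[OF assms])

lemma cramer_sol_mult:
  assumes "det A \<noteq> 0"
  shows "A *v cramer_sol A z = z" "cramer_sol A (A *v x) = x"
  using cramer_sol_iff[OF assms, of "cramer_sol A z" z] cramer_sol_iff[OF assms, of x "A *v x"] by simp_all

lemma borel_measurable_cramer_sol [measurable (raw)]:
  fixes f :: "'a \<Rightarrow> real ^ 'n ^ 'n"
  assumes "f \<in> borel_measurable M" "g \<in> borel_measurable M"
  shows "(\<lambda>x. cramer_sol (f x) (g x)) \<in> borel_measurable M"
proof -
  have "(\<lambda>p :: (real ^ 'n ^ 'n) \<times> (real ^ 'n). det (\<chi> i j. if j = k then snd p $ i else fst p $ i $ j)) \<in> borel_measurable borel" for k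
  proof (rule borel_measurable_continuous_onI, rule continuous_on_compose2[OF continuous_on_det])
    have "continuous_on UNIV (\<lambda>x :: (real ^ 'n ^ 'n) \<times> (real ^ 'n). if j = k then snd x $ i else fst x $ i $ j)" for i j
      by (cases "j = k") (auto intro!: continuous_intros)
    then show "continuous_on UNIV (\<lambda>x :: (real ^ 'n ^ 'n) \<times> (real ^ 'n). \<chi> i j. if j = k then snd x $ i else fst x $ i $ j)"
      by (intro continuous_on_vec_lambda)
  qed simp
  then have "(\<lambda>x. det (\<chi> i j. if j = k then g x $ i else f x $ i $ j)) \<in> borel_measurable M" for k
    using measurable_compose[OF borel_measurable_Pair[OF assms], of "\<lambda>p. det (\<chi> i j. if j = k then snd p $ i else fst p $ i $ j)" borel]
    by (simp cong: if_cong)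
  then show ?thesis unfolding cramer_sol_def
    by (intro borel_measurable_vec_lambda borel_measurable_divide measurable_compose[OF assms(1)] borel_measurable_det)
qed

lemma tendsto_cramer_sol:
  fixes A :: "real ^ 'n ^ 'n"
  assumes "(f \<longlongrightarrow> z) F"
  shows "((\<lambda>x. cramer_sol A (f x)) \<longlongrightarrow> cramer_sol A z) F"
proof -
  have "((\<lambda>x. det (\<chi> i j. if j = k then f x $ i else A $ i $ j)) \<longlongrightarrow> det (\<chi> i j. if j = k then z $ i else A $ i $ j)) F" for k
  proof (rule continuous_on_tendsto_compose[OF continuous_on_det])
    show "((\<lambda>x. \<chi> i j. if j = k then f x $ i else A $ i $ j) \<longlongrightarrow> (\<chi> i j. if j = k then z $ i else A $ i $ j)) F"
    proof (intro tendsto_vec_lambda)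
      fix i j show "((\<lambda>x. if j = k then f x $ i else A $ i $ j) \<longlongrightarrow> (if j = k then z $ i else A $ i $ j)) F"
        by (cases "j = k") (auto intro!: tendsto_vec_nth assms)
    qed
  qed simp_all
  then show ?thesis unfolding cramer_sol_def divide_inverse
    by (intro tendsto_vec_lambda tendsto_mult_right)
qed

text \<open>Written as a product so that it factors over independent rows.
  \<open>slab 1 (1 + \<zeta>)\<close> is the indicator of the cube of side 2 centred at 0.\<close>

definition slab :: "real \<Rightarrow> real ^ 'n \<Rightarrow> ennreal" where
  "slab \<epsilon> z = (\<Prod>i\<in>UNIV. indicator {- \<epsilon>..\<epsilon>} (z $ i - 1))"

lemma slab_measurable [measurable]: "slab \<epsilon> \<in> borel_measurable borel"
  unfolding slab_def[abs_def] by measurable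

text \<open>Both sides are the integral of \<open>slab \<epsilon> z * g (cramer_sol A z)\<close>
  over \<open>z\<close>, after the substitution \<open>z = 1 + \<epsilon> *\<^sub>R \<zeta>\<close>
  on the left and \<open>z = A *v w\<close> on the right.\<close>

lemma nn_integral_cramer_sol:
  fixes A :: "real ^ 'n ^ 'n" and g :: "real ^ 'n \<Rightarrow> ennreal"
  assumes [measurable]: "g \<in> borel_measurable borel" and A: "det A \<noteq> 0" and \<epsilon>: "\<epsilon> > 0"
  shows "ennreal (\<epsilon> ^ CARD('n)) * (\<integral>\<^sup>+\<zeta>. slab 1 (1 + \<zeta>) * g (cramer_sol A (1 + \<epsilon> *\<^sub>R \<zeta>)) \<partial>lborel)
    = (\<integral>\<^sup>+w. ennreal \<bar>det A\<bar> * (slab \<epsilon> (A *v w) * g w) \<partial>lborel)"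
proof -
  define F where "F z = slab \<epsilon> z * g (cramer_sol A z)" for z
  have [measurable]: "F \<in> borel_measurable borel" unfolding F_def[abs_def] by measurable
  have s: "slab \<epsilon> (1 + \<epsilon> *\<^sub>R \<zeta>) = slab 1 (1 + \<zeta> :: real ^ 'n)" for \<zeta> :: "real ^ 'n"
    unfolding slab_def
  proof (rule prod.cong[OF refl])
    fix i
    have "- \<epsilon> \<le> \<epsilon> * a \<longleftrightarrow> - 1 \<le> a" "\<epsilon> * a \<le> \<epsilon> \<longleftrightarrow> a \<le> 1" for a
      using \<epsilon> mult_le_cancel_left_pos[of \<epsilon> "-1" a] mult_le_cancel_left_pos[of \<epsilon> a 1] by auto
    then show "indicator {- \<epsilon>..\<epsilon>} ((1 + \<epsilon> *\<^sub>R \<zeta>) $ i - 1) = (indicator {- 1..1} ((1 + \<zeta>) $ i - 1) :: ennreal)"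
      by (simp add: indicator_def)
  qed
  have "(\<integral>\<^sup>+z. F z \<partial>lborel) = (\<integral>\<^sup>+z. F z \<partial>density (distr lborel borel (\<lambda>x. 1 + \<epsilon> *\<^sub>R x)) (\<lambda>_. \<bar>\<epsilon>\<bar> ^ DIM(real ^ 'n)))"
    using lborel_affine[of \<epsilon> "1 :: real ^ 'n"] \<epsilon> by simp
  also have "\<dots> = ennreal (\<epsilon> ^ CARD('n)) * (\<integral>\<^sup>+\<zeta>. F (1 + \<epsilon> *\<^sub>R \<zeta>) \<partial>lborel)"
    using \<epsilon> by (simp add: nn_integral_density nn_integral_distr nn_integral_cmult ennreal_power[symmetric])
  finally have 1: "(\<integral>\<^sup>+z. F z \<partial>lborel) = \<dots>" .
  have "(\<integral>\<^sup>+z. F z \<partial>lborel) = ennreal \<bar>det A\<bar> * (\<integral>\<^sup>+w. F (A *v w) \<partial>lborel)"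
    by (rule nn_integral_lborel_matrix[OF A]) measurable
  also have "\<dots> = (\<integral>\<^sup>+w. ennreal \<bar>det A\<bar> * (slab \<epsilon> (A *v w) * g w) \<partial>lborel)"
    by (subst nn_integral_cmult[symmetric]) (simp_all add: F_def cramer_sol_mult[OF A])
  finally show ?thesis using 1 by (simp add: F_def s)
qed

text \<open>Divided by \<open>(2 * \<epsilon>) ^ CARD('n)\<close>, this is the Lebesgue density of
  the solution \<open>w\<close> when the right-hand side is uniform on the cube of half-width
  \<open>\<epsilon>\<close> around 1; \<open>nn_integral_unif_rows_cramer_sol\<close> expresses
  this.\<close>

definition slab_det :: "real \<Rightarrow> real ^ 'n \<Rightarrow> ennreal" where
  "slab_det \<epsilon> w = (\<integral>\<^sup>+x. ennreal \<bar>det (\<chi> i. x i)\<bar> * slab \<epsilon> ((\<chi> i. x i) *v w) \<partial>unif_rows)"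

lemma borel_measurable_mult_vec [measurable (raw)]:
  fixes f :: "'a \<Rightarrow> real ^ 'n ^ 'm"
  assumes "f \<in> borel_measurable M" "g \<in> borel_measurable M"
  shows "(\<lambda>x. f x *v g x) \<in> borel_measurable M"
proof -
  have "(\<lambda>p :: (real ^ 'n ^ 'm) \<times> (real ^ 'n). fst p *v snd p) \<in> borel_measurable borel"
    unfolding matrix_vector_mult_def
    by (intro borel_measurable_continuous_onI continuous_intros)
  from measurable_compose[OF borel_measurable_Pair[OF assms] this] show ?thesis by simp
qed

lemma nn_integral_unif_rows_cramer_sol:
  fixes g :: "real ^ 'n \<Rightarrow> ennreal"
  assumes n: "CARD('n::finite) \<ge> 2" and [measurable]: "g \<in> borel_measurable borel" and \<epsilon>: "\<epsilon> > 0"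
  shows "ennreal (\<epsilon> ^ CARD('n)) * (\<integral>\<^sup>+x. (\<integral>\<^sup>+\<zeta>. slab 1 (1 + \<zeta>) * g (cramer_sol (\<chi> i. x i) (1 + \<epsilon> *\<^sub>R \<zeta>)) \<partial>lborel) \<partial>unif_rows)
    = (\<integral>\<^sup>+w. slab_det \<epsilon> w * g w \<partial>lborel)"
proof -
  interpret P: pair_sigma_finite "unif_rows :: ('n \<Rightarrow> real ^ 'n) measure" "lborel :: (real ^ 'n) measure"
    by unfold_locales
  have "ennreal (\<epsilon> ^ CARD('n)) * (\<integral>\<^sup>+x. (\<integral>\<^sup>+\<zeta>. slab 1 (1 + \<zeta>) * g (cramer_sol (\<chi> i. x i) (1 + \<epsilon> *\<^sub>R \<zeta>)) \<partial>lborel) \<partial>unif_rows)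
    = (\<integral>\<^sup>+x. ennreal (\<epsilon> ^ CARD('n)) * (\<integral>\<^sup>+\<zeta>. slab 1 (1 + \<zeta>) * g (cramer_sol (\<chi> i. x i) (1 + \<epsilon> *\<^sub>R \<zeta>)) \<partial>lborel) \<partial>unif_rows)"
    by (rule nn_integral_cmult[symmetric]) measurable
  also have "\<dots> = (\<integral>\<^sup>+x. (\<integral>\<^sup>+w. ennreal \<bar>det (\<chi> i. x i)\<bar> * (slab \<epsilon> ((\<chi> i. x i) *v w) * g w) \<partial>lborel) \<partial>unif_rows)"
    using AE_det_unif_rows[OF n]
    by (intro nn_integral_cong_AE, elim eventually_mono) (rule nn_integral_cramer_sol[OF _ _ \<epsilon>], measurable)
  also have "\<dots> = (\<integral>\<^sup>+w. (\<integral>\<^sup>+x. ennreal \<bar>det (\<chi> i. x i)\<bar> * (slab \<epsilon> ((\<chi> i. x i) *v w) * g w) \<partial>unif_rows) \<partial>lborel)"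
    by (rule P.Fubini'[symmetric]) measurable
  also have "\<dots> = (\<integral>\<^sup>+w. slab_det \<epsilon> w * g w \<partial>lborel)"
  proof (rule nn_integral_cong)
    fix w :: "real ^ 'n"
    show "(\<integral>\<^sup>+x. ennreal \<bar>det (\<chi> i. x i)\<bar> * (slab \<epsilon> ((\<chi> i. x i) *v w) * g w) \<partial>unif_rows) = slab_det \<epsilon> w * g w"
      unfolding slab_det_def by (subst nn_integral_multc[symmetric]) (simp_all add: mult.assoc)
  qed
  finally show ?thesis .
qed

text \<open>Rotating all points at once multiplies the matrix on the right by
  \<open>transpose B\<close>. This keeps the modulus of the determinant and the product measure, so
  only the norm of \<open>w\<close> matters.\<close>

lemma slab_det_rotate:
  fixes w :: "real ^ 'n::finite" and k :: 'n
  shows "slab_det \<epsilon> w = slab_det \<epsilon> (norm w *\<^sub>R axis k 1)"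
proof -
  obtain T where T: "orthogonal_transformation T" "T (norm w *\<^sub>R (axis k 1 :: real ^ 'n)) = w"
    using orthogonal_transformation_exists[of "norm w *\<^sub>R axis k 1" w] by auto
  define B where "B = matrix T"
  have B: "orthogonal_matrix B" using T(1) orthogonal_transformation_matrix by (auto simp: B_def)
  have BT: "B *v x = T x" for x
    using T(1) orthogonal_transformation_matrix unfolding B_def by force
  let ?u = "norm w *\<^sub>R axis k 1 :: real ^ 'n"
  define F where "F x = ennreal \<bar>det (\<chi> i. x i)\<bar> * slab \<epsilon> ((\<chi> i. x i) *v w)" for x :: "'n \<Rightarrow> real ^ 'n"
  have [measurable]: "F \<in> borel_measurable unif_rows" unfolding F_def[abs_def] by measurable
  have "distr unif_rows unif_rows (compose UNIV ((*v) B)) = Pi\<^sub>M UNIV (\<lambda>_. distr sphere_unif sphere_unif ((*v) B))"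
    by (rule distr_PiM_finite_prob_space') (simp_all add: sphere_unif.prob_space_axioms)
  also have "distr sphere_unif sphere_unif ((*v) B) = sphere_unif"
    using distr_sphere_unif_orthogonal[OF B] by (simp cong: distr_cong)
  finally have inv: "distr unif_rows unif_rows (compose UNIV ((*v) B)) = unif_rows" .
  have eq: "F (compose UNIV ((*v) B) x) = ennreal \<bar>det (\<chi> i. x i)\<bar> * slab \<epsilon> ((\<chi> i. x i) *v ?u)" for x
  proof -
    have mul: "(\<chi> i. compose UNIV ((*v) B) x i) = (\<chi> i. x i) ** transpose B"
      by (simp add: vec_eq_iff compose_def matrix_vector_mult_def matrix_matrix_mult_def transpose_def mult.commute)
    have "\<bar>det (transpose B)\<bar> = 1" using det_orthogonal_matrix[OF B] by (auto simp: det_transpose)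
    then have "\<bar>det ((\<chi> i. x i) ** transpose B)\<bar> = \<bar>det (\<chi> i. x i)\<bar>" by (simp add: det_mul abs_mult)
    moreover have "((\<chi> i. x i) ** transpose B) *v w = (\<chi> i. x i) *v ?u"
    proof -
      have "transpose B *v w = ?u"
      proof -
        have "transpose B *v (B *v ?u) = ?u"
          using B by (simp only: matrix_vector_mul_assoc orthogonal_matrix_def matrix_vector_mul_lid)
        then show ?thesis by (simp only: BT T(2))
      qed
      then show ?thesis by (simp flip: matrix_vector_mul_assoc)
    qed
    ultimately show ?thesis by (simp only: F_def mul)
  qed
  have "slab_det \<epsilon> w = (\<integral>\<^sup>+x. F x \<partial>distr unif_rows unif_rows (compose UNIV ((*v) B)))"
    by (simp add: inv slab_det_def F_def)
  also have "\<dots> = (\<integral>\<^sup>+x. F (compose UNIV ((*v) B) x) \<partial>unif_rows)"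
    by (rule nn_integral_distr) (auto simp: compose_def intro!: measurable_PiM_single')
  also have "\<dots> = slab_det \<epsilon> ?u" by (simp add: eq slab_det_def)
  finally show ?thesis .
qed

text \<open>Induction over the points: for each new point, \<open>sphere_unif_indep_perp\<close>
  separates its height from its direction. \<open>K\<close> is an arbitrary function of all
  directions because the induction hypothesis is applied to \<open>K'\<close>, the average over the
  new direction.\<close>

lemma nn_integral_PiM_indep_perp:
  fixes k :: "'n::finite" and I :: "'i set"
  assumes n: "CARD('n) \<ge> 2" and [measurable]: "A \<in> sets borel" and "finite I"
    and "K \<in> borel_measurable (Pi\<^sub>M I (\<lambda>_. borel))"
  shows "(\<integral>\<^sup>+x. (\<Prod>i\<in>I. indicator A (x i $ k)) * K (\<lambda>i\<in>I. sgn (perp k (x i))) \<partial>Pi\<^sub>M I (\<lambda>_. sphere_unif :: (real ^ 'n) measure))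
    = emeasure sphere_unif {x :: real ^ 'n. x $ k \<in> A} ^ card I *
      (\<integral>\<^sup>+x. K (\<lambda>i\<in>I. sgn (perp k (x i))) \<partial>Pi\<^sub>M I (\<lambda>_. sphere_unif))"
  using assms(3,4)
proof (induction I arbitrary: K rule: finite_induct)
  case empty
  then show ?case by simp
next
  case (insert i I)
  define \<theta> where "\<theta> y = sgn (perp k y)" for y :: "real ^ 'n"
  define L where "L = emeasure sphere_unif {x :: real ^ 'n. x $ k \<in> A}"
  let ?M = "\<lambda>I. Pi\<^sub>M I (\<lambda>_ :: 'i. sphere_unif :: (real ^ 'n) measure)"
  let ?B = "\<lambda>I. Pi\<^sub>M I (\<lambda>_ :: 'i. borel :: (real ^ 'n) measure)"
  have fin: "finite I" and i: "i \<notin> I" by fact+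
  have \<theta>m [measurable]: "\<theta> \<in> borel_measurable borel" unfolding \<theta>_def[abs_def] by measurable
  have [measurable]: "K \<in> borel_measurable (?B (insert i I))" by (rule insert.prems)
  have restr [measurable]: "(\<lambda>x. \<lambda>j\<in>J. \<theta> (x j)) \<in> ?M J \<rightarrow>\<^sub>M ?B J" for J
  proof (rule measurable_restrict)
    fix j assume "j \<in> J"
    then have "(\<lambda>x. x j) \<in> ?M J \<rightarrow>\<^sub>M sphere_unif" by measurable
    then show "(\<lambda>x. \<theta> (x j)) \<in> borel_measurable (?M J)"
      by (rule measurable_compose) (simp add: measurable_cong_sets[OF sets_sphere_unif refl])
  qed
  have upd: "(\<lambda>j\<in>insert i I. \<theta> ((x(i := y)) j)) = (\<lambda>j\<in>I. \<theta> (x j))(i := \<theta> y)" for x y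
    using i by (auto simp: fun_eq_iff restrict_def)
  define K' where "K' z = (\<integral>\<^sup>+y. K (z(i := \<theta> y)) \<partial>sphere_unif)" for z
  have [measurable]: "K' \<in> borel_measurable (?B I)"
    unfolding K'_def[abs_def]
  proof (rule sphere_unif.borel_measurable_nn_integral)
    have "(\<lambda>(z, y). z(i := y)) \<in> ?B I \<Otimes>\<^sub>M borel \<rightarrow>\<^sub>M ?B (insert i I)"
      by (rule measurable_add_dim)
    then have "(\<lambda>p. (fst p)(i := \<theta> (snd p))) \<in> ?B I \<Otimes>\<^sub>M (sphere_unif :: (real ^ 'n) measure) \<rightarrow>\<^sub>M ?B (insert i I)"
      by measurable
    then show "(\<lambda>(z, y). K (z(i := \<theta> y))) \<in> borel_measurable (?B I \<Otimes>\<^sub>M (sphere_unif :: (real ^ 'n) measure))"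
      unfolding case_prod_beta by (rule measurable_compose) measurable
  qed
  have Km: "(\<lambda>x. K (\<lambda>j\<in>insert i I. \<theta> (x j))) \<in> borel_measurable (?M (insert i I))"
    by (rule measurable_compose[OF restr insert.prems])
  have K'm: "(\<lambda>x. K' (\<lambda>j\<in>I. \<theta> (x j))) \<in> borel_measurable (?M I)"
    by (rule measurable_compose[OF restr]) fact
  have nth: "(\<lambda>y :: real ^ 'n. y $ k) \<in> borel_measurable borel" by measurable
  have "(\<lambda>y :: real ^ 'n. indicator A (y $ k) :: ennreal) \<in> borel_measurable borel"
    by (rule measurable_compose[OF nth borel_measurable_indicator[OF assms(2)]])
  then have Ik: "(\<lambda>y :: real ^ 'n. indicator A (y $ k) :: ennreal) \<in> borel_measurable sphere_unif"
    by (simp only: measurable_cong_sets[OF sets_sphere_unif refl])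
  have Ak: "{x :: real ^ 'n. x $ k \<in> A} \<in> sets borel"
    using measurable_sets[OF nth assms(2)] by (simp add: vimage_def)
  have Pm: "(\<lambda>x. (\<Prod>j\<in>J. indicator A (x j $ k)) :: ennreal) \<in> borel_measurable (?M J)" for J
  proof (rule borel_measurable_prod_ennreal)
    fix j assume "j \<in> J"
    then have "(\<lambda>x. x j) \<in> ?M J \<rightarrow>\<^sub>M sphere_unif" by measurable
    then show "(\<lambda>x. indicator A (x j $ k) :: ennreal) \<in> borel_measurable (?M J)"
      by (rule measurable_compose[where g="\<lambda>y. indicator A (y $ k)", OF _ Ik])
  qed
  have full: "(\<integral>\<^sup>+x. K (\<lambda>j\<in>insert i I. \<theta> (x j)) \<partial>?M (insert i I)) = (\<integral>\<^sup>+x. K' (\<lambda>j\<in>I. \<theta> (x j)) \<partial>?M I)"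
    by (subst unif_prod.product_nn_integral_insert[OF fin i Km]) (simp only: upd K'_def)
  have "(\<integral>\<^sup>+x. (\<Prod>j\<in>insert i I. indicator A (x j $ k)) * K (\<lambda>j\<in>insert i I. \<theta> (x j)) \<partial>?M (insert i I))
    = (\<integral>\<^sup>+x. (\<integral>\<^sup>+y. (\<Prod>j\<in>insert i I. indicator A ((x(i := y)) j $ k)) * K (\<lambda>j\<in>insert i I. \<theta> ((x(i := y)) j)) \<partial>sphere_unif) \<partial>?M I)"
    by (rule unif_prod.product_nn_integral_insert[OF fin i borel_measurable_times_ennreal[OF Pm Km]])
  also have "\<dots> = (\<integral>\<^sup>+x. L * ((\<Prod>j\<in>I. indicator A (x j $ k)) * K' (\<lambda>j\<in>I. \<theta> (x j))) \<partial>?M I)"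
  proof (rule nn_integral_cong)
    fix x assume x: "x \<in> space (?M I)"
    define z where "z = (\<lambda>j\<in>I. \<theta> (x j))"
    have z: "z \<in> space (?B I)" by (auto simp: z_def space_PiM)
    have hm: "(\<lambda>t. K (z(i := t))) \<in> borel_measurable borel"
      by (rule measurable_compose[OF measurable_component_update[OF z i], of K]) fact
    have "(\<Prod>j\<in>insert i I. indicator A ((x(i := y)) j $ k)) = indicator A (y $ k) * (\<Prod>j\<in>I. indicator A (x j $ k) :: ennreal)" for y
    proof -
      have "(\<Prod>j\<in>I. indicator A ((x(i := y)) j $ k)) = (\<Prod>j\<in>I. indicator A (x j $ k) :: ennreal)"
        using i by (intro prod.cong) auto
      then show ?thesis using fin i by simp
    qed
    then have "(\<integral>\<^sup>+y. (\<Prod>j\<in>insert i I. indicator A ((x(i := y)) j $ k)) * K (\<lambda>j\<in>insert i I. \<theta> ((x(i := y)) j)) \<partial>sphere_unif)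
       = (\<integral>\<^sup>+y. (\<Prod>j\<in>I. indicator A (x j $ k)) * (indicator A (y $ k) * K (z(i := \<theta> y))) \<partial>sphere_unif)"
      unfolding upd z_def by (simp add: mult_ac)
    also have "\<dots> = (\<Prod>j\<in>I. indicator A (x j $ k)) * (\<integral>\<^sup>+y. indicator A (y $ k) * K (z(i := \<theta> y)) \<partial>sphere_unif)"
    proof (rule nn_integral_cmult)
      have "(\<lambda>y. K (z(i := \<theta> y))) \<in> borel_measurable sphere_unif"
        by (subst measurable_cong_sets[OF sets_sphere_unif refl]) (rule measurable_compose[OF \<theta>m hm])
      then show "(\<lambda>y. indicator A (y $ k) * K (z(i := \<theta> y))) \<in> borel_measurable sphere_unif"
        by (rule borel_measurable_times_ennreal[OF Ik])
    qed
    also have "(\<integral>\<^sup>+y. indicator A (y $ k) * K (z(i := \<theta> y)) \<partial>sphere_unif)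
       = (\<integral>\<^sup>+y. indicator A (y $ k) \<partial>(sphere_unif :: (real ^ 'n) measure)) * (\<integral>\<^sup>+y. K (z(i := \<theta> y)) \<partial>sphere_unif)"
      unfolding \<theta>_def by (rule sphere_unif_indep_perp[OF n borel_measurable_indicator[OF assms(2)] hm])
    also have "(\<integral>\<^sup>+y. indicator A (y $ k) \<partial>(sphere_unif :: (real ^ 'n) measure)) = L"
      unfolding L_def by (rule nn_integral_sphere_unif_indicator[OF Ak])
    also have "(\<Prod>j\<in>I. indicator A (x j $ k)) * (L * (\<integral>\<^sup>+y. K (z(i := \<theta> y)) \<partial>sphere_unif)) = L * ((\<Prod>j\<in>I. indicator A (x j $ k)) * K' z)"
      unfolding K'_def by (rule mult.left_commute)
    finally show "(\<integral>\<^sup>+y. (\<Prod>j\<in>insert i I. indicator A ((x(i := y)) j $ k)) * K (\<lambda>j\<in>insert i I. \<theta> ((x(i := y)) j)) \<partial>sphere_unif)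
       = L * ((\<Prod>j\<in>I. indicator A (x j $ k)) * K' (\<lambda>j\<in>I. \<theta> (x j)))"
      unfolding z_def .
  qed
  also have "\<dots> = L * (\<integral>\<^sup>+x. (\<Prod>j\<in>I. indicator A (x j $ k)) * K' (\<lambda>j\<in>I. \<theta> (x j)) \<partial>?M I)"
    by (rule nn_integral_cmult[OF borel_measurable_times_ennreal[OF Pm K'm]])
  also have "(\<integral>\<^sup>+x. (\<Prod>j\<in>I. indicator A (x j $ k)) * K' (\<lambda>j\<in>I. \<theta> (x j)) \<partial>?M I) = L ^ card I * (\<integral>\<^sup>+x. K' (\<lambda>j\<in>I. \<theta> (x j)) \<partial>?M I)"
    unfolding \<theta>_def L_def by (rule insert.IH) fact
  finally show ?case
    unfolding \<theta>_def[symmetric] L_def[symmetric] full using fin i by (simp add: mult.assoc)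
qed

text \<open>The left matrix arises from the right one by scaling column \<open>k\<close> by
  \<open>t\<close> and every other column by \<open>c\<close>. For points of common height
  \<open>t\<close> on the sphere, with \<open>c = sqrt (1 - t\<^sup>2)\<close>, this isolates the
  influence of the height on the determinant.\<close>

lemma det_axis_add_rows:
  fixes v :: "'n::finite \<Rightarrow> real ^ 'n"
  assumes v: "\<And>i. v i $ k = 0"
  shows "det (\<chi> i. t *\<^sub>R axis k 1 + c *\<^sub>R v i) = t * c ^ (CARD('n) - 1) * det (\<chi> i. axis k 1 + v i)"
proof -
  define E where "E = (\<chi> i j. if i = j then (if i = k then t else c) else 0 :: real ^ 'n ^ 'n)"
  have "(\<chi> i. t *\<^sub>R axis k 1 + c *\<^sub>R v i) = (\<chi> i. axis k 1 + v i) ** E"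
  proof -
    have "(\<Sum>l\<in>UNIV. (axis k 1 + v i) $ l * (if l = j then (if l = k then t else c) else 0)) = (t *\<^sub>R axis k 1 + c *\<^sub>R v i) $ j" for i j
    proof -
      have "(\<Sum>l\<in>UNIV. (axis k 1 + v i) $ l * (if l = j then (if l = k then t else c) else 0))
         = (\<Sum>l\<in>{j}. (axis k 1 + v i) $ l * (if l = j then (if l = k then t else c) else 0))"
        by (rule sum.mono_neutral_right) auto
      then show ?thesis using v by (auto simp: axis_def)
    qed
    then show ?thesis by (simp add: matrix_matrix_mult_def E_def vec_eq_iff)
  qed
  moreover have "det E = t * c ^ (CARD('n) - 1)"
  proof -
    have "det E = (\<Prod>i\<in>UNIV. E $ i $ i)" by (rule det_diagonal) (simp add: E_def)
    also have "\<dots> = t * (\<Prod>i\<in>UNIV - {k}. E $ i $ i)"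
      by (subst prod.remove[of _ k]) (simp_all add: E_def)
    also have "(\<Prod>i\<in>UNIV - {k}. E $ i $ i) = c ^ (CARD('n) - 1)"
      by (simp add: E_def card_Diff_singleton)
    finally show ?thesis .
  qed
  ultimately show ?thesis by (simp add: det_mul mult.commute)
qed

section \<open>Uniform estimates for determinants\<close>

lemma norm_rows_le:
  fixes X :: "'n::finite \<Rightarrow> real ^ 'n"
  assumes "\<And>i. norm (X i) \<le> b"
  shows "norm (\<chi> i. X i) \<le> real CARD('n) * b"
proof -
  have "norm (\<chi> i. X i) \<le> (\<Sum>i\<in>UNIV. norm (X i))"
    unfolding norm_vec_def[of "\<chi> i. X i"] by (rule order_trans[OF L2_set_le_sum]) simp_all
  also have "\<dots> \<le> (\<Sum>i\<in>(UNIV :: 'n set). b)" by (rule sum_mono) (rule assms)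
  finally show ?thesis by simp
qed

text \<open>Rows of norm at most 1 form a matrix in the compact ball of radius
  \<open>CARD('n)\<close>, where \<open>det\<close> is uniformly continuous.\<close>

lemma det_rows_uniform:
  assumes "\<eta> > 0"
  shows "\<exists>\<delta>>0. \<forall>X Y :: 'n::finite \<Rightarrow> real ^ 'n. (\<forall>i. norm (X i) \<le> 1 \<and> norm (Y i) \<le> 1 \<and> norm (X i - Y i) < \<delta>)
    \<longrightarrow> \<bar>det (\<chi> i. X i) - det (\<chi> i. Y i)\<bar> < \<eta>"
proof -
  have "uniformly_continuous_on (cball 0 (real CARD('n))) (det :: real ^ 'n ^ 'n \<Rightarrow> real)"
    by (rule compact_uniformly_continuous) (auto intro: continuous_on_subset[OF continuous_on_det])
  then obtain d where d: "d > 0" and D: "\<And>A B :: real ^ 'n ^ 'n. A \<in> cball 0 (real CARD('n)) \<Longrightarrow> B \<in> cball 0 (real CARD('n)) \<Longrightarrow>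
      dist A B < d \<Longrightarrow> dist (det A) (det B) < \<eta>"
    unfolding uniformly_continuous_on_def using assms by (metis dist_commute)
  define \<delta> where "\<delta> = d / (2 * real CARD('n))"
  have "\<delta> > 0" using d by (simp add: \<delta>_def)
  moreover have "\<bar>det (\<chi> i. X i) - det (\<chi> i. Y i)\<bar> < \<eta>"
    if "\<forall>i. norm (X i) \<le> 1 \<and> norm (Y i) \<le> 1 \<and> norm (X i - Y i) < \<delta>" for X Y :: "'n \<Rightarrow> real ^ 'n"
  proof -
    have "norm ((\<chi> i. X i) - (\<chi> i. Y i)) = norm (\<chi> i. X i - Y i)"
      by (rule arg_cong[where f=norm]) (simp add: vec_eq_iff)
    also have "\<dots> \<le> real CARD('n) * \<delta>" by (rule norm_rows_le) (use that in \<open>auto intro: less_imp_le\<close>)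
    also have "\<dots> = d / 2" by (simp add: \<delta>_def)
    also have "\<dots> < d" using d by simp
    finally have "dist (det (\<chi> i. X i)) (det (\<chi> i. Y i)) < \<eta>"
      using norm_rows_le[of X 1] norm_rows_le[of Y 1] that by (intro D) (auto simp: dist_norm)
    then show ?thesis by (simp add: dist_real_def)
  qed
  ultimately show ?thesis by blast
qed

lemma det_rows_bounded:
  "\<exists>M>0. \<forall>X :: 'n::finite \<Rightarrow> real ^ 'n. (\<forall>i. norm (X i) \<le> 1) \<longrightarrow> \<bar>det (\<chi> i. X i)\<bar> \<le> M"
proof -
  have "compact ((det :: real ^ 'n ^ 'n \<Rightarrow> real) ` cball 0 (real CARD('n)))"
    by (rule compact_continuous_image) (auto intro: continuous_on_subset[OF continuous_on_det])
  then have "bounded ((det :: real ^ 'n ^ 'n \<Rightarrow> real) ` cball 0 (real CARD('n)))"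
    by (rule compact_imp_bounded)
  then obtain M where M: "M > 0" "\<And>x. x \<in> (det :: real ^ 'n ^ 'n \<Rightarrow> real) ` cball 0 (real CARD('n)) \<Longrightarrow> norm x \<le> M"
    unfolding bounded_pos by blast
  have "\<bar>det (\<chi> i. X i)\<bar> \<le> M" if "\<forall>i. norm (X i) \<le> 1" for X :: "'n \<Rightarrow> real ^ 'n"
    using M(2)[of "det (\<chi> i. X i)"] norm_rows_le[of X 1] that by auto
  then show ?thesis using M(1) by blast
qed

lemma sphere_point_decomp:
  fixes x :: "real ^ 'n"
  assumes "norm x = 1"
  shows "x = (x $ k) *\<^sub>R axis k 1 + sqrt (1 - (x $ k)\<^sup>2) *\<^sub>R sgn (perp k x)"
proof -
  have "x = perp k x + (x $ k) *\<^sub>R axis k 1" by (simp add: perp_def)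
  then have "(norm x)\<^sup>2 = (sqrt ((norm (perp k x))\<^sup>2 + (x $ k)\<^sup>2))\<^sup>2" by (metis norm_perp_add_axis)
  then have "(norm (perp k x))\<^sup>2 = 1 - (x $ k)\<^sup>2" using assms by simp
  then have "norm (perp k x) = sqrt (1 - (x $ k)\<^sup>2)" by (metis norm_ge_zero real_sqrt_unique)
  then have "sqrt (1 - (x $ k)\<^sup>2) *\<^sub>R sgn (perp k x) = norm (perp k x) *\<^sub>R sgn (perp k x)"
    by simp
  also have "\<dots> = perp k x" by (cases "perp k x = 0") (simp_all add: sgn_div_norm)
  finally have "sqrt (1 - (x $ k)\<^sup>2) *\<^sub>R sgn (perp k x) = perp k x" .
  then show ?thesis by (simp add: perp_def)
qed

lemma norm_sphere_point_le:
  assumes "\<bar>t\<bar> \<le> 1"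
  shows "norm (t *\<^sub>R axis k 1 + sqrt (1 - t\<^sup>2) *\<^sub>R sgn (perp k x)) \<le> 1"
proof -
  have t: "t\<^sup>2 \<le> 1" using assms by (simp add: abs_square_le_1)
  have "norm (perp k (sqrt (1 - t\<^sup>2) *\<^sub>R sgn (perp k x)) + t *\<^sub>R axis k 1) = sqrt ((norm (sqrt (1 - t\<^sup>2) *\<^sub>R sgn (perp k x)))\<^sup>2 + t\<^sup>2)"
    unfolding norm_perp_add_axis by (simp add: perp_scaleR)
  also have "\<dots> \<le> sqrt 1"
  proof (rule real_sqrt_le_mono)
    have "norm (sgn (perp k x)) \<le> 1" by (simp add: norm_sgn)
    then have "(norm (sqrt (1 - t\<^sup>2) *\<^sub>R sgn (perp k x)))\<^sup>2 \<le> (sqrt (1 - t\<^sup>2))\<^sup>2"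
      using t by (intro power_mono) (auto simp: mult_left_le)
    then show "(norm (sqrt (1 - t\<^sup>2) *\<^sub>R sgn (perp k x)))\<^sup>2 + t\<^sup>2 \<le> 1" using t by simp
  qed
  finally show ?thesis by (simp add: perp_scaleR add.commute)
qed

section \<open>Mean determinant of points in a thin slab\<close>

lemma measure_sphere_unif_slab:
  fixes k :: "'n::finite"
  assumes n: "CARD('n) \<ge> 2" and "a \<le> b"
  shows "measure sphere_unif {x :: real ^ 'n. x $ k \<in> {a..b}} = sphere_cdf k b - sphere_cdf k a"
proof -
  have "measure sphere_unif {x :: real ^ 'n. x $ k \<in> {a..b}} = measure sphere_unif ({x :: real ^ 'n. x $ k \<le> b} - {x. x $ k \<le> a})"
    using AE_sphere_unif_nth_neq[OF n, of k a]
    by (intro measure_eq_AE) (auto elim: eventually_mono)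
  also have "\<dots> = measure sphere_unif {x :: real ^ 'n. x $ k \<le> b} - measure sphere_unif {x :: real ^ 'n. x $ k \<le> a}"
    by (rule sphere_unif.finite_measure_Diff) (use assms(2) in auto)
  finally show ?thesis by (simp add: sphere_cdf_def)
qed

text \<open>For a normal vector of length \<open>1 / h\<close> along the axis, a tolerance
  \<open>\<epsilon>\<close> in the inner product is a tolerance \<open>h * \<epsilon>\<close> in the
  height. This half-width is the source of a factor \<open>h ^ CARD('n)\<close> in the
  limit.\<close>

lemma slab_det_axis:
  fixes k :: "'n::finite"
  assumes "h > 0"
  shows "slab_det \<epsilon> ((1 / h) *\<^sub>R axis k 1) =
    (\<integral>\<^sup>+x. ennreal \<bar>det (\<chi> i. x i)\<bar> * (\<Prod>i\<in>UNIV. indicator {h - h * \<epsilon>..h + h * \<epsilon>} (x i $ k)) \<partial>(unif_rows :: ('n \<Rightarrow> real ^ 'n) measure))"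
proof -
  have "slab \<epsilon> ((\<chi> i. x i) *v ((1 / h) *\<^sub>R axis k 1)) = (\<Prod>i\<in>UNIV. indicator {h - h * \<epsilon>..h + h * \<epsilon>} (x i $ k))" for x :: "'n \<Rightarrow> real ^ 'n"
    unfolding slab_def
  proof (rule prod.cong[OF refl])
    fix i
    have e: "((\<chi> i. x i) *v ((1 / h) *\<^sub>R axis k 1)) $ i = x i $ k / h"
    proof -
      have "(\<chi> i. x i) *v ((1 / h) *\<^sub>R axis k 1) = (1 / h) *\<^sub>R ((\<chi> i. x i) *v axis k 1)"
        by (simp add: matrix_vector_mult_scaleR)
      then show ?thesis by (simp add: matrix_vector_mul_component inner_axis)
    qed
    show "indicator {- \<epsilon>..\<epsilon>} (((\<chi> i. x i) *v ((1 / h) *\<^sub>R axis k 1)) $ i - 1) = (indicator {h - h * \<epsilon>..h + h * \<epsilon>} (x i $ k) :: ennreal)"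
      unfolding e using assms by (simp add: indicator_def field_simps)
  qed
  then show ?thesis by (simp add: slab_det_def)
qed

text \<open>Up to the factorial of \<open>CARD('n) - 1\<close>, the mean volume of a simplex whose
  vertices are uniform on the unit sphere orthogonal to the axis. Its value is never computed: it
  enters a single constant, which a total mass fixes.\<close>

definition perp_det :: "'n::finite \<Rightarrow> ennreal" where
  "perp_det k = (\<integral>\<^sup>+x. ennreal \<bar>det (\<chi> i. axis k 1 + sgn (perp k (x i)))\<bar> \<partial>(unif_rows :: ('n \<Rightarrow> real ^ 'n) measure))"

lemma AE_unif_rows_norm: "AE x in (unif_rows :: ('n::finite \<Rightarrow> real ^ 'n) measure). \<forall>i. norm (x i) = 1"
proof -
  have "AE x in (unif_rows :: ('n::finite \<Rightarrow> real ^ 'n) measure). norm (x i) = 1" for i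
    by (rule AE_PiM_component[OF sphere_unif.prob_space_axioms UNIV_I AE_sphere_unif_norm])
  then show ?thesis by (subst AE_all_countable) auto
qed

lemma nn_integral_slab_const:
  fixes k :: "'n::finite"
  assumes n: "CARD('n) \<ge> 2" and "\<epsilon> > 0" "h > 0"
  shows "(\<integral>\<^sup>+x. C * (\<Prod>i\<in>UNIV. indicator {h - h * \<epsilon>..h + h * \<epsilon>} (x i $ k)) \<partial>(unif_rows :: ('n \<Rightarrow> real ^ 'n) measure))
    = C * ennreal (sphere_cdf k (h + h * \<epsilon>) - sphere_cdf k (h - h * \<epsilon>)) ^ CARD('n)"
proof -
  have "(\<integral>\<^sup>+x. (\<Prod>i\<in>UNIV. indicator {h - h * \<epsilon>..h + h * \<epsilon>} (x i $ k)) * C \<partial>(unif_rows :: ('n \<Rightarrow> real ^ 'n) measure))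
     = emeasure sphere_unif {x :: real ^ 'n. x $ k \<in> {h - h * \<epsilon>..h + h * \<epsilon>}} ^ CARD('n) * (\<integral>\<^sup>+x. C \<partial>(unif_rows :: ('n \<Rightarrow> real ^ 'n) measure))"
    by (rule nn_integral_PiM_indep_perp[OF n]) simp_all
  moreover have "(\<integral>\<^sup>+x. C \<partial>(unif_rows :: ('n \<Rightarrow> real ^ 'n) measure)) = C"
  proof -
    have "emeasure (unif_rows :: ('n \<Rightarrow> real ^ 'n) measure) (space unif_rows) = 1"
      by (rule unif_rows.emeasure_space_1)
    then show ?thesis by (simp only: nn_integral_const mult_1_right)
  qed
  ultimately show ?thesis using measure_sphere_unif_slab[OF n, of "h - h * \<epsilon>" "h + h * \<epsilon>" k] assms(2,3)
    by (simp add: sphere_unif.emeasure_eq_measure mult.commute)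
qed

text \<open>The determinant is bounded by a constant while the slab condition keeps its exact
  probability. This serves as the dominating bound in the limit of small
  \<open>\<epsilon>\<close>.\<close>

lemma slab_det_bound_ex:
  fixes k :: "'n::finite"
  assumes n: "CARD('n) \<ge> 2"
  shows "\<exists>M>0. \<forall>\<epsilon>>0. \<forall>h>0. slab_det \<epsilon> ((1 / h) *\<^sub>R axis k 1 :: real ^ 'n) \<le> ennreal (M * (sphere_cdf k (h + h * \<epsilon>) - sphere_cdf k (h - h * \<epsilon>)) ^ CARD('n))"
proof -
  obtain M where M: "M > 0" "\<And>X :: 'n \<Rightarrow> real ^ 'n. (\<forall>i. norm (X i) \<le> 1) \<Longrightarrow> \<bar>det (\<chi> i. X i)\<bar> \<le> M"
    using det_rows_bounded[where 'n='n] by blast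
  have "slab_det \<epsilon> ((1 / h) *\<^sub>R axis k 1 :: real ^ 'n) \<le> ennreal (M * (sphere_cdf k (h + h * \<epsilon>) - sphere_cdf k (h - h * \<epsilon>)) ^ CARD('n))"
    if \<epsilon>: "\<epsilon> > 0" and h: "h > 0" for \<epsilon> h
  proof -
    have "slab_det \<epsilon> ((1 / h) *\<^sub>R axis k 1 :: real ^ 'n) \<le>
       (\<integral>\<^sup>+x. ennreal M * (\<Prod>i\<in>UNIV. indicator {h - h * \<epsilon>..h + h * \<epsilon>} (x i $ k)) \<partial>(unif_rows :: ('n \<Rightarrow> real ^ 'n) measure))"
      unfolding slab_det_axis[OF h]
      using AE_unif_rows_norm
      by (intro nn_integral_mono_AE) (auto elim!: eventually_mono intro!: mult_right_mono M(2) ennreal_leI)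
    also have "\<dots> = ennreal M * ennreal (sphere_cdf k (h + h * \<epsilon>) - sphere_cdf k (h - h * \<epsilon>)) ^ CARD('n)"
      by (rule nn_integral_slab_const[OF n \<epsilon> h])
    also have "\<dots> = ennreal (M * (sphere_cdf k (h + h * \<epsilon>) - sphere_cdf k (h - h * \<epsilon>)) ^ CARD('n))"
    proof -
      have "sphere_cdf k (h + h * \<epsilon>) - sphere_cdf k (h - h * \<epsilon>) \<ge> 0"
        using mult_pos_pos[OF h \<epsilon>] by (subst measure_sphere_unif_slab[OF n, symmetric]) auto
      then show ?thesis using M(1) by (simp add: ennreal_mult ennreal_power)
    qed
    finally show ?thesis .
  qed
  then show ?thesis using M(1) by blast
qed

lemma perp_det_finite:
  fixes k :: "'n::finite"
  shows "perp_det k < \<infinity>"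
proof -
  obtain M where M: "M > 0" "\<And>X :: 'n \<Rightarrow> real ^ 'n. (\<forall>i. norm (X i) \<le> 1) \<Longrightarrow> \<bar>det (\<chi> i. X i)\<bar> \<le> M"
    using det_rows_bounded[where 'n='n] by blast
  \<comment> \<open>Halving both parts of each row brings the rows into the unit ball, where
    \<open>M\<close> bounds the determinant; \<open>c\<close> is the factor that
    \<open>det_axis_add_rows\<close> then produces.\<close>
  define c where "c = 1 / 2 * (1 / 2 :: real) ^ (CARD('n) - 1)"
  have c: "c > 0" by (simp add: c_def)
  have "\<bar>det (\<chi> i. axis k 1 + sgn (perp k (x i)))\<bar> \<le> M / c" for x :: "'n \<Rightarrow> real ^ 'n"
  proof -
    have "\<bar>det (\<chi> i. (1 / 2) *\<^sub>R axis k 1 + (1 / 2) *\<^sub>R sgn (perp k (x i)))\<bar> \<le> M"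
    proof (rule M(2), rule allI)
      fix i
      have "norm ((1 / 2) *\<^sub>R axis k 1 + (1 / 2) *\<^sub>R sgn (perp k (x i))) \<le> 1 / 2 * 1 + 1 / 2 * norm (sgn (perp k (x i)))"
        by (rule order_trans[OF norm_triangle_ineq]) simp
      then show "norm ((1 / 2) *\<^sub>R axis k 1 + (1 / 2) *\<^sub>R sgn (perp k (x i))) \<le> 1"
        by (simp add: norm_sgn split: if_splits)
    qed
    also have "det (\<chi> i. (1 / 2) *\<^sub>R axis k 1 + (1 / 2) *\<^sub>R sgn (perp k (x i))) = c * det (\<chi> i. axis k 1 + sgn (perp k (x i)))"
      unfolding c_def by (rule det_axis_add_rows) simp
    finally show ?thesis using c by (simp add: abs_mult field_simps)
  qed
  then have "perp_det k \<le> (\<integral>\<^sup>+x. ennreal (M / c) \<partial>(unif_rows :: ('n \<Rightarrow> real ^ 'n) measure))"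
    unfolding perp_det_def by (intro nn_integral_mono ennreal_leI)
  also have "\<dots> = ennreal (M / c)"
  proof -
    have "emeasure (unif_rows :: ('n \<Rightarrow> real ^ 'n) measure) (space unif_rows) = 1"
      by (rule unif_rows.emeasure_space_1)
    then show ?thesis by (simp only: nn_integral_const mult_1_right)
  qed
  finally show ?thesis by (simp add: order_le_less_trans)
qed

text \<open>Points in a thin slab are moved to height exactly \<open>h\<close>, with their
  directions kept. This changes the determinant by less than \<open>\<eta>\<close>, uniformly. For
  the moved points it depends on the directions alone, which are independent of the heights, so the
  mean splits into the slab probability, the scaling by \<open>det_axis_add_rows\<close> and
  \<open>perp_det k\<close>.\<close>

lemma slab_det_approx:
  fixes k :: "'n::finite"
  assumes n: "CARD('n) \<ge> 2" and h: "0 < h" "h < 1" and \<eta>: "\<eta> > 0"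
  shows "\<exists>\<epsilon>0>0. \<forall>\<epsilon>. 0 < \<epsilon> \<longrightarrow> \<epsilon> < \<epsilon>0 \<longrightarrow>
    \<bar>enn2real (slab_det \<epsilon> ((1 / h) *\<^sub>R axis k 1 :: real ^ 'n)) -
      (sphere_cdf k (h + h * \<epsilon>) - sphere_cdf k (h - h * \<epsilon>)) ^ CARD('n) * (h * sqrt (1 - h\<^sup>2) ^ (CARD('n) - 1) * enn2real (perp_det k))\<bar>
    \<le> \<eta> * (sphere_cdf k (h + h * \<epsilon>) - sphere_cdf k (h - h * \<epsilon>)) ^ CARD('n)"
proof -
  obtain \<delta> where \<delta>: "\<delta> > 0" and D: "\<And>X Y :: 'n \<Rightarrow> real ^ 'n. (\<forall>i. norm (X i) \<le> 1 \<and> norm (Y i) \<le> 1 \<and> norm (X i - Y i) < \<delta>)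
    \<Longrightarrow> \<bar>det (\<chi> i. X i) - det (\<chi> i. Y i)\<bar> < \<eta>"
    using det_rows_uniform[OF \<eta>, where 'n='n] by blast
  obtain M where M: "M > 0" and MB: "\<And>\<epsilon> h. \<epsilon> > 0 \<Longrightarrow> h > 0 \<Longrightarrow> slab_det \<epsilon> ((1 / h) *\<^sub>R axis k 1 :: real ^ 'n) \<le> ennreal (M * (sphere_cdf k (h + h * \<epsilon>) - sphere_cdf k (h - h * \<epsilon>)) ^ CARD('n))"
    using slab_det_bound_ex[OF n, of k] by blast
  have "isCont (\<lambda>t. sqrt (1 - t\<^sup>2)) h" by (intro continuous_intros)
  then obtain \<delta>2 where \<delta>2: "\<delta>2 > 0" and C: "\<And>t. \<bar>t - h\<bar> < \<delta>2 \<Longrightarrow> \<bar>sqrt (1 - t\<^sup>2) - sqrt (1 - h\<^sup>2)\<bar> < \<delta> / 2"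
    using \<delta> unfolding continuous_at_eps_delta dist_real_def by (metis half_gt_zero)
  \<comment> \<open>Half of \<open>\<delta>\<close> pays for the change of height, at most
    \<open>h * \<epsilon> \<le> \<epsilon>\<close>; the other half pays for the change of the
    distance from the axis, by the choice of \<open>\<delta>2\<close>.\<close>
  define \<epsilon>0 where "\<epsilon>0 = min (\<delta> / 2) (min \<delta>2 (1 - h))"
  have "\<epsilon>0 > 0" using \<delta> \<delta>2 h by (simp add: \<epsilon>0_def)
  moreover have "\<bar>enn2real (slab_det \<epsilon> ((1 / h) *\<^sub>R axis k 1 :: real ^ 'n)) -
      (sphere_cdf k (h + h * \<epsilon>) - sphere_cdf k (h - h * \<epsilon>)) ^ CARD('n) * (h * sqrt (1 - h\<^sup>2) ^ (CARD('n) - 1) * enn2real (perp_det k))\<bar>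
    \<le> \<eta> * (sphere_cdf k (h + h * \<epsilon>) - sphere_cdf k (h - h * \<epsilon>)) ^ CARD('n)"
    if \<epsilon>: "0 < \<epsilon>" "\<epsilon> < \<epsilon>0" for \<epsilon>
  proof -
    define L where "L = sphere_cdf k (h + h * \<epsilon>) - sphere_cdf k (h - h * \<epsilon>)"
    define P where "P x = (\<Prod>i\<in>UNIV. indicator {h - h * \<epsilon>..h + h * \<epsilon>} (x i $ k) :: ennreal)" for x :: "'n \<Rightarrow> real ^ 'n"
    define Y where "Y x i = h *\<^sub>R axis k 1 + sqrt (1 - h\<^sup>2) *\<^sub>R sgn (perp k (x i))" for x :: "'n \<Rightarrow> real ^ 'n" and i
    let ?S = "slab_det \<epsilon> ((1 / h) *\<^sub>R axis k 1 :: real ^ 'n)"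
    have L: "L \<ge> 0" unfolding L_def
      using mult_pos_pos[OF h(1) \<epsilon>(1)] by (subst measure_sphere_unif_slab[OF n, symmetric]) auto
    have P: "P x = (if \<forall>i. \<bar>x i $ k - h\<bar> \<le> h * \<epsilon> then 1 else 0)" for x
    proof (cases "\<forall>i. \<bar>x i $ k - h\<bar> \<le> h * \<epsilon>")
      case True
      then have "indicator {h - h * \<epsilon>..h + h * \<epsilon>} (x i $ k) = (1 :: ennreal)" for i
        by (auto simp: indicator_def abs_le_iff algebra_simps)
      then show ?thesis using True by (simp add: P_def)
    next
      case False
      then obtain i where "\<not> \<bar>x i $ k - h\<bar> \<le> h * \<epsilon>" by blast
      then have "indicator {h - h * \<epsilon>..h + h * \<epsilon>} (x i $ k) = (0 :: ennreal)"
        by (auto simp: indicator_def abs_le_iff algebra_simps)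
      then have "P x = 0" unfolding P_def by (intro prod_zero) auto
      then show ?thesis using False by (simp only: if_False)
    qed
    have close: "\<bar>det (\<chi> i. x i) - det (\<chi> i. Y x i)\<bar> < \<eta>" if nx: "\<forall>i. norm (x i) = 1" and x: "\<forall>i. \<bar>x i $ k - h\<bar> \<le> h * \<epsilon>" for x
    proof (rule D, safe)
      fix i
      have "h * \<epsilon> \<le> \<epsilon>" using h \<epsilon> by simp
      then have d: "\<bar>x i $ k - h\<bar> < \<delta> / 2" "\<bar>x i $ k - h\<bar> < \<delta>2" 
      proof -
        have "\<epsilon> < \<delta> / 2" "\<epsilon> < \<delta>2" using \<epsilon> by (auto simp: \<epsilon>0_def)
        then show "\<bar>x i $ k - h\<bar> < \<delta> / 2" "\<bar>x i $ k - h\<bar> < \<delta>2"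
          using x[rule_format, of i] \<open>h * \<epsilon> \<le> \<epsilon>\<close> by linarith+
      qed
      show "norm (x i) \<le> 1" using nx by simp
      show "norm (Y x i) \<le> 1" unfolding Y_def by (rule norm_sphere_point_le) (use h in simp)
      have "x i - Y x i = (x i $ k - h) *\<^sub>R axis k 1 + (sqrt (1 - (x i $ k)\<^sup>2) - sqrt (1 - h\<^sup>2)) *\<^sub>R sgn (perp k (x i))"
        by (subst sphere_point_decomp[of "x i" k]) (use nx in \<open>simp_all add: Y_def algebra_simps\<close>)
      also have "norm \<dots> \<le> \<bar>x i $ k - h\<bar> * 1 + \<bar>sqrt (1 - (x i $ k)\<^sup>2) - sqrt (1 - h\<^sup>2)\<bar> * norm (sgn (perp k (x i)))"
        by (rule order_trans[OF norm_triangle_ineq]) simp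
      also have "\<dots> \<le> \<bar>x i $ k - h\<bar> * 1 + \<bar>sqrt (1 - (x i $ k)\<^sup>2) - sqrt (1 - h\<^sup>2)\<bar> * 1"
        by (intro add_left_mono mult_left_mono) (auto simp: norm_sgn)
      also have "\<dots> < \<delta>" using d(1) C[OF d(2)] by simp
      finally show "norm (x i - Y x i) < \<delta>" .
    qed
    have Pm [measurable]: "P \<in> borel_measurable unif_rows" unfolding P_def[abs_def] by measurable
    have Ym [measurable]: "(\<lambda>x. \<chi> i. Y x i) \<in> borel_measurable unif_rows"
      unfolding Y_def by (rule borel_measurable_vec_lambda) measurable
    have S: "?S = (\<integral>\<^sup>+x. ennreal \<bar>det (\<chi> i. x i)\<bar> * P x \<partial>unif_rows)"
      unfolding P_def by (rule slab_det_axis[OF h(1)])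
    define T where "T = (\<integral>\<^sup>+x. ennreal \<bar>det (\<chi> i. Y x i)\<bar> * P x \<partial>unif_rows)"
    have const: "(\<integral>\<^sup>+x. ennreal \<eta> * P x \<partial>unif_rows) = ennreal (\<eta> * L ^ CARD('n))"
      using nn_integral_slab_const[OF n \<epsilon>(1) h(1), of "ennreal \<eta>" k] L \<eta>
      by (simp add: P_def L_def ennreal_mult ennreal_power)
    have ST: "?S \<le> T + ennreal (\<eta> * L ^ CARD('n))" and TS: "T \<le> ?S + ennreal (\<eta> * L ^ CARD('n))"
    proof -
      have "?S \<le> (\<integral>\<^sup>+x. ennreal \<bar>det (\<chi> i. Y x i)\<bar> * P x + ennreal \<eta> * P x \<partial>unif_rows)"
        unfolding S
      proof (rule nn_integral_mono_AE)
        show "AE x in unif_rows. ennreal \<bar>det (\<chi> i. x i)\<bar> * P x \<le> ennreal \<bar>det (\<chi> i. Y x i)\<bar> * P x + ennreal \<eta> * P x"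
          using AE_unif_rows_norm
        proof eventually_elim
          case (elim x)
          show ?case
          proof (cases "\<forall>i. \<bar>x i $ k - h\<bar> \<le> h * \<epsilon>")
            case True
            have "ennreal \<bar>det (\<chi> i. x i)\<bar> \<le> ennreal (\<bar>det (\<chi> i. Y x i)\<bar> + \<eta>)"
              using close[OF elim True] by (intro ennreal_leI) linarith
            then show ?thesis using True \<eta> by (simp add: P ennreal_plus)
          qed (simp only: P if_False mult_zero_right, simp)
        qed
      qed
      also have "\<dots> = T + ennreal (\<eta> * L ^ CARD('n))"
        unfolding T_def const[symmetric] by (rule nn_integral_add) measurable
      finally show "?S \<le> T + ennreal (\<eta> * L ^ CARD('n))" .
      have "T \<le> (\<integral>\<^sup>+x. ennreal \<bar>det (\<chi> i. x i)\<bar> * P x + ennreal \<eta> * P x \<partial>unif_rows)"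
        unfolding T_def
      proof (rule nn_integral_mono_AE)
        show "AE x in unif_rows. ennreal \<bar>det (\<chi> i. Y x i)\<bar> * P x \<le> ennreal \<bar>det (\<chi> i. x i)\<bar> * P x + ennreal \<eta> * P x"
          using AE_unif_rows_norm
        proof eventually_elim
          case (elim x)
          show ?case
          proof (cases "\<forall>i. \<bar>x i $ k - h\<bar> \<le> h * \<epsilon>")
            case True
            have "ennreal \<bar>det (\<chi> i. Y x i)\<bar> \<le> ennreal (\<bar>det (\<chi> i. x i)\<bar> + \<eta>)"
              using close[OF elim True] by (intro ennreal_leI) linarith
            then show ?thesis using True \<eta> by (simp add: P ennreal_plus)
          qed (simp only: P if_False mult_zero_right, simp)
        qed
      qed
      also have "\<dots> = ?S + ennreal (\<eta> * L ^ CARD('n))"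
        unfolding S const[symmetric] by (rule nn_integral_add) measurable
      finally show "T \<le> ?S + ennreal (\<eta> * L ^ CARD('n))" .
    qed
    define b where "b = h * sqrt (1 - h\<^sup>2) ^ (CARD('n) - 1)"
    have b: "b \<ge> 0" using h by (simp add: b_def abs_square_le_1)
    have T: "T = ennreal (L ^ CARD('n) * (b * enn2real (perp_det k)))"
    proof -
      have Km: "(\<lambda>z. ennreal \<bar>det (\<chi> i. h *\<^sub>R axis k 1 + sqrt (1 - h\<^sup>2) *\<^sub>R z i)\<bar>) \<in> borel_measurable (Pi\<^sub>M UNIV (\<lambda>_ :: 'n. borel :: (real ^ 'n) measure))"
      proof -
        have "(\<lambda>z. \<chi> i. h *\<^sub>R axis k 1 + sqrt (1 - h\<^sup>2) *\<^sub>R z i) \<in> borel_measurable (Pi\<^sub>M UNIV (\<lambda>_ :: 'n. borel :: (real ^ 'n) measure))"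
          by (rule borel_measurable_vec_lambda) measurable
        from measurable_compose[OF this borel_measurable_det] show ?thesis by measurable
      qed
      have "T = (\<integral>\<^sup>+x. (\<Prod>i\<in>UNIV. indicator {h - h * \<epsilon>..h + h * \<epsilon>} (x i $ k)) *
          (\<lambda>z. ennreal \<bar>det (\<chi> i. h *\<^sub>R axis k 1 + sqrt (1 - h\<^sup>2) *\<^sub>R z i)\<bar>) (\<lambda>i\<in>UNIV. sgn (perp k (x i))) \<partial>unif_rows)"
        by (simp add: T_def P_def Y_def mult.commute)
      also have "\<dots> = emeasure sphere_unif {x :: real ^ 'n. x $ k \<in> {h - h * \<epsilon>..h + h * \<epsilon>}} ^ CARD('n) *
          (\<integral>\<^sup>+x. (\<lambda>z. ennreal \<bar>det (\<chi> i. h *\<^sub>R axis k 1 + sqrt (1 - h\<^sup>2) *\<^sub>R z i)\<bar>) (\<lambda>i\<in>UNIV. sgn (perp k (x i))) \<partial>unif_rows)"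
        by (rule nn_integral_PiM_indep_perp[OF n _ _ Km]) simp_all
      also have "emeasure sphere_unif {x :: real ^ 'n. x $ k \<in> {h - h * \<epsilon>..h + h * \<epsilon>}} = ennreal L"
        unfolding L_def using mult_pos_pos[OF h(1) \<epsilon>(1)]
        by (subst measure_sphere_unif_slab[OF n, symmetric]) (auto simp: sphere_unif.emeasure_eq_measure)
      also have "(\<integral>\<^sup>+x. (\<lambda>z. ennreal \<bar>det (\<chi> i. h *\<^sub>R axis k 1 + sqrt (1 - h\<^sup>2) *\<^sub>R z i)\<bar>) (\<lambda>i\<in>UNIV. sgn (perp k (x i))) \<partial>unif_rows)
         = (\<integral>\<^sup>+x. ennreal b * ennreal \<bar>det (\<chi> i. axis k 1 + sgn (perp k (x i)))\<bar> \<partial>unif_rows)"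
      proof (rule nn_integral_cong)
        fix x :: "'n \<Rightarrow> real ^ 'n"
        have "det (\<chi> i. h *\<^sub>R axis k 1 + sqrt (1 - h\<^sup>2) *\<^sub>R sgn (perp k (x i))) = b * det (\<chi> i. axis k 1 + sgn (perp k (x i)))"
          unfolding b_def by (rule det_axis_add_rows) simp
        then show "(\<lambda>z. ennreal \<bar>det (\<chi> i. h *\<^sub>R axis k 1 + sqrt (1 - h\<^sup>2) *\<^sub>R z i)\<bar>) (\<lambda>i\<in>UNIV. sgn (perp k (x i)))
           = ennreal b * ennreal \<bar>det (\<chi> i. axis k 1 + sgn (perp k (x i)))\<bar>"
          using b by (simp add: abs_mult ennreal_mult)
      qed
      also have "\<dots> = ennreal b * perp_det k"
        unfolding perp_det_def
      proof (rule nn_integral_cmult)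
        have "(\<lambda>x. \<chi> i. axis k 1 + sgn (perp k (x i))) \<in> borel_measurable (unif_rows :: ('n \<Rightarrow> real ^ 'n) measure)"
          by (rule borel_measurable_vec_lambda) measurable
        from measurable_compose[OF this borel_measurable_det]
        show "(\<lambda>x. ennreal \<bar>det (\<chi> i. axis k 1 + sgn (perp k (x i)))\<bar>) \<in> borel_measurable (unif_rows :: ('n \<Rightarrow> real ^ 'n) measure)"
          by measurable
      qed
      also have "perp_det k = ennreal (enn2real (perp_det k))" using perp_det_finite[of k] by simp
      finally show ?thesis using L b by (simp add: ennreal_mult ennreal_power)
    qed
    have fin: "?S < \<infinity>" using MB[OF \<epsilon>(1) h(1)] by (simp add: order_le_less_trans)
    then obtain s where s: "?S = ennreal s" "s \<ge> 0" by (cases ?S) auto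
    define a where "a = L ^ CARD('n) * (b * enn2real (perp_det k))"
    define c where "c = \<eta> * L ^ CARD('n)"
    have a0: "a \<ge> 0" and c0: "c \<ge> 0" using L b \<eta> by (simp_all add: a_def c_def)
    have "ennreal s \<le> ennreal (a + c)"
      using ST by (simp only: s(1) T ennreal_plus[OF a0 c0] flip: a_def c_def)
    then have "s \<le> a + c" using a0 c0 ennreal_le_iff[of "a + c" s] by simp
    moreover have "ennreal a \<le> ennreal (s + c)"
      using TS by (simp only: s(1) T ennreal_plus[OF s(2) c0] flip: a_def c_def)
    then have "a \<le> s + c" using s(2) c0 ennreal_le_iff[of "s + c" a] by simp
    ultimately have "\<bar>s - a\<bar> \<le> c" by linarith
    then show ?thesis using s by (simp add: L_def b_def a_def c_def)
  qed
  ultimately show ?thesis by blast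
qed

text \<open>The slab probability divided by \<open>\<epsilon> j\<close> tends to the derivative
  \<open>2 * h * \<phi>\<close> of the slab probability at width 0. Its powers are bounded by some
  \<open>B\<close>, so \<open>slab_det_approx\<close> with \<open>\<eta>\<close> small against
  \<open>1 / B\<close> makes the remaining difference vanish.\<close>

lemma slab_det_tendsto:
  fixes k :: "'n::finite"
  assumes n: "CARD('n) \<ge> 2" and h: "0 < h" "h < 1" and der: "(sphere_cdf k has_real_derivative \<phi>) (at h)"
    and \<epsilon>: "\<And>j. \<epsilon> j > 0" "\<epsilon> \<longlonglongrightarrow> 0"
  shows "(\<lambda>j. enn2real (slab_det (\<epsilon> j) ((1 / h) *\<^sub>R axis k 1 :: real ^ 'n)) / \<epsilon> j ^ CARD('n))
    \<longlonglongrightarrow> (2 * h * \<phi>) ^ CARD('n) * (h * sqrt (1 - h\<^sup>2) ^ (CARD('n) - 1) * enn2real (perp_det k))"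
proof -
  define D where "D = h * sqrt (1 - h\<^sup>2) ^ (CARD('n) - 1) * enn2real (perp_det k)"
  define L where "L j = sphere_cdf k (h + h * \<epsilon> j) - sphere_cdf k (h - h * \<epsilon> j)" for j
  define S where "S j = enn2real (slab_det (\<epsilon> j) ((1 / h) *\<^sub>R axis k 1 :: real ^ 'n))" for j
  have "((\<lambda>e. sphere_cdf k (h + h * e) - sphere_cdf k (h - h * e)) has_real_derivative 2 * h * \<phi>) (at 0)"
  proof -
    have "((\<lambda>e. sphere_cdf k (h + h * e)) has_real_derivative \<phi> * h) (at 0)"
      by (rule DERIV_chain2[where f="sphere_cdf k"]) (use der in \<open>auto intro!: derivative_eq_intros\<close>)
    moreover have "((\<lambda>e. sphere_cdf k (h - h * e)) has_real_derivative \<phi> * (- h)) (at 0)"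
      by (rule DERIV_chain2[where f="sphere_cdf k"]) (use der in \<open>auto intro!: derivative_eq_intros\<close>)
    ultimately have "((\<lambda>e. sphere_cdf k (h + h * e) - sphere_cdf k (h - h * e)) has_real_derivative \<phi> * h - \<phi> * (- h)) (at 0)"
      by (rule DERIV_diff)
    then show ?thesis by (simp add: mult_ac)
  qed
  then have "((\<lambda>y. (sphere_cdf k (h + h * y) - sphere_cdf k (h - h * y)) / y) \<longlongrightarrow> 2 * h * \<phi>) (at 0)"
    by (simp add: has_field_derivative_iff)
  moreover have "filterlim \<epsilon> (at 0) sequentially"
    using \<epsilon> by (auto simp: filterlim_at intro!: always_eventually less_imp_neq[symmetric])
  ultimately have "(\<lambda>j. L j / \<epsilon> j) \<longlonglongrightarrow> 2 * h * \<phi>"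
    unfolding L_def by (rule filterlim_compose)
  then have Ln: "(\<lambda>j. (L j / \<epsilon> j) ^ CARD('n)) \<longlonglongrightarrow> (2 * h * \<phi>) ^ CARD('n)"
    by (intro tendsto_intros)
  then have LD: "(\<lambda>j. (L j / \<epsilon> j) ^ CARD('n) * D) \<longlonglongrightarrow> (2 * h * \<phi>) ^ CARD('n) * D"
    by (rule tendsto_mult[OF _ tendsto_const])
  have "Bseq (\<lambda>j. (L j / \<epsilon> j) ^ CARD('n))"
    using Ln by (auto intro: convergent_imp_Bseq convergentI)
  then obtain B where B: "B > 0" "\<And>j. \<bar>(L j / \<epsilon> j) ^ CARD('n)\<bar> \<le> B"
    by (auto simp: Bseq_def)
  have "(\<lambda>j. S j / \<epsilon> j ^ CARD('n) - (L j / \<epsilon> j) ^ CARD('n) * D) \<longlonglongrightarrow> 0"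
  proof (rule LIMSEQ_I)
    fix r :: real assume r: "r > 0"
    define \<eta> where "\<eta> = r / (2 * B)"
    have \<eta>: "\<eta> > 0" using r B by (simp add: \<eta>_def)
    obtain \<epsilon>0 where \<epsilon>0: "\<epsilon>0 > 0" "\<And>e. 0 < e \<Longrightarrow> e < \<epsilon>0 \<Longrightarrow> \<bar>enn2real (slab_det e ((1 / h) *\<^sub>R axis k 1 :: real ^ 'n)) -
      (sphere_cdf k (h + h * e) - sphere_cdf k (h - h * e)) ^ CARD('n) * D\<bar>
    \<le> \<eta> * (sphere_cdf k (h + h * e) - sphere_cdf k (h - h * e)) ^ CARD('n)"
      using slab_det_approx[OF n h \<eta>, of k] unfolding D_def by blast
    have "eventually (\<lambda>j. \<epsilon> j < \<epsilon>0) sequentially"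
      using \<epsilon>(2) \<epsilon>0(1) by (rule order_tendstoD)
    then obtain N where N: "\<And>j. j \<ge> N \<Longrightarrow> \<epsilon> j < \<epsilon>0" by (auto simp: eventually_sequentially)
    have "norm (S j / \<epsilon> j ^ CARD('n) - (L j / \<epsilon> j) ^ CARD('n) * D - 0) < r" if "j \<ge> N" for j
    proof -
      have e: "\<bar>S j - L j ^ CARD('n) * D\<bar> \<le> \<eta> * L j ^ CARD('n)"
        unfolding S_def L_def by (rule \<epsilon>0(2)) (use \<epsilon> N[OF that] in auto)
      have "\<bar>S j / \<epsilon> j ^ CARD('n) - (L j / \<epsilon> j) ^ CARD('n) * D\<bar> = \<bar>S j - L j ^ CARD('n) * D\<bar> / \<epsilon> j ^ CARD('n)"
        using \<epsilon>(1)[of j] by (simp add: power_divide diff_divide_distrib[symmetric] abs_divide)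
      also have "\<dots> \<le> (\<eta> * L j ^ CARD('n)) / \<epsilon> j ^ CARD('n)"
        using e \<epsilon>(1)[of j] by (intro divide_right_mono) auto
      also have "\<dots> = \<eta> * (L j / \<epsilon> j) ^ CARD('n)" by (simp add: power_divide)
      also have "\<dots> \<le> \<eta> * B" using B(2)[of j] \<eta> by (intro mult_left_mono) auto
      also have "\<dots> < r" using r B(1) by (simp add: \<eta>_def)
      finally show ?thesis by simp
    qed
    then show "\<exists>no. \<forall>j\<ge>no. norm (S j / \<epsilon> j ^ CARD('n) - (L j / \<epsilon> j) ^ CARD('n) * D - 0) < r" by blast
  qed
  from tendsto_add[OF this LD] show ?thesis by (simp add: S_def D_def)
qed

section \<open>Distance of a random hyperplane from the origin\<close>

text \<open>The ball of radius \<open>1 / h\<close> has volume \<open>v / h ^ CARD('n)\<close>, and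
  the density is minus its derivative in \<open>h\<close>. The restriction to \<open>{a..b}\<close>
  keeps both measures finite, so that they can be compared on half-lines.\<close>

lemma distr_inverse_norm:
  fixes a b :: real
  assumes ab: "0 < a" "a < b"
  defines "v \<equiv> unit_ball_vol (real CARD('n::finite))"
  shows "distr (density lborel (\<lambda>w :: real ^ 'n. indicator {a..b} (1 / norm w))) borel (\<lambda>w. 1 / norm w)
    = density lborel (\<lambda>h. ennreal (real CARD('n) * v / h ^ (CARD('n) + 1)) * indicator {a..b} h)"
proof (rule measure_eqI_lessThan)
  let ?n = "CARD('n)"
  let ?M = "distr (density lborel (\<lambda>w :: real ^ 'n. indicator {a..b} (1 / norm w))) borel (\<lambda>w. 1 / norm w)"
  let ?N = "density lborel (\<lambda>h. ennreal (real ?n * v / h ^ (?n + 1)) * indicator {a..b} h)"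
  have v: "v \<ge> 0" by (simp add: v_def)
  show "sets ?M = sets borel" "sets ?N = sets borel" by simp_all
  have m1: "emeasure ?M {x<..} = (\<integral>\<^sup>+w. indicator {a..b} (1 / norm w) * indicator {x<..} (1 / norm w) \<partial>(lborel :: (real ^ 'n) measure))" for x
    by (subst nn_integral_indicator[symmetric])
      (simp_all add: nn_integral_distr nn_integral_density del: nn_integral_indicator)
  have n1: "emeasure ?N {x<..} = (\<integral>\<^sup>+h. ennreal (real ?n * v / h ^ (?n + 1)) * indicator {a..b} h * indicator {x<..} h \<partial>lborel)" for x
    by (simp add: emeasure_density)
  have FTC: "(\<integral>\<^sup>+h. ennreal (real ?n * v / h ^ (?n + 1)) * indicator {y..b} h \<partial>lborel) = ennreal (v * (1 / y) ^ ?n - v * (1 / b) ^ ?n)" if y: "0 < y" "y \<le> b" for y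
  proof -
    have "(\<integral>\<^sup>+h. ennreal (real ?n * v / h ^ (?n + 1)) * indicator {y..b} h \<partial>lborel) = ennreal (- v / b ^ ?n - (- v / y ^ ?n))"
    proof (rule nn_integral_FTC_Icc[where F="\<lambda>h. - v / h ^ ?n"])
      fix h assume h: "h \<in> {y..b}"
      then have h0: "h > 0" using y by simp
      have "((\<lambda>h. - v / h ^ ?n) has_real_derivative (0 * h ^ ?n - (- v) * (real ?n * h ^ (?n - 1))) / (h ^ ?n * h ^ ?n)) (at h)"
        using h0 by (auto intro!: derivative_eq_intros)
      moreover have "(0 * h ^ ?n - (- v) * (real ?n * h ^ (?n - 1))) / (h ^ ?n * h ^ ?n) = real ?n * v / h ^ (?n + 1)"
      proof -
        have "?n + ?n = (?n - 1) + (?n + 1)" using zero_less_card_finite[where 'a='n] by simp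
        then have "h ^ ?n * h ^ ?n = h ^ (?n - 1) * h ^ (?n + 1)" by (metis power_add)
        then show ?thesis using h0 by (simp add: field_simps)
      qed
      ultimately show "((\<lambda>h. - v / h ^ ?n) has_real_derivative real ?n * v / h ^ (?n + 1)) (at h)" by simp
      show "0 \<le> real ?n * v / h ^ (?n + 1)" using h0 v by simp
    qed (use y in simp_all)
    then show ?thesis by (simp add: power_one_over)
  qed
  have vol: "emeasure lborel (cball (0 :: real ^ 'n) r) = ennreal (v * r ^ ?n)" "emeasure lborel (ball (0 :: real ^ 'n) r) = ennreal (v * r ^ ?n)" if "r \<ge> 0" for r
    using that by (simp_all add: emeasure_cball emeasure_ball v_def)
  have shell: "emeasure lborel (B - ball (0 :: real ^ 'n) r) = ennreal (v * R ^ ?n - v * r ^ ?n)"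
    if "B = ball 0 R \<or> B = cball 0 R" "0 \<le> r" "r \<le> R" for B r R
  proof -
    have "ball 0 r \<subseteq> B" using that by auto
    then have "emeasure lborel (B - ball (0 :: real ^ 'n) r) = emeasure lborel B - emeasure lborel (ball (0 :: real ^ 'n) r)"
      using that vol[of r] by (intro emeasure_Diff) auto
    also have "\<dots> = ennreal (v * R ^ ?n) - ennreal (v * r ^ ?n)" using that vol by auto
    also have "\<dots> = ennreal (v * R ^ ?n - v * r ^ ?n)" using v that by (intro ennreal_minus) auto
    finally show ?thesis .
  qed
  have eq: "emeasure ?M {x<..} = emeasure ?N {x<..}" for x
  proof (cases "x < b")
    case False
    have "emeasure ?M {x<..} = 0" unfolding m1 using False by (auto simp: nn_integral_0_iff_AE indicator_def)
    moreover have "emeasure ?N {x<..} = 0" unfolding n1 using False by (auto simp: nn_integral_0_iff_AE indicator_def)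
    ultimately show ?thesis by simp
  next
    case True
    show ?thesis
    proof (cases "x < a")
      case xa: True
      have "emeasure ?M {x<..} = (\<integral>\<^sup>+w. indicator (cball 0 (1 / a) - ball 0 (1 / b)) w \<partial>(lborel :: (real ^ 'n) measure))"
        unfolding m1
      proof (rule nn_integral_cong)
        fix w :: "real ^ 'n"
        have "a \<le> 1 / norm w \<and> 1 / norm w \<le> b \<and> x < 1 / norm w \<longleftrightarrow> norm w \<le> 1 / a \<and> 1 / b \<le> norm w"
        proof -
          have "a \<le> 1 / norm w \<and> 1 / norm w \<le> b \<and> x < 1 / norm w \<longleftrightarrow> a \<le> 1 / norm w \<and> 1 / norm w \<le> b"
            using xa by linarith
          also have "\<dots> \<longleftrightarrow> norm w \<le> 1 / a \<and> 1 / b \<le> norm w"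
            using ab by (cases "w = 0") (auto simp: field_simps)
          finally show ?thesis .
        qed
        then show "indicator {a..b} (1 / norm w) * indicator {x<..} (1 / norm w) = (indicator (cball 0 (1 / a) - ball 0 (1 / b)) w :: ennreal)"
          by (auto simp: indicator_def)
      qed
      also have "\<dots> = ennreal (v * (1 / a) ^ ?n - v * (1 / b) ^ ?n)"
        using ab by (simp add: shell[of _ "1 / a" "1 / b"] frac_le)
      also have "\<dots> = emeasure ?N {x<..}"
        unfolding n1 using ab xa
        by (subst FTC[symmetric]) (auto intro!: nn_integral_cong simp: indicator_def)
      finally show ?thesis .
    next
      case False
      have "emeasure ?M {x<..} = (\<integral>\<^sup>+w. indicator (ball 0 (1 / x) - ball 0 (1 / b)) w \<partial>(lborel :: (real ^ 'n) measure))"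
        unfolding m1
      proof (rule nn_integral_cong)
        fix w :: "real ^ 'n"
        have "a \<le> 1 / norm w \<and> 1 / norm w \<le> b \<and> x < 1 / norm w \<longleftrightarrow> norm w < 1 / x \<and> 1 / b \<le> norm w"
        proof -
          have "a \<le> 1 / norm w \<and> 1 / norm w \<le> b \<and> x < 1 / norm w \<longleftrightarrow> x < 1 / norm w \<and> 1 / norm w \<le> b"
            using False by linarith
          also have "\<dots> \<longleftrightarrow> norm w < 1 / x \<and> 1 / b \<le> norm w"
            using ab False by (cases "w = 0") (auto simp: field_simps)
          finally show ?thesis .
        qed
        then show "indicator {a..b} (1 / norm w) * indicator {x<..} (1 / norm w) = (indicator (ball 0 (1 / x) - ball 0 (1 / b)) w :: ennreal)"
          by (auto simp: indicator_def)
      qed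
      also have "\<dots> = ennreal (v * (1 / x) ^ ?n - v * (1 / b) ^ ?n)"
        using ab False True by (simp add: shell[of _ "1 / x" "1 / b"] frac_le)
      also have "\<dots> = (\<integral>\<^sup>+h. ennreal (real ?n * v / h ^ (?n + 1)) * indicator {x..b} h \<partial>lborel)"
        using ab False True by (subst FTC) auto
      also have "\<dots> = emeasure ?N {x<..}"
        unfolding n1 using AE_lborel_singleton[of x] False
        by (intro nn_integral_cong_AE) (auto elim!: eventually_mono simp: indicator_def)
      finally show ?thesis .
    qed
  qed
  show "emeasure ?M {x<..} = emeasure ?N {x<..}" for x by (rule eq)
  show "emeasure ?M {x<..} < \<infinity>" for x
  proof -
    have "emeasure ?N {x<..} \<le> emeasure ?N UNIV" by (rule emeasure_mono) auto
    also have "emeasure ?N UNIV = (\<integral>\<^sup>+h. ennreal (real ?n * v / h ^ (?n + 1)) * indicator {a..b} h \<partial>lborel)"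
      by (simp add: emeasure_density)
    also have "\<dots> = ennreal (v * (1 / a) ^ ?n - v * (1 / b) ^ ?n)" using ab by (intro FTC) auto
    also have "\<dots> < \<infinity>" by simp
    finally show ?thesis unfolding eq .
  qed
qed

lemma nn_integral_inverse_norm:
  fixes F :: "real \<Rightarrow> ennreal"
  assumes [measurable]: "F \<in> borel_measurable borel" and ab: "0 < a" "a < b"
    and supp: "\<And>h. h \<notin> {a..b} \<Longrightarrow> F h = 0"
  shows "(\<integral>\<^sup>+w. F (1 / norm w) \<partial>(lborel :: (real ^ 'n::finite) measure))
    = (\<integral>\<^sup>+h. ennreal (real CARD('n) * unit_ball_vol (real CARD('n)) / h ^ (CARD('n) + 1)) * F h \<partial>lborel)"
proof -
  have "(\<integral>\<^sup>+w. F (1 / norm w) \<partial>(lborel :: (real ^ 'n) measure)) =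
      (\<integral>\<^sup>+w. indicator {a..b} (1 / norm w) * F (1 / norm w) \<partial>(lborel :: (real ^ 'n) measure))"
    by (rule nn_integral_cong) (auto simp: indicator_def supp)
  also have "\<dots> = (\<integral>\<^sup>+h. F h \<partial>distr (density lborel (\<lambda>w :: real ^ 'n. indicator {a..b} (1 / norm w))) borel (\<lambda>w. 1 / norm w))"
    by (simp add: nn_integral_distr nn_integral_density)
  also have "\<dots> = (\<integral>\<^sup>+h. (ennreal (real CARD('n) * unit_ball_vol (real CARD('n)) / h ^ (CARD('n) + 1)) * indicator {a..b} h) * F h \<partial>lborel)"
    unfolding distr_inverse_norm[OF ab] by (rule nn_integral_density) measurable
  also have "\<dots> = (\<integral>\<^sup>+h. ennreal (real CARD('n) * unit_ball_vol (real CARD('n)) / h ^ (CARD('n) + 1)) * F h \<partial>lborel)"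
    by (rule nn_integral_cong) (auto simp: indicator_def supp)
  finally show ?thesis .
qed

text \<open>As every row has inner product 1 with \<open>w\<close>, Cauchy-Schwarz gives
  \<open>norm w \<ge> 1\<close>. Equality would make every row equal to \<open>w\<close>, and two
  equal rows contradict the non-zero determinant.\<close>

lemma cramer_sol_norm:
  fixes X :: "'n::finite \<Rightarrow> real ^ 'n"
  assumes n: "CARD('n) \<ge> 2" and det: "det (\<chi> i. X i) \<noteq> 0" and norm: "\<And>i. norm (X i) = 1"
  shows "norm (cramer_sol (\<chi> i. X i) 1) > 1" "X i \<bullet> cramer_sol (\<chi> i. X i) 1 = 1"
proof -
  define w where "w = cramer_sol (\<chi> i. X i) 1"
  have "((\<chi> i. X i) *v w) $ i = X i \<bullet> w" for i by (simp add: matrix_vector_mul_component)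
  then have eq: "X i \<bullet> w = 1" for i using cramer_sol_mult(1)[OF det, of 1] by (simp add: w_def)
  then show "X i \<bullet> cramer_sol (\<chi> i. X i) 1 = 1" by (simp add: w_def)
  have ge: "1 \<le> norm w" using norm_cauchy_schwarz[of "X undefined" w] by (simp add: eq norm)
  have "norm w \<noteq> 1"
  proof
    assume 1: "norm w = 1"
    have "X i = w" for i using norm_cauchy_schwarz_eq[of "X i" w] by (simp add: eq norm 1)
    moreover obtain i j :: 'n where "i \<noteq> j"
    proof -
      have "card {undefined :: 'n} < CARD('n)" using n by simp
      then have "UNIV \<noteq> {undefined :: 'n}" by (metis less_irrefl)
      then show ?thesis using that by auto
    qed
    ultimately have "row i (\<chi> i. X i) = row j (\<chi> i. X i)" by (simp add: row_def)
    then have "det (\<chi> i. X i) = 0" by (rule det_identical_rows[OF \<open>i \<noteq> j\<close>])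
    then show False using det by simp
  qed
  then show "norm (cramer_sol (\<chi> i. X i) 1) > 1" using ge by (simp add: w_def)
qed

lemma AE_inverse_norm_cramer_sol:
  assumes n: "CARD('n::finite) \<ge> 2"
  shows "AE x in (unif_rows :: ('n \<Rightarrow> real ^ 'n) measure). 0 < 1 / norm (cramer_sol (\<chi> i. x i) 1) \<and> 1 / norm (cramer_sol (\<chi> i. x i) 1) < 1"
  using AE_det_unif_rows[OF n] AE_unif_rows_norm
proof eventually_elim
  case (elim x)
  then have "norm (cramer_sol (\<chi> i. x i) 1) > 1" using cramer_sol_norm(1)[OF n] by blast
  moreover have "0 < 1 / t \<and> 1 / t < 1" if "t > 1" for t :: real using that by simp
  ultimately show ?case by blast
qed

lemma sphere_cdf_lipschitz:
  fixes k :: "'n::finite"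
  assumes n: "CARD('n) \<ge> 2" and "b < 1"
  shows "\<exists>B>0. \<forall>x y. - b \<le> x \<longrightarrow> x \<le> y \<longrightarrow> y \<le> b \<longrightarrow> sphere_cdf k y - sphere_cdf k x \<le> B * (y - x)"
proof -
  define r where "r = (real CARD('n) - 3) / 2"
  obtain c where c: "c > 0" and der: "\<And>t. \<bar>t\<bar> < 1 \<Longrightarrow> (sphere_cdf k has_real_derivative c * (1 - t\<^sup>2) powr r) (at t)"
    using sphere_cdf_has_derivative_ex[OF n, of k] unfolding r_def by blast
  \<comment> \<open>The summand 1 serves a non-negative exponent \<open>r\<close>; the power of
    \<open>1 - b\<^sup>2\<close> serves a negative one, where the density grows towards the
    ends.\<close>
  define B where "B = c * (1 + (1 - b\<^sup>2) powr r)"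
  have B: "B > 0" using c by (simp add: B_def add_pos_nonneg)
  have "sphere_cdf k y - sphere_cdf k x \<le> B * (y - x)" if xy: "- b \<le> x" "x \<le> y" "y \<le> b" for x y
  proof (cases "x = y")
    case False
    then have lt: "x < y" using xy by simp
    have "\<exists>z>x. z < y \<and> sphere_cdf k y - sphere_cdf k x = (y - x) * (c * (1 - z\<^sup>2) powr r)"
      by (rule MVT2[OF lt]) (use xy assms(2) in \<open>intro der; auto simp: abs_less_iff\<close>)
    then obtain z where z: "x < z" "z < y" "sphere_cdf k y - sphere_cdf k x = (y - x) * (c * (1 - z\<^sup>2) powr r)" by blast
    have "\<bar>z\<bar> \<le> b" using z xy by (auto simp: abs_le_iff)
    then have zb: "z\<^sup>2 \<le> b\<^sup>2" by (metis abs_ge_zero power2_abs power_mono)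
    have b0: "b \<ge> 0" using \<open>\<bar>z\<bar> \<le> b\<close> by simp
    then have b1: "b\<^sup>2 < 1" using assms(2) by (simp add: abs_square_less_1)
    have "(1 - z\<^sup>2) powr r \<le> 1 + (1 - b\<^sup>2) powr r"
    proof (cases "r \<ge> 0")
      case True
      have "(1 - z\<^sup>2) powr r \<le> 1" using True zb b1 by (intro powr_le1) auto
      then show ?thesis using powr_ge_zero[of "1 - b\<^sup>2" r] by linarith
    next
      case False
      have "(1 - z\<^sup>2) powr r \<le> (1 - b\<^sup>2) powr r" using False zb b1 by (intro powr_mono2') auto
      then show ?thesis by simp
    qed
    then have "c * (1 - z\<^sup>2) powr r \<le> B" using c by (simp add: B_def)
    then have "(y - x) * (c * (1 - z\<^sup>2) powr r) \<le> (y - x) * B" using lt by (intro mult_left_mono) auto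
    then show ?thesis using z(3) by (simp add: mult.commute)
  qed simp
  then show ?thesis using B by blast
qed

lemma slab_det_measurable [measurable]: "slab_det \<epsilon> \<in> borel_measurable borel"
proof -
  have "(\<lambda>w :: real ^ 'n. \<integral>\<^sup>+x. ennreal \<bar>det (\<chi> i. x i)\<bar> * slab \<epsilon> ((\<chi> i. x i) *v w) \<partial>unif_rows) \<in> borel_measurable borel"
    by measurable
  then show ?thesis by (simp add: slab_det_def[abs_def])
qed

lemma nn_integral_slab_1:
  "(\<integral>\<^sup>+\<zeta>. slab 1 (1 + \<zeta>) \<partial>(lborel :: (real ^ 'n) measure)) = ennreal (2 ^ CARD('n))"
proof -
  have "slab 1 (1 + \<zeta>) = indicator (cbox (- 1) 1) \<zeta>" for \<zeta> :: "real ^ 'n"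
  proof (cases "\<zeta> \<in> cbox (- 1) 1")
    case True
    then show ?thesis by (auto simp: slab_def mem_box_cart indicator_def)
  next
    case False
    then obtain i where "\<not> (- 1 \<le> \<zeta> $ i \<and> \<zeta> $ i \<le> 1)" by (auto simp: mem_box_cart)
    then have "indicator {- 1..1} ((1 + \<zeta>) $ i - 1) = (0 :: ennreal)" by (auto simp: indicator_def)
    then have "slab 1 (1 + \<zeta>) = 0" unfolding slab_def by (intro prod_zero) auto
    then show ?thesis using False by simp
  qed
  then have "(\<integral>\<^sup>+\<zeta>. slab 1 (1 + \<zeta>) \<partial>(lborel :: (real ^ 'n) measure)) = emeasure lborel (cbox (- 1) 1 :: (real ^ 'n) set)"
    by simp
  also have "\<dots> = (\<Prod>b\<in>Basis. (1 - (- 1)) \<bullet> (b :: real ^ 'n))"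
    by (rule emeasure_lborel_cbox) (auto simp: Basis_vec_def inner_axis)
  also have "\<dots> = ennreal (2 ^ CARD('n))"
    unfolding prod_Basis_vec by (simp add: inner_axis)
  finally show ?thesis .
qed

text \<open>
  The density of the distance \<open>1 / norm w\<close>, for \<open>w\<close> with \<open>x i \<bullet> w = 1\<close> for all \<open>i\<close>, is obtained by
  smearing the right-hand side \<open>1\<close> over a small cube and letting its size tend to \<open>0\<close>.
\<close>

lemma nn_integral_hyperplane_distance_lim:
  fixes k :: "'n::finite" and \<psi> :: "real \<Rightarrow> real"
  assumes n: "CARD('n) \<ge> 2" and ab: "0 < a" "a < b" "b < 1"
    and cont: "continuous_on UNIV \<psi>" and nonneg: "\<And>h. \<psi> h \<ge> 0" and supp: "\<And>h. h \<notin> {a..b} \<Longrightarrow> \<psi> h = 0"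
    and der: "\<And>t. \<bar>t\<bar> < 1 \<Longrightarrow> (sphere_cdf k has_real_derivative \<phi> t) (at t)"
    and \<phi>m [measurable]: "\<phi> \<in> borel_measurable borel"
  defines "q \<equiv> \<lambda>h. (2 * h * \<phi> h) ^ CARD('n) * (h * sqrt (1 - h\<^sup>2) ^ (CARD('n) - 1) * enn2real (perp_det k))"
  shows "ennreal (2 ^ CARD('n)) * (\<integral>\<^sup>+x. ennreal (\<psi> (1 / norm (cramer_sol (\<chi> i. x i) 1))) \<partial>(unif_rows :: ('n \<Rightarrow> real ^ 'n) measure))
    = (\<integral>\<^sup>+w. ennreal (q (1 / norm w) * \<psi> (1 / norm w)) \<partial>(lborel :: (real ^ 'n) measure))"
proof -
  let ?n = "CARD('n)"
  have \<psi>m [measurable]: "\<psi> \<in> borel_measurable borel" by (rule borel_measurable_continuous_onI[OF cont])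
  have qm [measurable]: "q \<in> borel_measurable borel" unfolding q_def by measurable
  have qw: "(\<lambda>w :: real ^ 'n. ennreal (q (1 / norm w))) \<in> borel_measurable borel" by measurable
  define g where "g w = ennreal (\<psi> (1 / norm w))" for w :: "real ^ 'n"
  have gm [measurable]: "g \<in> borel_measurable borel" unfolding g_def[abs_def] by measurable
  obtain P where P: "\<And>h. \<psi> h \<le> P" "P \<ge> 0"
  proof -
    have "compact (\<psi> ` {a..b})" by (rule compact_continuous_image) (auto intro: continuous_on_subset[OF cont])
    then have "bounded (\<psi> ` {a..b})" by (rule compact_imp_bounded)
    then obtain P where P: "P > 0" "\<And>x. x \<in> \<psi> ` {a..b} \<Longrightarrow> norm x \<le> P" unfolding bounded_pos by blast
    have "\<psi> h \<le> P" for h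
    proof (cases "h \<in> {a..b}")
      case True then show ?thesis using P(2)[of "\<psi> h"] by auto
    qed (use supp P(1) in auto)
    then show ?thesis using P(1) by (intro that[of P]) auto
  qed
  \<comment> \<open>For \<open>\<epsilon> j \<le> \<epsilon>1\<close> the slab around any
    \<open>h \<le> b\<close> stays below \<open>(1 + b) / 2 < 1\<close>, where the distribution
    function is Lipschitz.\<close>
  define \<epsilon>1 where "\<epsilon>1 = (1 - b) / 2"
  define \<epsilon> where "\<epsilon> j = \<epsilon>1 / (real j + 1)" for j :: nat
  have \<epsilon>1: "\<epsilon>1 > 0" using ab by (simp add: \<epsilon>1_def)
  have \<epsilon>: "\<epsilon> j > 0" "\<epsilon> j \<le> \<epsilon>1" for j using \<epsilon>1 by (auto simp: \<epsilon>_def field_simps)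
  have \<epsilon>0: "\<epsilon> \<longlonglongrightarrow> 0" unfolding \<epsilon>_def by real_asymp
  \<comment> \<open>\<open>I j\<close> is evaluated twice. As an expectation it tends to the
    unsmeared one times the cube volume \<open>2 ^ CARD('n)\<close>; as an integral against
    \<open>slab_det\<close> it tends to the integral against \<open>q\<close>.\<close>
  define I where "I j = (\<integral>\<^sup>+x. (\<integral>\<^sup>+\<zeta>. slab 1 (1 + \<zeta>) * g (cramer_sol (\<chi> i. x i) (1 + \<epsilon> j *\<^sub>R \<zeta>)) \<partial>lborel) \<partial>unif_rows)" for j
  have I_eq: "I j = (\<integral>\<^sup>+w. ennreal (1 / \<epsilon> j ^ ?n) * (slab_det (\<epsilon> j) w * g w) \<partial>lborel)" for j
  proof -
    have "(\<integral>\<^sup>+w. ennreal (1 / \<epsilon> j ^ ?n) * (slab_det (\<epsilon> j) w * g w) \<partial>lborel) = ennreal (1 / \<epsilon> j ^ ?n) * (ennreal (\<epsilon> j ^ ?n) * I j)"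
      unfolding I_def nn_integral_unif_rows_cramer_sol[OF n gm \<epsilon>(1)]
      by (rule nn_integral_cmult, rule borel_measurable_times_ennreal) (simp_all add: gm slab_det_measurable)
    also have "\<dots> = (ennreal (1 / \<epsilon> j ^ ?n) * ennreal (\<epsilon> j ^ ?n)) * I j" by (simp add: mult.assoc)
    also have "ennreal (1 / \<epsilon> j ^ ?n) * ennreal (\<epsilon> j ^ ?n) = 1"
      using \<epsilon>(1)[of j] by (simp flip: ennreal_mult)
    finally show ?thesis by simp
  qed
  have lim1: "I \<longlonglongrightarrow> (\<integral>\<^sup>+x. g (cramer_sol (\<chi> i. x i) 1) * ennreal (2 ^ ?n) \<partial>unif_rows)"
    unfolding I_def
  proof (rule nn_integral_dominated_convergence[where w="\<lambda>_. ennreal P * ennreal (2 ^ ?n)"])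
    have bnd: "slab 1 (1 + \<zeta>) * g w \<le> ennreal P * slab 1 (1 + \<zeta>)" for \<zeta> :: "real ^ 'n" and w
      unfolding g_def by (subst mult.commute, intro mult_right_mono ennreal_leI P) simp
    have sl: "(\<integral>\<^sup>+\<zeta>. ennreal P * slab 1 (1 + \<zeta>) \<partial>(lborel :: (real ^ 'n) measure)) = ennreal P * ennreal (2 ^ ?n)"
      by (subst nn_integral_cmult) (simp_all add: nn_integral_slab_1)
    show "AE x in unif_rows. (\<integral>\<^sup>+\<zeta>. slab 1 (1 + \<zeta>) * g (cramer_sol (\<chi> i. x i) (1 + \<epsilon> j *\<^sub>R \<zeta>)) \<partial>lborel) \<le> ennreal P * ennreal (2 ^ ?n)" for j
      unfolding sl[symmetric] by (intro AE_I2 nn_integral_mono bnd)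
    show "(\<integral>\<^sup>+x. ennreal P * ennreal (2 ^ ?n) \<partial>(unif_rows :: ('n \<Rightarrow> real ^ 'n) measure)) < \<infinity>"
    proof -
      have "emeasure (unif_rows :: ('n \<Rightarrow> real ^ 'n) measure) (space unif_rows) = 1"
        by (rule unif_rows.emeasure_space_1)
      then show ?thesis by (simp only: nn_integral_const mult_1_right) (simp flip: ennreal_mult'')
    qed
    show "AE x in unif_rows. (\<lambda>j. \<integral>\<^sup>+\<zeta>. slab 1 (1 + \<zeta>) * g (cramer_sol (\<chi> i. x i) (1 + \<epsilon> j *\<^sub>R \<zeta>)) \<partial>lborel) \<longlonglongrightarrow> g (cramer_sol (\<chi> i. x i) 1) * ennreal (2 ^ ?n)"
      using AE_inverse_norm_cramer_sol[OF n]
    proof eventually_elim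
      case (elim x)
      define A where "A = (\<chi> i. x i)"
      have nz: "norm (cramer_sol A 1) \<noteq> 0" using elim by (auto simp: A_def)
      have "(\<lambda>\<zeta> :: real ^ 'n. 1 + \<zeta>) \<in> borel_measurable borel" by simp
      then have sm: "(\<lambda>\<zeta> :: real ^ 'n. slab 1 (1 + \<zeta>)) \<in> borel_measurable borel"
        by (rule measurable_compose[OF _ slab_measurable])
      have cm: "(\<lambda>\<zeta>. g (cramer_sol A (1 + e *\<^sub>R \<zeta>))) \<in> borel_measurable borel" for e
        by (rule measurable_compose[OF borel_measurable_cramer_sol gm]) simp_all
      have "(\<lambda>j. \<integral>\<^sup>+\<zeta>. slab 1 (1 + \<zeta>) * g (cramer_sol A (1 + \<epsilon> j *\<^sub>R \<zeta>)) \<partial>lborel) \<longlonglongrightarrow> (\<integral>\<^sup>+\<zeta>. slab 1 (1 + \<zeta> :: real ^ 'n) * g (cramer_sol A 1) \<partial>lborel)"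
      proof (rule nn_integral_dominated_convergence[where M="lborel" and u="\<lambda>j \<zeta>. slab 1 (1 + \<zeta>) * g (cramer_sol A (1 + \<epsilon> j *\<^sub>R \<zeta>))"
            and u'="\<lambda>\<zeta> :: real ^ 'n. slab 1 (1 + \<zeta>) * g (cramer_sol A 1)" and w="\<lambda>\<zeta> :: real ^ 'n. ennreal P * slab 1 (1 + \<zeta>)"])
        show "AE \<zeta> in lborel. slab 1 (1 + \<zeta>) * g (cramer_sol A (1 + \<epsilon> j *\<^sub>R \<zeta>)) \<le> ennreal P * slab 1 (1 + \<zeta>)" for j
          by (intro AE_I2 bnd)
        show "(\<integral>\<^sup>+\<zeta>. ennreal P * slab 1 (1 + \<zeta>) \<partial>(lborel :: (real ^ 'n) measure)) < \<infinity>"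
          unfolding sl by (simp flip: ennreal_mult'')
        show "AE \<zeta> in lborel. (\<lambda>j. slab 1 (1 + \<zeta>) * g (cramer_sol A (1 + \<epsilon> j *\<^sub>R \<zeta>))) \<longlonglongrightarrow> slab 1 (1 + \<zeta>) * g (cramer_sol A 1)"
        proof (rule AE_I2)
          fix \<zeta> :: "real ^ 'n"
          have "(\<lambda>j. 1 + \<epsilon> j *\<^sub>R \<zeta>) \<longlonglongrightarrow> 1 + 0 *\<^sub>R \<zeta>" by (intro tendsto_intros \<epsilon>0)
          then have "(\<lambda>j. cramer_sol A (1 + \<epsilon> j *\<^sub>R \<zeta>)) \<longlonglongrightarrow> cramer_sol A 1" by (intro tendsto_cramer_sol) simp
          then have "(\<lambda>j. 1 / norm (cramer_sol A (1 + \<epsilon> j *\<^sub>R \<zeta>))) \<longlonglongrightarrow> 1 / norm (cramer_sol A 1)"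
            using nz by (intro tendsto_intros)
          then have "(\<lambda>j. \<psi> (1 / norm (cramer_sol A (1 + \<epsilon> j *\<^sub>R \<zeta>)))) \<longlonglongrightarrow> \<psi> (1 / norm (cramer_sol A 1))"
            by (rule continuous_on_tendsto_compose[OF cont]) simp_all
          then have "(\<lambda>j. g (cramer_sol A (1 + \<epsilon> j *\<^sub>R \<zeta>))) \<longlonglongrightarrow> g (cramer_sol A 1)"
            unfolding g_def by (rule tendsto_ennrealI)
          moreover have "slab 1 (1 + \<zeta>) \<noteq> \<top>"
            unfolding slab_def by (auto simp: ennreal_prod_eq_top indicator_def)
          ultimately show "(\<lambda>j. slab 1 (1 + \<zeta>) * g (cramer_sol A (1 + \<epsilon> j *\<^sub>R \<zeta>))) \<longlonglongrightarrow> slab 1 (1 + \<zeta>) * g (cramer_sol A 1)"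
            by (intro ennreal_tendsto_cmult) (auto simp: less_top)
        qed
      qed (auto intro!: borel_measurable_times_ennreal sm cm)
      also have "(\<integral>\<^sup>+\<zeta>. slab 1 (1 + \<zeta> :: real ^ 'n) * g (cramer_sol A 1) \<partial>lborel) = g (cramer_sol A 1) * ennreal (2 ^ ?n)"
        by (subst nn_integral_multc) (simp_all add: nn_integral_slab_1 mult.commute)
      finally show ?case by (simp add: A_def)
    qed
  qed measurable
  have lim2: "I \<longlonglongrightarrow> (\<integral>\<^sup>+w. ennreal (q (1 / norm w)) * g w \<partial>lborel)"
    unfolding I_eq
  proof -
    define b' where "b' = (1 + b) / 2"
    have b': "b' < 1" using ab by (simp add: b'_def)
    obtain B where B: "B > 0" "\<And>x y. - b' \<le> x \<Longrightarrow> x \<le> y \<Longrightarrow> y \<le> b' \<Longrightarrow> sphere_cdf k y - sphere_cdf k x \<le> B * (y - x)"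
      using sphere_cdf_lipschitz[OF n b', of k] by blast
    obtain M where M: "M > 0" and MB: "\<And>\<epsilon> h. \<epsilon> > 0 \<Longrightarrow> h > 0 \<Longrightarrow> slab_det \<epsilon> ((1 / h) *\<^sub>R axis k 1 :: real ^ 'n) \<le> ennreal (M * (sphere_cdf k (h + h * \<epsilon>) - sphere_cdf k (h - h * \<epsilon>)) ^ CARD('n))"
      using slab_det_bound_ex[OF n, of k] by blast
    define C where "C = M * (2 * B) ^ ?n"
    have C: "C \<ge> 0" using M B by (simp add: C_def)
    have rot: "slab_det e w = slab_det e ((1 / (1 / norm w)) *\<^sub>R axis k 1)" for e and w :: "real ^ 'n"
      using slab_det_rotate[of e w k] by simp
    have bound: "slab_det (\<epsilon> j) w \<le> ennreal (C * \<epsilon> j ^ ?n)" if w: "1 / norm w \<in> {a..b}" for j and w :: "real ^ 'n"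
    proof -
      define h where "h = 1 / norm w"
      have h: "h > 0" "h < 1" "h \<le> b" using w ab by (auto simp: h_def)
      have he: "h * \<epsilon> j \<le> \<epsilon> j" using h \<epsilon>(1)[of j] by simp
      have he0: "h * \<epsilon> j > 0" using h \<epsilon>(1)[of j] by simp
      have "sphere_cdf k (h + h * \<epsilon> j) - sphere_cdf k (h - h * \<epsilon> j) \<le> B * ((h + h * \<epsilon> j) - (h - h * \<epsilon> j))"
        using h he he0 \<epsilon>(2)[of j] by (intro B(2)) (auto simp: b'_def \<epsilon>1_def field_simps)
      also have "\<dots> \<le> 2 * B * \<epsilon> j" using he B(1) by simp
      finally have L: "sphere_cdf k (h + h * \<epsilon> j) - sphere_cdf k (h - h * \<epsilon> j) \<le> 2 * B * \<epsilon> j" .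
      have L0: "0 \<le> sphere_cdf k (h + h * \<epsilon> j) - sphere_cdf k (h - h * \<epsilon> j)"
        using he0 by (subst measure_sphere_unif_slab[OF n, symmetric]) auto
      have "slab_det (\<epsilon> j) w \<le> ennreal (M * (sphere_cdf k (h + h * \<epsilon> j) - sphere_cdf k (h - h * \<epsilon> j)) ^ ?n)"
        unfolding rot[of _ w] h_def[symmetric] by (rule MB[OF \<epsilon>(1) h(1)])
      also have "\<dots> \<le> ennreal (M * (2 * B * \<epsilon> j) ^ ?n)"
        using L L0 M by (intro ennreal_leI mult_left_mono power_mono) auto
      finally show ?thesis by (simp add: C_def power_mult_distrib mult.assoc)
    qed
    have g0: "g w = 0" if "1 / norm w \<notin> {a..b}" for w using supp[OF that] by (simp add: g_def)
    show "(\<lambda>j. \<integral>\<^sup>+w. ennreal (1 / \<epsilon> j ^ ?n) * (slab_det (\<epsilon> j) w * g w) \<partial>lborel) \<longlonglongrightarrow> (\<integral>\<^sup>+w. ennreal (q (1 / norm w)) * g w \<partial>lborel)"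
    \<comment> \<open>Since \<open>\<psi>\<close> vanishes below \<open>a\<close>, only
      \<open>norm w \<le> 1 / a\<close> contributes, and a constant on this ball is
      integrable.\<close>
    proof (rule nn_integral_dominated_convergence[where w="\<lambda>w :: real ^ 'n. ennreal (C * P) * indicator (cball 0 (1 / a)) w"])
      show "AE w in lborel. ennreal (1 / \<epsilon> j ^ ?n) * (slab_det (\<epsilon> j) w * g w) \<le> ennreal (C * P) * indicator (cball 0 (1 / a)) w" for j
      proof (rule AE_I2)
        fix w :: "real ^ 'n"
        show "ennreal (1 / \<epsilon> j ^ ?n) * (slab_det (\<epsilon> j) w * g w) \<le> ennreal (C * P) * indicator (cball 0 (1 / a)) w"
        proof (cases "1 / norm w \<in> {a..b}")
          case True
          then have "norm w > 0" using ab by (auto simp: zero_less_iff_neq_zero)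
          then have "norm w \<le> 1 / a" using True ab by (auto simp: field_simps)
          have "ennreal (1 / \<epsilon> j ^ ?n) * (slab_det (\<epsilon> j) w * g w) \<le> ennreal (1 / \<epsilon> j ^ ?n) * (ennreal (C * \<epsilon> j ^ ?n) * ennreal P)"
            unfolding g_def by (intro mult_left_mono mult_mono bound[OF True] ennreal_leI P) auto
          also have "\<dots> = ennreal (C * P)"
            using \<epsilon>(1)[of j] C P(2) by (simp flip: ennreal_mult)
          finally show ?thesis using \<open>norm w \<le> 1 / a\<close> by simp
        qed (simp add: g0)
      qed
      show "(\<integral>\<^sup>+w. ennreal (C * P) * indicator (cball 0 (1 / a)) w \<partial>(lborel :: (real ^ 'n) measure)) < \<infinity>"
        using ab by (subst nn_integral_cmult) (simp_all add: emeasure_cball flip: ennreal_mult'')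
      show "AE w in lborel. (\<lambda>j. ennreal (1 / \<epsilon> j ^ ?n) * (slab_det (\<epsilon> j) w * g w)) \<longlonglongrightarrow> ennreal (q (1 / norm w)) * g w"
      proof (rule AE_I2)
        fix w :: "real ^ 'n"
        show "(\<lambda>j. ennreal (1 / \<epsilon> j ^ ?n) * (slab_det (\<epsilon> j) w * g w)) \<longlonglongrightarrow> ennreal (q (1 / norm w)) * g w"
        proof (cases "1 / norm w \<in> {a..b}")
          case True
          define h where "h = 1 / norm w"
          have h: "0 < h" "h < 1" using True ab by (auto simp: h_def)
          have "(\<lambda>j. enn2real (slab_det (\<epsilon> j) ((1 / h) *\<^sub>R axis k 1 :: real ^ 'n)) / \<epsilon> j ^ ?n) \<longlonglongrightarrow> q h"
            unfolding q_def by (rule slab_det_tendsto[OF n h der \<epsilon>(1) \<epsilon>0]) (use h in auto)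
          then have "(\<lambda>j. ennreal (enn2real (slab_det (\<epsilon> j) w) / \<epsilon> j ^ ?n)) \<longlonglongrightarrow> ennreal (q h)"
            unfolding rot[of _ w] h_def[symmetric] by (rule tendsto_ennrealI)
          moreover have "ennreal (enn2real (slab_det (\<epsilon> j) w) / \<epsilon> j ^ ?n) = ennreal (1 / \<epsilon> j ^ ?n) * slab_det (\<epsilon> j) w" for j
          proof -
            have "slab_det (\<epsilon> j) w < \<top>" using bound[OF True, of j] by (simp add: order_le_less_trans)
            then have "ennreal (1 / \<epsilon> j ^ ?n) * slab_det (\<epsilon> j) w = ennreal (1 / \<epsilon> j ^ ?n) * ennreal (enn2real (slab_det (\<epsilon> j) w))" by simp
            also have "\<dots> = ennreal (1 / \<epsilon> j ^ ?n * enn2real (slab_det (\<epsilon> j) w))"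
              using \<epsilon>(1)[of j] by (subst ennreal_mult) auto
            finally show ?thesis by simp
          qed
          ultimately have "(\<lambda>j. ennreal (1 / \<epsilon> j ^ ?n) * slab_det (\<epsilon> j) w) \<longlonglongrightarrow> ennreal (q h)" by simp
          then have "(\<lambda>j. g w * (ennreal (1 / \<epsilon> j ^ ?n) * slab_det (\<epsilon> j) w)) \<longlonglongrightarrow> g w * ennreal (q h)"
            by (rule ennreal_tendsto_cmult[rotated]) (simp add: g_def)
          then show ?thesis by (simp add: mult_ac h_def)
        qed (simp add: g0)
      qed
    qed (auto intro!: borel_measurable_times_ennreal borel_measurable_indicator slab_det_measurable gm qw)
  qed
  have "(\<integral>\<^sup>+x. g (cramer_sol (\<chi> i. x i) 1) * ennreal (2 ^ ?n) \<partial>unif_rows) = (\<integral>\<^sup>+w. ennreal (q (1 / norm w)) * g w \<partial>lborel)"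
    by (rule LIMSEQ_unique[OF lim1 lim2])
  moreover have "(\<integral>\<^sup>+x. g (cramer_sol (\<chi> i. x i) 1) * ennreal (2 ^ ?n) \<partial>unif_rows) = ennreal (2 ^ ?n) * (\<integral>\<^sup>+x. g (cramer_sol (\<chi> i. x i) 1) \<partial>unif_rows)"
    by (subst nn_integral_multc) (simp_all add: mult.commute)
  moreover have "ennreal (q (1 / norm w)) * g w = ennreal (q (1 / norm w) * \<psi> (1 / norm w))" for w
    unfolding g_def by (rule ennreal_mult''[symmetric]) (rule nonneg)
  ultimately show ?thesis by (simp add: g_def)
qed

text \<open>A continuous bump that vanishes within \<open>1 / (j + 3)\<close> of both ends of the
  unit interval and increases to 1 inside it. The summand 3 makes the interval from
  \<open>1 / (j + 3)\<close> to \<open>1 - 1 / (j + 3)\<close> proper already for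
  \<open>j = 0\<close>.\<close>

definition cutoff :: "nat \<Rightarrow> real \<Rightarrow> real" where
  "cutoff j h = max 0 (min 1 ((real j + 3) * min h (1 - h) - 1))"

lemma cutoff_bounds: "0 \<le> cutoff j h" "cutoff j h \<le> 1"
  by (auto simp: cutoff_def)

lemma cutoff_eq_0:
  assumes "h \<notin> {1 / (real j + 3)..1 - 1 / (real j + 3)}"
  shows "cutoff j h = 0"
proof -
  have "min h (1 - h) < 1 / (real j + 3)" using assms by auto
  then have "(real j + 3) * min h (1 - h) < 1" by (simp add: field_simps)
  then show ?thesis by (simp add: cutoff_def)
qed

lemma cutoff_mono:
  assumes "0 < h" "h < 1" "i \<le> j"
  shows "cutoff i h \<le> cutoff j h"
proof -
  have "(real i + 3) * min h (1 - h) \<le> (real j + 3) * min h (1 - h)"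
    using assms by (intro mult_right_mono) auto
  then show ?thesis by (auto simp: cutoff_def)
qed

lemma cutoff_tendsto:
  assumes "0 < h" "h < 1"
  shows "(\<lambda>j. cutoff j h) \<longlonglongrightarrow> 1"
proof -
  define m where "m = min h (1 - h)"
  have m: "m > 0" using assms by (simp add: m_def)
  obtain N where N: "real N > 2 / m" using reals_Archimedean2 by blast
  have "cutoff j h = 1" if "j \<ge> N" for j
  proof -
    have "real j + 3 \<ge> 2 / m" using N that by linarith
    then have "(real j + 3) * m \<ge> 2" using m by (simp add: field_simps)
    then show ?thesis by (simp add: cutoff_def m_def)
  qed
  then show ?thesis by (intro tendsto_eventually) (auto simp: eventually_sequentially)
qed

text \<open>Nothing is known of \<open>\<Psi>\<close> outside the unit interval, but there the
  product is 0. Continuity is glued from two open sets that cover the line: \<open>{0<..<1}\<close>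
  and the complement of the interval outside which the cutoff vanishes.\<close>

lemma continuous_on_cutoff_mult:
  assumes "continuous_on {0<..<1} \<Psi>"
  shows "continuous_on UNIV (\<lambda>h. cutoff j h * \<Psi> h)"
proof -
  let ?S = "{1 / (real j + 3)..1 - 1 / (real j + 3)}"
  have cc: "continuous_on A (cutoff j)" for A
    unfolding cutoff_def[abs_def] by (intro continuous_intros)
  have "continuous_on ({0<..<1} \<union> - ?S) (\<lambda>h. cutoff j h * \<Psi> h)"
  proof (rule continuous_on_open_Un)
    show "continuous_on {0<..<1} (\<lambda>h. cutoff j h * \<Psi> h)" by (intro continuous_intros cc assms)
    have "continuous_on (- ?S) (\<lambda>_. 0 :: real)" by simp
    then show "continuous_on (- ?S) (\<lambda>h. cutoff j h * \<Psi> h)"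
      by (rule continuous_on_eq) (simp add: cutoff_eq_0)
    show "open (- ?S)" by (intro open_Compl closed_atLeastAtMost)
  qed simp
  moreover have "{0<..<1} \<union> - ?S = UNIV"
  proof -
    have "1 / (real j + 3) > 0" by simp
    have "0 < x \<and> x < 1" if "x \<in> ?S" for x
      using that \<open>1 / (real j + 3) > 0\<close> unfolding atLeastAtMost_iff by linarith
    then have "?S \<subseteq> {0<..<1}" by auto
    then show ?thesis by blast
  qed
  ultimately show ?thesis by simp
qed

text \<open>Passing from \<open>w\<close> to \<open>h = 1 / norm w\<close> contributes
  \<open>1 / h ^ (CARD('n) + 1)\<close>, which cancels all powers of \<open>h\<close> in the limit
  formula; the powers of 2 cancel as well. The exponent of \<open>1 - h\<^sup>2\<close> collects
  \<open>CARD('n)\<close> coordinate densities and \<open>CARD('n) - 1\<close> square roots from the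
  scaling of the determinant. Monotone convergence along \<open>cutoff\<close> extends the formula
  from compactly supported test functions.\<close>

lemma hyperplane_distance_distribution_ex:
  assumes n: "CARD('n::finite) \<ge> 2"
  shows "\<exists>C\<ge>0. \<forall>\<Psi>. continuous_on {0<..<1} \<Psi> \<longrightarrow> (\<forall>h\<in>{0<..<1}. \<Psi> h \<ge> 0) \<longrightarrow>
    (\<integral>\<^sup>+x. ennreal (\<Psi> (1 / norm (cramer_sol (\<chi> i. x i) 1))) \<partial>(unif_rows :: ('n \<Rightarrow> real ^ 'n) measure))
    = ennreal C * (\<integral>\<^sup>+h. ennreal (indicator {0<..<1} h * (\<Psi> h * (1 - h\<^sup>2) powr (((real CARD('n) - 1)\<^sup>2 - 2) / 2))) \<partial>lborel)"
proof -
  let ?n = "CARD('n)"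
  fix k :: 'n
  define r0 where "r0 = (real ?n - 3) / 2"
  define r where "r = ((real ?n - 1)\<^sup>2 - 2) / 2"
  obtain c where c: "c > 0" and der: "\<And>t. \<bar>t\<bar> < 1 \<Longrightarrow> (sphere_cdf k has_real_derivative c * (1 - t\<^sup>2) powr r0) (at t)"
    using sphere_cdf_has_derivative_ex[OF n, of k] unfolding r0_def by blast
  define D where "D = enn2real (perp_det k)"
  define V where "V = real ?n * unit_ball_vol (real ?n)"
  define C where "C = V * c ^ ?n * D"
  have V: "V \<ge> 0" by (simp add: V_def)
  have D: "D \<ge> 0" by (simp add: D_def)
  have C: "C \<ge> 0" using V D c by (simp add: C_def)
  define W where "W x = 1 / norm (cramer_sol (\<chi> i. x i) 1)" for x :: "'n \<Rightarrow> real ^ 'n"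
  have Wm [measurable]: "W \<in> borel_measurable unif_rows" unfolding W_def[abs_def] by measurable
  have compact: "(\<integral>\<^sup>+x. ennreal (\<psi> (W x)) \<partial>unif_rows) = ennreal C * (\<integral>\<^sup>+h. ennreal (\<psi> h * (1 - h\<^sup>2) powr r) \<partial>lborel)"
    if cont: "continuous_on UNIV \<psi>" and nonneg: "\<And>h. \<psi> h \<ge> 0" and ab: "0 < a" "a < b" "b < 1" and supp: "\<And>h. h \<notin> {a..b} \<Longrightarrow> \<psi> h = 0" for \<psi> a b
  proof -
    have \<psi>m [measurable]: "\<psi> \<in> borel_measurable borel" by (rule borel_measurable_continuous_onI[OF cont])
    define q where "q h = (2 * h * (c * (1 - h\<^sup>2) powr r0)) ^ ?n * (h * sqrt (1 - h\<^sup>2) ^ (?n - 1) * D)" for h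
    have qm [measurable]: "q \<in> borel_measurable borel" unfolding q_def[abs_def] by measurable
    have "ennreal (2 ^ ?n) * (\<integral>\<^sup>+x. ennreal (\<psi> (W x)) \<partial>unif_rows) = (\<integral>\<^sup>+w. ennreal (q (1 / norm w) * \<psi> (1 / norm w)) \<partial>(lborel :: (real ^ 'n) measure))"
      unfolding W_def q_def D_def
      by (rule nn_integral_hyperplane_distance_lim[OF n ab cont nonneg supp der]) measurable
    also have "\<dots> = (\<integral>\<^sup>+h. ennreal (V / h ^ (?n + 1)) * ennreal (q h * \<psi> h) \<partial>lborel)"
      unfolding V_def
      by (rule nn_integral_inverse_norm[where F="\<lambda>h. ennreal (q h * \<psi> h)", OF _ ab(1,2)]) (simp_all add: supp)
    also have "\<dots> = (\<integral>\<^sup>+h. ennreal (2 ^ ?n) * (ennreal C * ennreal (\<psi> h * (1 - h\<^sup>2) powr r)) \<partial>lborel)"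
    proof (rule nn_integral_cong)
      fix h :: real
      show "ennreal (V / h ^ (?n + 1)) * ennreal (q h * \<psi> h) = ennreal (2 ^ ?n) * (ennreal C * ennreal (\<psi> h * (1 - h\<^sup>2) powr r))"
      proof (cases "h \<in> {a..b}")
        case True
        then have h: "0 < h" "h < 1" using ab by auto
        then have h2: "1 - h\<^sup>2 > 0" by (simp add: abs_square_less_1)
        define y where "y = 1 - h\<^sup>2"
        have "(y powr r0) ^ ?n * sqrt y ^ (?n - 1) = y powr r"
        proof -
          have y: "y > 0" using h2 by (simp add: y_def)
          have "(y powr r0) ^ ?n = y powr (r0 * real ?n)" using y by (simp add: powr_powr flip: powr_realpow)
          moreover have "sqrt y ^ (?n - 1) = y powr (1 / 2 * real (?n - 1))"
            using y by (simp add: powr_powr powr_half_sqrt[symmetric] flip: powr_realpow)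
          ultimately have "(y powr r0) ^ ?n * sqrt y ^ (?n - 1) = y powr (r0 * real ?n + 1 / 2 * real (?n - 1))"
            by (simp add: powr_add)
          also have "r0 * real ?n + 1 / 2 * real (?n - 1) = r"
            using n by (simp add: r0_def r_def of_nat_diff power2_eq_square field_simps)
          finally show ?thesis .
        qed
        then have "V / h ^ (?n + 1) * q h = 2 ^ ?n * (C * y powr r)"
          using h by (simp add: q_def C_def power_mult_distrib flip: y_def)
        then have "V / h ^ (?n + 1) * (q h * \<psi> h) = 2 ^ ?n * (C * (\<psi> h * y powr r))"
          by (metis mult.assoc mult.commute)
        moreover have "V / h ^ (?n + 1) \<ge> 0" using V h by simp
        moreover have "q h * \<psi> h \<ge> 0" using h h2 c D nonneg[of h] by (simp add: q_def)
        ultimately have "ennreal (V / h ^ (?n + 1)) * ennreal (q h * \<psi> h) = ennreal (2 ^ ?n * (C * (\<psi> h * y powr r)))"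
          by (metis ennreal_mult)
        also have "\<dots> = ennreal (2 ^ ?n) * (ennreal C * ennreal (\<psi> h * y powr r))"
          using C nonneg[of h] by (simp add: ennreal_mult)
        finally show ?thesis by (simp only: y_def)
      qed (simp add: supp)
    qed
    also have "\<dots> = ennreal (2 ^ ?n) * (ennreal C * (\<integral>\<^sup>+h. ennreal (\<psi> h * (1 - h\<^sup>2) powr r) \<partial>lborel))"
      by (simp add: nn_integral_cmult)
    finally show ?thesis by (simp add: ennreal_mult_cancel_left)
  qed
  have "(\<integral>\<^sup>+x. ennreal (\<Psi> (W x)) \<partial>unif_rows) = ennreal C * (\<integral>\<^sup>+h. ennreal (indicator {0<..<1} h * (\<Psi> h * (1 - h\<^sup>2) powr r)) \<partial>lborel)"
    if cont: "continuous_on {0<..<1} \<Psi>" and nonneg: "\<And>h. h \<in> {0<..<1} \<Longrightarrow> \<Psi> h \<ge> 0" for \<Psi>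
  proof -
    define \<psi> where "\<psi> j h = cutoff j h * \<Psi> h" for j h
    have \<psi>0: "\<psi> j h = 0" if "h \<notin> {0<..<1}" for j h
    proof -
      have "1 / (real j + 3) > 0" by simp
      then have "h \<notin> {1 / (real j + 3)..1 - 1 / (real j + 3)}"
        using that unfolding atLeastAtMost_iff greaterThanLessThan_iff by linarith
      then show ?thesis by (simp add: \<psi>_def cutoff_eq_0)
    qed
    have \<psi>nn: "\<psi> j h \<ge> 0" for j h
      using nonneg[of h] \<psi>0[of h j] cutoff_bounds[of j h] by (cases "h \<in> {0<..<1}") (auto simp: \<psi>_def)
    have \<psi>c: "continuous_on UNIV (\<psi> j)" for j
      unfolding \<psi>_def[abs_def] by (rule continuous_on_cutoff_mult[OF cont])
    then have \<psi>m [measurable]: "\<psi> j \<in> borel_measurable borel" for j by (rule borel_measurable_continuous_onI)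
    have \<psi>mono: "\<psi> i h \<le> \<psi> j h" if "i \<le> j" for i j h
    proof (cases "h \<in> {0<..<1}")
      case True
      then show ?thesis unfolding \<psi>_def by (intro mult_right_mono cutoff_mono that nonneg) auto
    qed (simp add: \<psi>0)
    have \<psi>lim: "(\<lambda>j. \<psi> j h) \<longlonglongrightarrow> indicator {0<..<1} h * \<Psi> h" for h
    proof (cases "h \<in> {0<..<1}")
      case True
      then have "(\<lambda>j. \<psi> j h) \<longlonglongrightarrow> 1 * \<Psi> h" unfolding \<psi>_def by (intro tendsto_intros cutoff_tendsto) auto
      then show ?thesis using True by simp
    qed (simp add: \<psi>0)
    have eq: "(\<integral>\<^sup>+x. ennreal (\<psi> j (W x)) \<partial>unif_rows) = ennreal C * (\<integral>\<^sup>+h. ennreal (\<psi> j h * (1 - h\<^sup>2) powr r) \<partial>lborel)" for j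
    proof (rule compact[OF \<psi>c \<psi>nn])
      show "0 < 1 / (real j + 3)" "1 / (real j + 3) < 1 - 1 / (real j + 3)" "1 - 1 / (real j + 3) < 1"
        by (simp_all add: field_simps)
      show "\<psi> j h = 0" if "h \<notin> {1 / (real j + 3)..1 - 1 / (real j + 3)}" for h
        using cutoff_eq_0[OF that] by (simp add: \<psi>_def)
    qed
    have "(\<lambda>j. \<integral>\<^sup>+x. ennreal (\<psi> j (W x)) \<partial>unif_rows) \<longlonglongrightarrow> (\<integral>\<^sup>+x. ennreal (indicator {0<..<1} (W x) * \<Psi> (W x)) \<partial>unif_rows)"
    proof (rule nn_integral_LIMSEQ)
      show "incseq (\<lambda>j x. ennreal (\<psi> j (W x)))"
        by (auto simp: incseq_def le_fun_def intro!: ennreal_leI \<psi>mono)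
      show "(\<lambda>i. ennreal (\<psi> i (W x))) \<longlonglongrightarrow> ennreal (indicator {0<..<1} (W x) * \<Psi> (W x))" for x
        by (intro tendsto_ennrealI \<psi>lim)
    qed measurable
    moreover have "(\<lambda>j. \<integral>\<^sup>+x. ennreal (\<psi> j (W x)) \<partial>unif_rows) \<longlonglongrightarrow>
        ennreal C * (\<integral>\<^sup>+h. ennreal (indicator {0<..<1} h * (\<Psi> h * (1 - h\<^sup>2) powr r)) \<partial>lborel)"
      unfolding eq
    proof (rule ennreal_tendsto_cmult, simp, rule nn_integral_LIMSEQ)
      show "incseq (\<lambda>j h. ennreal (\<psi> j h * (1 - h\<^sup>2) powr r))"
        by (auto simp: incseq_def le_fun_def intro!: ennreal_leI mult_right_mono \<psi>mono)
      show "(\<lambda>i. ennreal (\<psi> i h * (1 - h\<^sup>2) powr r)) \<longlonglongrightarrow> ennreal (indicator {0<..<1} h * (\<Psi> h * (1 - h\<^sup>2) powr r))" for h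
        unfolding mult.assoc[symmetric] by (intro tendsto_ennrealI tendsto_mult_right \<psi>lim)
    qed measurable
    ultimately have "(\<integral>\<^sup>+x. ennreal (indicator {0<..<1} (W x) * \<Psi> (W x)) \<partial>unif_rows) =
        ennreal C * (\<integral>\<^sup>+h. ennreal (indicator {0<..<1} h * (\<Psi> h * (1 - h\<^sup>2) powr r)) \<partial>lborel)"
      by (rule LIMSEQ_unique)
    moreover have "(\<integral>\<^sup>+x. ennreal (indicator {0<..<1} (W x) * \<Psi> (W x)) \<partial>unif_rows) = (\<integral>\<^sup>+x. ennreal (\<Psi> (W x)) \<partial>unif_rows)"
    proof (rule nn_integral_cong_AE)
      show "AE x in unif_rows. ennreal (indicator {0<..<1} (W x) * \<Psi> (W x)) = ennreal (\<Psi> (W x))"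
        using AE_inverse_norm_cramer_sol[OF n] unfolding W_def
        by (rule eventually_mono) simp
    qed
    ultimately show ?thesis by simp
  qed
  then show ?thesis using C unfolding W_def r_def by blast
qed

section \<open>Asymptotics of the cap integral\<close>

text \<open>Log-convexity of Gamma, used twice: \<open>x + a\<close> lies between \<open>x\<close>
  and \<open>x + 1\<close>, which gives the upper bound, and \<open>x + 1\<close> lies between
  \<open>x + a\<close> and \<open>x + a + 1\<close>, which gives the lower one.\<close>

lemma Gamma_ratio_unit:
  fixes x a :: real
  assumes x: "x \<ge> 1" and a: "0 \<le> a" "a \<le> 1"
  shows "Gamma (x + a) \<le> Gamma x * x powr a" "Gamma (x + a) \<ge> Gamma x * x powr a * (1 - a / x)"
proof -
  have G: "Gamma y > 0" if "y > 0" for y :: real using that by (rule Gamma_real_pos)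
  have plus1: "Gamma (y + 1) = y * Gamma y" if "y > 0" for y :: real
    using that by (intro Gamma_plus1 notI) (auto dest: nonpos_Ints_nonpos)
  have conv: "ln (Gamma ((1 - t) * y + t * z)) \<le> (1 - t) * ln (Gamma y) + t * ln (Gamma z)"
    if "y > 0" "z > 0" "0 \<le> t" "t \<le> 1" for y z t :: real
    using convex_onD[OF log_convex_Gamma_real, of t y z] that by (simp add: o_def)
  have "ln (Gamma (x + a)) \<le> (1 - a) * ln (Gamma x) + a * ln (Gamma (x + 1))"
    using conv[of x "x + 1" a] x a by (simp add: algebra_simps)
  also have "\<dots> = ln (Gamma x * x powr a)"
    using x G[of x] by (subst plus1) (simp_all add: ln_mult ln_powr algebra_simps)
  finally show "Gamma (x + a) \<le> Gamma x * x powr a"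
    using x a G[of x] G[of "x + a"] by (subst (asm) ln_le_cancel_iff) auto
  have "x + 1 = (1 - (1 - a)) * (x + a) + (1 - a) * (x + a + 1)" by (simp add: algebra_simps)
  then have "ln (Gamma (x + 1)) \<le> (1 - (1 - a)) * ln (Gamma (x + a)) + (1 - a) * ln (Gamma (x + a + 1))"
    using conv[of "x + a" "x + a + 1" "1 - a"] x a by simp
  also have "\<dots> = ln (Gamma (x + a) * (x + a) powr (1 - a))"
  proof -
    have "x + a > 0" using x a by simp
    then have "Gamma (x + a) > 0" by (rule G)
    then have Gp: "Gamma (x + a) \<noteq> 0" by linarith
    have e: "ln (Gamma (x + a + 1)) = ln (x + a) + ln (Gamma (x + a))"
      using plus1[OF \<open>x + a > 0\<close>] Gp \<open>x + a > 0\<close> by (simp add: ln_mult)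
    show ?thesis unfolding e using Gp \<open>x + a > 0\<close> by (simp add: ln_mult ln_powr algebra_simps)
  qed
  finally have "Gamma (x + 1) \<le> Gamma (x + a) * (x + a) powr (1 - a)"
    using x a G[of "x + 1"] G[of "x + a"] by (subst (asm) ln_le_cancel_iff) auto
  then have le: "x * Gamma x \<le> Gamma (x + a) * (x + a) powr (1 - a)" using x by (simp add: plus1)
  \<comment> \<open>The linear bound holds for exponent 1 in place of \<open>1 - a\<close>, and a
    base of at most 1 grows when its exponent drops.\<close>
  have "1 - a / x \<le> (x / (x + a)) powr (1 - a)"
  proof -
    have "1 - a / x \<le> x / (x + a)" using x a by (simp add: field_simps)
    also have "\<dots> = (x / (x + a)) powr 1" using x a by simp
    also have "\<dots> \<le> (x / (x + a)) powr (1 - a)" using x a by (intro powr_mono') auto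
    finally show ?thesis .
  qed
  then have "Gamma x * x powr a * (1 - a / x) \<le> Gamma x * x powr a * (x / (x + a)) powr (1 - a)"
    using G[of x] x by (intro mult_left_mono) auto
  also have "\<dots> = x * Gamma x / (x + a) powr (1 - a)"
  proof -
    have "x powr a * x powr (1 - a) = x" using x by (simp flip: powr_add)
    then show ?thesis using x a by (simp add: powr_divide mult_ac)
  qed
  also have "\<dots> \<le> Gamma (x + a)" using le x a by (simp add: divide_le_eq)
  finally show "Gamma (x + a) \<ge> Gamma x * x powr a * (1 - a / x)" .
qed

text \<open>The previous bounds serve the fractional part of \<open>a\<close>. The functional
  equation then raises the exponent by 1 at a time, each time with a further factor
  \<open>1 + e / x\<close>.\<close>

lemma Gamma_ratio_bound:
  fixes a :: real
  assumes "a \<ge> 0"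
  shows "\<exists>K\<ge>0. \<forall>x\<ge>1. \<bar>Gamma (x + a) / (Gamma x * x powr a) - 1\<bar> \<le> K / x"
proof -
  define b where "b = a - of_int \<lfloor>a\<rfloor>"
  define m where "m = nat \<lfloor>a\<rfloor>"
  have b: "0 \<le> b" "b \<le> 1" unfolding b_def by linarith+
  have a: "a = b + real m" using assms by (simp add: b_def m_def)
  have "\<exists>K\<ge>0. \<forall>x\<ge>1. \<bar>Gamma (x + (b + real m)) / (Gamma x * x powr (b + real m)) - 1\<bar> \<le> K / x"
  proof (induction m)
    case 0
    have "\<bar>Gamma (x + b) / (Gamma x * x powr b) - 1\<bar> \<le> b / x" if x: "x \<ge> 1" for x
    proof -
      have p: "Gamma x * x powr b > 0" using x by (simp add: Gamma_real_pos)
      have "Gamma (x + b) / (Gamma x * x powr b) \<le> 1"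
        using Gamma_ratio_unit(1)[OF x b] p by (simp add: divide_le_eq)
      moreover have "Gamma (x + b) / (Gamma x * x powr b) \<ge> 1 - b / x"
        using Gamma_ratio_unit(2)[OF x b] p by (simp add: le_divide_eq mult.commute)
      ultimately show ?thesis using b x by (simp add: abs_le_iff)
    qed
    then show ?case using b by auto
  next
    case (Suc m)
    then obtain K where K: "K \<ge> 0" "\<And>x. x \<ge> 1 \<Longrightarrow> \<bar>Gamma (x + (b + real m)) / (Gamma x * x powr (b + real m)) - 1\<bar> \<le> K / x" by blast
    define e where "e = b + real m"
    have e: "e \<ge> 0" using b by (simp add: e_def)
    \<comment> \<open>As \<open>r * (1 + e / x) - 1 = (r - 1) * (1 + e / x) + e / x\<close> and
      \<open>x \<ge> 1\<close>, the old constant is multiplied by \<open>1 + e\<close>, and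
      \<open>e\<close> is added.\<close>
    have "\<bar>Gamma (x + (b + real (Suc m))) / (Gamma x * x powr (b + real (Suc m))) - 1\<bar> \<le> (K * (1 + e) + e) / x" if x: "x \<ge> 1" for x
    proof -
      define r where "r = Gamma (x + e) / (Gamma x * x powr e)"
      have r: "\<bar>r - 1\<bar> \<le> K / x" using K(2)[OF x] by (simp add: r_def e_def)
      have "Gamma (x + e + 1) = (x + e) * Gamma (x + e)"
        using x e by (intro Gamma_plus1 notI) (auto dest: nonpos_Ints_nonpos)
      then have "Gamma (x + (b + real (Suc m))) / (Gamma x * x powr (b + real (Suc m))) = r * (1 + e / x)"
        using x by (simp add: r_def e_def powr_add algebra_simps add_divide_distrib)
      moreover have "\<bar>r * (1 + e / x) - 1\<bar> \<le> K / x * (1 + e) + e / x"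
      proof -
        have "r * (1 + e / x) - 1 = (r - 1) * (1 + e / x) + e / x" using x by (simp add: field_simps)
        also have "\<bar>\<dots>\<bar> \<le> \<bar>r - 1\<bar> * (1 + e / x) + e / x"
          using x e by (intro order_trans[OF abs_triangle_ineq]) (simp add: abs_mult)
        also have "\<dots> \<le> K / x * (1 + e) + e / x"
        proof -
          have "e / x \<le> e" using x e by (simp add: divide_le_eq mult_le_cancel_left1)
          then show ?thesis using r x e K(1) by (intro add_right_mono mult_mono) auto
        qed
        finally show ?thesis .
      qed
      ultimately show ?thesis by (simp add: add_divide_distrib)
    qed
    moreover have "K * (1 + e) + e \<ge> 0" using K(1) e by simp
    ultimately show ?case by blast
  qed
  then show ?thesis by (simp add: a)
qed

text \<open>Mean value theorem on an interval enlarged to contain 1. The exponent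
  \<open>s - 1\<close> may have either sign, so the derivative is bounded by the sum of the powers
  at both ends.\<close>

lemma powr_lipschitz_at_1:
  fixes lo hi s :: real
  assumes "0 < lo"
  shows "\<exists>K\<ge>0. \<forall>x. lo \<le> x \<longrightarrow> x \<le> hi \<longrightarrow> \<bar>x powr s - 1\<bar> \<le> K * \<bar>x - 1\<bar>"
proof -
  define l where "l = min lo 1"
  define u where "u = max hi 1"
  define K where "K = \<bar>s\<bar> * (l powr (s - 1) + u powr (s - 1))"
  have l: "0 < l" "l \<le> 1" "1 \<le> u" using assms by (auto simp: l_def u_def)
  have K: "K \<ge> 0" by (simp add: K_def)
  have der: "\<bar>s * z powr (s - 1)\<bar> \<le> K" if "l \<le> z" "z \<le> u" for z
  proof -
    have "z powr (s - 1) \<le> l powr (s - 1) + u powr (s - 1)"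
    proof (cases "s - 1 \<ge> 0")
      case True
      then have "z powr (s - 1) \<le> u powr (s - 1)" using that l by (intro powr_mono2) auto
      then show ?thesis by (simp add: add_increasing)
    next
      case False
      then have "z powr (s - 1) \<le> l powr (s - 1)" using that l by (intro powr_mono2') auto
      then show ?thesis by (simp add: add_increasing2)
    qed
    then show ?thesis unfolding K_def abs_mult by (intro mult_left_mono) auto
  qed
  have D: "((\<lambda>x. x powr s) has_real_derivative s * z powr (s - 1)) (at z)" if "l \<le> z" for z
    using that l by (intro has_real_derivative_powr) auto
  have "\<bar>x powr s - 1\<bar> \<le> K * \<bar>x - 1\<bar>" if x: "lo \<le> x" "x \<le> hi" for x
  proof -
    have xl: "l \<le> x" "x \<le> u" using x by (auto simp: l_def u_def)
    consider "x = 1" | "x < 1" | "x > 1" by linarith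
    then show ?thesis
    proof cases
      case 2
      then have "\<exists>z>x. z < 1 \<and> 1 powr s - x powr s = (1 - x) * (s * z powr (s - 1))"
        by (rule MVT2) (use xl in \<open>auto intro!: D\<close>)
      then obtain z where z: "x < z" "z < 1" "1 - x powr s = (1 - x) * (s * z powr (s - 1))" by auto
      have "\<bar>x powr s - 1\<bar> = \<bar>1 - x\<bar> * \<bar>s * z powr (s - 1)\<bar>"
        unfolding abs_mult[symmetric] z(3)[symmetric] by simp
      also have "\<dots> \<le> \<bar>1 - x\<bar> * K" using z xl l by (intro mult_left_mono der) auto
      finally show ?thesis by (simp add: mult.commute abs_minus_commute)
    next
      case 3
      then have "\<exists>z>1. z < x \<and> x powr s - 1 powr s = (x - 1) * (s * z powr (s - 1))"
        by (rule MVT2) (use xl l in \<open>auto intro!: D\<close>)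
      then obtain z where z: "1 < z" "z < x" "x powr s - 1 = (x - 1) * (s * z powr (s - 1))" by auto
      have "\<bar>x powr s - 1\<bar> = \<bar>x - 1\<bar> * \<bar>s * z powr (s - 1)\<bar>" by (simp add: z(3) abs_mult)
      also have "\<dots> \<le> \<bar>x - 1\<bar> * K" using z xl l by (intro mult_left_mono der) auto
      finally show ?thesis by (simp add: mult.commute)
    qed simp
  qed
  then show ?thesis using K by blast
qed

section \<open>The Beta integral behind the constants\<close>

lemma kappa_pos: "m \<ge> 1 \<Longrightarrow> kappa m > 0"
  by (auto simp: kappa_def omega_pos intro!: divide_pos_pos mult_pos_pos)

lemma Gamma_duplication_real:
  fixes x :: real
  assumes x: "x > 0"
  shows "Gamma x * Gamma (x + 1 / 2) = 2 powr (1 - 2 * x) * sqrt pi * Gamma (2 * x)"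
proof -
  have "complex_of_real (Gamma x * Gamma (x + 1 / 2)) = Gamma (complex_of_real x) * Gamma (complex_of_real x + 1 / 2)"
    by (simp flip: Gamma_complex_of_real)
  also have "\<dots> = exp ((1 - 2 * complex_of_real x) * of_real (ln 2)) * of_real (sqrt pi) * Gamma (2 * complex_of_real x)"
  proof (rule Gamma_legendre_duplication)
    show "complex_of_real x \<notin> \<int>\<^sub>\<le>\<^sub>0" using x by (auto elim!: nonpos_Ints_cases simp: complex_eq_iff)
    have "complex_of_real x + 1 / 2 = complex_of_real (x + 1 / 2)" by simp
    then show "complex_of_real x + 1 / 2 \<notin> \<int>\<^sub>\<le>\<^sub>0" using x by (auto elim!: nonpos_Ints_cases simp: complex_eq_iff)
  qed
  also have "\<dots> = complex_of_real (exp ((1 - 2 * x) * ln 2) * sqrt pi * Gamma (2 * x))"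
    by (simp add: exp_of_real[symmetric] flip: Gamma_complex_of_real)
  finally show ?thesis by (simp only: of_real_eq_iff) (simp add: powr_def)
qed

text \<open>The substitution \<open>t = 2 * u - 1\<close> leads to the Beta function with both
  arguments \<open>m / 2\<close>, and the duplication formula turns it into the Gamma quotient of
  \<open>kappa m\<close>. The case \<open>m = d\<close> normalises the density of a coordinate, the
  case \<open>m = d\<^sup>2\<close> the law of the distance \<open>h\<close>.\<close>

lemma nn_integral_one_minus_square_powr:
  assumes m: "m \<ge> 1"
  shows "(\<integral>\<^sup>+t. ennreal (indicator {-1<..<1} t * (1 - t\<^sup>2) powr ((real m - 2) / 2)) \<partial>lborel) = ennreal (1 / (real m * kappa m))"
proof -
  define b where "b = real m / 2"
  have b: "b > 0" using m by (simp add: b_def)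
  have e: "(real m - 2) / 2 = b - 1" by (simp add: b_def)
  define F where "F t = ennreal (indicator {-1<..<1} t * (1 - t\<^sup>2) powr (b - 1))" for t :: real
  have [measurable]: "F \<in> borel_measurable borel" unfolding F_def[abs_def] by measurable
  have "(\<integral>\<^sup>+t. F t \<partial>lborel) = ennreal 2 * (\<integral>\<^sup>+u. F (- 1 + 2 * u) \<partial>lborel)"
    by (subst nn_integral_real_affine[of _ 2 "- 1"]) (auto simp: F_def)
  also have "(\<integral>\<^sup>+u. F (- 1 + 2 * u) \<partial>lborel) = (\<integral>\<^sup>+u. ennreal (4 powr (b - 1)) * (ennreal (u powr (b - 1) * (1 - u) powr (b - 1)) * indicator {0..1} u) \<partial>lborel)"
  proof (rule nn_integral_cong)
    fix u :: real
    show "F (- 1 + 2 * u) = ennreal (4 powr (b - 1)) * (ennreal (u powr (b - 1) * (1 - u) powr (b - 1)) * indicator {0..1} u)"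
    proof (cases "0 < u \<and> u < 1")
      case True
      have "1 - (- 1 + 2 * u)\<^sup>2 = 4 * (u * (1 - u))" by (simp add: power2_eq_square algebra_simps)
      then have "(1 - (- 1 + 2 * u)\<^sup>2) powr (b - 1) = 4 powr (b - 1) * (u powr (b - 1) * (1 - u) powr (b - 1))"
        using True by (simp only: powr_mult)
      then show ?thesis using True by (simp add: F_def ennreal_mult)
    next
      case False
      then have "indicator {-1<..<1} (- 1 + 2 * u) = (0 :: real)" by (auto simp: indicator_def)
      moreover have "u = 0 \<or> u = 1 \<or> u \<notin> {0..1}" using False by auto
      ultimately show ?thesis by (auto simp: F_def)
    qed
  qed
  also have "\<dots> = ennreal (4 powr (b - 1)) * (\<integral>\<^sup>+u. ennreal (u powr (b - 1) * (1 - u) powr (b - 1)) * indicator {0..1} u \<partial>lborel)"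
    by (rule nn_integral_cmult) measurable
  also have "(\<integral>\<^sup>+u. ennreal (u powr (b - 1) * (1 - u) powr (b - 1)) * indicator {0..1} u \<partial>lborel) = ennreal (Beta b b)"
    by (rule nn_integral_has_integral_lebesgue'[OF _ has_integral_Beta_real[OF b b]]) simp
  also have "ennreal 2 * (ennreal (4 powr (b - 1)) * ennreal (Beta b b)) = ennreal (2 * (4 powr (b - 1) * Beta b b))"
    using b by (subst ennreal_mult[symmetric]; (subst ennreal_mult[symmetric])?) (auto simp: Beta_def Gamma_real_pos intro!: divide_nonneg_nonneg mult_nonneg_nonneg less_imp_le)
  also have "2 * (4 powr (b - 1) * Beta b b) = 1 / (real m * kappa m)"
  proof -
    have G: "Gamma b > 0" "Gamma (b + 1 / 2) > 0" "Gamma (2 * b) > 0" using b by (auto intro!: Gamma_real_pos)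
    have "(4 :: real) powr (b - 1) = (2 powr 2) powr (b - 1)" by simp
    then have "(4 :: real) powr (b - 1) = 2 powr (2 * (b - 1))" by (simp only: powr_powr)
    then have "2 * 4 powr (b - 1) * 2 powr (1 - 2 * b) = (2 :: real) powr 1 * (2 powr (2 * (b - 1)) * 2 powr (1 - 2 * b))"
      by simp
    also have "\<dots> = 2 powr (1 + (2 * (b - 1) + (1 - 2 * b)))" by (simp only: powr_add)
    also have "\<dots> = 1" by simp
    finally have two: "2 * 4 powr (b - 1) * 2 powr (1 - 2 * b) = (1 :: real)" .
    have "2 * (4 powr (b - 1) * Beta b b) * Gamma (b + 1 / 2) = 2 * 4 powr (b - 1) * Gamma b * (Gamma b * Gamma (b + 1 / 2)) / Gamma (2 * b)"
      by (simp add: Beta_def)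
    also have "\<dots> = (2 * 4 powr (b - 1) * 2 powr (1 - 2 * b)) * Gamma b * sqrt pi"
      using G by (simp add: Gamma_duplication_real[OF b])
    also have "\<dots> = sqrt pi * Gamma b" by (simp only: two) simp
    finally have 1: "2 * (4 powr (b - 1) * Beta b b) = sqrt pi * Gamma b / Gamma (b + 1 / 2)" using G by (simp add: field_simps)
    have "kappa m = 1 / real m * (Gamma (b + 1 / 2) / (sqrt pi * Gamma b))"
      using kappa_altdef[OF m] by (simp add: b_def add_divide_distrib)
    then show ?thesis using 1 m by simp
  qed
  finally show ?thesis by (simp add: F_def e)
qed

text \<open>The asymptotics see the distribution function only through its derivative and its limits
  at both ends. These data determine the parameter \<open>c\<close>; its value is found in
  \<open>c_eq\<close>.\<close>

locale cap_function =
  fixes d :: nat and \<Phi> :: "real \<Rightarrow> real" and c :: real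
  assumes d: "d \<ge> 1" and c: "c > 0"
    and der: "\<And>t. \<bar>t\<bar> < 1 \<Longrightarrow> (\<Phi> has_real_derivative c * (1 - t\<^sup>2) powr ((real d - 2) / 2)) (at t)"
    and lim1: "(\<Phi> \<longlongrightarrow> 1) (at_left 1)" and lim0: "(\<Phi> \<longlongrightarrow> 0) (at_right (-1))"
begin

definition \<phi> :: "real \<Rightarrow> real" where "\<phi> t = c * (1 - t\<^sup>2) powr ((real d - 2) / 2)"

lemma \<phi>_nonneg: "\<phi> t \<ge> 0" using c by (simp add: \<phi>_def)

lemma \<phi>_pos: "\<bar>t\<bar> < 1 \<Longrightarrow> \<phi> t > 0"
  using c abs_square_less_1[of t] by (simp add: \<phi>_def)

lemma \<phi>_measurable [measurable]: "\<phi> \<in> borel_measurable borel"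
  unfolding \<phi>_def[abs_def] by measurable

lemma \<phi>_isCont: "\<bar>t\<bar> < 1 \<Longrightarrow> isCont \<phi> t"
  unfolding \<phi>_def[abs_def] using abs_square_less_1[of t] by (intro continuous_intros) auto

lemma strict_mono:
  assumes "-1 < x" "x < y" "y < 1"
  shows "\<Phi> x < \<Phi> y"
proof (rule DERIV_pos_imp_increasing[OF assms(2)])
  fix t assume "x \<le> t" "t \<le> y"
  then have "\<bar>t\<bar> < 1" using assms by auto
  then show "\<exists>z. (\<Phi> has_real_derivative z) (at t) \<and> 0 < z"
    using der[folded \<phi>_def] \<phi>_pos by blast
qed

lemma less_1: "-1 < x \<Longrightarrow> x < 1 \<Longrightarrow> \<Phi> x < 1"
proof -
  assume x: "-1 < x" "x < 1"
  \<comment> \<open>The limit bounds \<open>\<Phi>\<close> at the larger point \<open>y\<close>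
    weakly; strict monotonicity then gives the strict bound at \<open>x\<close>.\<close>
  define y where "y = (x + 1) / 2"
  have y: "x < y" "y < 1" using x by (auto simp: y_def)
  have "eventually (\<lambda>t. \<Phi> y \<le> \<Phi> t) (at_left 1)"
    using eventually_at_left_real[OF y(2)]
    by eventually_elim (use strict_mono[of y] x y in \<open>auto intro: less_imp_le\<close>)
  then have "\<Phi> y \<le> 1" by (intro tendsto_lowerbound[OF lim1]) auto
  then show "\<Phi> x < 1" using strict_mono[OF x(1) y(1) y(2)] by simp
qed

lemma greater_0: "-1 < x \<Longrightarrow> x < 1 \<Longrightarrow> \<Phi> x > 0"
proof -
  assume x: "-1 < x" "x < 1"
  define y where "y = (x - 1) / 2"
  have y: "-1 < y" "y < x" using x by (auto simp: y_def)
  have "eventually (\<lambda>t. \<Phi> t \<le> \<Phi> y) (at_right (-1))"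
    using eventually_at_right_real[OF y(1)]
    by eventually_elim (use strict_mono[of _ y] x y in \<open>auto intro: less_imp_le\<close>)
  then have "0 \<le> \<Phi> y" by (intro tendsto_upperbound[OF lim0]) auto
  then show "\<Phi> x > 0" using strict_mono[OF y x(2)] by simp
qed

text \<open>For \<open>d = 1\<close> the density is unbounded at the ends, so the fundamental
  theorem is used in its form for non-negative functions with one-sided limits of a
  primitive.\<close>

lemma density_integral:
  "set_integrable lborel {-1<..<1} \<phi>" "(LBINT x:{-1<..<1}. \<phi> x) = 1"
proof -
  have "set_integrable lborel (einterval (ereal (-1)) (ereal 1)) \<phi>"
    "(LBINT x=ereal (-1)..ereal 1. \<phi> x) = 1 - 0"
    by (rule interval_integral_FTC_nonneg[where F=\<Phi>];
        use der[folded \<phi>_def] \<phi>_isCont \<phi>_nonneg lim1 lim0 in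
          \<open>auto simp: ereal_tendsto_simps abs_less_iff\<close>)+
  then show "set_integrable lborel {-1<..<1} \<phi>" "(LBINT x:{-1<..<1}. \<phi> x) = 1"
    by (simp_all add: interval_lebesgue_integral_def)
qed

text \<open>The density has total mass 1, and the Beta integral evaluates this mass as
  \<open>c / (d * kappa d)\<close>.\<close>

lemma c_eq: "c = real d * kappa d"
proof -
  have "ennreal 1 = (\<integral>\<^sup>+t. ennreal (indicator {-1<..<1} t * \<phi> t) \<partial>lborel)"
  proof -
    have "(\<integral>\<^sup>+t. ennreal (indicator {-1<..<1} t * \<phi> t) \<partial>lborel) = ennreal (LBINT t. indicator {-1<..<1} t * \<phi> t)"
      using density_integral(1) \<phi>_nonneg unfolding set_integrable_def
      by (intro nn_integral_eq_integral) auto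
    then show ?thesis using density_integral(2) by (simp add: set_lebesgue_integral_def)
  qed
  also have "\<dots> = (\<integral>\<^sup>+t. ennreal c * ennreal (indicator {-1<..<1} t * (1 - t\<^sup>2) powr ((real d - 2) / 2)) \<partial>lborel)"
    using c by (intro nn_integral_cong) (simp add: \<phi>_def mult.left_commute flip: ennreal_mult)
  also have "\<dots> = ennreal c * ennreal (1 / (real d * kappa d))"
    unfolding nn_integral_one_minus_square_powr[OF d, symmetric] by (rule nn_integral_cmult) measurable
  also have "\<dots> = ennreal (c / (real d * kappa d))" using c kappa_pos[OF d] d by (simp flip: ennreal_mult)
  finally have "c / (real d * kappa d) = 1" using c kappa_pos[OF d] d by (subst (asm) ennreal_inj) auto
  then show ?thesis using kappa_pos[OF d] d by simp
qed

text \<open>The substitution \<open>v = \<Phi> h\<close> absorbs the density \<open>\<phi>\<close>.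
  Integrability in \<open>h\<close> is shown first, by domination by \<open>\<phi>\<close>, since
  the substitution rule presupposes it.\<close>

lemma Beta_substitution:
  assumes j: "j \<ge> 1" and m: "m \<ge> 0"
  shows "set_integrable lborel {-1<..<1} (\<lambda>h. \<Phi> h ^ j * (1 - \<Phi> h) powr m * \<phi> h)"
    and "(LBINT h:{-1<..<1}. \<Phi> h ^ j * (1 - \<Phi> h) powr m * \<phi> h) = Beta (real j + 1) (m + 1)"
proof -
  define f where "f v = v ^ j * (1 - v) powr m" for v :: real
  have \<Phi>c: "isCont \<Phi> h" if "\<bar>h\<bar> < 1" for h using der[OF that] by (rule DERIV_isCont)
  have fb: "\<bar>f (\<Phi> h)\<bar> \<le> 1" "f (\<Phi> h) \<ge> 0" if "h \<in> {-1<..<1}" for h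
  proof -
    have "0 < \<Phi> h" "\<Phi> h < 1" using greater_0 less_1 that by auto
    then show "f (\<Phi> h) \<ge> 0" by (simp add: f_def)
    have "f (\<Phi> h) \<le> 1 * 1" unfolding f_def using \<open>0 < \<Phi> h\<close> \<open>\<Phi> h < 1\<close> m by (intro mult_mono power_le_one powr_le1) auto
    then show "\<bar>f (\<Phi> h)\<bar> \<le> 1" using \<open>f (\<Phi> h) \<ge> 0\<close> by simp
  qed
  have fc: "isCont f (\<Phi> h)" if "\<bar>h\<bar> < 1" for h
    unfolding f_def[abs_def] using less_1[of h] that m by (intro continuous_intros) (auto simp: abs_less_iff)
  have co: "continuous_on {-1<..<1} (\<lambda>h. f (\<Phi> h))"
    by (intro continuous_at_imp_continuous_on ballI isCont_o2[OF \<Phi>c fc]) auto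
  have "(\<lambda>h. indicator {-1<..<1} h *\<^sub>R f (\<Phi> h)) \<in> borel_measurable borel"
    by (rule borel_measurable_continuous_on_indicator[OF _ co]) simp
  then have fm: "(\<lambda>h. indicator {-1<..<1} h *\<^sub>R (f (\<Phi> h) * \<phi> h)) \<in> borel_measurable lborel"
    using borel_measurable_times[OF _ \<phi>_measurable, of "\<lambda>h. indicator {-1<..<1} h *\<^sub>R f (\<Phi> h)"]
    by (simp add: mult.assoc)
  show int: "set_integrable lborel {-1<..<1} (\<lambda>h. \<Phi> h ^ j * (1 - \<Phi> h) powr m * \<phi> h)"
    unfolding f_def[symmetric] set_integrable_def
  proof (rule Bochner_Integration.integrable_bound[OF density_integral(1)[unfolded set_integrable_def] fm])
    show "AE x in lborel. norm (indicator {-1<..<1} x *\<^sub>R (f (\<Phi> x) * \<phi> x)) \<le> norm (indicator {-1<..<1} x *\<^sub>R \<phi> x)"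
      using fb \<phi>_nonneg by (intro AE_I2) (auto simp: indicator_def abs_mult intro!: mult_left_le_one_le)
  qed
  have lims: "((ereal \<circ> \<Phi> \<circ> real_of_ereal) \<longlongrightarrow> ereal 0) (at_right (ereal (-1)))"
    "((ereal \<circ> \<Phi> \<circ> real_of_ereal) \<longlongrightarrow> ereal 1) (at_left (ereal 1))"
    using lim0 lim1 by (simp_all add: ereal_tendsto_simps1 ereal_tendsto_simps2)
  have s: "set_integrable lborel (einterval (ereal 0) (ereal 1)) f"
     "(LBINT v=ereal 0..ereal 1. f v) = (LBINT h=ereal (-1)..ereal 1. f (\<Phi> h) * \<phi> h)"
    by (rule interval_integral_substitution_nonneg[where g=\<Phi> and g'=\<phi> and a="ereal (-1)" and b="ereal 1" and A="ereal 0" and B="ereal 1"];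
      use der[folded \<phi>_def] \<phi>_isCont \<phi>_nonneg lims fb fc int[folded f_def] in
        \<open>auto simp: abs_less_iff\<close>)+
  have "(LBINT h:{-1<..<1}. f (\<Phi> h) * \<phi> h) = (LBINT v:{0<..<1}. f v)"
    using s(2) by (simp add: interval_lebesgue_integral_def)
  also have "\<dots> = integral {0<..<1} f"
    using s(1) by (intro set_borel_integral_eq_integral) simp
  also have "\<dots> = integral {0..1} f" by (rule integral_open_interval_real[symmetric])
  also have "\<dots> = integral {0..1} (\<lambda>v. v powr (real j + 1 - 1) * (1 - v) powr (m + 1 - 1))"
  proof (rule integral_cong)
    fix v :: real assume "v \<in> {0..1}"
    \<comment> \<open>At \<open>v = 0\<close> the two forms agree because of
      \<open>j \<ge> 1\<close>: \<open>0 ^ j\<close> and \<open>0 powr j\<close> are both 0, whereas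
      \<open>0 ^ 0\<close> and \<open>0 powr 0\<close> differ.\<close>
    then consider "v = 0" | "v > 0" by fastforce
    then show "f v = v powr (real j + 1 - 1) * (1 - v) powr (m + 1 - 1)"
      by cases (use j in \<open>auto simp: f_def powr_realpow\<close>)
  qed
  also have "\<dots> = Beta (real j + 1) (m + 1)"
    using m by (intro integral_unique has_integral_Beta_real) auto
  finally show "(LBINT h:{-1<..<1}. \<Phi> h ^ j * (1 - \<Phi> h) powr m * \<phi> h) = Beta (real j + 1) (m + 1)"
    by (simp add: f_def)
qed

text \<open>With \<open>y = 1 - h\<close>, the tail \<open>1 - \<Phi> h\<close> is close to
  \<open>H y = kappa d * (2 * y) powr (d / 2)\<close>, and
  \<open>1 - h\<^sup>2 = 2 * y * (1 - y / 2)\<close>. The exponent \<open>m\<close> is the one for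
  which both terms have the same leading power \<open>(2 * y) powr (d * m / 2)\<close>. The relative
  error is of order \<open>y\<close>, which is of order \<open>(1 - \<Phi> h) powr (2 / d)\<close>.
  The exponent \<open>(d\<^sup>2 - d) / 2\<close> is what remains of
  \<open>(d\<^sup>2 - 2) / 2\<close> when one factor \<open>\<phi>\<close> is set aside for the
  substitution.\<close>

lemma comparison_ex:
  fixes p :: real
  assumes p: "p \<ge> 0"
  defines "m \<equiv> p / real d + real d - 1"
  shows "\<exists>K\<ge>0. \<forall>h. \<bar>h\<bar> < 1 \<longrightarrow>
    \<bar>(2 * (1 - h)) powr (p / 2) * (1 - h\<^sup>2) powr ((real d ^ 2 - real d) / 2) - ((1 - \<Phi> h) / kappa d) powr m\<bar>
      \<le> K * (1 - \<Phi> h) powr (m + 2 / real d)"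
proof -
  define s where "s = (real d - 2) / 2"
  define \<kappa> where "\<kappa> = kappa d"
  have \<kappa>: "\<kappa> > 0" using kappa_pos[OF d] by (simp add: \<kappa>_def)
  have d0: "real d > 0" using d by simp
  define G where "G y = 1 - \<Phi> (1 - y)" for y
  define H where "H y = \<kappa> * (2 * y) powr (real d / 2)" for y
  have dG: "(G has_real_derivative c * (2 * y) powr s * (1 - y / 2) powr s) (at y)" if "0 < y" "y < 2" for y
  proof -
    have "((\<lambda>y. \<Phi> (1 - y)) has_real_derivative (c * (1 - (1 - y)\<^sup>2) powr s) * (- 1)) (at y)"
      unfolding s_def by (rule DERIV_chain2[where f=\<Phi>, OF der]) (use that in \<open>auto intro!: derivative_eq_intros\<close>)
    then have "(G has_real_derivative 0 - (c * (1 - (1 - y)\<^sup>2) powr s) * (- 1)) (at y)"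
      unfolding G_def[abs_def] by (intro DERIV_diff DERIV_const)
    moreover have "1 - (1 - y)\<^sup>2 = (2 * y) * (1 - y / 2)" by (simp add: power2_eq_square algebra_simps)
    then have "(1 - (1 - y)\<^sup>2) powr s = (2 * y) powr s * (1 - y / 2) powr s"
      by (simp only: powr_mult)
    ultimately show ?thesis by (simp add: mult.assoc)
  qed
  have dH: "(H has_real_derivative c * (2 * y) powr s) (at y)" if "0 < y" for y
  proof -
    have "(H has_real_derivative \<kappa> * (real d / 2 * (2 * y) powr (real d / 2 - 1) * 2)) (at y)"
      unfolding H_def[abs_def]
      by (rule DERIV_cmult, rule DERIV_chain2[where f="\<lambda>x. x powr (real d / 2)"], rule has_real_derivative_powr)
        (use that in \<open>auto intro!: derivative_eq_intros\<close>)
    moreover have "\<kappa> * (real d / 2 * (2 * y) powr (real d / 2 - 1) * 2) = c * (2 * y) powr s"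
      by (simp add: c_eq \<kappa>_def s_def diff_divide_distrib)
    ultimately show ?thesis by simp
  qed
  have G0: "(G \<longlongrightarrow> 0) (at_right 0)"
  proof -
    have "filterlim (\<lambda>y. 1 - y) (at_left 1) (at_right (0 :: real))"
      unfolding filterlim_at by (auto intro!: tendsto_eq_intros simp: eventually_at_filter)
    then have "((\<lambda>y. \<Phi> (1 - y)) \<longlongrightarrow> 1) (at_right 0)" by (rule filterlim_compose[OF lim1])
    then have "((\<lambda>y. 1 - \<Phi> (1 - y)) \<longlongrightarrow> 1 - 1) (at_right 0)" by (intro tendsto_diff tendsto_const)
    then show ?thesis by (simp add: G_def[abs_def])
  qed
  have H0: "(H \<longlongrightarrow> 0) (at_right 0)"
  proof -
    have "((\<lambda>y. (2 * y) powr (real d / 2)) \<longlongrightarrow> 0) (at_right 0)"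
      using d0 by (intro tendsto_zero_powrI[where b="real d / 2"]) (auto intro!: tendsto_eq_intros simp: eventually_at_filter)
    from tendsto_mult_left[OF this, of \<kappa>] show ?thesis by (simp add: H_def[abs_def])
  qed
  have Gpos: "G y > 0" "G y < 1" if "0 < y" "y < 2" for y
    using less_1[of "1 - y"] greater_0[of "1 - y"] that by (auto simp: G_def)
  have Gmono: "G x \<le> G y" if "0 < x" "x \<le> y" "y < 2" for x y
    using strict_mono[of "1 - y" "1 - x"] that by (cases "x = y") (auto simp: G_def)
  have Hpos: "H y > 0" if "0 < y" for y using that \<kappa> by (simp add: H_def)
  have Hmono: "H x \<le> H y" if "0 < x" "x \<le> y" for x y
    using that \<kappa> d0 unfolding H_def by (intro mult_left_mono powr_mono2) auto
  obtain K0 where K0: "K0 \<ge> 0" "\<And>x. 1 / 2 \<le> x \<Longrightarrow> x \<le> 1 \<Longrightarrow> \<bar>x powr s - 1\<bar> \<le> K0 * \<bar>x - 1\<bar>"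
    using powr_lipschitz_at_1[of "1 / 2" 1 s] by auto
  \<comment> \<open>\<open>G\<close> and \<open>H\<close> tend to 0 at 0, and their derivatives
    differ by the factor \<open>(1 - x / 2) powr s\<close>. So
    \<open>K0 * y * H z + \<sigma> * (G z - H z)\<close> is nondecreasing in \<open>z\<close> up to
    \<open>y\<close>, with limit 0. The sign \<open>\<sigma>\<close> treats both bounds at
    once.\<close>
  have near: "\<bar>G y - H y\<bar> \<le> K0 * y * H y" if y: "0 < y" "y \<le> 1" for y
  proof -
    have "K0 * y * H y + \<sigma> * (G y - H y) \<ge> 0" if \<sigma>: "\<bar>\<sigma>\<bar> = 1" for \<sigma>
    proof -
      define D where "D z = K0 * y * H z + \<sigma> * (G z - H z)" for z
      have "D z \<le> D y" if z: "0 < z" "z < y" for z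
      proof (rule DERIV_nonneg_imp_nondecreasing[OF less_imp_le[OF z(2)]])
        fix x assume x: "z \<le> x" "x \<le> y"
        have "(D has_real_derivative K0 * y * (c * (2 * x) powr s) + \<sigma> * (c * (2 * x) powr s * (1 - x / 2) powr s - c * (2 * x) powr s)) (at x)"
          unfolding D_def[abs_def]
          by (intro DERIV_add DERIV_cmult DERIV_diff dG dH) (use x z y in auto)
        moreover have "0 \<le> K0 * y * (c * (2 * x) powr s) + \<sigma> * (c * (2 * x) powr s * (1 - x / 2) powr s - c * (2 * x) powr s)"
        proof -
          define u where "u = (1 - x / 2) powr s - 1"
          have "\<bar>u\<bar> \<le> K0 * \<bar>(1 - x / 2) - 1\<bar>" unfolding u_def by (rule K0(2)) (use x y z in auto)
          also have "\<dots> \<le> K0 * y" using x y z K0(1) by (intro mult_left_mono) auto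
          finally have "\<bar>\<sigma> * u\<bar> \<le> K0 * y" using \<sigma> by (simp add: abs_mult)
          then have "0 \<le> (c * (2 * x) powr s) * (K0 * y + \<sigma> * u)" using c by (intro mult_nonneg_nonneg) auto
          then show ?thesis by (simp add: u_def algebra_simps)
        qed
        ultimately show "\<exists>v. (D has_real_derivative v) (at x) \<and> 0 \<le> v" by blast
      qed
      then have "eventually (\<lambda>z. D z \<le> D y) (at_right 0)"
        using eventually_at_right_real[OF y(1)] by (auto elim!: eventually_mono)
      moreover have "(D \<longlongrightarrow> K0 * y * 0 + \<sigma> * (0 - 0)) (at_right 0)"
        unfolding D_def[abs_def] by (intro tendsto_intros G0 H0)
      ultimately have "0 \<le> D y" by (intro tendsto_upperbound[of D 0]) auto
      then show ?thesis by (simp add: D_def)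
    qed
    from this[of 1] this[of "-1"] show ?thesis by (simp add: abs_le_iff)
  qed
  \<comment> \<open>The choice ensures \<open>K0 * y0 \<le> 1 / 2\<close>, hence a quotient
    \<open>R\<close> of at least \<open>1 / 2\<close> up to \<open>y0\<close>; beyond, monotonicity
    bounds it below by \<open>G y0 / H 2\<close>.\<close>
  define y0 where "y0 = 1 / (2 * K0 + 1)"
  have y0: "0 < y0" "y0 \<le> 1" "K0 * y0 \<le> 1 / 2" using K0(1) by (auto simp: y0_def field_simps)
  define R where "R y = G y / H y" for y
  define r0 where "r0 = min (1 / 2) (G y0 / H 2)"
  have r0: "r0 > 0" using Gpos[of y0] y0 Hpos[of 2] by (simp add: r0_def)
  have R1: "\<bar>R y - 1\<bar> \<le> K0 * y" if "0 < y" "y \<le> 1" for y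
  proof -
    have "R y - 1 = (G y - H y) / H y" using Hpos[OF that(1)] by (simp add: R_def field_simps)
    then show ?thesis using near[OF that] Hpos[OF that(1)] by (simp add: abs_divide divide_le_eq)
  qed
  have Rlo: "r0 \<le> R y" if y: "0 < y" "y < 2" for y
  proof (cases "y \<le> y0")
    case True
    then have "K0 * y \<le> 1 / 2" using y0 K0(1) mult_left_mono[of y y0 K0] by linarith
    then have "R y \<ge> 1 / 2" using R1[OF y(1)] True y0 by linarith
    then show ?thesis by (simp add: r0_def)
  next
    case False
    have "G y0 / H 2 \<le> G y / H y"
      using Gmono[of y0 y] Hmono[of y 2] Hpos[of y] Hpos[of 2] Gpos[of y0] y False y0
      by (intro frac_le) auto
    then show ?thesis by (simp add: r0_def R_def)
  qed
  \<comment> \<open>\<open>K0\<close> serves \<open>y \<le> 1\<close>. For \<open>y > 1\<close> the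
    quotient lies between 0 and \<open>1 / H 1\<close>, so its distance from 1 is at most
    \<open>1 / H 1 + 1\<close>, and the factor \<open>y\<close> only enlarges the bound.\<close>
  define K1 where "K1 = K0 + 1 / H 1 + 1"
  have K1: "K1 \<ge> 0" using K0(1) Hpos[of 1] by (simp add: K1_def)
  have RK1: "\<bar>R y - 1\<bar> \<le> K1 * y" if y: "0 < y" "y < 2" for y
  proof (cases "y \<le> 1")
    case True
    have "K0 * y \<le> K1 * y" using y Hpos[of 1] by (intro mult_right_mono) (auto simp: K1_def)
    then show ?thesis using R1[OF y(1) True] by linarith
  next
    case False
    have "R y \<le> 1 / H 1" unfolding R_def using False Gpos[OF y] Hmono[of 1 y] Hpos[of 1] by (intro frac_le) auto
    moreover have "R y > 0" using Rlo[OF y] r0 by simp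
    ultimately have "\<bar>R y - 1\<bar> \<le> K1" using K0(1) unfolding K1_def abs_le_iff using Hpos[of 1] by auto
    also have "K1 \<le> K1 * y" using K1 False by (simp add: mult_le_cancel_left1)
    finally show ?thesis .
  qed
  have "p / real d \<ge> 0" "real d \<ge> 1" using p d by simp_all
  then have m0: "m \<ge> 0" unfolding m_def by linarith
  obtain K2 where K2: "K2 \<ge> 0" "\<And>x. r0 \<le> x \<Longrightarrow> x \<le> 1 + 2 * K1 \<Longrightarrow> \<bar>x powr m - 1\<bar> \<le> K2 * \<bar>x - 1\<bar>"
    using powr_lipschitz_at_1[OF r0, of "1 + 2 * K1" m] by auto
  \<comment> \<open>The exponent \<open>(d\<^sup>2 - d) / 2\<close> is a natural number, so
    Bernoulli's inequality bounds \<open>1 - (1 - y / 2) ^ e\<close> linearly in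
    \<open>y\<close>.\<close>
  define e where "e = d * (d - 1) div 2"
  have e: "real e = (real d ^ 2 - real d) / 2"
  proof -
    have "2 * e = d * (d - 1)" unfolding e_def by (rule dvd_mult_div_cancel) (cases "even d", simp_all)
    then have "2 * real e = real d * real (d - 1)" by (metis of_nat_mult of_nat_numeral)
    then show ?thesis using d by (simp add: of_nat_diff power2_eq_square algebra_simps)
  qed
  define K3 where "K3 = real e + K2 * K1"
  have K3: "K3 \<ge> 0" using K2 K1 by (simp add: K3_def)
  define t where "t = m + 2 / real d"
  \<comment> \<open>The factor \<open>1 / 2\<close> stems from
    \<open>y = b powr (2 / d) / 2\<close>, the power from
    \<open>b \<le> G y / (\<kappa> * r0)\<close>.\<close>
  define K where "K = K3 / 2 * (1 / (\<kappa> * r0)) powr t"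
  have K: "K \<ge> 0" using K3 by (simp add: K_def)
  have "\<bar>(2 * (1 - h)) powr (p / 2) * (1 - h\<^sup>2) powr ((real d ^ 2 - real d) / 2) - ((1 - \<Phi> h) / kappa d) powr m\<bar>
      \<le> K * (1 - \<Phi> h) powr (m + 2 / real d)" if h: "\<bar>h\<bar> < 1" for h
  proof -
    define y where "y = 1 - h"
    have y: "0 < y" "y < 2" using h by (auto simp: y_def)
    have hy: "h = 1 - y" by (simp add: y_def)
    define b where "b = (2 * y) powr (real d / 2)"
    have b: "b > 0" using y by (simp add: b_def)
    have "H y \<noteq> 0" using Hpos[OF y(1)] by linarith
    then have "G y = H y * R y" by (simp add: R_def)
    then have GH: "G y = \<kappa> * b * R y" by (simp only: H_def b_def)
    have Rp: "R y > 0" using Rlo[OF y] r0 by simp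
    have bm: "b powr m = (2 * y) powr (p / 2) * (2 * y) powr real e"
    proof -
      have "real d / 2 * m = p / 2 + real e" using d0 by (simp add: m_def e power2_eq_square field_simps)
      moreover have "b powr m = (2 * y) powr (real d / 2 * m)" unfolding b_def by (rule powr_powr)
      ultimately show ?thesis by (simp only: powr_add)
    qed
    have "(1 - h\<^sup>2) = (2 * y) * (1 - y / 2)" by (simp add: hy power2_eq_square algebra_simps)
    then have "(1 - h\<^sup>2) powr ((real d ^ 2 - real d) / 2) = (2 * y) powr real e * (1 - y / 2) powr real e"
      unfolding e[symmetric] by (simp only: powr_mult)
    also have "(1 - y / 2) powr real e = (1 - y / 2) ^ e" using y by (simp add: powr_realpow)
    finally have q: "(2 * (1 - h)) powr (p / 2) * (1 - h\<^sup>2) powr ((real d ^ 2 - real d) / 2) = b powr m * (1 - y / 2) ^ e"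
      by (simp add: bm y_def)
    have g: "((1 - \<Phi> h) / kappa d) powr m = b powr m * R y powr m"
    proof -
      have "1 - \<Phi> h = G y" by (simp add: G_def y_def)
      then have "(1 - \<Phi> h) / kappa d = b * R y" using \<kappa> by (simp add: GH flip: \<kappa>_def)
      then show ?thesis by (simp only: powr_mult)
    qed
    have u1: "\<bar>(1 - y / 2) ^ e - 1\<bar> \<le> real e * y"
    proof -
      have "1 + real e * (- (y / 2)) \<le> (1 + (- (y / 2))) ^ e" by (rule Bernoulli_inequality) (use y in auto)
      moreover have "(1 - y / 2) ^ e \<le> 1" using y by (intro power_le_one) auto
      moreover have "real e * y \<ge> 0" using y by simp
      ultimately show ?thesis by (simp add: abs_le_iff)
    qed
    have u2: "\<bar>R y powr m - 1\<bar> \<le> K2 * K1 * y"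
    proof -
      have "K1 * y \<le> K1 * 2" using y K1 by (intro mult_left_mono) auto
      then have "R y \<le> 1 + 2 * K1" using RK1[OF y] by linarith
      then have "\<bar>R y powr m - 1\<bar> \<le> K2 * \<bar>R y - 1\<bar>" by (rule K2(2)[OF Rlo[OF y]])
      also have "\<dots> \<le> K2 * (K1 * y)" using RK1[OF y] K2(1) by (intro mult_left_mono) auto
      finally show ?thesis by simp
    qed
    have "\<bar>(1 - y / 2) ^ e - R y powr m\<bar> \<le> K3 * y"
    proof -
      have "K3 * y = real e * y + K2 * K1 * y" by (simp add: K3_def algebra_simps)
      then show ?thesis using u1 u2 by linarith
    qed
    then have "b powr m * \<bar>(1 - y / 2) ^ e - R y powr m\<bar> \<le> b powr m * (K3 * y)"
      by (intro mult_left_mono) auto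
    also have "b powr m * (K3 * y) = K3 / 2 * b powr t"
    proof -
      have "b powr (2 / real d) = (2 * y) powr 1" using d0 by (simp add: b_def powr_powr)
      also have "\<dots> = 2 * y" using y by simp
      finally show ?thesis by (simp add: t_def powr_add)
    qed
    also have "\<dots> \<le> K3 / 2 * ((1 / (\<kappa> * r0)) powr t * G y powr t)"
    proof -
      have "\<kappa> * b * r0 \<le> G y" unfolding GH using Rlo[OF y] \<kappa> b by (intro mult_left_mono) auto
      then have "b \<le> 1 / (\<kappa> * r0) * G y" using \<kappa> r0 by (simp add: field_simps)
      then have "b powr t \<le> (1 / (\<kappa> * r0) * G y) powr t"
        using b m0 d0 by (intro powr_mono2) (auto simp: t_def)
      also have "\<dots> = (1 / (\<kappa> * r0)) powr t * G y powr t"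
        by (rule powr_mult)
      finally show ?thesis using K3 by (intro mult_left_mono) auto
    qed
    also have "\<dots> = K * (1 - \<Phi> h) powr (m + 2 / real d)" by (simp add: K_def G_def y_def t_def)
    finally have "b powr m * \<bar>(1 - y / 2) ^ e - R y powr m\<bar> \<le> K * (1 - \<Phi> h) powr (m + 2 / real d)" .
    moreover have "\<bar>b powr m * (1 - y / 2) ^ e - b powr m * R y powr m\<bar> = b powr m * \<bar>(1 - y / 2) ^ e - R y powr m\<bar>"
      by (simp add: abs_mult flip: right_diff_distrib)
    ultimately show ?thesis unfolding q g by simp
  qed
  then show ?thesis using K by blast
qed

text \<open>Up to a constant, the expected contribution of one set of \<open>d + 1\<close> points
  out of \<open>N\<close>; the other \<open>N - (d + 1)\<close> points supply the power of
  \<open>\<Phi>\<close>. Positive \<open>h\<close> stands for facets with a hole smaller than a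
  hemisphere, negative \<open>h\<close> for those with a larger hole.\<close>

definition hull_integral :: "real \<Rightarrow> nat \<Rightarrow> real" where
  "hull_integral p N = (LBINT h:{-1<..<1}. (2 * (1 - h)) powr (p / 2) * \<Phi> h ^ (N - (d + 1)) * (1 - h\<^sup>2) powr ((real d ^ 2 - 2) / 2))"

text \<open>Multiplied by \<open>\<Phi> h ^ j * \<phi> h / c\<close>, the comparison turns the main
  term and the error into integrals that \<open>Beta_substitution\<close> evaluates. The integrand
  itself is integrable because these two dominate it.\<close>

lemma hull_integral_approx_ex:
  fixes p :: real
  assumes p: "p \<ge> 0"
  defines "m \<equiv> p / real d + real d - 1"
  shows "\<exists>K\<ge>0. \<forall>N\<ge>d + 2.
    (\<integral>\<^sup>+h. ennreal (indicator {-1<..<1} h * ((2 * (1 - h)) powr (p / 2) * \<Phi> h ^ (N - (d + 1)) * (1 - h\<^sup>2) powr ((real d ^ 2 - 2) / 2))) \<partial>lborel) = ennreal (hull_integral p N) \<and>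
    \<bar>hull_integral p N - Beta (real N - real d) (m + 1) / (c * kappa d powr m)\<bar> \<le> K * Beta (real N - real d) (m + 2 / real d + 1)"
proof -
  obtain K where K: "K \<ge> 0" and comp: "\<And>h. \<bar>h\<bar> < 1 \<Longrightarrow>
    \<bar>(2 * (1 - h)) powr (p / 2) * (1 - h\<^sup>2) powr ((real d ^ 2 - real d) / 2) - ((1 - \<Phi> h) / kappa d) powr m\<bar>
      \<le> K * (1 - \<Phi> h) powr (m + 2 / real d)"
    using comparison_ex[OF p] unfolding m_def by blast
  have \<kappa>: "kappa d > 0" by (rule kappa_pos[OF d])
  have "p / real d \<ge> 0" "real d \<ge> 1" using p d by simp_all
  then have m0: "m \<ge> 0" unfolding m_def by linarith
  define t where "t = m + 2 / real d"
  have t0: "t \<ge> 0" using m0 by (simp add: t_def)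
  have "(\<integral>\<^sup>+h. ennreal (indicator {-1<..<1} h * ((2 * (1 - h)) powr (p / 2) * \<Phi> h ^ (N - (d + 1)) * (1 - h\<^sup>2) powr ((real d ^ 2 - 2) / 2))) \<partial>lborel) = ennreal (hull_integral p N) \<and>
    \<bar>hull_integral p N - Beta (real N - real d) (m + 1) / (c * kappa d powr m)\<bar> \<le> (K / c) * Beta (real N - real d) (m + 2 / real d + 1)"
    if N: "N \<ge> d + 2" for N
  proof -
    define j where "j = N - (d + 1)"
    \<comment> \<open>\<open>N \<ge> d + 2\<close> provides the condition \<open>j \<ge> 1\<close>
      of \<open>Beta_substitution\<close>; \<open>j + 1 = N - d\<close> is the first Beta
      parameter.\<close>
    have j: "j \<ge> 1" "real j + 1 = real N - real d" using N by (auto simp: j_def)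
    define I where "I h = (2 * (1 - h)) powr (p / 2) * \<Phi> h ^ j * (1 - h\<^sup>2) powr ((real d ^ 2 - 2) / 2)" for h
    define g where "g h = \<Phi> h ^ j * (1 - \<Phi> h) powr m * \<phi> h" for h
    define e where "e h = \<Phi> h ^ j * (1 - \<Phi> h) powr t * \<phi> h" for h
    define A where "A = 1 / (c * kappa d powr m)"
    note gi = Beta_substitution[OF j(1) m0, folded g_def]
    note ei = Beta_substitution[OF j(1) t0, folded e_def]
    have I0: "I h \<ge> 0" if "h \<in> {-1<..<1}" for h using greater_0[of h] that by (simp add: I_def)
    have diff: "\<bar>I h - A * g h\<bar> \<le> K / c * e h" if h: "h \<in> {-1<..<1}" for h
    proof -
      have h': "\<bar>h\<bar> < 1" using h by auto
      then have h2: "1 - h\<^sup>2 > 0" by (simp add: abs_square_less_1)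
      have \<Phi>: "0 < \<Phi> h" "\<Phi> h < 1" using greater_0 less_1 h by auto
      have "(real d ^ 2 - 2) / 2 = (real d ^ 2 - real d) / 2 + (real d - 2) / 2" by (simp add: field_simps)
      then have "(1 - h\<^sup>2) powr ((real d ^ 2 - 2) / 2) = (1 - h\<^sup>2) powr ((real d ^ 2 - real d) / 2) * (1 - h\<^sup>2) powr ((real d - 2) / 2)"
        by (simp only: powr_add)
      also have "(1 - h\<^sup>2) powr ((real d - 2) / 2) = \<phi> h / c" using c by (simp add: \<phi>_def)
      finally have "I h = ((2 * (1 - h)) powr (p / 2) * (1 - h\<^sup>2) powr ((real d ^ 2 - real d) / 2)) * (\<Phi> h ^ j * \<phi> h / c)"
        by (simp add: I_def)
      moreover have "A * g h = ((1 - \<Phi> h) / kappa d) powr m * (\<Phi> h ^ j * \<phi> h / c)"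
        using \<Phi> \<kappa> by (simp add: A_def g_def powr_divide mult_ac)
      ultimately have "I h - A * g h = ((2 * (1 - h)) powr (p / 2) * (1 - h\<^sup>2) powr ((real d ^ 2 - real d) / 2) - ((1 - \<Phi> h) / kappa d) powr m) * (\<Phi> h ^ j * \<phi> h / c)"
        by (simp only: left_diff_distrib)
      moreover have "\<Phi> h ^ j * \<phi> h / c \<ge> 0" using \<Phi> c \<phi>_nonneg[of h] by simp
      ultimately have "\<bar>I h - A * g h\<bar> = \<bar>(2 * (1 - h)) powr (p / 2) * (1 - h\<^sup>2) powr ((real d ^ 2 - real d) / 2) - ((1 - \<Phi> h) / kappa d) powr m\<bar> * (\<Phi> h ^ j * \<phi> h / c)"
        by (simp only: abs_mult abs_of_nonneg)
      also have "\<dots> \<le> K * (1 - \<Phi> h) powr t * (\<Phi> h ^ j * \<phi> h / c)"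
        using comp[OF h'] \<Phi> c \<phi>_nonneg[of h] unfolding t_def by (intro mult_right_mono) auto
      finally show ?thesis by (simp add: e_def mult_ac)
    qed
    have co: "continuous_on {-1<..<1} I"
    proof -
      have "continuous_on {-1<..<1} \<Phi>"
        by (intro continuous_at_imp_continuous_on ballI DERIV_isCont[OF der]) auto
      moreover have "1 - h\<^sup>2 \<noteq> 0" if "h \<in> {-1<..<1}" for h :: real
        using that abs_square_less_1[of h] by auto
      ultimately show ?thesis unfolding I_def[abs_def] by (intro continuous_intros) auto
    qed
    have Im: "(\<lambda>h. indicator {-1<..<1} h *\<^sub>R I h) \<in> borel_measurable lborel"
      using borel_measurable_continuous_on_indicator[OF _ co] by simp
    have "set_integrable lborel {-1<..<1} (\<lambda>h. A * g h + K / c * e h)"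
      by (intro set_integral_add(1) set_integrable_mult_right gi(1) ei(1))
    then have Ii: "set_integrable lborel {-1<..<1} I"
      unfolding set_integrable_def
    proof (rule Bochner_Integration.integrable_bound[OF _ Im], intro AE_I2)
      fix h show "norm (indicator {-1<..<1} h *\<^sub>R I h) \<le> norm (indicator {-1<..<1} h *\<^sub>R (A * g h + K / c * e h))"
        using diff[of h] I0[of h] by (cases "h \<in> {-1<..<1}") auto
    qed
    have J: "hull_integral p N = (LBINT h:{-1<..<1}. I h)"
      by (simp add: hull_integral_def I_def j_def)
    have "(\<integral>\<^sup>+h. ennreal (indicator {-1<..<1} h * I h) \<partial>lborel) = ennreal (hull_integral p N)"
      using Ii I0 unfolding J set_integrable_def set_lebesgue_integral_def
      by (subst nn_integral_eq_integral) (auto simp: indicator_def)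
    moreover have "\<bar>hull_integral p N - A * Beta (real N - real d) (m + 1)\<bar> \<le> (K / c) * Beta (real N - real d) (t + 1)"
    proof -
      have "hull_integral p N - A * Beta (real N - real d) (m + 1) = (LBINT h:{-1<..<1}. I h - A * g h)"
        unfolding J using gi Ii by (subst set_integral_diff(2)) (auto simp: j(2))
      also have "norm \<dots> \<le> (LBINT h:{-1<..<1}. norm (I h - A * g h))"
        by (rule set_integral_norm_bound) (intro set_integral_diff Ii set_integrable_mult_right gi(1))
      also have "\<dots> \<le> (LBINT h:{-1<..<1}. K / c * e h)"
        by (rule set_integral_mono)
          (use diff in \<open>auto intro!: set_integrable_abs set_integral_diff(1) Ii set_integrable_mult_right gi(1) ei(1)\<close>)
      also have "\<dots> = (K / c) * Beta (real N - real d) (t + 1)"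
        using ei by (simp add: j(2))
      finally show ?thesis by simp
    qed
    ultimately show ?thesis by (simp add: I_def j_def A_def t_def)
  qed
  moreover have "K / c \<ge> 0" using K c by simp
  ultimately show ?thesis by blast
qed

text \<open>\<open>Gamma_ratio_bound\<close> at \<open>x = N + b\<close>: once
  \<open>K / x \<le> 1 / 2\<close>, the ratio is at least \<open>1 / 2\<close>, whence the constant
  2.\<close>

lemma Gamma_quotient_bigo:
  fixes a b :: real
  assumes "a \<ge> 0" "b \<ge> 0"
  shows "(\<lambda>N. Gamma (real N + b) / Gamma (real N + b + a)) \<in> O(\<lambda>N. real N powr (- a))"
proof -
  obtain K where K: "K \<ge> 0" "\<And>x. x \<ge> 1 \<Longrightarrow> \<bar>Gamma (x + a) / (Gamma x * x powr a) - 1\<bar> \<le> K / x"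
    using Gamma_ratio_bound[OF assms(1)] by blast
  obtain M :: nat where M: "real M > 2 * K + 1" using reals_Archimedean2 by blast
  have "norm (Gamma (real N + b) / Gamma (real N + b + a)) \<le> 2 * norm (real N powr (- a))" if N: "N \<ge> M" for N
  proof -
    define x where "x = real N + b"
    have N1: "real N > 2 * K + 1" using M N by linarith
    have x: "x \<ge> 1" "x \<ge> real N" using N1 K(1) assms(2) by (auto simp: x_def)
    have "K / x \<le> 1 / 2" using x N1 by (simp add: field_simps)
    then have r: "Gamma (x + a) / (Gamma x * x powr a) \<ge> 1 / 2" using K(2)[OF x(1)] by linarith
    have G: "Gamma x > 0" "Gamma (x + a) > 0" "x powr a > 0" using x assms(1) by (auto intro!: Gamma_real_pos)
    have "Gamma x / Gamma (x + a) \<le> 2 * (1 / x powr a)" using r G by (simp add: field_simps)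
    also have "1 / x powr a \<le> 1 / real N powr a"
      using x N1 K(1) assms(1) by (intro divide_left_mono powr_mono2 mult_pos_pos) auto
    finally have "Gamma x / Gamma (x + a) \<le> 2 * real N powr (- a)" by (simp add: powr_minus_divide)
    then show ?thesis using G by (simp add: x_def)
  qed
  then show ?thesis by (intro bigoI[where c=2]) (auto simp: eventually_sequentially)
qed

text \<open>The number of subsets, the constant in the law of \<open>h\<close> and the leading Beta
  term multiply exactly to the Gamma expression. So \<open>\<epsilon>\<close> is the relative error
  of the integral alone, bounded by a quotient of two Beta values whose second parameters differ by
  \<open>2 / d\<close>. In \<open>\<delta>\<close> there is also the error of
  \<open>Gamma (N + 1) / Gamma (N + p / d)\<close> against a power of \<open>N\<close>, which is
  \<open>O(1 / N)\<close>. For \<open>d \<ge> 2\<close> the first error absorbs it.\<close>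

theorem hull_asymptotics:
  fixes p :: real
  assumes p: "p \<ge> 0"
  shows "\<exists>\<epsilon> \<delta> :: nat \<Rightarrow> real.
       \<epsilon> \<in> O(\<lambda>N. real N powr (- 2 / real d)) \<and>
       \<delta> \<in> O(\<lambda>N. if d = 1 \<and> p \<notin> {0, 1} then 1 / real N else real N powr (- 2 / real d)) \<and>
       (\<forall>N \<ge> d + 2.
          (\<integral>\<^sup>+h. ennreal (indicator {-1<..<1} h * ((2 * (1 - h)) powr (p / 2) * \<Phi> h ^ (N - (d + 1)) * (1 - h\<^sup>2) powr ((real d ^ 2 - 2) / 2))) \<partial>lborel) = ennreal (hull_integral p N) \<and>
          hull_integral p N \<ge> 0 \<and>
          real (N choose (d + 1)) * (2 * real (d\<^sup>2) * kappa (d\<^sup>2)) * hull_integral p N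
            = B_hull d * kappa d powr (- p / real d)
              * (Gamma (real d + p / real d) * Gamma (real N + 1)
                  / (Gamma (real d) * Gamma (real N + p / real d))) * (1 + \<epsilon> N) \<and>
          real (N choose (d + 1)) * (2 * real (d\<^sup>2) * kappa (d\<^sup>2)) * hull_integral p N
            = c_hole d p * real N powr (1 - p / real d) * (1 + \<delta> N))"
proof -
  define m where "m = p / real d + real d - 1"
  define J where "J = hull_integral p"
  have d0: "real d > 0" using d by simp
  obtain K where K: "K \<ge> 0" and nn: "\<And>N. N \<ge> d + 2 \<Longrightarrow>
      (\<integral>\<^sup>+h. ennreal (indicator {-1<..<1} h * ((2 * (1 - h)) powr (p / 2) * \<Phi> h ^ (N - (d + 1)) * (1 - h\<^sup>2) powr ((real d ^ 2 - 2) / 2))) \<partial>lborel) = ennreal (J N)"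
    and approx: "\<And>N. N \<ge> d + 2 \<Longrightarrow> \<bar>J N - Beta (real N - real d) (m + 1) / (c * kappa d powr m)\<bar> \<le> K * Beta (real N - real d) (m + 2 / real d + 1)"
    using hull_integral_approx_ex[OF p] unfolding m_def J_def by blast
  have \<kappa>: "kappa d > 0" by (rule kappa_pos[OF d])
  define J0 where "J0 N = Beta (real N - real d) (m + 1) / (c * kappa d powr m)" for N
  have Jnn: "J N \<ge> 0" for N
    unfolding J_def hull_integral_def set_lebesgue_integral_def
    using greater_0[THEN less_imp_le] by (intro integral_nonneg_AE AE_I2) (auto simp: indicator_def)
  have m1: "m + 1 = real d + p / real d" by (simp add: m_def)
  have Gpos: "Gamma x > 0" if "x > 0" for x :: real using that by (rule Gamma_real_pos)
  have md: "real d + p / real d > 0" using d0 p by (intro add_pos_nonneg) auto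
  have Beta1: "Beta (real N - real d) (m + 1) = Gamma (real N - real d) * Gamma (real d + p / real d) / Gamma (real N + p / real d)" for N
    by (simp add: Beta_def m1)
  have Beta2: "Beta (real N - real d) (m + 2 / real d + 1) = Gamma (real N - real d) * Gamma (real d + p / real d + 2 / real d) / Gamma (real N + p / real d + 2 / real d)" for N
    by (simp add: Beta_def m_def algebra_simps)
  have J0pos: "J0 N > 0" if "N \<ge> d + 2" for N
  proof -
    have "real N - real d > 0" using that by simp
    moreover have "real N + p / real d > 0" using that p d0 by (intro add_pos_nonneg) auto
    ultimately show ?thesis using md c \<kappa> unfolding J0_def Beta1 by (intro divide_pos_pos mult_pos_pos Gpos) auto
  qed
  define \<epsilon> where "\<epsilon> N = (if N \<ge> d + 2 then J N / J0 N - 1 else 0)" for N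
  define Q where "Q N = Gamma (real N + p / real d) / Gamma (real N + p / real d + 2 / real d)" for N
  define K1 where "K1 = K * (c * kappa d powr m) * (Gamma (real d + p / real d + 2 / real d) / Gamma (real d + p / real d))"
  have md2: "real d + p / real d + 2 / real d > 0" by (rule add_pos_pos[OF md]) (use d0 in simp)
  have K1: "K1 \<ge> 0" unfolding K1_def using K c \<kappa> md md2
    by (intro mult_nonneg_nonneg divide_nonneg_nonneg less_imp_le[OF Gpos]) auto
  have \<epsilon>_bound: "\<bar>\<epsilon> N\<bar> \<le> K1 * Q N" if N: "N \<ge> d + 2" for N
  proof -
    have "\<epsilon> N = (J N - J0 N) / J0 N" using J0pos[OF N] N by (simp add: \<epsilon>_def diff_divide_distrib)
    then have "\<bar>\<epsilon> N\<bar> = \<bar>J N - J0 N\<bar> / J0 N" using J0pos[OF N] by (simp add: abs_divide)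
    also have "\<dots> \<le> K * Beta (real N - real d) (m + 2 / real d + 1) / J0 N"
      using approx[OF N] J0pos[OF N] by (intro divide_right_mono) (auto simp: J0_def)
    also have "\<dots> = K1 * Q N"
    proof -
      have x: "real N - real d > 0" "real N + p / real d > 0" using N p d0 by (auto intro!: add_pos_nonneg)
      then have "Gamma (real N - real d) > 0" "Gamma (real N + p / real d) > 0" "Gamma (real d + p / real d) > 0"
        using md by (auto intro!: Gpos)
      then show ?thesis unfolding J0_def Beta1 Beta2 K1_def Q_def using c \<kappa> by (simp add: field_simps)
    qed
    finally show ?thesis .
  qed
  have "Q \<in> O(\<lambda>N. real N powr (- (2 / real d)))"
    unfolding Q_def[abs_def] using p by (intro Gamma_quotient_bigo) auto
  then have "(\<lambda>N. K1 * Q N) \<in> O(\<lambda>N. real N powr (- 2 / real d))" 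
    using landau_o.big.mult[of "\<lambda>_. K1" sequentially "\<lambda>_. 1" Q] by simp
  moreover have "\<epsilon> \<in> O(\<lambda>N. K1 * Q N)"
    by (rule bigoI[where c=1]) (use \<epsilon>_bound in \<open>auto simp: eventually_sequentially intro!: exI[of _ "d + 2"] order_trans[OF _ abs_ge_self]\<close>)
  ultimately have \<epsilon>O: "\<epsilon> \<in> O(\<lambda>N. real N powr (- 2 / real d))" by (rule landau_o.big_trans[rotated])
  \<comment> \<open>\<open>\<rho> N\<close> compares the Gamma quotient with the pure power of
    \<open>N\<close>, and \<open>1 + \<delta> N\<close> is the product of the two correction
    factors.\<close>
  define \<rho> where "\<rho> N = Gamma (real N + 1) / (Gamma (real N + p / real d) * real N powr (1 - p / real d))" for N
  define \<delta> where "\<delta> N = (1 + \<epsilon> N) * \<rho> N - 1" for N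
  have plus1: "Gamma (real N + 1) = real N * Gamma (real N)" if "N \<ge> 1" for N
    using that by (intro Gamma_plus1 notI) (auto dest: nonpos_Ints_nonpos)
  have \<rho>_eq: "\<rho> N = 1 / (Gamma (real N + p / real d) / (Gamma (real N) * real N powr (p / real d)))" if "N \<ge> 1" for N
  proof -
    have "real N powr (1 - p / real d) = real N / real N powr (p / real d)" using that by (simp add: powr_diff)
    then show ?thesis using that by (simp add: \<rho>_def plus1)
  qed
  have main: "real (N choose (d + 1)) * (2 * real (d\<^sup>2) * kappa (d\<^sup>2)) * J0 N
      = B_hull d * kappa d powr (- p / real d) * (Gamma (real d + p / real d) * Gamma (real N + 1) / (Gamma (real d) * Gamma (real N + p / real d)))"
    if N: "N \<ge> d + 2" for N
  proof -
    have bin: "real (N choose (d + 1)) = Gamma (real N + 1) / (real (d + 1) * real d * Gamma (real d) * Gamma (real N - real d))"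
    proof -
      have "real (N choose (d + 1)) = fact N / (fact (d + 1) * fact (N - (d + 1)))"
        using N by (intro binomial_fact) auto
      moreover have "fact N = Gamma (real N + 1)" by (simp add: Gamma_fact add.commute)
      moreover have "fact (N - (d + 1)) = Gamma (real N - real d)"
      proof -
        have "real N - real d = 1 + real (N - (d + 1))" using N by simp
        then show ?thesis by (simp only: Gamma_fact)
      qed
      moreover have "fact (d + 1) = real (d + 1) * real d * Gamma (real d)"
      proof -
        have "Gamma (real d) = fact (d - 1)" using d Gamma_fact[of "d - 1", where 'a=real] by (simp add: of_nat_diff)
        moreover have "fact d = real d * fact (d - 1)" using d by (simp add: fact_reduce)
        ultimately show ?thesis by simp
      qed
      ultimately show ?thesis by simp
    qed
    have G: "Gamma (real N - real d) > 0" "Gamma (real d) > 0" "Gamma (real N + p / real d) > 0"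
      using N d0 p by (auto intro!: Gpos add_pos_nonneg)
    then have G': "Gamma (real N - real d) \<noteq> 0" "Gamma (real d) \<noteq> 0" "Gamma (real N + p / real d) \<noteq> 0" by linarith+
    \<comment> \<open>\<open>1 + m = d + p / d\<close>: the factor \<open>kappa d\<close> contained
      in \<open>c\<close> joins the power from the comparison, and together they give
      \<open>kappa d ^ d\<close> of \<open>B_hull\<close> and the power of \<open>kappa d\<close> in
      the claim.\<close>
    have km: "kappa d * kappa d powr m = kappa d ^ d * kappa d powr (p / real d)"
    proof -
      have "kappa d * kappa d powr m = kappa d powr 1 * kappa d powr m" using \<kappa> by simp
      also have "\<dots> = kappa d powr (1 + m)" by (rule powr_add[symmetric])
      also have "1 + m = real d + p / real d" by (simp add: m_def)
      finally show ?thesis using \<kappa> by (simp add: powr_add powr_realpow)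
    qed
    have J0: "J0 N = Gamma (real N - real d) * Gamma (real d + p / real d) / (Gamma (real N + p / real d) * (real d * (kappa d ^ d * kappa d powr (p / real d))))"
      unfolding J0_def Beta1 c_eq by (simp add: km mult.assoc)
    have neg: "kappa d powr (- p / real d) = 1 / kappa d powr (p / real d)" by (simp add: powr_minus_divide flip: minus_divide_left)
    \<comment> \<open>The cancellation is done for free variables, with all Gamma and kappa values
      as opaque factors.\<close>
    have gen: "(D + 1) \<noteq> 0 \<Longrightarrow> D \<noteq> 0 \<Longrightarrow> g1 \<noteq> 0 \<Longrightarrow> g2 \<noteq> 0 \<Longrightarrow> g3 \<noteq> 0 \<Longrightarrow> kd \<noteq> 0 \<Longrightarrow> kp \<noteq> 0 \<Longrightarrow>
        G1 / ((D + 1) * D * g2 * g1) * (2 * D\<^sup>2 * k2) * (g1 * A / (g3 * (D * (kd * kp)))) = 2 / (D + 1) * (k2 / kd) * (1 / kp) * (A * G1 / (g2 * g3))"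
      for D g1 g2 g3 kd kp G1 k2 A :: real
      by (simp add: divide_simps power2_eq_square)
    show ?thesis unfolding bin J0 B_hull_def neg of_nat_add of_nat_1 of_nat_power
      by (rule gen) (use G' d0 \<kappa> in auto)
  qed
  have first: "real (N choose (d + 1)) * (2 * real (d\<^sup>2) * kappa (d\<^sup>2)) * J N
      = B_hull d * kappa d powr (- p / real d) * (Gamma (real d + p / real d) * Gamma (real N + 1) / (Gamma (real d) * Gamma (real N + p / real d))) * (1 + \<epsilon> N)"
    if N: "N \<ge> d + 2" for N
  proof -
    have e: "J N = J0 N * (1 + \<epsilon> N)" using J0pos[OF N] N by (simp add: \<epsilon>_def)
    show ?thesis unfolding e main[OF N, symmetric] by (simp only: mult.assoc)
  qed
  have second: "real (N choose (d + 1)) * (2 * real (d\<^sup>2) * kappa (d\<^sup>2)) * J N = c_hole d p * real N powr (1 - p / real d) * (1 + \<delta> N)"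
    if N: "N \<ge> d + 2" for N
  proof -
    have G: "Gamma (real N + p / real d) > 0" using N d0 p by (auto intro!: Gpos add_pos_nonneg)
    have "Gamma (real N + 1) / Gamma (real N + p / real d) = \<rho> N * real N powr (1 - p / real d)"
      using N G by (simp add: \<rho>_def)
    then have "Gamma (real d + p / real d) * Gamma (real N + 1) / (Gamma (real d) * Gamma (real N + p / real d))
       = Gamma (real d + p / real d) / Gamma (real d) * (\<rho> N * real N powr (1 - p / real d))"
      by (metis times_divide_times_eq)
    then show ?thesis unfolding first[OF N] by (simp add: c_hole_def B_hole_def \<delta>_def)
  qed
  obtain K2 where K2: "K2 \<ge> 0" "\<And>x. x \<ge> 1 \<Longrightarrow> \<bar>Gamma (x + p / real d) / (Gamma x * x powr (p / real d)) - 1\<bar> \<le> K2 / x"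
    using Gamma_ratio_bound[of "p / real d"] p by auto
  have \<rho>_bound: "eventually (\<lambda>N. \<bar>\<rho> N - 1\<bar> \<le> 2 * K2 / real N \<and> \<bar>\<rho> N\<bar> \<le> 2) sequentially"
  proof -
    obtain M :: nat where M: "real M > 2 * K2 + 1" using reals_Archimedean2 by blast
    have "\<bar>\<rho> N - 1\<bar> \<le> 2 * K2 / real N \<and> \<bar>\<rho> N\<bar> \<le> 2" if "N \<ge> M" for N
    proof -
      have N: "real N > 2 * K2 + 1" using M that by linarith
      then have N1: "N \<ge> 1" using K2(1) by simp
      define r where "r = Gamma (real N + p / real d) / (Gamma (real N) * real N powr (p / real d))"
      have r: "\<bar>r - 1\<bar> \<le> K2 / real N" using K2(2)[of "real N"] N1 by (simp add: r_def)
      have "K2 / real N \<le> 1 / 2" using N K2(1) by (simp add: field_simps)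
      then have r2: "r \<ge> 1 / 2" using r by linarith
      have \<rho>r: "\<rho> N = 1 / r" unfolding r_def by (rule \<rho>_eq[OF N1])
      have "\<rho> N - 1 = (1 - r) / r" using r2 by (simp add: \<rho>r field_simps)
      then have "\<bar>\<rho> N - 1\<bar> = \<bar>r - 1\<bar> / r" using r2 by (simp add: abs_divide abs_minus_commute)
      also have "\<dots> \<le> (K2 / real N) / (1 / 2)" using r r2 by (intro frac_le) auto
      finally have "\<bar>\<rho> N - 1\<bar> \<le> 2 * K2 / real N" by (simp add: mult.commute)
      moreover have "\<bar>\<rho> N\<bar> \<le> 2" using r2 by (simp add: \<rho>r field_simps)
      ultimately show ?thesis by simp
    qed
    then show ?thesis by (auto simp: eventually_sequentially)
  qed
  have \<delta>_eq: "\<delta> = (\<lambda>N. \<epsilon> N * \<rho> N + (\<rho> N - 1))" by (simp add: \<delta>_def fun_eq_iff algebra_simps)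
  have "\<rho> \<in> O(\<lambda>_. 1)" using \<rho>_bound by (intro bigoI[where c=2]) (auto elim: eventually_mono)
  then have \<epsilon>\<rho>: "(\<lambda>N. \<epsilon> N * \<rho> N) \<in> O(\<lambda>N. real N powr (- 2 / real d))"
    using landau_o.big.mult[OF \<epsilon>O, of \<rho> "\<lambda>_. 1"] by simp
  have \<rho>1: "(\<lambda>N. \<rho> N - 1) \<in> O(\<lambda>N. 1 / real N)"
    using \<rho>_bound by (intro bigoI[where c="2 * K2"]) (auto elim: eventually_mono)
  have \<delta>O: "\<delta> \<in> O(\<lambda>N. if d = 1 \<and> p \<notin> {0, 1} then 1 / real N else real N powr (- 2 / real d))"
  proof (cases "d = 1")
    case True
    show ?thesis
    proof (cases "p \<in> {0, 1}")
      case p01: True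
      \<comment> \<open>For \<open>d = 1\<close> the quotient
        \<open>Gamma (N + 1) / Gamma (N + p)\<close> is exactly \<open>N\<close> at
        \<open>p = 0\<close> and exactly 1 at \<open>p = 1\<close>, so no error besides
        \<open>\<epsilon>\<close> arises.\<close>
      have "\<rho> N = 1" if "N \<ge> 1" for N
      proof -
        have "Gamma (real N) > 0" using that by (intro Gpos) simp
        then have "Gamma (real N) \<noteq> 0" by linarith
        then show ?thesis using p01 True that by (auto simp: \<rho>_eq plus1)
      qed
      then have "eventually (\<lambda>N. \<rho> N - 1 = 0) sequentially" by (auto simp: eventually_sequentially)
      then have "(\<lambda>N. \<rho> N - 1) \<in> O(\<lambda>N. real N powr (- 2 / real d))"
        by (intro bigoI[where c=0]) (auto elim: eventually_mono)
      then show ?thesis using sum_in_bigo(1)[OF \<epsilon>\<rho>] p01 by (simp add: \<delta>_eq)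
    next
      case False
      have "(\<lambda>N. real N powr (- 2 / real d)) \<in> O(\<lambda>N. 1 / real N)"
        unfolding True by (simp, real_asymp)
      then have "(\<lambda>N. \<epsilon> N * \<rho> N) \<in> O(\<lambda>N. 1 / real N)" using \<epsilon>\<rho> by (rule landau_o.big_trans[rotated])
      then show ?thesis using sum_in_bigo(1)[OF _ \<rho>1] True False by (simp add: \<delta>_eq)
    qed
  next
    case False
    then have d2: "2 / real d \<le> 1" using d by simp
    have "(\<lambda>N. 1 / real N) \<in> O(\<lambda>N. real N powr (- 2 / real d))"
    proof (rule bigoI[where c=1])
      have "1 / real N \<le> real N powr (- 2 / real d)" if "N \<ge> 1" for N
      proof -
        have "1 / real N = real N powr (- 1)" using that by (simp add: powr_minus_divide)
        also have "\<dots> \<le> real N powr (- (2 / real d))" using that d2 by (intro powr_mono) auto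
        finally show ?thesis by simp
      qed
      then show "eventually (\<lambda>N. norm (1 / real N) \<le> 1 * norm (real N powr (- 2 / real d))) sequentially"
        by (auto simp: eventually_sequentially intro!: exI[of _ 1])
    qed
    then have "(\<lambda>N. \<rho> N - 1) \<in> O(\<lambda>N. real N powr (- 2 / real d))" using \<rho>1 by (rule landau_o.big_trans[rotated])
    then show ?thesis using sum_in_bigo(1)[OF \<epsilon>\<rho>] False by (simp add: \<delta>_eq)
  qed
  show ?thesis
    by (intro exI[of _ \<epsilon>] exI[of _ \<delta>] conjI \<epsilon>O \<delta>O allI impI nn[unfolded J_def] first[unfolded J_def] second[unfolded J_def] Jnn[unfolded J_def])
qed

end

section \<open>Facets and holes of a point set in general position\<close>

text \<open>Two test points suffice: the foot \<open>y0\<close> of the perpendicular from the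
  origin, and \<open>y0 + v\<close>, where \<open>v\<close> is the part of \<open>a\<close>
  orthogonal to \<open>w\<close>. They force \<open>v = 0\<close>, and \<open>y0\<close> gives the
  factor \<open>b\<close>.\<close>

lemma hyperplane_subset_hyperplane:
  fixes w a :: "'a::euclidean_space"
  assumes w: "w \<noteq> 0" and sub: "{y. w \<bullet> y = 1} \<subseteq> {y. a \<bullet> y = b}"
  shows "a = b *\<^sub>R w"
proof -
  define y0 where "y0 = (1 / (w \<bullet> w)) *\<^sub>R w"
  have y0: "w \<bullet> y0 = 1" using w by (simp add: y0_def)
  then have ay0: "a \<bullet> y0 = b" using sub by auto
  define v where "v = a - ((a \<bullet> w) / (w \<bullet> w)) *\<^sub>R w"
  have wv: "w \<bullet> v = 0" using w by (simp add: v_def inner_diff_right inner_commute)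
  have "w \<bullet> (y0 + v) = 1" by (simp add: inner_add_right y0 wv)
  then have "a \<bullet> (y0 + v) = b" using sub by auto
  then have av: "a \<bullet> v = 0" by (simp add: inner_add_right ay0)
  have "v \<bullet> v = a \<bullet> v - ((a \<bullet> w) / (w \<bullet> w)) * (w \<bullet> v)" by (simp add: v_def inner_diff_left)
  then have "v = 0" by (simp add: av wv)
  then have a: "a = ((a \<bullet> w) / (w \<bullet> w)) *\<^sub>R w" by (simp add: v_def)
  have "b = (a \<bullet> w) / (w \<bullet> w)" using ay0 by (simp add: y0_def)
  then show ?thesis using a by simp
qed

lemma two_sin_half_arccos:
  assumes "\<bar>g\<bar> \<le> 1"
  shows "2 * sin (arccos g / 2) = sqrt (2 * (1 - g))"
proof -
  have "cos (2 * (arccos g / 2)) = 1 - 2 * (sin (arccos g / 2))\<^sup>2" by (rule cos_double_sin)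
  then have "(2 * sin (arccos g / 2))\<^sup>2 = 2 * (1 - g)" using assms by (simp add: power_mult_distrib cos_arccos_abs)
  moreover have "2 * sin (arccos g / 2) \<ge> 0"
    using arccos_bounded[of g] assms by (intro mult_nonneg_nonneg sin_ge_zero) (auto simp: abs_le_iff)
  ultimately show ?thesis by (metis real_sqrt_unique)
qed

text \<open>Deterministic consequences of an almost sure event, so that facets can be treated
  without measure theory. By \<open>card_I\<close> there is a point outside every \<open>T\<close>,
  which makes the hull full-dimensional and the two sides of a facet distinguishable.\<close>

locale general_position =
  fixes x :: "'i \<Rightarrow> real ^ 'n" and I :: "'i set" and w :: "'i set \<Rightarrow> real ^ 'n" and m :: nat
  assumes dim [simp]: "CARD('n) = m" and n: "m \<ge> 2" and fin: "finite I" and card_I: "card I \<ge> m + 1"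
    and norm_x: "\<And>i. i \<in> I \<Longrightarrow> norm (x i) = 1"
    and on: "\<And>T i. T \<subseteq> I \<Longrightarrow> card T = m \<Longrightarrow> i \<in> T \<Longrightarrow> x i \<bullet> w T = 1"
    and off: "\<And>T i. T \<subseteq> I \<Longrightarrow> card T = m \<Longrightarrow> i \<in> I - T \<Longrightarrow> x i \<bullet> w T \<noteq> 1"
    and aff: "\<And>T. T \<subseteq> I \<Longrightarrow> card T = m \<Longrightarrow> affine hull (x ` T) = {y. w T \<bullet> y = 1}"
    and norm_w: "\<And>T. T \<subseteq> I \<Longrightarrow> card T = m \<Longrightarrow> norm (w T) > 1"
begin

abbreviation simplices :: "'i set set" where "simplices \<equiv> {T. T \<subseteq> I \<and> card T = m}"

text \<open>The origin satisfies \<open>0 \<bullet> w T < 1\<close>. So \<open>below\<close> puts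
  the other points on the side of the origin, with a hole smaller than a hemisphere, and
  \<open>above\<close> on the far side, with a hole larger than one.\<close>

definition below :: "'i set \<Rightarrow> bool" where "below T \<longleftrightarrow> (\<forall>i\<in>I - T. x i \<bullet> w T < 1)"
definition above :: "'i set \<Rightarrow> bool" where "above T \<longleftrightarrow> (\<forall>i\<in>I - T. x i \<bullet> w T > 1)"

lemma w_nonzero: "T \<in> simplices \<Longrightarrow> w T \<noteq> 0"
  using norm_w[of T] by auto

lemma rest_nonempty:
  assumes "T \<in> simplices" shows "I - T \<noteq> {}"
proof
  assume "I - T = {}"
  then have "card I \<le> card T" using assms by (intro card_mono) (auto intro: finite_subset[OF _ fin])
  then show False using card_I assms by simp
qed

lemma not_both: "T \<in> simplices \<Longrightarrow> \<not> (below T \<and> above T)"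
  using rest_nonempty[of T] unfolding below_def above_def by (metis all_not_in_conv less_asym)

text \<open>If \<open>x i = x j\<close>, a set \<open>T\<close> with \<open>i\<close> but without
  \<open>j\<close> would have the same point both on and off its hyperplane; \<open>card_I\<close>
  leaves enough points for such a \<open>T\<close>.\<close>

lemma inj_on_x: "inj_on x I"
proof (rule inj_onI, rule ccontr)
  fix i j assume ij: "i \<in> I" "j \<in> I" "x i = x j" "i \<noteq> j"
  have "m - 1 \<le> card (I - {i, j})" using card_I ij fin by (simp add: card_Diff_subset)
  then obtain A where A: "A \<subseteq> I - {i, j}" "card A = m - 1" by (meson obtain_subset_with_card_n)
  have "card (insert i A) = m"
    using A n fin finite_subset[OF A(1)] by (subst card_insert_disjoint) auto
  then have "x i \<bullet> w (insert i A) = 1" "x j \<bullet> w (insert i A) \<noteq> 1"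
    using on[of "insert i A" i] off[of "insert i A" j] A ij by auto
  then show False using ij by simp
qed

lemma aff_dim_simplex:
  assumes "T \<in> simplices" shows "aff_dim (x ` T) = int m - 1"
proof -
  have "aff_dim (x ` T) = aff_dim {y. w T \<bullet> y = 1}"
    using assms aff by (metis (mono_tags, lifting) aff_dim_affine_hull mem_Collect_eq)
  then show ?thesis using w_nonzero[OF assms] n by (simp add: aff_dim_hyperplane of_nat_diff)
qed

text \<open>The points of one \<open>T\<close> span a hyperplane, and any further point lies off
  it.\<close>

lemma aff_dim_hull: "aff_dim (convex hull (x ` I)) = int m"
proof -
  obtain T where T: "T \<subseteq> I" "card T = m"
    using card_I by (metis add_leD1 obtain_subset_with_card_n)
  then have Ts: "T \<in> simplices" by simp
  obtain i where i: "i \<in> I - T" using rest_nonempty[OF Ts] by blast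
  have "aff_dim (x ` T) \<le> aff_dim (x ` I)" using T by (intro aff_dim_subset) auto
  moreover have "aff_dim (x ` T) \<noteq> aff_dim (x ` I)"
  proof
    assume eq: "aff_dim (x ` T) = aff_dim (x ` I)"
    have "affine hull (x ` T) = affine hull (x ` I)"
      by (rule affine_dim_equal) (use T eq n in \<open>auto simp: aff_dim_affine_hull intro!: hull_mono\<close>)
    moreover have "x i \<in> affine hull (x ` I)" using i by (intro hull_inc) auto
    ultimately have "w T \<bullet> x i = 1" using aff[OF T] by auto
    then show False using off[OF T i] by (simp add: inner_commute)
  qed
  moreover have "aff_dim (x ` I) \<le> int m" using aff_dim_le_DIM[of "x ` I"] by simp
  ultimately show ?thesis using aff_dim_simplex[OF Ts] by (simp add: aff_dim_convex_hull)
qed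

lemma on_iff:
  assumes "T \<in> simplices" "i \<in> I"
  shows "x i \<bullet> w T = 1 \<longleftrightarrow> i \<in> T"
  using assms on off by blast

text \<open>A supporting hyperplane cuts out a face that is the hull of some of the points, and by
  general position these are exactly the points of \<open>T\<close>. The two choices of
  \<open>a\<close> and \<open>b\<close> cover both sides of the hyperplane.\<close>

lemma supporting_facet:
  assumes T: "T \<in> simplices" and a: "(a = w T \<and> b = 1) \<or> (a = - w T \<and> b = -1)"
    and le: "\<And>i. i \<in> I \<Longrightarrow> a \<bullet> x i \<le> b"
  shows "convex hull (x ` T) facet_of convex hull (x ` I)"
proof -
  let ?C = "convex hull (x ` I)"
  have eq: "a \<bullet> x i = b \<longleftrightarrow> i \<in> T" if "i \<in> I" for i
    using on_iff[OF T that] a by (auto simp: inner_commute)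
  have "x ` I \<subseteq> {y. a \<bullet> y \<le> b}" using le by auto
  then have "?C \<subseteq> {y. a \<bullet> y \<le> b}" by (rule hull_minimal) (rule convex_halfspace_le)
  then have face: "?C \<inter> {y. a \<bullet> y = b} face_of ?C"
    by (intro face_of_Int_supporting_hyperplane_le) auto
  have "compact (x ` I)" using fin by (intro finite_imp_compact) simp
  then obtain S' where S': "S' \<subseteq> x ` I" "?C \<inter> {y. a \<bullet> y = b} = convex hull S'"
    using face_of_convex_hull_subset[OF _ face] by blast
  have "S' \<subseteq> x ` T"
  proof
    fix y assume y: "y \<in> S'"
    then obtain i where i: "y = x i" "i \<in> I" using S'(1) by auto
    have "y \<in> convex hull S'" using y by (rule hull_inc)
    then have "a \<bullet> x i = b" using S'(2) i by auto
    then show "y \<in> x ` T" using eq i by auto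
  qed
  moreover have "x ` T \<subseteq> ?C \<inter> {y. a \<bullet> y = b}" using T eq by (auto intro!: hull_inc)
  then have "convex hull (x ` T) \<subseteq> ?C \<inter> {y. a \<bullet> y = b}"
    by (rule hull_minimal) (intro convex_Int convex_convex_hull convex_hyperplane)
  ultimately have "?C \<inter> {y. a \<bullet> y = b} = convex hull (x ` T)"
    using S'(2) hull_mono[of S' "x ` T" convex] by blast
  then have "convex hull (x ` T) face_of ?C" using face by simp
  moreover have "convex hull (x ` T) \<noteq> {}" using T n by auto
  ultimately show ?thesis
    using aff_dim_simplex[OF T] aff_dim_hull by (simp add: facet_of_def aff_dim_convex_hull)
qed

lemma facet_of_simplex:
  assumes T: "T \<in> simplices" and side: "below T \<or> above T"
  shows "convex hull (x ` T) facet_of convex hull (x ` I)"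
  using side
proof
  assume b: "below T"
  have le: "w T \<bullet> x i \<le> 1" if "i \<in> I" for i
    using b on_iff[OF T that] that unfolding below_def by (cases "i \<in> T") (auto simp: inner_commute intro: less_imp_le)
  show ?thesis by (rule supporting_facet[OF T, of "w T" 1]) (simp_all add: le)
next
  assume a: "above T"
  have le: "- w T \<bullet> x i \<le> - 1" if "i \<in> I" for i
    using a on_iff[OF T that] that unfolding above_def by (cases "i \<in> T") (auto simp: inner_commute intro: less_imp_le)
  show ?thesis by (rule supporting_facet[OF T, of "- w T" "- 1"]) (use le in simp_all)
qed

text \<open>A facet is the hull of some of the points. An affine basis of these has \<open>m\<close>
  elements and provides \<open>T\<close>, and general position leaves no further point in the
  hyperplane. As a face of a polyhedron the facet is exposed; the exposing functional must be
  \<open>b *\<^sub>R w T\<close>, and the sign of \<open>b\<close> tells the side.\<close>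

lemma facet_is_simplex:
  assumes F: "F facet_of convex hull (x ` I)"
  shows "\<exists>T\<in>simplices. (below T \<or> above T) \<and> F = convex hull (x ` T)"
proof -
  let ?C = "convex hull (x ` I)"
  have face: "F face_of ?C" and dimF: "aff_dim F = int m - 1" and Fne: "F \<noteq> {}"
    using F aff_dim_hull by (auto simp: facet_of_def)
  have "compact (x ` I)" using fin by (intro finite_imp_compact) simp
  then obtain S' where S': "S' \<subseteq> x ` I" "F = convex hull S'"
    using face_of_convex_hull_subset[OF _ face] by blast
  obtain B where B: "B \<subseteq> S'" "\<not> affine_dependent B" "affine hull S' = affine hull B"
    using affine_basis_exists[of S'] by blast
  have "aff_dim B = int m - 1"
    using dimF B(3) S'(2) by (metis aff_dim_affine_hull aff_dim_convex_hull)
  moreover have "int (card B) = aff_dim B + 1" by (rule aff_dim_affine_independent[OF B(2)])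
  ultimately have cardB: "card B = m" by simp
  have "B \<subseteq> x ` I" using B S' by blast
  then obtain T where T: "T \<subseteq> I" "B = x ` T" by (meson subset_imageE)
  then have "card T = m" using cardB card_image[OF inj_on_subset[OF inj_on_x T(1)]] by simp
  then have Ts: "T \<in> simplices" using T by simp
  have hyp: "affine hull S' = {y. w T \<bullet> y = 1}" using aff[of T] Ts B(3) T(2) by simp
  have "S' \<subseteq> x ` T"
  proof
    fix y assume y: "y \<in> S'"
    then obtain i where i: "y = x i" "i \<in> I" using S'(1) by auto
    have "w T \<bullet> y = 1" using hull_inc[OF y, of affine] hyp by auto
    then show "y \<in> x ` T" using on_iff[OF Ts i(2)] i by (auto simp: inner_commute)
  qed
  then have S'T: "S' = x ` T" using B(1) T(2) by blast
  have "polyhedron ?C" using fin by (intro polytope_imp_polyhedron polytope_convex_hull) simp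
  then have "F exposed_face_of ?C" using face by (simp add: exposed_face_of_polyhedron)
  then obtain a b where ab: "?C \<subseteq> {y. a \<bullet> y \<le> b}" "F = ?C \<inter> {y. a \<bullet> y = b}"
    unfolding exposed_face_of_def by blast
  have "affine hull S' \<subseteq> {y. a \<bullet> y = b}"
  proof (rule hull_minimal)
    show "S' \<subseteq> {y. a \<bullet> y = b}" using hull_subset[of S' convex] S'(2) ab(2) by blast
  qed (rule affine_hyperplane)
  then have a: "a = b *\<^sub>R w T"
    using hyp by (intro hyperplane_subset_hyperplane[OF w_nonzero[OF Ts]]) simp
  \<comment> \<open>For \<open>b = 0\<close> the functional would vanish and the facet would be the
    whole hull, whose dimension is larger.\<close>
  have "b \<noteq> 0"
  proof
    assume "b = 0"
    then have "F = ?C" using ab(2) a by auto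
    then show False using dimF aff_dim_hull by simp
  qed
  have le: "b * (x i \<bullet> w T) \<le> b" if "i \<in> I" for i
  proof -
    have "x i \<in> ?C" using that by (intro hull_inc) auto
    then show ?thesis using ab(1) a by (auto simp: inner_commute)
  qed
  have "below T \<or> above T"
  proof (cases "b > 0")
    case True
    have "x i \<bullet> w T < 1" if "i \<in> I - T" for i
      using le[of i] off[of T i] Ts True that by (auto simp: mult_le_cancel_left1 order_less_le)
    then show ?thesis by (simp add: below_def)
  next
    case False
    then have "b < 0" using \<open>b \<noteq> 0\<close> by simp
    then have "x i \<bullet> w T > 1" if "i \<in> I - T" for i
      using le[of i] off[of T i] Ts that by (auto simp: mult_le_cancel_left2 order_less_le)
    then show ?thesis by (simp add: above_def)
  qed
  then show ?thesis using Ts S'T S'(2) by blast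
qed

lemma bij_betw_facets:
  "bij_betw (\<lambda>T. convex hull (x ` T)) {T \<in> simplices. below T \<or> above T} (hull_facets (x ` I))"
proof (rule bij_betw_imageI)
  show "inj_on (\<lambda>T. convex hull (x ` T)) {T \<in> simplices. below T \<or> above T}"
  proof (rule inj_onI)
    fix T U assume T: "T \<in> {T \<in> simplices. below T \<or> above T}" and U: "U \<in> {T \<in> simplices. below T \<or> above T}"
      and eq: "convex hull (x ` T) = convex hull (x ` U)"
    \<comment> \<open>Equal hulls lie in the same hyperplane, and by general position the hyperplane
      determines \<open>T\<close>.\<close>
    have "affine hull (x ` T) = affine hull (x ` U)" using eq by (metis affine_hull_convex_hull)
    then have e: "w T \<bullet> y = 1 \<longleftrightarrow> w U \<bullet> y = 1" for y using aff[of T] aff[of U] T U by auto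
    show "T = U"
      using on_iff[of T] on_iff[of U] e T U by (auto simp: inner_commute)
  qed
  show "(\<lambda>T. convex hull (x ` T)) ` {T \<in> simplices. below T \<or> above T} = hull_facets (x ` I)"
    using facet_of_simplex facet_is_simplex by (auto simp: hull_facets_def)
qed

text \<open>Two equations of the same hyperplane are proportional, so
  \<open>c = cos \<alpha> *\<^sub>R w T\<close>, and the norms give
  \<open>cos \<alpha> = \<plusminus> 1 / norm (w T)\<close>. An empty cap means
  \<open>c \<bullet> x i \<le> cos \<alpha>\<close> for all points; division by
  \<open>cos \<alpha>\<close> yields the side according to its sign.\<close>

lemma is_hole_iff:
  assumes T: "T \<in> simplices"
  shows "(\<exists>c. is_hole (x ` I) (convex hull (x ` T)) c \<alpha>) \<longleftrightarrow>
    (\<alpha> = arccos (1 / norm (w T)) \<and> (\<forall>i\<in>I. x i \<bullet> w T \<le> 1)) \<or> (\<alpha> = arccos (- 1 / norm (w T)) \<and> (\<forall>i\<in>I. x i \<bullet> w T \<ge> 1))"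
proof -
  define W where "W = norm (w T)"
  have W: "W > 1" using norm_w[of T] T by (simp add: W_def)
  then have h: "0 < 1 / W" "1 / W < 1" by auto
  have hyp: "affine hull (convex hull (x ` T)) = {y. w T \<bullet> y = 1}" using aff[of T] T by (simp add: affine_hull_convex_hull)
  have cap: "open_cap c \<alpha> \<inter> x ` I = {} \<longleftrightarrow> (\<forall>i\<in>I. c \<bullet> x i \<le> cos \<alpha>)" if c: "norm c = 1" and \<alpha>: "0 \<le> \<alpha>" "\<alpha> \<le> pi" for c \<alpha>
  proof -
    have "arccos (c \<bullet> x i) < \<alpha> \<longleftrightarrow> c \<bullet> x i > cos \<alpha>" if "i \<in> I" for i
    proof -
      have "\<bar>c \<bullet> x i\<bar> \<le> 1" using Cauchy_Schwarz_ineq2[of c "x i"] c norm_x[OF that] by simp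
      then have "arccos (c \<bullet> x i) < arccos (cos \<alpha>) \<longleftrightarrow> cos \<alpha> < c \<bullet> x i" by (intro arccos_less_mono) auto
      then show ?thesis using \<alpha> by (simp add: arccos_cos)
    qed
    moreover have "open_cap c \<alpha> \<inter> x ` I = {} \<longleftrightarrow> (\<forall>i\<in>I. \<not> arccos (c \<bullet> x i) < \<alpha>)"
      using norm_x by (auto simp: open_cap_def disjoint_iff)
    ultimately show ?thesis by (simp add: not_less)
  qed
  have dir: "is_hole (x ` I) (convex hull (x ` T)) (\<sigma> *\<^sub>R w T) \<alpha>"
    if \<sigma>: "\<bar>\<sigma>\<bar> = 1 / W" and \<alpha>: "\<alpha> = arccos \<sigma>" and side: "\<And>i. i \<in> I \<Longrightarrow> \<sigma> * (x i \<bullet> w T) \<le> \<sigma>" for \<sigma> \<alpha>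
  proof -
    have "\<bar>\<sigma>\<bar> \<le> 1" using \<sigma> h by simp
    then have ca: "cos \<alpha> = \<sigma>" "0 \<le> \<alpha>" "\<alpha> \<le> pi" using \<alpha> arccos_bounded[of \<sigma>] by (auto simp: cos_arccos_abs abs_le_iff)
    have n1: "norm (\<sigma> *\<^sub>R w T) = 1" using \<sigma> W by (simp flip: W_def)
    have "\<sigma> \<noteq> 0" using \<sigma> W by auto
    then have "{y. w T \<bullet> y = 1} = {y. (\<sigma> *\<^sub>R w T) \<bullet> y = cos \<alpha>}" by (simp add: ca)
    with hyp have e: "affine hull (convex hull (x ` T)) = {y. (\<sigma> *\<^sub>R w T) \<bullet> y = cos \<alpha>}" by (rule trans)
    show ?thesis unfolding is_hole_def cap[OF n1 ca(2,3)]
    proof (intro conjI ballI e)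
      show "\<sigma> *\<^sub>R w T \<in> unit_sphere" using n1 by simp
      show "(\<sigma> *\<^sub>R w T) \<bullet> x i \<le> cos \<alpha>" if "i \<in> I" for i
        using side[OF that] ca(1) by (simp add: inner_commute)
    qed (rule ca)+
  qed
  show ?thesis
  proof
    assume "\<exists>c. is_hole (x ` I) (convex hull (x ` T)) c \<alpha>"
    then obtain c where c: "norm c = 1" "0 \<le> \<alpha>" "\<alpha> \<le> pi" "{y. w T \<bullet> y = 1} = {y. c \<bullet> y = cos \<alpha>}" "open_cap c \<alpha> \<inter> x ` I = {}"
      unfolding is_hole_def hyp by auto
    have cw: "c = cos \<alpha> *\<^sub>R w T"
      using c(4) by (intro hyperplane_subset_hyperplane[OF w_nonzero[OF T]]) simp
    then have "\<bar>cos \<alpha>\<bar> * W = 1" using c(1) by (simp add: W_def)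
    then have ca: "\<bar>cos \<alpha>\<bar> = 1 / W" using W by (simp add: field_simps)
    have le: "cos \<alpha> * (x i \<bullet> w T) \<le> cos \<alpha>" if "i \<in> I" for i
    proof -
      have "c \<bullet> x i \<le> cos \<alpha>" using c(5) cap[OF c(1-3)] that by blast
      then show ?thesis using cw by (metis inner_commute inner_scaleR_left)
    qed
    have ac: "\<alpha> = arccos (cos \<alpha>)" using c by (simp add: arccos_cos)
    show "(\<alpha> = arccos (1 / norm (w T)) \<and> (\<forall>i\<in>I. x i \<bullet> w T \<le> 1)) \<or> (\<alpha> = arccos (- 1 / norm (w T)) \<and> (\<forall>i\<in>I. x i \<bullet> w T \<ge> 1))"
    proof (cases "cos \<alpha> > 0")
      case True
      then have "cos \<alpha> = 1 / W" using ca by simp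
      moreover have "\<forall>i\<in>I. x i \<bullet> w T \<le> 1" using le True by (simp add: mult_le_cancel_left1)
      ultimately show ?thesis using ac by (simp add: W_def)
    next
      case False
      have "cos \<alpha> \<noteq> 0" using ca h by linarith
      then have "cos \<alpha> < 0" using False by linarith
      then have "cos \<alpha> = - 1 / W" using ca by simp
      moreover have "\<forall>i\<in>I. x i \<bullet> w T \<ge> 1" using le \<open>cos \<alpha> < 0\<close> by (simp add: mult_le_cancel_left2)
      ultimately show ?thesis using ac by (simp add: W_def)
    qed
  next
    assume "(\<alpha> = arccos (1 / norm (w T)) \<and> (\<forall>i\<in>I. x i \<bullet> w T \<le> 1)) \<or> (\<alpha> = arccos (- 1 / norm (w T)) \<and> (\<forall>i\<in>I. x i \<bullet> w T \<ge> 1))"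
    then show "\<exists>c. is_hole (x ` I) (convex hull (x ` T)) c \<alpha>"
    proof
      assume "\<alpha> = arccos (1 / norm (w T)) \<and> (\<forall>i\<in>I. x i \<bullet> w T \<le> 1)"
      then show ?thesis using dir[of "1 / W" \<alpha>] h W by (auto simp: W_def divide_right_mono)
    next
      assume "\<alpha> = arccos (- 1 / norm (w T)) \<and> (\<forall>i\<in>I. x i \<bullet> w T \<ge> 1)"
      then show ?thesis using dir[of "- 1 / W" \<alpha>] h W by (auto simp: W_def divide_right_mono)
    qed
  qed
qed

text \<open>A point outside \<open>T\<close> refutes one of the two alternatives of
  \<open>is_hole_iff\<close>, so the definite description in \<open>hole_radius\<close> has exactly
  one solution; the half-angle formula converts it.\<close>

lemma euclidean_hole_radius_simplex:
  assumes T: "T \<in> simplices"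
  shows "below T \<Longrightarrow> euclidean_hole_radius (x ` I) (convex hull (x ` T)) = sqrt (2 * (1 - 1 / norm (w T)))"
    and "above T \<Longrightarrow> euclidean_hole_radius (x ` I) (convex hull (x ` T)) = sqrt (2 * (1 + 1 / norm (w T)))"
proof -
  have W: "norm (w T) > 1" using norm_w[of T] T by simp
  then have "0 < norm (w T)" by linarith
  then have h: "0 < 1 / norm (w T)" "1 / norm (w T) < 1" using W by (simp_all only: zero_less_divide_1_iff divide_less_eq_1_pos)
  obtain j where j: "j \<in> I - T" using rest_nonempty[OF T] by blast
  have hole: "hole_radius (x ` I) (convex hull (x ` T)) = arccos (1 / norm (w T))" if b: "below T"
  proof -
    have "\<forall>i\<in>I. x i \<bullet> w T \<le> 1"
      using b on_iff[OF T] unfolding below_def by (metis DiffI eq_iff less_imp_le)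
    moreover have "\<not> (\<forall>i\<in>I. x i \<bullet> w T \<ge> 1)" using b j unfolding below_def by (meson DiffD1 not_less)
    ultimately show ?thesis unfolding hole_radius_def is_hole_iff[OF T] by (intro the_equality) auto
  qed
  have hole': "hole_radius (x ` I) (convex hull (x ` T)) = arccos (- 1 / norm (w T))" if b: "above T"
  proof -
    have "\<forall>i\<in>I. x i \<bullet> w T \<ge> 1"
      using b on_iff[OF T] unfolding above_def by (metis DiffI eq_iff less_imp_le)
    moreover have "\<not> (\<forall>i\<in>I. x i \<bullet> w T \<le> 1)" using b j unfolding above_def by (meson DiffD1 not_less)
    ultimately show ?thesis unfolding hole_radius_def is_hole_iff[OF T] by (intro the_equality) auto
  qed
  show "below T \<Longrightarrow> euclidean_hole_radius (x ` I) (convex hull (x ` T)) = sqrt (2 * (1 - 1 / norm (w T)))"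
    unfolding euclidean_hole_radius_def hole by (rule two_sin_half_arccos) (use h in linarith)
  have "2 * sin (arccos (- 1 / norm (w T)) / 2) = sqrt (2 * (1 - - 1 / norm (w T)))"
    by (rule two_sin_half_arccos) (use h in \<open>simp only: minus_divide_left[symmetric] abs_minus_cancel; linarith\<close>)
  then show "above T \<Longrightarrow> euclidean_hole_radius (x ` I) (convex hull (x ` T)) = sqrt (2 * (1 + 1 / norm (w T)))"
    unfolding euclidean_hole_radius_def hole' by simp
qed

text \<open>A random set of facets gives way to a fixed index set, which allows expectations term by
  term. The two terms may be added because \<open>not_both\<close> lets at most one of them
  survive.\<close>

theorem hole_power_sum_eq:
  "hole_power_sum p (x ` I) = (\<Sum>T\<in>simplices.
     (if below T then (2 * (1 - 1 / norm (w T))) powr (p / 2) else 0) +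
     (if above T then (2 * (1 + 1 / norm (w T))) powr (p / 2) else 0))"
proof -
  have sq: "sqrt z powr p = z powr (p / 2)" if "z \<ge> 0" for z
    using that by (simp add: powr_half_sqrt[symmetric] powr_powr)
  have "hole_power_sum p (x ` I) = (\<Sum>T\<in>{T \<in> simplices. below T \<or> above T}. euclidean_hole_radius (x ` I) (convex hull (x ` T)) powr p)"
    unfolding hole_power_sum_def by (rule sum.reindex_bij_betw[OF bij_betw_facets, symmetric])
  also have "\<dots> = (\<Sum>T\<in>{T \<in> simplices. below T \<or> above T}. (if below T then (2 * (1 - 1 / norm (w T))) powr (p / 2) else 0) +
     (if above T then (2 * (1 + 1 / norm (w T))) powr (p / 2) else 0))"
  proof (rule sum.cong[OF refl])
    fix T assume T: "T \<in> {T \<in> simplices. below T \<or> above T}"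
    then have Ts: "T \<in> simplices" by simp
    have "norm (w T) > 1" using norm_w[of T] Ts by simp
    then have "1 - 1 / norm (w T) \<ge> 0" "1 + 1 / norm (w T) \<ge> 0" by (auto simp: divide_le_eq)
    then show "euclidean_hole_radius (x ` I) (convex hull (x ` T)) powr p = (if below T then (2 * (1 - 1 / norm (w T))) powr (p / 2) else 0) +
     (if above T then (2 * (1 + 1 / norm (w T))) powr (p / 2) else 0)"
      using T not_both[OF Ts] euclidean_hole_radius_simplex[OF Ts] by (auto simp: sq)
  qed
  also have "\<dots> = (\<Sum>T\<in>simplices. (if below T then (2 * (1 - 1 / norm (w T))) powr (p / 2) else 0) +
     (if above T then (2 * (1 + 1 / norm (w T))) powr (p / 2) else 0))"
  proof (rule sum.mono_neutral_left)
    have "simplices \<subseteq> Pow I" by auto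
    then show "finite simplices" using fin by (metis finite_Pow_iff finite_subset)
  qed auto
  finally show ?thesis .
qed

end

section \<open>The expected sum of hole radii\<close>

lemma nn_integral_fold_symmetric:
  fixes F :: "real \<Rightarrow> ennreal"
  assumes [measurable]: "F \<in> borel_measurable borel"
  shows "(\<integral>\<^sup>+h. indicator {0<..<1} h * (F h + F (- h)) \<partial>lborel) = (\<integral>\<^sup>+h. indicator {-1<..<1} h * F h \<partial>lborel)"
proof -
  have "(\<integral>\<^sup>+h. indicator {0<..<1} h * F (- h) \<partial>lborel) = (\<integral>\<^sup>+h. indicator {-1<..<0} h * F h \<partial>lborel)"
    by (subst nn_integral_real_affine[of _ "-1" 0]) (auto intro!: nn_integral_cong simp: indicator_def)
  then have "(\<integral>\<^sup>+h. indicator {0<..<1} h * (F h + F (- h)) \<partial>lborel) =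
      (\<integral>\<^sup>+h. indicator {0<..<1} h * F h + indicator {-1<..<0} h * F h \<partial>lborel)"
    by (simp add: distrib_left nn_integral_add)
  also have "\<dots> = (\<integral>\<^sup>+h. indicator {-1<..<1} h * F h \<partial>lborel)"
    using AE_lborel_singleton[of 0] by (intro nn_integral_cong_AE) (auto elim!: eventually_mono simp: indicator_def)
  finally show ?thesis .
qed

text \<open>Only the constant is left to find. The test function 1 has expectation 1, and by
  symmetry twice its integral over \<open>{0<..<1}\<close> is the Beta integral for
  \<open>m = d\<^sup>2\<close>; hence the factor 2.\<close>

lemma hyperplane_distance_distribution:
  assumes n: "CARD('n::finite) = d + 1" and d: "d \<ge> 1"
    and cont: "continuous_on {0<..<1} \<Psi>" and nonneg: "\<And>h. h \<in> {0<..<1} \<Longrightarrow> \<Psi> h \<ge> 0"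
  shows "(\<integral>\<^sup>+x. ennreal (\<Psi> (1 / norm (cramer_sol (\<chi> i. x i) 1))) \<partial>(unif_rows :: ('n \<Rightarrow> real ^ 'n) measure))
    = ennreal (2 * real (d\<^sup>2) * kappa (d\<^sup>2)) * (\<integral>\<^sup>+h. ennreal (indicator {0<..<1} h * (\<Psi> h * (1 - h\<^sup>2) powr ((real d ^ 2 - 2) / 2))) \<partial>lborel)"
proof -
  have n2: "CARD('n) \<ge> 2" using n d by simp
  obtain C where C: "C \<ge> 0" and eq: "\<And>\<Psi>. continuous_on {0<..<1} \<Psi> \<Longrightarrow> (\<forall>h\<in>{0<..<1}. \<Psi> h \<ge> 0) \<Longrightarrow>
    (\<integral>\<^sup>+x. ennreal (\<Psi> (1 / norm (cramer_sol (\<chi> i. x i) 1))) \<partial>(unif_rows :: ('n \<Rightarrow> real ^ 'n) measure))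
    = ennreal C * (\<integral>\<^sup>+h. ennreal (indicator {0<..<1} h * (\<Psi> h * (1 - h\<^sup>2) powr ((real d ^ 2 - 2) / 2))) \<partial>lborel)"
    using hyperplane_distance_distribution_ex[OF n2] n by auto
  define F where "F h = ennreal ((1 - h\<^sup>2) powr ((real d ^ 2 - 2) / 2))" for h :: real
  have Fm [measurable]: "F \<in> borel_measurable borel" unfolding F_def[abs_def] by measurable
  define J where "J = (\<integral>\<^sup>+h. indicator {0<..<1} h * F h \<partial>lborel)"
  have "emeasure (unif_rows :: ('n \<Rightarrow> real ^ 'n) measure) (space unif_rows) = 1"
    by (rule unif_rows.emeasure_space_1)
  then have "(\<integral>\<^sup>+x. ennreal 1 \<partial>(unif_rows :: ('n \<Rightarrow> real ^ 'n) measure)) = 1" by (simp only: nn_integral_const ennreal_1 mult_1_right)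
  moreover have "ennreal (indicator {0<..<1} h * (1 * (1 - h\<^sup>2) powr ((real d ^ 2 - 2) / 2))) = indicator {0<..<1} h * F h" for h
    by (simp add: F_def indicator_def)
  ultimately have CJ: "ennreal C * J = 1" using eq[of "\<lambda>_. 1"] by (simp add: J_def)
  define k where "k = kappa (d\<^sup>2)"
  have k: "k > 0" "real (d\<^sup>2) > 0" using kappa_pos[of "d\<^sup>2"] d by (auto simp: k_def)
  have "J + J = ennreal (1 / (real (d\<^sup>2) * k))"
  proof -
    have "J + J = (\<integral>\<^sup>+h. indicator {0<..<1} h * (F h + F (- h)) \<partial>lborel)"
    proof -
      have "F (- h) = F h" for h by (simp add: F_def)
      then show ?thesis by (simp add: distrib_left nn_integral_add J_def)
    qed
    also have "\<dots> = (\<integral>\<^sup>+h. indicator {-1<..<1} h * F h \<partial>lborel)" by (rule nn_integral_fold_symmetric) measurable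
    also have "\<dots> = (\<integral>\<^sup>+t. ennreal (indicator {-1<..<1} t * (1 - t\<^sup>2) powr ((real (d\<^sup>2) - 2) / 2)) \<partial>lborel)"
      by (rule nn_integral_cong) (simp add: F_def indicator_def)
    also have "\<dots> = ennreal (1 / (real (d\<^sup>2) * k))" unfolding k_def by (rule nn_integral_one_minus_square_powr) (use d in simp)
    finally show ?thesis .
  qed
  moreover have "ennreal (C * (1 / (real (d\<^sup>2) * k))) = ennreal C * ennreal (1 / (real (d\<^sup>2) * k))"
    by (rule ennreal_mult) (use C k in auto)
  ultimately have "ennreal (C * (1 / (real (d\<^sup>2) * k))) = ennreal C * J + ennreal C * J" by (metis distrib_left)
  also have "\<dots> = ennreal 2" unfolding CJ by (metis ennreal_numeral one_add_one)
  finally have "ennreal (C * (1 / (real (d\<^sup>2) * k))) = ennreal 2" .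
  then have "C * (1 / (real (d\<^sup>2) * k)) = 2" using C k by (subst (asm) ennreal_inj) auto
  then have "C = 2 * real (d\<^sup>2) * k" using k by (simp add: field_simps)
  then show ?thesis using eq[OF cont] nonneg by (simp add: k_def)
qed

text \<open>The transposed matrix is invertible, so every \<open>z\<close> is a linear combination
  of the rows. The inner product with \<open>w\<close> shows that its coefficients sum to
  \<open>w \<bullet> z\<close>, so on the hyperplane the combination is affine.\<close>

lemma affine_hull_rows:
  fixes y :: "'n::finite \<Rightarrow> real ^ 'n"
  assumes det: "det (\<chi> i. y i) \<noteq> 0"
  shows "affine hull (range y) = {z. cramer_sol (\<chi> i. y i) 1 \<bullet> z = 1}"
proof
  define w where "w = cramer_sol (\<chi> i. y i) 1"
  have "((\<chi> i. y i) *v w) $ i = y i \<bullet> w" for i by (simp add: matrix_vector_mul_component)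
  then have w: "w \<bullet> y i = 1" for i using cramer_sol_mult(1)[OF det, of 1] by (simp add: w_def inner_commute)
  show "affine hull (range y) \<subseteq> {z. cramer_sol (\<chi> i. y i) 1 \<bullet> z = 1}"
    by (rule hull_minimal) (use w in \<open>auto simp: w_def affine_hyperplane\<close>)
  show "{z. cramer_sol (\<chi> i. y i) 1 \<bullet> z = 1} \<subseteq> affine hull (range y)"
  proof
    fix z assume "z \<in> {z. cramer_sol (\<chi> i. y i) 1 \<bullet> z = 1}"
    then have z: "w \<bullet> z = 1" by (simp add: w_def)
    have inj: "inj y"
    proof (rule injI, rule ccontr)
      fix i j assume "y i = y j" "i \<noteq> j"
      then have "row i (\<chi> i. y i) = row j (\<chi> i. y i)" by (simp add: row_def)
      then show False using det_identical_rows[OF \<open>i \<noteq> j\<close>] det by blast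
    qed
    define c where "c = cramer_sol (transpose (\<chi> i. y i)) z"
    have "transpose (\<chi> i. y i) *v c = z" unfolding c_def by (rule cramer_sol_mult(1)) (simp add: det_transpose det)
    then have zc: "z = (\<Sum>i\<in>UNIV. (c $ i) *\<^sub>R y i)"
      by (auto simp: vec_eq_iff matrix_vector_mult_def transpose_def mult.commute)
    have "(\<Sum>i\<in>UNIV. c $ i) = w \<bullet> z" unfolding zc by (simp add: inner_sum_right w)
    then have sum1: "(\<Sum>i\<in>UNIV. c $ i) = 1" using z by simp
    show "z \<in> affine hull (range y)"
      unfolding affine_hull_finite[OF finite_imageI[OF finite]]
    proof (intro CollectI exI[of _ "\<lambda>v. c $ (inv y v)"] conjI)
      show "(\<Sum>v\<in>range y. c $ inv y v) = 1"
        using inj sum1 by (simp add: sum.reindex)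
      show "(\<Sum>v\<in>range y. (c $ inv y v) *\<^sub>R v) = z"
        using inj zc by (simp add: sum.reindex)
    qed
  qed
qed

text \<open>An arbitrary indexing of the \<open>CARD('n)\<close> points in \<open>T\<close> by \<open>'n\<close>; the normal vector below does not depend on it.\<close>

definition indexing :: "'i set \<Rightarrow> 'n::finite \<Rightarrow> 'i" where
  "indexing T = (SOME b. bij_betw b UNIV T)"

lemma bij_betw_indexing:
  assumes "card T = CARD('n::finite)"
  shows "bij_betw (indexing T :: 'n \<Rightarrow> 'i) UNIV T"
proof -
  have "finite T" using assms by (metis card.infinite zero_less_card_finite less_irrefl)
  then have "\<exists>b. bij_betw b (UNIV :: 'n set) T" using assms by (intro finite_same_card_bij) auto
  then show ?thesis unfolding indexing_def by (rule someI_ex)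
qed

definition normal :: "('i \<Rightarrow> real ^ 'n) \<Rightarrow> 'i set \<Rightarrow> real ^ 'n" where
  "normal x T = cramer_sol (\<chi> i. x (indexing T i)) 1"

lemma normal_nonzero:
  fixes x :: "'i \<Rightarrow> real ^ 'n"
  assumes "det ((\<chi> j. x (indexing T j)) :: real ^ 'n ^ 'n) \<noteq> 0"
  shows "normal x T \<noteq> 0"
proof
  assume "normal x T = 0"
  then have "(\<chi> j. x (indexing T j)) *v 0 = (1 :: real ^ 'n)" using cramer_sol_mult(1)[OF assms, of 1] by (simp add: normal_def)
  then show False by (simp add: vec_eq_iff)
qed

lemma AE_PiM_reindex_rows:
  fixes T I :: "'i set"
  assumes T: "T \<subseteq> I" "card T = CARD('n::finite)"
    and P: "AE y in (unif_rows :: ('n \<Rightarrow> real ^ 'n) measure). P y"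
  shows "AE x in Pi\<^sub>M I (\<lambda>_. sphere_unif :: (real ^ 'n) measure). P (\<lambda>i. x (indexing T i))"
proof -
  let ?M = "\<lambda>I. Pi\<^sub>M I (\<lambda>_. sphere_unif :: (real ^ 'n) measure)"
  let ?b = "indexing T :: 'n \<Rightarrow> 'i"
  have b: "inj ?b" "range ?b = T" using bij_betw_indexing[OF T(2)] by (auto simp: bij_betw_def)
  have d: "distr (?M I) (unif_rows :: ('n \<Rightarrow> real ^ 'n) measure) (\<lambda>\<omega>. \<lambda>n\<in>UNIV. \<omega> (?b n)) = unif_rows"
    by (rule distr_PiM_reindex[where M="\<lambda>_. sphere_unif"]) (use b T sphere_unif.prob_space_axioms in auto)
  have "AE y in distr (?M I) (unif_rows :: ('n \<Rightarrow> real ^ 'n) measure) (\<lambda>\<omega>. \<lambda>n\<in>UNIV. \<omega> (?b n)). P y"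
    unfolding d by (rule P)
  then have "AE x in ?M I. P (\<lambda>n\<in>UNIV. x (?b n))"
    by (rule AE_distrD[rotated]) (use b T in \<open>auto intro!: measurable_restrict measurable_component_singleton\<close>)
  then show ?thesis by (simp add: restrict_def)
qed

lemma nn_integral_PiM_reindex_rows:
  fixes T :: "'i set"
  assumes T: "card T = CARD('n::finite)" and f: "f \<in> borel_measurable (unif_rows :: ('n \<Rightarrow> real ^ 'n) measure)"
  shows "(\<integral>\<^sup>+x. f (\<lambda>i. x (indexing T i)) \<partial>Pi\<^sub>M T (\<lambda>_. sphere_unif :: (real ^ 'n) measure)) = (\<integral>\<^sup>+y. f y \<partial>unif_rows)"
proof -
  let ?M = "Pi\<^sub>M T (\<lambda>_. sphere_unif :: (real ^ 'n) measure)"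
  let ?b = "indexing T :: 'n \<Rightarrow> 'i"
  have b: "inj ?b" "range ?b = T" using bij_betw_indexing[OF T] by (auto simp: bij_betw_def)
  have d: "distr ?M (unif_rows :: ('n \<Rightarrow> real ^ 'n) measure) (\<lambda>\<omega>. \<lambda>n\<in>UNIV. \<omega> (?b n)) = unif_rows"
    by (rule distr_PiM_reindex[where M="\<lambda>_. sphere_unif"]) (use b sphere_unif.prob_space_axioms in auto)
  have "(\<integral>\<^sup>+y. f y \<partial>unif_rows) = (\<integral>\<^sup>+y. f y \<partial>distr ?M (unif_rows :: ('n \<Rightarrow> real ^ 'n) measure) (\<lambda>\<omega>. \<lambda>n\<in>UNIV. \<omega> (?b n)))" by (simp only: d)
  also have "\<dots> = (\<integral>\<^sup>+x. f (\<lambda>n\<in>UNIV. x (?b n)) \<partial>?M)"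
    by (rule nn_integral_distr) (use b f in \<open>auto intro!: measurable_restrict measurable_component_singleton\<close>)
  finally show ?thesis by (simp add: restrict_def)
qed

section \<open>Random normal vectors and almost sure general position\<close>

lemma measurable_PiM_component_borel:
  assumes "i \<in> I"
  shows "(\<lambda>x. x i) \<in> borel_measurable (Pi\<^sub>M I (\<lambda>_. sphere_unif :: (real ^ 'n::finite) measure))"
  using measurable_component_singleton[OF assms, of "\<lambda>_. sphere_unif :: (real ^ 'n) measure"]
  by (simp add: measurable_cong_sets[OF refl sets_sphere_unif])

lemma measurable_normal:
  fixes T I :: "'i set"
  assumes "T \<subseteq> I" "card T = CARD('n::finite)"
  shows "(\<lambda>x. normal x T) \<in> borel_measurable (Pi\<^sub>M I (\<lambda>_. sphere_unif :: (real ^ 'n) measure))"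
proof -
  have "indexing T i \<in> I" for i :: 'n using bij_betw_indexing[OF assms(2)] assms(1) by (auto simp: bij_betw_def)
  then show ?thesis unfolding normal_def
    by (intro borel_measurable_cramer_sol borel_measurable_vec_lambda measurable_PiM_component_borel) auto
qed

lemma normal_cong:
  assumes "card T = CARD('n::finite)" "\<And>i. i \<in> T \<Longrightarrow> x i = y i"
  shows "normal x T = (normal y T :: real ^ 'n)"
proof -
  have "indexing T i \<in> T" for i :: 'n using bij_betw_indexing[OF assms(1)] by (auto simp: bij_betw_def)
  then have "(\<chi> i. x (indexing T i)) = ((\<chi> i. y (indexing T i)) :: real ^ 'n ^ 'n)" using assms(2) by (simp add: vec_eq_iff)
  then show ?thesis unfolding normal_def by simp
qed

text \<open>With all points but \<open>i\<close> fixed, the normal vector is constant and almost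
  surely non-zero, and a hyperplane has probability 0 for the point \<open>i\<close>.\<close>

lemma AE_normal_off:
  fixes I :: "'i set"
  assumes n: "CARD('n::finite) \<ge> 2" and fin: "finite I" and T: "T \<subseteq> I" "card T = CARD('n)" and i: "i \<in> I - T"
  shows "AE x in Pi\<^sub>M I (\<lambda>_. sphere_unif :: (real ^ 'n) measure). x i \<bullet> normal x T \<noteq> 1"
proof -
  let ?M = "\<lambda>I. Pi\<^sub>M I (\<lambda>_. sphere_unif :: (real ^ 'n) measure)"
  let ?J = "I - {i}"
  have I: "I = insert i ?J" using i by auto
  have TJ: "T \<subseteq> ?J" using T i by auto
  define f where "f x = (indicator {1} (x i \<bullet> normal x T) :: ennreal)" for x :: "'i \<Rightarrow> real ^ 'n"
  have fm: "f \<in> borel_measurable (?M I)"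
    unfolding f_def
    by (rule measurable_compose[OF _ borel_measurable_indicator])
       (use i in \<open>auto intro!: borel_measurable_inner measurable_PiM_component_borel measurable_normal T\<close>)
  have "(\<integral>\<^sup>+x. f x \<partial>?M I) = (\<integral>\<^sup>+x. (\<integral>\<^sup>+y. f (x(i := y)) \<partial>sphere_unif) \<partial>?M ?J)"
    using unif_prod.product_nn_integral_insert[of ?J i f] fin fm I by auto
  also have "\<dots> = (\<integral>\<^sup>+x. 0 \<partial>?M ?J)"
  proof (rule nn_integral_cong_AE)
    have "AE x in ?M ?J. det (\<chi> j. x (indexing T j)) \<noteq> 0"
      by (rule AE_PiM_reindex_rows[OF TJ T(2) AE_det_unif_rows[OF n]])
    then show "AE x in ?M ?J. (\<integral>\<^sup>+y. f (x(i := y)) \<partial>sphere_unif) = 0"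
    proof eventually_elim
      case (elim x)
      then have w: "normal x T \<noteq> 0" by (rule normal_nonzero)
      have "normal (x(i := y)) T = normal x T" for y
        by (rule normal_cong[OF T(2)]) (use i in auto)
      then have "(\<integral>\<^sup>+y. f (x(i := y)) \<partial>sphere_unif) = (\<integral>\<^sup>+y. indicator {1} (y \<bullet> normal x T) \<partial>sphere_unif)"
        by (simp add: f_def)
      also have "\<dots> = (\<integral>\<^sup>+y. 0 \<partial>(sphere_unif :: (real ^ 'n) measure))"
        using AE_sphere_unif_inner_neq[OF n w, of 1] by (intro nn_integral_cong_AE) (auto elim!: eventually_mono)
      finally show ?case by simp
    qed
  qed
  finally have "AE x in ?M I. f x = 0" using fm by (simp add: nn_integral_0_iff_AE)
  then show ?thesis by eventually_elim (auto simp: f_def indicator_def)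
qed

text \<open>There are finitely many index sets \<open>T\<close>, so the exceptional null sets can be
  united; for a single \<open>T\<close>, a non-zero determinant and unit vectors give all properties
  of its normal vector except \<open>off\<close>.\<close>

lemma AE_general_position:
  fixes I :: "'i set"
  assumes n: "CARD('n::finite) \<ge> 2" and fin: "finite I" and card: "card I \<ge> CARD('n) + 1"
  shows "AE x in Pi\<^sub>M I (\<lambda>_. sphere_unif :: (real ^ 'n) measure). general_position x I (normal x) CARD('n)"
proof -
  let ?M = "Pi\<^sub>M I (\<lambda>_. sphere_unif :: (real ^ 'n) measure)"
  let ?S = "{T. T \<subseteq> I \<and> card T = CARD('n)}"
  have finS: "finite ?S" using fin by simp
  have norm: "AE x in ?M. \<forall>i\<in>I. norm (x i) = 1"
    by (intro AE_finite_allI[OF fin] AE_PiM_component sphere_unif.prob_space_axioms AE_sphere_unif_norm)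
  have det: "AE x in ?M. \<forall>T\<in>?S. det (\<chi> j. x (indexing T j)) \<noteq> 0"
    by (intro AE_finite_allI[OF finS] AE_PiM_reindex_rows[OF _ _ AE_det_unif_rows[OF n]]) auto
  have off: "AE x in ?M. \<forall>T\<in>?S. \<forall>i\<in>I - T. x i \<bullet> normal x T \<noteq> 1"
    by (intro AE_finite_allI[OF finS] AE_finite_allI AE_normal_off n fin) (use fin in auto)
  show ?thesis using norm det off
  proof eventually_elim
    case (elim x)
    show ?case
    proof
      fix T assume T: "T \<subseteq> I" "card T = CARD('n)"
      have b: "bij_betw (indexing T :: 'n \<Rightarrow> 'i) UNIV T" by (rule bij_betw_indexing[OF T(2)])
      then have bT: "range (indexing T :: 'n \<Rightarrow> 'i) = T" by (simp add: bij_betw_def)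
      have d: "det (\<chi> j. x (indexing T j)) \<noteq> 0" using elim(2) T by blast
      have nj: "norm (x (indexing T j)) = 1" for j :: 'n using elim(1) bT T by blast
      show "norm (normal x T) > 1" unfolding normal_def by (rule cramer_sol_norm(1)[OF n d nj])
      have "range (\<lambda>j :: 'n. x (indexing T j)) = x ` T" using arg_cong[OF bT, of "image x"] by (simp only: image_image)
      then show "affine hull (x ` T) = {y. normal x T \<bullet> y = 1}"
        using affine_hull_rows[OF d] by (simp add: normal_def)
      fix i
      show "x i \<bullet> normal x T = 1" if "i \<in> T"
      proof -
        have "i \<in> range (indexing T :: 'n \<Rightarrow> 'i)" using that unfolding bT .
        then obtain j :: 'n where "i = indexing T j" by (rule rangeE)
        then show ?thesis unfolding normal_def using cramer_sol_norm(2)[OF n d nj] by simp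
      qed
      show "x i \<bullet> normal x T \<noteq> 1" if "i \<in> I - T" using elim(3) T that by blast
    qed (use n fin card elim(1) in auto)
  qed
qed

lemma measurable_one_sided:
  fixes T I :: "'i set" and A :: "real \<Rightarrow> real"
  assumes T: "T \<subseteq> I" "card T = CARD('n::finite)"
    and A [measurable]: "A \<in> borel_measurable borel" and S [measurable]: "S \<in> sets borel"
  shows "(\<lambda>x. ennreal (A (1 / norm (normal x T))) * (\<Prod>i\<in>I - T. indicator S (x i \<bullet> normal x T)))
    \<in> borel_measurable (Pi\<^sub>M I (\<lambda>_. sphere_unif :: (real ^ 'n) measure))" (is "_ \<in> borel_measurable ?M")
proof (rule borel_measurable_times_ennreal)
  show "(\<lambda>x. ennreal (A (1 / norm (normal x T)))) \<in> borel_measurable ?M"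
    using measurable_compose[OF measurable_normal[OF T], of "\<lambda>w. ennreal (A (1 / norm w))" borel] by measurable
  show "(\<lambda>x. \<Prod>i\<in>I - T. indicator S (x i \<bullet> normal x T) :: ennreal) \<in> borel_measurable ?M"
  proof (rule borel_measurable_prod_ennreal)
    fix i assume "i \<in> I - T"
    then have "(\<lambda>x. x i \<bullet> normal x T) \<in> borel_measurable ?M"
      by (intro borel_measurable_inner measurable_PiM_component_borel measurable_normal T) auto
    from measurable_compose[OF this borel_measurable_indicator[OF S]]
    show "(\<lambda>x. indicator S (x i \<bullet> normal x T) :: ennreal) \<in> borel_measurable ?M" .
  qed
qed

text \<open>Given the points of \<open>T\<close>, the normal vector is fixed and the other points
  are independent, so the product of indicators integrates to a power of the one-point probability
  \<open>f\<close>.\<close>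

lemma nn_integral_one_sided:
  fixes T I :: "'i set" and A f :: "real \<Rightarrow> real"
  assumes n: "CARD('n::finite) \<ge> 2" and fin: "finite I" and T: "T \<subseteq> I" "card T = CARD('n)"
    and A [measurable]: "A \<in> borel_measurable borel" and S [measurable]: "S \<in> sets borel"
    and f: "\<And>w :: real ^ 'n. w \<noteq> 0 \<Longrightarrow> emeasure sphere_unif {y. y \<bullet> w \<in> S} = ennreal (f (1 / norm w))"
    and fm [measurable]: "f \<in> borel_measurable borel"
  shows "(\<integral>\<^sup>+x. ennreal (A (1 / norm (normal x T))) * (\<Prod>i\<in>I - T. indicator S (x i \<bullet> normal x T)) \<partial>Pi\<^sub>M I (\<lambda>_. sphere_unif :: (real ^ 'n) measure))
    = (\<integral>\<^sup>+y. ennreal (A (1 / norm (cramer_sol (\<chi> i. y i) 1))) * ennreal (f (1 / norm (cramer_sol (\<chi> i. y i) 1))) ^ card (I - T) \<partial>(unif_rows :: ('n \<Rightarrow> real ^ 'n) measure))"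
proof -
  let ?M = "\<lambda>I. Pi\<^sub>M I (\<lambda>_. sphere_unif :: (real ^ 'n) measure)"
  let ?J = "I - T"
  have I: "T \<union> ?J = I" "T \<inter> ?J = {}" using T by auto
  have finT: "finite T" "finite ?J" using fin T finite_subset by auto
  define F where "F x = ennreal (A (1 / norm (normal x T))) * (\<Prod>i\<in>?J. indicator S (x i \<bullet> normal x T))" for x :: "'i \<Rightarrow> real ^ 'n"
  have Fm: "F \<in> borel_measurable (?M I)"
    unfolding F_def by (rule measurable_one_sided[OF T A S])
  have "(\<integral>\<^sup>+x. F x \<partial>?M I) = (\<integral>\<^sup>+x. (\<integral>\<^sup>+y. F (merge T ?J (x, y)) \<partial>?M ?J) \<partial>?M T)"
    using unif_prod.product_nn_integral_fold[OF I(2) finT, of F] Fm I(1) by simp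
  also have "\<dots> = (\<integral>\<^sup>+x. ennreal (A (1 / norm (normal x T))) * ennreal (f (1 / norm (normal x T))) ^ card ?J \<partial>?M T)"
  proof (rule nn_integral_cong_AE)
    have "AE x in ?M T. det (\<chi> j. x (indexing T j)) \<noteq> 0"
      by (rule AE_PiM_reindex_rows[OF order_refl T(2) AE_det_unif_rows[OF n]])
    then show "AE x in ?M T. (\<integral>\<^sup>+y. F (merge T ?J (x, y)) \<partial>?M ?J) = ennreal (A (1 / norm (normal x T))) * ennreal (f (1 / norm (normal x T))) ^ card ?J"
    proof eventually_elim
      case (elim x)
      then have w: "normal x T \<noteq> 0" by (rule normal_nonzero)
      have im: "(\<lambda>z. indicator S (z \<bullet> normal x T) :: ennreal) \<in> borel_measurable sphere_unif"
      proof -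
        have "(\<lambda>z. z \<bullet> normal x T) \<in> borel_measurable borel" by simp
        from measurable_compose[OF this borel_measurable_indicator[OF S]]
        show ?thesis by (simp add: measurable_cong_sets[OF sets_sphere_unif refl])
      qed
      have "normal (merge T ?J (x, y)) T = normal x T" for y
        by (rule normal_cong[OF T(2)]) (simp add: merge_def)
      then have "F (merge T ?J (x, y)) = ennreal (A (1 / norm (normal x T))) * (\<Prod>i\<in>?J. indicator S (y i \<bullet> normal x T))" for y
        unfolding F_def by (intro arg_cong2[where f="(*)"] prod.cong) (auto simp: merge_def)
      then have "(\<integral>\<^sup>+y. F (merge T ?J (x, y)) \<partial>?M ?J) = (\<integral>\<^sup>+y. ennreal (A (1 / norm (normal x T))) * (\<Prod>i\<in>?J. indicator S (y i \<bullet> normal x T)) \<partial>?M ?J)"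
        by simp
      also have "\<dots> = ennreal (A (1 / norm (normal x T))) * (\<integral>\<^sup>+y. (\<Prod>i\<in>?J. indicator S (y i \<bullet> normal x T)) \<partial>?M ?J)"
      proof (rule nn_integral_cmult, rule borel_measurable_prod_ennreal)
        fix i assume i: "i \<in> ?J"
        show "(\<lambda>y. indicator S (y i \<bullet> normal x T) :: ennreal) \<in> borel_measurable (?M ?J)"
          by (rule measurable_compose[OF measurable_component_singleton[OF i] im])
      qed
      also have "(\<integral>\<^sup>+y. (\<Prod>i\<in>?J. indicator S (y i \<bullet> normal x T)) \<partial>?M ?J) = (\<Prod>i\<in>?J. \<integral>\<^sup>+z. indicator S (z \<bullet> normal x T) \<partial>sphere_unif)"
        by (rule unif_prod.product_nn_integral_prod[OF finT(2)]) (rule im)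
      also have "(\<integral>\<^sup>+z. indicator S (z \<bullet> normal x T) \<partial>sphere_unif) = emeasure sphere_unif {y. y \<bullet> normal x T \<in> S}"
      proof (rule nn_integral_sphere_unif_indicator)
        have "(\<lambda>z. z \<bullet> normal x T) -` S \<inter> space borel \<in> sets borel" by (rule measurable_sets[OF _ S]) simp
        then show "{z. z \<bullet> normal x T \<in> S} \<in> sets borel" by (simp add: vimage_def)
      qed
      also have "\<dots> = ennreal (f (1 / norm (normal x T)))" by (rule f[OF w])
      finally show ?case by simp
    qed
  qed
  also have "\<dots> = (\<integral>\<^sup>+y. ennreal (A (1 / norm (cramer_sol (\<chi> i. y i) 1))) * ennreal (f (1 / norm (cramer_sol (\<chi> i. y i) 1))) ^ card ?J \<partial>(unif_rows :: ('n \<Rightarrow> real ^ 'n) measure))"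
    unfolding normal_def
    by (rule nn_integral_PiM_reindex_rows[OF T(2), where f="\<lambda>y :: 'n \<Rightarrow> real ^ 'n. ennreal (A (1 / norm (cramer_sol (\<chi> i. y i) 1))) * ennreal (f (1 / norm (cramer_sol (\<chi> i. y i) 1))) ^ card ?J"])
       measurable
  finally show ?thesis by (simp add: F_def)
qed

section \<open>Expected contribution of one simplex\<close>

lemma measurable_sphere_cdf [measurable]: "sphere_cdf (k :: 'n::finite) \<in> borel_measurable borel"
proof (rule borel_measurable_mono, rule monoI)
  fix s t :: real assume "s \<le> t"
  moreover have "{x :: real ^ 'n. x $ k \<le> t} \<in> sets sphere_unif" by simp
  ultimately show "sphere_cdf k s \<le> sphere_cdf k t"
    unfolding sphere_cdf_def by (intro sphere_unif.finite_measure_mono) auto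
qed

lemma sphere_cdf_bounds: "0 \<le> sphere_cdf k t" "sphere_cdf k t \<le> 1"
  unfolding sphere_cdf_def by (auto intro: measure_nonneg sphere_unif.prob_le_1)

text \<open>Products of indicators stand for the conditions \<open>below\<close> and
  \<open>above\<close>, so that they factor over the points outside \<open>T\<close>.\<close>

definition hole_term :: "real \<Rightarrow> ('i \<Rightarrow> real ^ 'n) \<Rightarrow> 'i set \<Rightarrow> 'i set \<Rightarrow> ennreal" where
  "hole_term p x I T =
    ennreal ((2 * (1 - 1 / norm (normal x T))) powr (p / 2)) * (\<Prod>i\<in>I - T. indicator {..<1} (x i \<bullet> normal x T)) +
    ennreal ((2 * (1 + 1 / norm (normal x T))) powr (p / 2)) * (\<Prod>i\<in>I - T. indicator {1<..} (x i \<bullet> normal x T))"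

lemma prod_indicator_eq_1_or_0:
  "finite J \<Longrightarrow> (\<Prod>i\<in>J. indicator S (g i)) = (if \<forall>i\<in>J. g i \<in> S then 1 else 0 :: ennreal)"
  by (induction J rule: finite_induct) (auto simp: indicator_def)

lemma AE_hole_power_sum:
  fixes I :: "'i set"
  assumes n: "CARD('n::finite) \<ge> 2" and fin: "finite I" and card: "card I \<ge> CARD('n) + 1"
  shows "AE x in Pi\<^sub>M I (\<lambda>_. sphere_unif :: (real ^ 'n) measure).
    ennreal (hole_power_sum p (x ` I)) = (\<Sum>T | T \<subseteq> I \<and> card T = CARD('n). hole_term p x I T)"
  using AE_general_position[OF n fin card]
proof eventually_elim
  case (elim x)
  define m where "m = CARD('n)"
  interpret general_position x I "normal x" m using elim by (simp only: m_def)
  have eq: "hole_term p x I T = ennreal ((if below T then (2 * (1 - 1 / norm (normal x T))) powr (p / 2) else 0) +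
     (if above T then (2 * (1 + 1 / norm (normal x T))) powr (p / 2) else 0))" for T
    using fin by (simp add: hole_term_def prod_indicator_eq_1_or_0 below_def above_def)
  have "ennreal (hole_power_sum p (x ` I)) = (\<Sum>T\<in>simplices. hole_term p x I T)"
    unfolding hole_power_sum_eq eq by (rule sum_ennreal[symmetric]) auto
  then show ?case by (simp only: m_def)
qed

lemma measurable_hole_term:
  fixes T I :: "'i set"
  assumes T: "T \<subseteq> I" "card T = CARD('n::finite)"
  shows "(\<lambda>x. hole_term p x I T) \<in> borel_measurable (Pi\<^sub>M I (\<lambda>_. sphere_unif :: (real ^ 'n) measure))"
  unfolding hole_term_def
  by (intro borel_measurable_add measurable_one_sided[OF T, where A="\<lambda>h. (2 * (1 - h)) powr (p / 2)"]
      measurable_one_sided[OF T, where A="\<lambda>h. (2 * (1 + h)) powr (p / 2)"]) measurable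

text \<open>The reflection of \<open>h\<close> exchanges the weights
  \<open>(2 * (1 \<plusminus> h)) powr (p / 2)\<close> and, by \<open>sphere_cdf_minus\<close>, the
  probabilities of the two sides. So the second term over \<open>{0<..<1}\<close> is the first one
  over negative \<open>h\<close>, and a single integral over \<open>{-1<..<1}\<close>
  remains.\<close>

lemma nn_integral_hole_term:
  fixes T I :: "'i set" and k :: "'n::finite"
  assumes n: "CARD('n) = d + 1" and d: "d \<ge> 1" and fin: "finite I" and T: "T \<subseteq> I" "card T = CARD('n)"
  shows "(\<integral>\<^sup>+x. hole_term p x I T \<partial>Pi\<^sub>M I (\<lambda>_. sphere_unif :: (real ^ 'n) measure)) =
    ennreal (2 * real (d\<^sup>2) * kappa (d\<^sup>2)) * (\<integral>\<^sup>+h. ennreal (indicator {-1<..<1} h *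
      ((2 * (1 - h)) powr (p / 2) * sphere_cdf k h ^ (card I - (d + 1)) * (1 - h\<^sup>2) powr ((real d ^ 2 - 2) / 2))) \<partial>lborel)"
proof -
  let ?M = "Pi\<^sub>M I (\<lambda>_. sphere_unif :: (real ^ 'n) measure)"
  let ?U = "unif_rows :: ('n \<Rightarrow> real ^ 'n) measure"
  let ?\<Phi> = "sphere_cdf k" and ?j = "card I - (d + 1)"
  let ?h = "\<lambda>y :: 'n \<Rightarrow> real ^ 'n. 1 / norm (cramer_sol (\<chi> i. y i) 1)"
  have n2: "CARD('n) \<ge> 2" using n d by simp
  have j: "card (I - T) = ?j" using T fin n by (simp add: card_Diff_subset finite_subset)
  define A B where "A h = (2 * (1 - h)) powr (p / 2)" and "B h = (2 * (1 + h)) powr (p / 2)" for h :: real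
  have [measurable]: "A \<in> borel_measurable borel" "B \<in> borel_measurable borel"
    unfolding A_def[abs_def] B_def[abs_def] by measurable
  have AB: "A h \<ge> 0" "B h \<ge> 0" "B h = A (- h)" for h by (simp_all add: A_def B_def)
  define \<Psi> where "\<Psi> h = A h * ?\<Phi> h ^ ?j + B h * (1 - ?\<Phi> h) ^ ?j" for h
  have below: "emeasure sphere_unif {y. y \<bullet> w \<in> {..<1}} = ennreal (?\<Phi> (1 / norm w))" if "w \<noteq> 0" for w :: "real ^ 'n"
    using emeasure_sphere_unif_halfspace(1)[OF n2 that, of k] by simp
  have above: "emeasure sphere_unif {y. y \<bullet> w \<in> {1<..}} = ennreal (1 - ?\<Phi> (1 / norm w))" if "w \<noteq> 0" for w :: "real ^ 'n"
    using emeasure_sphere_unif_halfspace(2)[OF n2 that, of k] by simp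
  have hm: "?h \<in> borel_measurable ?U" by measurable
  have "(\<integral>\<^sup>+x. hole_term p x I T \<partial>?M)
    = (\<integral>\<^sup>+x. ennreal (A (1 / norm (normal x T))) * (\<Prod>i\<in>I - T. indicator {..<1} (x i \<bullet> normal x T)) \<partial>?M)
    + (\<integral>\<^sup>+x. ennreal (B (1 / norm (normal x T))) * (\<Prod>i\<in>I - T. indicator {1<..} (x i \<bullet> normal x T)) \<partial>?M)"
    unfolding hole_term_def A_def[symmetric] B_def[symmetric]
    by (rule nn_integral_add) (rule measurable_one_sided[OF T]; measurable)+
  also have "(\<integral>\<^sup>+x. ennreal (A (1 / norm (normal x T))) * (\<Prod>i\<in>I - T. indicator {..<1} (x i \<bullet> normal x T)) \<partial>?M)
      = (\<integral>\<^sup>+y. ennreal (A (?h y)) * ennreal (?\<Phi> (?h y)) ^ card (I - T) \<partial>?U)"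
    by (rule nn_integral_one_sided[OF n2 fin T _ _ below]) measurable
  also have "(\<integral>\<^sup>+x. ennreal (B (1 / norm (normal x T))) * (\<Prod>i\<in>I - T. indicator {1<..} (x i \<bullet> normal x T)) \<partial>?M)
      = (\<integral>\<^sup>+y. ennreal (B (?h y)) * ennreal (1 - ?\<Phi> (?h y)) ^ card (I - T) \<partial>?U)"
    by (rule nn_integral_one_sided[where f="\<lambda>h. 1 - ?\<Phi> h", OF n2 fin T _ _ above]) measurable
  also have "(\<integral>\<^sup>+y. ennreal (A (?h y)) * ennreal (?\<Phi> (?h y)) ^ card (I - T) \<partial>?U)
      + (\<integral>\<^sup>+y. ennreal (B (?h y)) * ennreal (1 - ?\<Phi> (?h y)) ^ card (I - T) \<partial>?U)
      = (\<integral>\<^sup>+y. ennreal (A (?h y)) * ennreal (?\<Phi> (?h y)) ^ card (I - T)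
          + ennreal (B (?h y)) * ennreal (1 - ?\<Phi> (?h y)) ^ card (I - T) \<partial>?U)"
  proof (rule nn_integral_add[symmetric])
    show "(\<lambda>y. ennreal (A (?h y)) * ennreal (?\<Phi> (?h y)) ^ card (I - T)) \<in> borel_measurable ?U"
      by (rule measurable_compose[OF hm]) measurable
    show "(\<lambda>y. ennreal (B (?h y)) * ennreal (1 - ?\<Phi> (?h y)) ^ card (I - T)) \<in> borel_measurable ?U"
      by (rule measurable_compose[OF hm, where g="\<lambda>h. ennreal (B h) * ennreal (1 - ?\<Phi> h) ^ card (I - T)"]) measurable
  qed
  also have "\<dots> = (\<integral>\<^sup>+y. ennreal (\<Psi> (?h y)) \<partial>?U)"
  proof (rule nn_integral_cong)
    fix y
    show "ennreal (A (?h y)) * ennreal (?\<Phi> (?h y)) ^ card (I - T) + ennreal (B (?h y)) * ennreal (1 - ?\<Phi> (?h y)) ^ card (I - T)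
      = ennreal (\<Psi> (?h y))"
      using AB sphere_cdf_bounds[of k "?h y"] unfolding \<Psi>_def j
      by (simp add: ennreal_power ennreal_mult ennreal_plus)
  qed
  also have "\<dots> = ennreal (2 * real (d\<^sup>2) * kappa (d\<^sup>2)) *
      (\<integral>\<^sup>+h. ennreal (indicator {0<..<1} h * (\<Psi> h * (1 - h\<^sup>2) powr ((real d ^ 2 - 2) / 2))) \<partial>lborel)"
  proof (rule hyperplane_distance_distribution[OF n d])
    obtain c where der: "\<And>t. \<bar>t\<bar> < 1 \<Longrightarrow> (?\<Phi> has_real_derivative c * (1 - t\<^sup>2) powr ((real CARD('n) - 3) / 2)) (at t)"
      using sphere_cdf_has_derivative_ex[OF n2, of k] by blast
    have "continuous_on {0<..<1} ?\<Phi>"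
      using der by (intro continuous_at_imp_continuous_on) (force intro: DERIV_isCont)
    then show "continuous_on {0<..<1} \<Psi>"
      unfolding \<Psi>_def A_def B_def by (intro continuous_intros) auto
    show "\<Psi> h \<ge> 0" for h
      using AB sphere_cdf_bounds[of k h] unfolding \<Psi>_def by simp
  qed
  also have "(\<integral>\<^sup>+h. ennreal (indicator {0<..<1} h * (\<Psi> h * (1 - h\<^sup>2) powr ((real d ^ 2 - 2) / 2))) \<partial>lborel) =
      (\<integral>\<^sup>+h. ennreal (indicator {-1<..<1} h * (A h * ?\<Phi> h ^ ?j * (1 - h\<^sup>2) powr ((real d ^ 2 - 2) / 2))) \<partial>lborel)"
  proof -
    define F where "F h = ennreal (A h * ?\<Phi> h ^ ?j * (1 - h\<^sup>2) powr ((real d ^ 2 - 2) / 2))" for h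
    have Fm: "F \<in> borel_measurable borel" unfolding F_def[abs_def] by measurable
    have "ennreal (indicator {0<..<1} h * (\<Psi> h * (1 - h\<^sup>2) powr ((real d ^ 2 - 2) / 2))) = indicator {0<..<1} h * (F h + F (- h))" for h
      using AB sphere_cdf_bounds[of k h]
      by (auto simp: F_def \<Psi>_def indicator_def sphere_cdf_minus[OF n2] distrib_right ennreal_plus[symmetric] simp del: ennreal_plus)
    then have "(\<integral>\<^sup>+h. ennreal (indicator {0<..<1} h * (\<Psi> h * (1 - h\<^sup>2) powr ((real d ^ 2 - 2) / 2))) \<partial>lborel)
        = (\<integral>\<^sup>+h. indicator {-1<..<1} h * F h \<partial>lborel)" by (simp only: nn_integral_fold_symmetric[OF Fm])
    also have "\<dots> = (\<integral>\<^sup>+h. ennreal (indicator {-1<..<1} h * (A h * ?\<Phi> h ^ ?j * (1 - h\<^sup>2) powr ((real d ^ 2 - 2) / 2))) \<partial>lborel)"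
      by (rule nn_integral_cong) (simp add: F_def indicator_def)
    finally show ?thesis .
  qed
  finally show ?thesis by (simp only: A_def)
qed

text \<open>Independence makes the joint law a product of the individual laws; reading these on
  \<open>borel\<close> instead of the sphere replaces each by \<open>sphere_unif\<close>.\<close>

lemma distr_indep_sphere:
  fixes X :: "nat \<Rightarrow> 'w \<Rightarrow> real ^ 'n::finite"
  assumes "prob_space M" and ind: "prob_space.indep_vars M (\<lambda>_. sphere_measure) X I" and "I \<noteq> {}"
    and X: "\<And>i. i \<in> I \<Longrightarrow> distr M sphere_measure (X i) = sphere_measure"
  shows "distr M (Pi\<^sub>M I (\<lambda>_. sphere_unif)) (\<lambda>w. \<lambda>i\<in>I. X i w) = Pi\<^sub>M I (\<lambda>_. sphere_unif)"
    and "(\<lambda>w. \<lambda>i\<in>I. X i w) \<in> M \<rightarrow>\<^sub>M Pi\<^sub>M I (\<lambda>_. sphere_unif)"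
proof -
  interpret prob_space M by fact
  have id: "(\<lambda>x. x) \<in> (sphere_measure :: (real ^ 'n) measure) \<rightarrow>\<^sub>M borel"
    by (simp add: measurable_cong_sets[OF sets_sphere_measure refl] measurable_restrict_space1)
  have rs: "X i \<in> M \<rightarrow>\<^sub>M sphere_measure" if "i \<in> I" for i using ind that by (simp add: indep_vars_def)
  have rb: "X i \<in> M \<rightarrow>\<^sub>M borel" if "i \<in> I" for i using measurable_compose[OF rs[OF that] id] .
  have "indep_vars (\<lambda>_. borel) X I"
    using indep_vars_compose2[OF ind, of "\<lambda>_ x. x" "\<lambda>_. borel"] id by simp
  then have "distr M (Pi\<^sub>M I (\<lambda>_. borel)) (\<lambda>w. \<lambda>i\<in>I. X i w) = (\<Pi>\<^sub>M i\<in>I. distr M borel (X i))"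
    using indep_vars_iff_distr_eq_PiM'[OF \<open>I \<noteq> {}\<close> rb] by simp
  also have "\<dots> = Pi\<^sub>M I (\<lambda>_. sphere_unif)"
  proof (rule PiM_cong[OF refl])
    fix i assume i: "i \<in> I"
    have "distr M borel (X i) = distr (distr M sphere_measure (X i)) borel (\<lambda>x. x)"
      by (subst distr_distr[OF id rs[OF i]]) (simp add: comp_def)
    then show "distr M borel (X i) = sphere_unif" by (simp add: X[OF i] distr_sphere_measure)
  qed
  also have "distr M (Pi\<^sub>M I (\<lambda>_. borel)) (\<lambda>w. \<lambda>i\<in>I. X i w) = distr M (Pi\<^sub>M I (\<lambda>_. sphere_unif)) (\<lambda>w. \<lambda>i\<in>I. X i w)"
    by (rule distr_cong[OF refl _ refl]) (rule sets_PiM_cong[OF refl], simp)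
  finally show "distr M (Pi\<^sub>M I (\<lambda>_. sphere_unif)) (\<lambda>w. \<lambda>i\<in>I. X i w) = Pi\<^sub>M I (\<lambda>_. sphere_unif)" .
  show "(\<lambda>w. \<lambda>i\<in>I. X i w) \<in> M \<rightarrow>\<^sub>M Pi\<^sub>M I (\<lambda>_. sphere_unif)"
    by (rule measurable_restrict) (simp add: measurable_cong_sets[OF refl sets_sphere_unif] rb)
qed

text \<open>\<open>\<epsilon>\<close> and \<open>\<delta>\<close> are chosen before \<open>M\<close>
  and \<open>X\<close>, which expresses that the error terms depend on \<open>d\<close> and
  \<open>p\<close> only. The equations between extended non-negative values include the finiteness
  of the expectation. For \<open>d = 1\<close>, \<open>Gamma (N + 1) / Gamma (N + p)\<close> is
  \<open>N powr (1 - p)\<close> times \<open>1 + p * (1 - p) / (2 * N)\<close> up to higher order,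
  so \<open>\<delta>\<close> has the order \<open>1 / N\<close> for \<open>p\<close> other than 0
  and 1, and the rate \<open>N powr (- 2)\<close> is claimed for it only in these two cases.\<close>

theorem theorem2p2:
  fixes d :: nat and p :: real
  assumes "d \<ge> 1" and "CARD('n::finite) = d + 1" and "p \<ge> 0"
  shows
    "\<exists>\<epsilon> \<delta> :: nat \<Rightarrow> real.
       \<epsilon> \<in> O(\<lambda>N. real N powr (- 2 / real d)) \<and>
       \<delta> \<in> O(\<lambda>N. if d = 1 \<and> p \<notin> {0, 1} then 1 / real N else real N powr (- 2 / real d)) \<and>
       (\<forall>N \<ge> d + 2. \<forall>(M :: 'w measure) (X :: nat \<Rightarrow> 'w \<Rightarrow> real ^ 'n).
          prob_space M \<and>
          prob_space.indep_vars M (\<lambda>_. sphere_measure) X {1..N} \<and>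
          (\<forall>i\<in>{1..N}. distr M sphere_measure (X i) = sphere_measure) \<longrightarrow>
          (\<integral>\<^sup>+w. ennreal (hole_power_sum p ((\<lambda>i. X i w) ` {1..N})) \<partial>M)
            = ennreal (B_hull d * kappa d powr (- p / real d)
              * (Gamma (real d + p / real d) * Gamma (real N + 1)
                  / (Gamma (real d) * Gamma (real N + p / real d))) * (1 + \<epsilon> N)) \<and>
          (\<integral>\<^sup>+w. ennreal (hole_power_sum p ((\<lambda>i. X i w) ` {1..N})) \<partial>M)
            = ennreal (c_hole d p * real N powr (1 - p / real d) * (1 + \<delta> N)))"
proof -
  have n: "CARD('n) \<ge> 2" using assms by simp
  obtain k :: 'n where "k = k" by blast
  have "(real CARD('n) - 3) / 2 = (real d - 2) / 2" using assms by simp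
  then obtain c where c: "c > 0" and der: "\<And>t. \<bar>t\<bar> < 1 \<Longrightarrow> (sphere_cdf k has_real_derivative c * (1 - t\<^sup>2) powr ((real d - 2) / 2)) (at t)"
    using sphere_cdf_has_derivative_ex[OF n, of k] by metis
  interpret cap_function d "sphere_cdf k" c
    using assms c der sphere_cdf_at_left[OF n, of k] by unfold_locales
  have expectation: "(\<integral>\<^sup>+w. ennreal (hole_power_sum p ((\<lambda>i. X i w) ` {1..N})) \<partial>M)
      = ennreal (real (N choose (d + 1)) * (2 * real (d\<^sup>2) * kappa (d\<^sup>2)) * hull_integral p N)"
    if N: "N \<ge> d + 2" and M: "prob_space M" "prob_space.indep_vars M (\<lambda>_. sphere_measure) X {1..N}"
      "\<And>i. i \<in> {1..N} \<Longrightarrow> distr M sphere_measure (X i) = sphere_measure"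
      and J: "(\<integral>\<^sup>+h. ennreal (indicator {-1<..<1} h * ((2 * (1 - h)) powr (p / 2) * sphere_cdf k h ^ (N - (d + 1)) * (1 - h\<^sup>2) powr ((real d ^ 2 - 2) / 2))) \<partial>lborel) = ennreal (hull_integral p N)"
      "hull_integral p N \<ge> 0"
    for N and M :: "'w measure" and X :: "nat \<Rightarrow> 'w \<Rightarrow> real ^ 'n"
  proof -
    let ?I = "{1..N}" and ?S = "{T. T \<subseteq> {1..N} \<and> card T = CARD('n)}"
    let ?P = "Pi\<^sub>M ?I (\<lambda>_. sphere_unif :: (real ^ 'n) measure)"
    let ?X = "\<lambda>w. \<lambda>i\<in>?I. X i w"
    let ?K = "2 * real (d\<^sup>2) * kappa (d\<^sup>2)"
    have ne: "?I \<noteq> {}" using N by simp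
    have distr: "distr M ?P ?X = ?P" "?X \<in> M \<rightarrow>\<^sub>M ?P"
      using distr_indep_sphere[OF M(1,2) ne M(3)] by blast+
    have meas: "(\<lambda>x. \<Sum>T\<in>?S. hole_term p x ?I T) \<in> borel_measurable ?P"
      by (intro borel_measurable_sum measurable_hole_term) auto
    have "AE x in distr M ?P ?X. ennreal (hole_power_sum p (x ` ?I)) = (\<Sum>T\<in>?S. hole_term p x ?I T)"
      unfolding distr(1) by (rule AE_hole_power_sum[OF n]) (use N assms in auto)
    then have "AE w in M. ennreal (hole_power_sum p (?X w ` ?I)) = (\<Sum>T\<in>?S. hole_term p (?X w) ?I T)"
      by (rule AE_distrD[OF distr(2)])
    moreover have "?X w ` ?I = (\<lambda>i. X i w) ` ?I" for w by (rule image_cong) auto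
    ultimately have "AE w in M. ennreal (hole_power_sum p ((\<lambda>i. X i w) ` ?I)) = (\<Sum>T\<in>?S. hole_term p (?X w) ?I T)"
      by simp
    \<comment> \<open>The integrand agrees almost surely with a finite sum of measurable terms, and
      this sum is what is transported to the product measure.\<close>
    then have "(\<integral>\<^sup>+w. ennreal (hole_power_sum p ((\<lambda>i. X i w) ` ?I)) \<partial>M) = (\<integral>\<^sup>+w. (\<Sum>T\<in>?S. hole_term p (?X w) ?I T) \<partial>M)"
      by (rule nn_integral_cong_AE)
    also have "\<dots> = (\<integral>\<^sup>+x. (\<Sum>T\<in>?S. hole_term p x ?I T) \<partial>distr M ?P ?X)"
      by (rule nn_integral_distr[symmetric, OF distr(2)]) (use meas in simp)
    also have "\<dots> = (\<integral>\<^sup>+x. (\<Sum>T\<in>?S. hole_term p x ?I T) \<partial>?P)" unfolding distr(1) ..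
    also have "\<dots> = (\<Sum>T\<in>?S. \<integral>\<^sup>+x. hole_term p x ?I T \<partial>?P)"
      by (rule nn_integral_sum) (auto intro: measurable_hole_term)
    also have "\<dots> = (\<Sum>T\<in>?S. ennreal ?K * ennreal (hull_integral p N))"
      using nn_integral_hole_term[OF assms(2,1), of ?I _ p k] J(1) by (intro sum.cong) auto
    also have "\<dots> = of_nat (card ?S) * (ennreal ?K * ennreal (hull_integral p N))" by simp
    also have "card ?S = N choose (d + 1)" using n_subsets[of ?I "CARD('n)"] assms(2) by simp
    also have "of_nat (N choose (d + 1)) * (ennreal ?K * ennreal (hull_integral p N))
        = ennreal (real (N choose (d + 1)) * ?K * hull_integral p N)"
      using J(2) kappa_pos[of "d\<^sup>2"] assms(1) by (simp add: ennreal_mult mult.assoc ennreal_of_nat_eq_real_of_nat)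
    finally show ?thesis .
  qed
  obtain \<epsilon> \<delta> :: "nat \<Rightarrow> real" where "\<epsilon> \<in> O(\<lambda>N. real N powr (- 2 / real d))"
    "\<delta> \<in> O(\<lambda>N. if d = 1 \<and> p \<notin> {0, 1} then 1 / real N else real N powr (- 2 / real d))"
    and N: "\<forall>N \<ge> d + 2.
          (\<integral>\<^sup>+h. ennreal (indicator {-1<..<1} h * ((2 * (1 - h)) powr (p / 2) * sphere_cdf k h ^ (N - (d + 1)) * (1 - h\<^sup>2) powr ((real d ^ 2 - 2) / 2))) \<partial>lborel) = ennreal (hull_integral p N) \<and>
          hull_integral p N \<ge> 0 \<and>
          real (N choose (d + 1)) * (2 * real (d\<^sup>2) * kappa (d\<^sup>2)) * hull_integral p N
            = B_hull d * kappa d powr (- p / real d)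
              * (Gamma (real d + p / real d) * Gamma (real N + 1)
                  / (Gamma (real d) * Gamma (real N + p / real d))) * (1 + \<epsilon> N) \<and>
          real (N choose (d + 1)) * (2 * real (d\<^sup>2) * kappa (d\<^sup>2)) * hull_integral p N
            = c_hole d p * real N powr (1 - p / real d) * (1 + \<delta> N)"
    using hull_asymptotics[OF assms(3)] by blast
  then show ?thesis
  proof (intro exI conjI allI impI)
    fix N and M :: "'w measure" and X :: "nat \<Rightarrow> 'w \<Rightarrow> real ^ 'n"
    assume "N \<ge> d + 2" and "prob_space M \<and> prob_space.indep_vars M (\<lambda>_. sphere_measure) X {1..N} \<and>
          (\<forall>i\<in>{1..N}. distr M sphere_measure (X i) = sphere_measure)"
    then have E: "(\<integral>\<^sup>+w. ennreal (hole_power_sum p ((\<lambda>i. X i w) ` {1..N})) \<partial>M)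
      = ennreal (real (N choose (d + 1)) * (2 * real (d\<^sup>2) * kappa (d\<^sup>2)) * hull_integral p N)"
      using N by (intro expectation) blast+
    note asym = N[rule_format, OF \<open>N \<ge> d + 2\<close>]
    show "(\<integral>\<^sup>+w. ennreal (hole_power_sum p ((\<lambda>i. X i w) ` {1..N})) \<partial>M)
            = ennreal (B_hull d * kappa d powr (- p / real d)
              * (Gamma (real d + p / real d) * Gamma (real N + 1)
                  / (Gamma (real d) * Gamma (real N + p / real d))) * (1 + \<epsilon> N))"
      unfolding E by (rule arg_cong[where f=ennreal]) (use asym in blast)
    show "(\<integral>\<^sup>+w. ennreal (hole_power_sum p ((\<lambda>i. X i w) ` {1..N})) \<partial>M)
            = ennreal (c_hole d p * real N powr (1 - p / real d) * (1 + \<delta> N))"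
      unfolding E by (rule arg_cong[where f=ennreal]) (use asym in blast)
  qed
qed

end
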